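(* Let $0<\alpha<\sqrt{2\beta}$ be arbitrarily small and $\beta<\infty$. Then the part of the singular spectrum of $H(\Gamma,\alpha)$ that is below the threshold $-\beta$ consists of the points $$E^{(0)}+\alpha^2E^{(2)}+O(\alpha^4)\qquad(\alpha\downarrow0),$$ where $E^{(0)}<-\beta$ belongs to the singular spectrum of $H(\Gamma,0)$ and $E^{(2)}$ is the explicit coefficient given in the context. Moreover, let $E\ge-\beta$ be in the singular spectrum of $H(\Gamma,\alpha)$. Then necessarily $E=-\beta$ and $\Gamma=\Gamma^\circ$; otherwise $E$ does not belong to the singular spectrum.
   Context: Operators. In $L^2(\mathbb R^3)\otimes\mathbb C^2$ let $H=-\Delta\otimes I+i\alpha(\nabla_1\otimes\sigma_2-\nabla_2\otimes\sigma_1)+\beta I\otimes\sigma_3$ on $H^2(\mathbb R^3)\otimes\mathbb C^2$ ($\sigma_j$ Pauli matrices, $\nabla_j=\partial/\partial x_j$), self-adjoint; in the present regime its spectrum is $[-\beta,\infty)$. $H^0$ is the restriction of $H$ to $\{f\in\mathrm{dom}\,H:f(0)=0\}$. Indices $s,s'$ take values $\pm$ (identified with $\pm1$). $g_+=(1,0)^T$, $g_-=(0,1)^T$, $\psi_s=\mathcal N_s\delta\otimes g_s$ with $\delta$ the Dirac distribution at $0$ and $\mathcal N_s>0$ normalizing $\|(H-i)^{-1}\psi_s\|=1$; $\Phi_s(z)=(H-z)^{-1}\psi_s$. Each $f\in\mathrm{dom}\,H^{0*}$ is uniquely $f=\tilde f+\frac12\sum_sb_s(f)(\Phi_s(i)+\Phi_s(-i))$,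 $\tilde f\in\mathrm{dom}\,H$. $R$ is a fixed Hermitian matrix (the "admissible matrix"). $H(\Gamma)\equiv H(\Gamma,\alpha)$ is the self-adjoint restriction of $H^{0*}$ to $\{f:\langle\psi,\tilde f\rangle=\Gamma b(f)\}$ (column vectors $\langle\psi,\tilde f\rangle=(\langle\psi_s,\tilde f\rangle)_s$, $b(f)=(b_s(f))_s$), with $\Gamma=(\Gamma_{ss'})$ a Hermitian $2\times2$ matrix, $\Gamma\ne-R$. Singular spectrum. It is the set of $E\in\mathbb R$ with $\det(\Gamma-Q(E))=0$, $Q_{ss'}(z)=\langle\psi_s,\frac{I+zH}{H-z}\frac1{H^2+I}\psi_{s'}\rangle$; explicitly $$\gamma=\prod_{s=\pm}\Bigl(\omega_s\pm\frac1{2\xi(E)}-\Bigl(\frac\alpha2-\frac{s\beta}\alpha\Bigr)\mathrm{artanh}(\alpha\xi(E))\Bigr)\quad( * )$$ (upper sign for $E<\beta$, lower for $E\ge\beta$), $\xi(E)=\frac1\beta\sqrt{\frac{-E}2(1-\sqrt{1-(\beta/E)^2})}$ (principal square roots, $\sqrt{-t}=i\sqrt t$ for $t>0$; at $E=0$ the limit $E\downarrow0$). Here $\tilde\Gamma_{ss'}=\Gamma_{ss'}/(\mathcal N_s\mathcal N_{s'})$, $\omega_s=4\pi(\tilde\Gamma_{ss}+\Lambda_s)$, $\gamma=(4\pi|\tilde\Gamma_{+-}|)^2$, $\Lambda_s=\mathrm{Re}\,G_s^{\rm ren}(0;i)-\frac1{4\sqrt2\pi}$, $G^{\rm ren}_s(0;z)=\frac{\sqrt{-z}}{4\pi}-\frac1{4\pi}\sqrt{\frac{-z}2(1+\sqrt{1-(\beta/z)^2})}+\bigl(\frac{\alpha}{8\pi}-\frac{s\beta}{4\pi\alpha}\bigr)\mathrm{artanh}\bigl(\frac\alpha\beta\sqrt{\frac{-z}2(1-\sqrt{1-(\beta/z)^2})}\bigr)$,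 and $\mathcal N_s^{-2}=\mathrm{Im}\,G_s^{\rm ren}(0;i)+\frac1{4\sqrt2\pi}$. For $\alpha=0$ limits $\alpha\downarrow0$ are taken, and $( * )$ reads $\gamma^{(0)}=\prod_s(\omega^{(0)}_s\pm\frac1{2\xi(E)}+s\beta\xi(E))$. Regime: $\beta>0$ and $\Gamma$ are fixed, $\alpha\downarrow0$; in the paper the singular spectrum for small $\alpha$ is determined from the expansion of $( * )$ in powers of $\alpha$, with solutions sought in the form $E=E^{(0)}+\epsilon(\alpha)$, $\epsilon(0)=0$, $E^{(0)}$ in the singular spectrum of $H(\Gamma,0)$. Expansion coefficients: $\mathcal N^{(0)}_s=2\sqrt[4]2\sqrt\pi(\sqrt{1+\beta^2}+s\beta)^{1/4}$, $\mathcal N^{(1)}_s=\frac{\sqrt\pi}{6\sqrt[4]2\beta^2}\bigl(3\beta+s(1-\sqrt{1+\beta^2})\bigr)\sqrt[4]{2+\beta^2-2\sqrt{1+\beta^2}}\,(\sqrt{1+\beta^2}+s\beta)^{3/4}$, $\Lambda^{(0)}_s=-\frac1{8\pi}\bigl(\sqrt{\sqrt{1+\beta^2}+1}+s\sqrt{\sqrt{1+\beta^2}-1}\bigr)$, $\Lambda^{(1)}_s=\frac1{48\pi\beta^2}\bigl(3\beta-s(1-\sqrt{1+\beta^2})\bigr)\sqrt[4]{2+\beta^2-2\sqrt{1+\beta^2}}$, so that $\mathcal N_s=\mathcal N_s^{(0)}-\alpha^2\mathcal N_s^{(1)}+O(\alpha^4)$, $\Lambda_s=\Lambda^{(0)}_s+\alpha^2\Lambda^{(1)}_s+O(\alpha^4)$;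 $\eta_{ss'}=\mathcal N_s^{(1)}/\mathcal N_s^{(0)}+\mathcal N_{s'}^{(1)}/\mathcal N_{s'}^{(0)}$, $\tilde\Gamma^{(0)}_{ss'}=\Gamma_{ss'}/(\mathcal N_s^{(0)}\mathcal N_{s'}^{(0)})$, $\omega^{(0)}_s=4\pi(\tilde\Gamma^{(0)}_{ss}+\Lambda^{(0)}_s)$, $\omega^{(1)}_s=4\pi(\eta_{ss}\tilde\Gamma^{(0)}_{ss}+\Lambda^{(1)}_s)$, $\gamma^{(0)}=(4\pi|\tilde\Gamma^{(0)}_{+-}|)^2$; $q_s^{(0)}=\omega_s^{(1)}-\xi_0(\frac12-\frac13s\beta\xi_0^2)$ with $\xi_0=\xi(E^{(0)})$. The coefficient $E^{(2)}$ (for $E^{(0)}<-\beta$). If $\gamma^{(0)}\ne0$: $$E^{(2)}=\frac{2\sqrt2}\beta\bigl(\sqrt{E^{(0)2}-\beta^2}-E^{(0)}\bigr)\sqrt{E^{(0)2}-\beta^2}\sqrt{-E^{(0)}-\sqrt{E^{(0)2}-\beta^2}}\;\frac{\sum_sq^{(0)}_{-s}(\omega^{(0)}_s+\sqrt{s\beta-E^{(0)}})-2\eta_{+-}\gamma^{(0)}}{\sum_s\sqrt{s\beta-E^{(0)}}(\sqrt{s\beta-E^{(0)}}+\sqrt{-s\beta-E^{(0)}})(\omega^{(0)}_s+\sqrt{s\beta-E^{(0)}})}.$$ If $\gamma^{(0)}=0$: $E^{(2)}=-2\omega_+^{(0)}q_+^{(0)}$ for $E^{(0)}=\beta-\omega_+^{(0)2}$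 with $\omega_+^{(0)}<-\sqrt{2\beta}$, $\omega_-^{(0)}\ne-\sqrt{\omega_+^{(0)2}-2\beta}$; $E^{(2)}=-2\omega_-^{(0)}q_-^{(0)}$ for $E^{(0)}=-\beta-\omega_-^{(0)2}$ with $\omega_-^{(0)}<0$, $\omega_+^{(0)}\neq-\sqrt{\omega_-^{(0)2}+2\beta}$; and if $\omega_+^{(0)}<-\sqrt{2\beta}$, $\omega_-^{(0)}=-\sqrt{\omega_+^{(0)2}-2\beta}$, then $E^{(2)}$ takes the two values $-2\omega_s^{(0)}q_s^{(0)}$, $s=\pm$. The matrices $\Gamma^\circ$. "$\Gamma=\Gamma^\circ$" means that $\Gamma$ satisfies: $-\beta$ is in the singular spectrum of $H(\Gamma,0)$ (i.e. $\gamma^{(0)}=(\omega_+^{(0)}+\sqrt{2\beta})\omega_-^{(0)}$) and $A\Gamma_{++}+B\Gamma_{--}+C=0$, where here $A=\mathcal N_-^{(0)2}(\Lambda_-^{(1)}-\eta_{--}\Lambda_-^{(0)})$, $B=\mathcal N_+^{(0)2}\bigl(\Lambda_+^{(1)}-\eta_{++}(\Lambda_+^{(0)}+\frac{\sqrt{2\beta}}{4\pi})\bigr)$, $C=(\mathcal N_+^{(0)}\mathcal N_-^{(0)})^2\bigl(\Lambda_-^{(0)}\Lambda_+^{(1)}+(\Lambda_+^{(0)}+\frac{\sqrt{2\beta}}{4\pi})(\Lambda_-^{(1)}-(\eta_{++}+\eta_{--})\Lambda_-^{(0)})\bigr)$.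
   Formalization: If −β lies in the singular spectrum of H(Γ,0), the points with E^(0)<−β are claimed to exhaust the singular spectrum only below −β−δ, for every δ>0 and small α, because a further point then emerges from the threshold −β itself. *)

theory Defs
  imports "HOL-Analysis.Analysis" "HOL-Library.Landau_Symbols"
begin

text \<open>
  Spin indices \<open>s = +, -\<close> are the elements \<open>1, 2\<close> of the type \<open>2\<close> (where \<open>2 = 0\<close>);
  \<open>axis s 1\<close> is the spinor \<open>g\<^sub>s\<close>.
\<close>

definition spin :: "2 \<Rightarrow> real" where
  "spin s = (if s = 1 then 1 else - 1)"

definition flip :: "2 \<Rightarrow> 2" where
  "flip s = (if s = 1 then 2 else 1)"

definition hermitian_mat :: "complex^2^2 \<Rightarrow> bool" where
  "hermitian_mat M \<longleftrightarrow> (\<forall>i j. M $ i $ j = cnj (M $ j $ i))"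

definition pauli1 :: "complex^2^2" where
  "pauli1 = vector [vector [0, 1], vector [1, 0]]"

definition pauli2 :: "complex^2^2" where
  "pauli2 = vector [vector [0, - \<i>], vector [\<i>, 0]]"

definition pauli3 :: "complex^2^2" where
  "pauli3 = vector [vector [1, 0], vector [0, - 1]]"


text \<open>
  \<open>H = -\<Delta> \<otimes> I + \<i>\<alpha>(\<nabla>\<^sub>1 \<otimes> \<sigma>\<^sub>2 - \<nabla>\<^sub>2 \<otimes> \<sigma>\<^sub>1) + \<beta> I \<otimes> \<sigma>\<^sub>3\<close> has constant coefficients, so the Fourier
  transform (\<open>\<nabla>\<^sub>j \<mapsto> \<i> p\<^sub>j\<close>) turns it into multiplication by the Hermitian matrix
  \<open>H_symbol \<beta> \<alpha> p\<close>, and turns functions of \<open>H\<close> into multiplication by the same functions of this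
  matrix. The distribution \<open>\<delta> \<otimes> g\<^sub>s\<close> becomes the constant \<open>(2\<pi>) powr (-3/2) g\<^sub>s\<close>.
\<close>

definition H_symbol :: "real \<Rightarrow> real \<Rightarrow> real^3 \<Rightarrow> complex^2^2" where
  "H_symbol \<beta> \<alpha> p =
     (norm p)\<^sup>2 *\<^sub>R mat 1 - \<alpha> *\<^sub>R ((p $ 1) *\<^sub>R pauli2 - (p $ 2) *\<^sub>R pauli1) + \<beta> *\<^sub>R pauli3"

definition H_resolvent :: "real \<Rightarrow> real \<Rightarrow> complex \<Rightarrow> real^3 \<Rightarrow> complex^2^2" where
  "H_resolvent \<beta> \<alpha> z p = matrix_inv (H_symbol \<beta> \<alpha> p - mat z)"

text \<open>
  \<open>\<N>\<^sub>s\<close> is the positive number with \<open>\<parallel>(H - \<i>)\<^sup>-\<^sup>1 \<psi>\<^sub>s\<parallel> = 1\<close> for \<open>\<psi>\<^sub>s = \<N>\<^sub>s \<delta> \<otimes> g\<^sub>s\<close>;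
  the integral below is \<open>\<parallel>(H - \<i>)\<^sup>-\<^sup>1 (\<delta> \<otimes> g\<^sub>s)\<parallel>\<^sup>2\<close>.
\<close>

definition psi_norm :: "real \<Rightarrow> real \<Rightarrow> 2 \<Rightarrow> real" where
  "psi_norm \<beta> \<alpha> s =
     1 / sqrt ((LINT p|lborel. (norm (H_resolvent \<beta> \<alpha> \<i> p *v axis s 1))\<^sup>2) / (2 * pi) ^ 3)"

text \<open>
  \<open>Q\<^sub>s\<^sub>s\<^sub>'(z) = \<langle>\<psi>\<^sub>s, (I + zH) (H - z)\<^sup>-\<^sup>1 (H\<^sup>2 + I)\<^sup>-\<^sup>1 \<psi>\<^sub>s\<^sub>'\<rangle>\<close>, for \<open>z\<close> outside the spectrum
  \<open>[-\<beta>, \<infinity>)\<close> of \<open>H\<close>.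
\<close>

definition Q_matrix :: "real \<Rightarrow> real \<Rightarrow> complex \<Rightarrow> complex^2^2" where
  "Q_matrix \<beta> \<alpha> z = (\<chi> s s'.
     of_real (psi_norm \<beta> \<alpha> s * psi_norm \<beta> \<alpha> s' / (2 * pi) ^ 3) *
     (LINT p|lborel.
        ((mat 1 + mat z ** H_symbol \<beta> \<alpha> p) ** H_resolvent \<beta> \<alpha> z p **
          matrix_inv (H_symbol \<beta> \<alpha> p ** H_symbol \<beta> \<alpha> p + mat 1)) $ s $ s'))"

text \<open>
  The real solutions \<open>E\<close> of \<open>det (\<Gamma> - Q(E)) = 0\<close>. On the spectrum \<open>[-\<beta>, \<infinity>)\<close> of \<open>H\<close> the value at
  \<open>E\<close> is the boundary value at \<open>E + \<i>0\<close>. For Hermitian \<open>\<Gamma>\<close> the boundary value at \<open>E - \<i>0\<close> gives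
  the same set, since the determinant at the conjugate point is the conjugate.
\<close>

definition singular_spectrum :: "real \<Rightarrow> real \<Rightarrow> complex^2^2 \<Rightarrow> real set" where
  "singular_spectrum \<beta> \<alpha> \<Gamma> = {E.
     if E < - \<beta> then det (\<Gamma> - Q_matrix \<beta> \<alpha> (of_real E)) = 0
     else ((\<lambda>\<epsilon>. det (\<Gamma> - Q_matrix \<beta> \<alpha> (Complex E \<epsilon>))) \<longlongrightarrow> 0) (at_right 0)}"


text \<open>Coefficients of the expansions in \<open>\<alpha>\<^sup>2\<close> (those of \<open>\<N>\<^sub>s\<close> as in
  \<open>\<N>\<^sub>s = N0 - \<alpha>\<^sup>2 N1 + O(\<alpha>\<^sup>4)\<close>).\<close>

definition N0 :: "real \<Rightarrow> 2 \<Rightarrow> real" where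
  "N0 \<beta> s = 2 * root 4 2 * sqrt pi * root 4 (sqrt (1 + \<beta>\<^sup>2) + spin s * \<beta>)"

definition N1 :: "real \<Rightarrow> 2 \<Rightarrow> real" where
  "N1 \<beta> s = sqrt pi / (6 * root 4 2 * \<beta>\<^sup>2) * (3 * \<beta> + spin s * (1 - sqrt (1 + \<beta>\<^sup>2)))
     * root 4 (2 + \<beta>\<^sup>2 - 2 * sqrt (1 + \<beta>\<^sup>2)) * (root 4 (sqrt (1 + \<beta>\<^sup>2) + spin s * \<beta>)) ^ 3"

definition Lam0 :: "real \<Rightarrow> 2 \<Rightarrow> real" where
  "Lam0 \<beta> s = - (1 / (8 * pi)) * (sqrt (sqrt (1 + \<beta>\<^sup>2) + 1) + spin s * sqrt (sqrt (1 + \<beta>\<^sup>2) - 1))"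

definition Lam1 :: "real \<Rightarrow> 2 \<Rightarrow> real" where
  "Lam1 \<beta> s = 1 / (48 * pi * \<beta>\<^sup>2) * (3 * \<beta> - spin s * (1 - sqrt (1 + \<beta>\<^sup>2)))
     * root 4 (2 + \<beta>\<^sup>2 - 2 * sqrt (1 + \<beta>\<^sup>2))"

definition eta :: "real \<Rightarrow> 2 \<Rightarrow> 2 \<Rightarrow> real" where
  "eta \<beta> s s' = N1 \<beta> s / N0 \<beta> s + N1 \<beta> s' / N0 \<beta> s'"

definition Gam0 :: "real \<Rightarrow> complex^2^2 \<Rightarrow> 2 \<Rightarrow> 2 \<Rightarrow> complex" where
  "Gam0 \<beta> \<Gamma> s s' = \<Gamma> $ s $ s' / of_real (N0 \<beta> s * N0 \<beta> s')"

text \<open>The diagonal entries of a Hermitian matrix are real, so \<open>Re\<close> below only adapts the type.\<close>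

definition om0 :: "real \<Rightarrow> complex^2^2 \<Rightarrow> 2 \<Rightarrow> real" where
  "om0 \<beta> \<Gamma> s = 4 * pi * (Re (Gam0 \<beta> \<Gamma> s s) + Lam0 \<beta> s)"

definition om1 :: "real \<Rightarrow> complex^2^2 \<Rightarrow> 2 \<Rightarrow> real" where
  "om1 \<beta> \<Gamma> s = 4 * pi * (eta \<beta> s s * Re (Gam0 \<beta> \<Gamma> s s) + Lam1 \<beta> s)"

definition gam0 :: "real \<Rightarrow> complex^2^2 \<Rightarrow> real" where
  "gam0 \<beta> \<Gamma> = (4 * pi * cmod (Gam0 \<beta> \<Gamma> 1 2))\<^sup>2"

text \<open>Used for \<open>E < - \<beta>\<close> only, where all radicands are positive.\<close>

definition xi :: "real \<Rightarrow> real \<Rightarrow> real" where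
  "xi \<beta> E = 1 / \<beta> * sqrt (- E / 2 * (1 - sqrt (1 - (\<beta> / E)\<^sup>2)))"

definition q0 :: "real \<Rightarrow> complex^2^2 \<Rightarrow> real \<Rightarrow> 2 \<Rightarrow> real" where
  "q0 \<beta> \<Gamma> E0 s = om1 \<beta> \<Gamma> s - xi \<beta> E0 * (1 / 2 - 1 / 3 * spin s * \<beta> * (xi \<beta> E0)\<^sup>2)"

definition E2_coupled :: "real \<Rightarrow> complex^2^2 \<Rightarrow> real \<Rightarrow> real" where
  "E2_coupled \<beta> \<Gamma> E0 =
     2 * sqrt 2 / \<beta> * (sqrt (E0\<^sup>2 - \<beta>\<^sup>2) - E0) * sqrt (E0\<^sup>2 - \<beta>\<^sup>2) * sqrt (- E0 - sqrt (E0\<^sup>2 - \<beta>\<^sup>2))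
     * (((\<Sum>s\<in>UNIV. q0 \<beta> \<Gamma> E0 (flip s) * (om0 \<beta> \<Gamma> s + sqrt (spin s * \<beta> - E0)))
           - 2 * eta \<beta> 1 2 * gam0 \<beta> \<Gamma>)
        / (\<Sum>s\<in>UNIV. sqrt (spin s * \<beta> - E0) * (sqrt (spin s * \<beta> - E0) + sqrt (- spin s * \<beta> - E0))
             * (om0 \<beta> \<Gamma> s + sqrt (spin s * \<beta> - E0))))"

text \<open>
  \<open>is_E2 \<beta> \<Gamma> E0 E2\<close>: \<open>E2\<close> is a value of the coefficient \<open>E\<^sup>(\<^sup>2\<^sup>)\<close> belonging to \<open>E0\<close>. It is a
  relation because of the last disjunct, where \<open>E\<^sup>(\<^sup>2\<^sup>)\<close> takes two values at the single point
  \<open>E0 = \<beta> - \<omega>\<^sub>+\<^sup>2 = - \<beta> - \<omega>\<^sub>-\<^sup>2\<close>.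
\<close>

definition is_E2 :: "real \<Rightarrow> complex^2^2 \<Rightarrow> real \<Rightarrow> real \<Rightarrow> bool" where
  "is_E2 \<beta> \<Gamma> E0 E2 \<longleftrightarrow>
     (gam0 \<beta> \<Gamma> \<noteq> 0 \<and> E2 = E2_coupled \<beta> \<Gamma> E0) \<or>
     (gam0 \<beta> \<Gamma> = 0 \<and>
       (let w1 = om0 \<beta> \<Gamma> 1; w2 = om0 \<beta> \<Gamma> 2 in
          (E0 = \<beta> - w1\<^sup>2 \<and> w1 < - sqrt (2 * \<beta>) \<and> w2 \<noteq> - sqrt (w1\<^sup>2 - 2 * \<beta>)
             \<and> E2 = - 2 * w1 * q0 \<beta> \<Gamma> E0 1) \<or>
          (E0 = - \<beta> - w2\<^sup>2 \<and> w2 < 0 \<and> w1 \<noteq> - sqrt (w2\<^sup>2 + 2 * \<beta>)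
             \<and> E2 = - 2 * w2 * q0 \<beta> \<Gamma> E0 2) \<or>
          (E0 = \<beta> - w1\<^sup>2 \<and> w1 < - sqrt (2 * \<beta>) \<and> w2 = - sqrt (w1\<^sup>2 - 2 * \<beta>)
             \<and> (\<exists>s. E2 = - 2 * om0 \<beta> \<Gamma> s * q0 \<beta> \<Gamma> E0 s))))"

text \<open>The pairs \<open>(E\<^sup>(\<^sup>0\<^sup>), E\<^sup>(\<^sup>2\<^sup>))\<close>.\<close>

definition expansion_coeffs :: "real \<Rightarrow> complex^2^2 \<Rightarrow> (real \<times> real) set" where
  "expansion_coeffs \<beta> \<Gamma> =
     {(E0, E2). E0 < - \<beta> \<and> E0 \<in> singular_spectrum \<beta> 0 \<Gamma> \<and> is_E2 \<beta> \<Gamma> E0 E2}"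


definition circ_A :: "real \<Rightarrow> real" where
  "circ_A \<beta> = (N0 \<beta> 2)\<^sup>2 * (Lam1 \<beta> 2 - eta \<beta> 2 2 * Lam0 \<beta> 2)"

definition circ_B :: "real \<Rightarrow> real" where
  "circ_B \<beta> = (N0 \<beta> 1)\<^sup>2 * (Lam1 \<beta> 1 - eta \<beta> 1 1 * (Lam0 \<beta> 1 + sqrt (2 * \<beta>) / (4 * pi)))"

definition circ_C :: "real \<Rightarrow> real" where
  "circ_C \<beta> = (N0 \<beta> 1 * N0 \<beta> 2)\<^sup>2 *
     (Lam0 \<beta> 2 * Lam1 \<beta> 1 + (Lam0 \<beta> 1 + sqrt (2 * \<beta>) / (4 * pi))
        * (Lam1 \<beta> 2 - (eta \<beta> 1 1 + eta \<beta> 2 2) * Lam0 \<beta> 2))"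

text \<open>The property written \<open>\<Gamma> = \<Gamma>\<^sup>\<circ>\<close>.\<close>

definition is_Gamma_circ :: "real \<Rightarrow> complex^2^2 \<Rightarrow> bool" where
  "is_Gamma_circ \<beta> \<Gamma> \<longleftrightarrow>
     - \<beta> \<in> singular_spectrum \<beta> 0 \<Gamma> \<and>
     circ_A \<beta> * Re (\<Gamma> $ 1 $ 1) + circ_B \<beta> * Re (\<Gamma> $ 2 $ 2) + circ_C \<beta> = 0"

end

theory Submission
  imports Defs "HOL-Complex_Analysis.Complex_Analysis" "HOL-Real_Asymp.Real_Asymp" "HOL-Probability.Sinc_Integral"
begin

text \<open>
  On the Fourier side \<open>H\<close> is multiplication by a \<open>2 \<times> 2\<close> matrix with eigenvalues
  \<open>|p|\<^sup>2 \<plusminus> sqrt (\<beta>\<^sup>2 + \<alpha>\<^sup>2 (p\<^sub>1\<^sup>2 + p\<^sub>2\<^sup>2))\<close>. Spectral calculus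
  for this matrix and integration in cylindrical coordinates show that \<open>Q\<close> is diagonal and that \<open>Q\<^sub>s\<^sub>s(z)\<close>
  is a positive multiple of \<open>Re (K\<^sub>s(\<i>)) - K\<^sub>s(z)\<close>, where
  \<open>K\<^sub>s = X + (2 s \<beta> - \<alpha>\<^sup>2) artanh (\<alpha> / X) / \<alpha>\<close> and
  \<open>X = sqrt (\<beta> - z) + sqrt (- \<beta> - z) = 1 / \<xi>\<close>.

  Above \<open>-\<beta>\<close> the imaginary parts of both diagonal entries have the same strict sign in the limit, so the
  determinant with a Hermitian \<open>\<Gamma>\<close> cannot tend to \<open>0\<close>. At \<open>-\<beta>\<close> the secular function is analytic
  in \<open>\<alpha>\<close>; if it had zeros accumulating at \<open>\<alpha> = 0\<close>, it would vanish for all \<open>0 < \<alpha> < sqrt (2 \<beta>)\<close>,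
  which its non-differentiable term of order \<open>(sqrt (2 \<beta>) - \<alpha>) ln (sqrt (2 \<beta>) - \<alpha>)\<close> forbids. Hence
  \<open>-\<beta>\<close> is not in the singular spectrum for small \<open>\<alpha> > 0\<close>, whatever \<open>\<Gamma>\<close> is. Below \<open>-\<beta>\<close> both
  factors of the secular equation are strictly decreasing in \<open>E\<close> and have expansions in \<open>\<alpha>\<^sup>2\<close>; simple zeros
  of the unperturbed equation persist by the intermediate value theorem, and monotonicity excludes others.
\<close>

section \<open>Cylindrical coordinates\<close>

text \<open>The closed form of K comes from taking X, the sum of the two roots, as variable: the
  integral over the third component turns each resolvent into an inverse root, and the weighted sum
  of inverse roots that is left has a rational density in X. K itself grows at infinity; only the
  combination of z with \<i> and -\<i> that occurs in Q makes the boundary term there vanish.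

  The obstacle in the first half is the threshold itself. If -\<beta> solves the unperturbed
  equation, a root may leave -\<beta> downwards for \<alpha> > 0, and there is no E0 < -\<beta> to
  expand it around. So the branches exhaust the spectrum below -\<beta> only if -\<beta> is not an
  unperturbed solution; in general they belong to it, and exhaust its part below -\<beta> - \<delta>
  for each \<delta> > 0.

  A second obstacle is a double zero. With \<gamma> = 0 both factors may vanish at the same point,
  so the factors are then treated one at a time. With \<gamma> > 0 the factors have equal sign at
  every zero, which makes the zeros simple.

  Both factors of the secular equation are carried doubled, which explains the factors 2 in front of
  \<omega> and q and 4 in front of \<gamma>.\<close>

definition disc_area :: "real measure" where
  "disc_area = density lborel (\<lambda>u. ennreal (pi * indicator {0<..} u))"

lemma sets_disc_area [measurable_cong, simp]: "sets disc_area = sets borel"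
  by (simp add: disc_area_def)

lemma space_disc_area [simp]: "space disc_area = UNIV"
  by (simp add: disc_area_def)

lemma emeasure_disc_area_atMost: "emeasure disc_area {..t} = ennreal (pi * max 0 t)"
proof -
  have "emeasure disc_area {..t} = (\<integral>\<^sup>+u. ennreal pi * indicator {0<..t} u \<partial>lborel)"
    unfolding disc_area_def by (subst emeasure_density) (auto intro!: nn_integral_cong simp: indicator_def)
  also have "\<dots> = ennreal pi * emeasure lborel {0<..t}"
    by (subst nn_integral_cmult_indicator) auto
  also have "\<dots> = ennreal (pi * max 0 t)"
    by (cases "t \<ge> 0") (auto simp: ennreal_mult max_def)
  finally show ?thesis .
qed

text \<open>The disc of radius sqrt t has area pi t, so both measures agree on the half lines {..t},
  which generate the Borel sets. The squared radius as coordinate makes the density constant, and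
  the eigenvalues of the symbol depend on the plane components only through it.\<close>

lemma distr_sum_squares_eq_disc_area:
  "distr (lborel :: (real \<times> real) measure) borel (\<lambda>(a, b). a\<^sup>2 + b\<^sup>2) = disc_area" (is "?M = _")
proof (rule measure_eqI_generator_eq)
  let ?E = "range (\<lambda>t::real. {..t})"
  have meas0: "(\<lambda>p. (fst p)\<^sup>2 + (snd p)\<^sup>2) \<in> borel_measurable (borel :: (real \<times> real) measure)"
    by (intro borel_measurable_continuous_onI continuous_intros)
  then have meas [measurable]: "(\<lambda>(a, b). a\<^sup>2 + b\<^sup>2) \<in> borel_measurable (lborel :: (real \<times> real) measure)"
    by (simp add: case_prod_unfold)
  show "Int_stable ?E"
    by (auto simp: Int_stable_def Int_atMost)
  have sig: "sets borel = sigma_sets UNIV ?E"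
    by (subst borel_eq_atMost) (simp add: image_def)
  show "?E \<subseteq> Pow UNIV" "sets ?M = sigma_sets UNIV ?E" "sets disc_area = sigma_sets UNIV ?E"
    using sig by auto
  have eq: "emeasure ?M {..t} = ennreal (pi * max 0 t)" for t
  proof -
    have "emeasure ?M {..t} = emeasure lborel {p::real \<times> real. (fst p)\<^sup>2 + (snd p)\<^sup>2 \<le> t}"
      by (subst emeasure_distr) (auto simp: vimage_def case_prod_unfold intro: meas0)
    also have "\<dots> = ennreal (pi * max 0 t)"
    proof (cases "t \<ge> 0")
      case True
      have "{p::real \<times> real. (fst p)\<^sup>2 + (snd p)\<^sup>2 \<le> t} = cball 0 (sqrt t)"
        by (auto simp: norm_prod_def case_prod_unfold)
      then show ?thesis
        using True by (simp add: emeasure_cball unit_ball_vol_2 ennreal_mult[symmetric])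
    next
      case False
      then have "(fst p)\<^sup>2 + (snd p)\<^sup>2 > t" for p :: "real \<times> real"
        by (smt (verit) zero_le_power2)
      then have "{p::real \<times> real. (fst p)\<^sup>2 + (snd p)\<^sup>2 \<le> t} = {}" by (auto simp: not_le)
      then show ?thesis using False by (simp add: max_def)
    qed
    finally show ?thesis .
  qed
  show "emeasure ?M X = emeasure disc_area X" if "X \<in> ?E" for X
    using that eq emeasure_disc_area_atMost by auto
  show "range (\<lambda>n::nat. {..real n}) \<subseteq> ?E" "(\<Union>n. {..real n}) = UNIV"
    by (auto simp: real_arch_simple)
  show "emeasure ?M {..real n} \<noteq> \<infinity>" for n
    by (simp add: eq)
qed

definition pt3 :: "(real \<times> real) \<times> real \<Rightarrow> real^3" where
  "pt3 = (\<lambda>((a, b), c). vector [a, b, c])"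

lemma pt3_nth [simp]: "pt3 q $ 1 = fst (fst q)" "pt3 q $ 2 = snd (fst q)" "pt3 q $ 3 = snd q"
  by (auto simp: pt3_def case_prod_unfold)

lemma measurable_pt3 [measurable]: "pt3 \<in> borel_measurable borel"
proof (rule borel_measurable_continuous_onI)
  have eq: "pt3 = (\<lambda>q. \<chi> i. if i = 1 then fst (fst q) else if i = 2 then snd (fst q) else snd q)"
    by (auto simp: fun_eq_iff vec_eq_iff forall_3)
  show "continuous_on UNIV pt3"
    unfolding eq
  proof (intro continuous_on_vec_lambda)
    show "continuous_on UNIV (\<lambda>q. if i = 1 then fst (fst q) else if i = 2 then snd (fst q) else snd q :: real)"
      for i :: 3 by (cases "i = 1"; cases "i = 2") (auto intro!: continuous_intros)
  qed
qed

text \<open>\<open>lborel\<close> is determined by its values on boxes, and a box pulls back to a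
  box of the same volume. This moves integrals over \<open>real^3\<close> to nested pairs, where
  Fubini applies.\<close>

lemma distr_pt3_lborel: "distr lborel borel pt3 = lborel"
proof (rule lborel_eqI[symmetric])
  fix l u :: "real^3"
  assume le: "\<And>b. b \<in> Basis \<Longrightarrow> l \<bullet> b \<le> u \<bullet> b"
  have le': "l $ i \<le> u $ i" for i
    using le[of "axis i 1"] by (simp add: inner_axis axis_in_Basis_iff)
  have "pt3 -` box l u = box ((l$1, l$2), l$3) ((u$1, u$2), u$3)"
    by (auto simp: mem_box_cart forall_3 mem_box Basis_prod_def)
  then have "emeasure (distr lborel borel pt3) (box l u) =
      emeasure lborel (box ((l$1, l$2), l$3) ((u$1, u$2), u$3))"
    by (subst emeasure_distr) auto
  also have "\<dots> = ennreal ((u$1 - l$1) * (u$2 - l$2) * (u$3 - l$3))"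
  proof -
    have B: "Basis = {((1::real, 0::real), 0::real), ((0,1),0), ((0,0),1)}"
      by (auto simp: Basis_prod_def zero_prod_def)
    have "\<forall>b\<in>Basis. ((l$1, l$2), l$3) \<bullet> b \<le> ((u$1, u$2), u$3) \<bullet> b"
      unfolding B using le'[of 1] le'[of 2] le'[of 3] by simp
    moreover have "(\<Prod>b\<in>Basis. (((u$1, u$2), u$3) - ((l$1, l$2), l$3)) \<bullet> b) =
        (u$1 - l$1) * (u$2 - l$2) * (u$3 - l$3)"
      unfolding B by simp
    ultimately show ?thesis
      by (subst emeasure_lborel_box) auto
  qed
  also have "(u$1 - l$1) * (u$2 - l$2) * (u$3 - l$3) = (\<Prod>b\<in>Basis. (u - l) \<bullet> b)"
  proof -
    have "Basis = (\<lambda>i. axis i 1 :: real^3) ` UNIV"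
      by (auto simp: Basis_vec_def)
    then have "(\<Prod>b\<in>Basis. (u - l) \<bullet> b) = (\<Prod>b\<in>(\<lambda>i. axis i 1 :: real^3) ` UNIV. (u - l) \<bullet> b)"
      by (rule arg_cong)
    also have "\<dots> = (\<Prod>i\<in>UNIV. (u - l) \<bullet> axis i 1)"
      by (subst prod.reindex) (auto simp: inj_on_def axis_eq_axis)
    also have "\<dots> = (\<Prod>i\<in>{1, 2, 3}. u $ i - l $ i)"
      by (simp add: inner_axis UNIV_3[symmetric])
    finally show ?thesis by simp
  qed
  finally show "emeasure (distr lborel borel pt3) (box l u) = ennreal (\<Prod>b\<in>Basis. (u - l) \<bullet> b)" .
qed simp

lemma sigma_finite_disc_area: "sigma_finite_measure disc_area"
  unfolding disc_area_def
  by (subst sigma_finite_measure.sigma_finite_iff_density_finite[OF sigma_finite_lborel]) auto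

lemma distr_cylindrical:
  "distr lborel (borel \<Otimes>\<^sub>M borel) (\<lambda>(q :: real \<times> real, t :: real). ((fst q)\<^sup>2 + (snd q)\<^sup>2, t)) =
     disc_area \<Otimes>\<^sub>M lborel"
proof -
  have [measurable]: "(\<lambda>p. (fst p)\<^sup>2 + (snd p)\<^sup>2) \<in> borel_measurable (borel :: (real \<times> real) measure)"
    by (intro borel_measurable_continuous_onI continuous_intros)
  have id: "distr lborel borel (\<lambda>t::real. t) = lborel"
    by (simp add: distr_id2)
  have "disc_area \<Otimes>\<^sub>M (lborel :: real measure) =
      distr lborel borel (\<lambda>p::real \<times> real. (fst p)\<^sup>2 + (snd p)\<^sup>2) \<Otimes>\<^sub>M distr lborel borel (\<lambda>t::real. t)"
    by (simp add: id distr_sum_squares_eq_disc_area[symmetric] case_prod_unfold)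
  also have "\<dots> = distr (lborel \<Otimes>\<^sub>M lborel) (borel \<Otimes>\<^sub>M borel)
      (\<lambda>(q :: real \<times> real, t :: real). ((fst q)\<^sup>2 + (snd q)\<^sup>2, t))"
    by (rule pair_measure_distr) (auto simp: id sigma_finite_lborel)
  finally show ?thesis by (simp add: lborel_prod)
qed

text \<open>Fubini after the change of variables. The second conclusion is recorded because the
  fundamental theorem of calculus is later applied to the outer integral, which presupposes
  integrability of the inner one on {0<..}.\<close>

lemma integral_cylindrical:
  fixes h :: "real \<times> real \<Rightarrow> complex"
  assumes int: "integrable (disc_area \<Otimes>\<^sub>M lborel) h"
  shows "(LINT p|lborel. h ((p $ 1)\<^sup>2 + (p $ 2)\<^sup>2, p $ (3::3))) =
     pi * (LINT u:{0<..}|lborel. LINT t|lborel. h (u, t))"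
    and "set_integrable lborel {0<..} (\<lambda>u. LINT t|lborel. h (u, t))"
proof -
  let ?T = "\<lambda>(q :: real \<times> real, t :: real). ((fst q)\<^sup>2 + (snd q)\<^sup>2, t)"
  interpret D: sigma_finite_measure disc_area by (rule sigma_finite_disc_area)
  interpret DL: pair_sigma_finite disc_area lborel ..
  have hm: "h \<in> borel_measurable (borel \<Otimes>\<^sub>M borel)"
    using borel_measurable_integrable[OF int] by (simp cong: measurable_cong_sets sets_pair_measure_cong)
  have hm': "h \<in> borel_measurable borel"
    using hm by (simp add: borel_prod)
  have m1: "(\<lambda>p::real^3. h ((p $ 1)\<^sup>2 + (p $ 2)\<^sup>2, p $ 3)) \<in> borel_measurable borel"
    by (rule measurable_compose[OF _ hm']) 
       (intro borel_measurable_continuous_onI continuous_intros)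
  have m2: "?T \<in> measurable lborel (borel \<Otimes>\<^sub>M borel)"
    unfolding borel_prod case_prod_unfold measurable_lborel2
    by (intro borel_measurable_continuous_onI continuous_intros)
  have "(LINT p|lborel. h ((p $ 1)\<^sup>2 + (p $ 2)\<^sup>2, p $ (3::3))) =
      (LINT p|distr lborel borel pt3. h ((p $ 1)\<^sup>2 + (p $ 2)\<^sup>2, p $ (3::3)))"
    by (simp add: distr_pt3_lborel)
  also have "\<dots> = (LINT q|lborel. h (?T q))"
    by (subst integral_distr) (use m1 in \<open>auto simp: case_prod_unfold\<close>)
  also have "\<dots> = (LINT y|distr lborel (borel \<Otimes>\<^sub>M borel) ?T. h y)"
    by (subst integral_distr[OF m2]) (use hm in auto)
  also have "\<dots> = (LINT u|disc_area. LINT t|lborel. h (u, t))"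
    unfolding distr_cylindrical using DL.integral_fst'[OF int] by simp
  also have "\<dots> = (LINT u|lborel. (pi * indicator {0<..} u) *\<^sub>R (LINT t|lborel. h (u, t)))"
    unfolding disc_area_def 
    by (rule integral_density) (use borel_measurable_integrable[OF DL.integrable_fst'[OF int]] in auto)
  also have "\<dots> = (LINT u|lborel. pi * (indicator {0<..} u *\<^sub>R (LINT t|lborel. h (u, t))))"
    by (intro Bochner_Integration.integral_cong) (auto simp: indicator_def scaleR_conv_of_real)
  also have "\<dots> = pi * (LINT u:{0<..}|lborel. LINT t|lborel. h (u, t))"
    unfolding set_lebesgue_integral_def by (subst integral_mult_right_zero) simp
  finally show "(LINT p|lborel. h ((p $ 1)\<^sup>2 + (p $ 2)\<^sup>2, p $ (3::3))) =
     pi * (LINT u:{0<..}|lborel. LINT t|lborel. h (u, t))" .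
  have "integrable (density lborel (\<lambda>u. ennreal (pi * indicator {0<..} u))) (\<lambda>u. LINT t|lborel. h (u, t))"
    using DL.integrable_fst'[OF int] by (simp add: disc_area_def)
  then have "integrable lborel (\<lambda>u. (pi * indicator {0<..} u) *\<^sub>R (LINT t|lborel. h (u, t)))"
    by (subst (asm) integrable_density) (use borel_measurable_integrable[OF DL.integrable_fst'[OF int]] in auto)
  then have "integrable lborel (\<lambda>u. (1/pi) *\<^sub>R ((pi * indicator {0<..} u) *\<^sub>R (LINT t|lborel. h (u, t))))"
    by (rule integrable_scaleR_right)
  then show "set_integrable lborel {0<..} (\<lambda>u. LINT t|lborel. h (u, t))"
    unfolding set_integrable_def by simp
qed

text \<open>The reflection preserves Lebesgue measure, so an integrable odd function has integral 0.
  If the function is not integrable, the value 0 is the default of the Bochner integral.\<close>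

lemma integral_odd_eq_0:
  fixes f :: "real^3 \<Rightarrow> complex"
  assumes "\<And>p. f (- p) = - f p"
  shows "(LINT p|lborel. f p) = 0"
proof (cases "integrable lborel f")
  case True
  then have m: "f \<in> borel_measurable borel" by auto
  have "lborel = distr lborel borel (uminus :: real^3 \<Rightarrow> real^3)"
    using lborel_affine[of "-1" "0::real^3"] by (simp add: density_1)
  then have "(LINT p|lborel. f p) = (LINT p|distr lborel borel uminus. f p)"
    by simp
  also have "\<dots> = - (LINT p|lborel. f p)"
    by (subst integral_distr) (use m assms in auto)
  finally show ?thesis by simp
qed (simp add: not_integrable_integral_eq)

section \<open>Spectral calculus of the symbol\<close>

definition gap :: "real \<Rightarrow> real \<Rightarrow> real \<Rightarrow> real" where
  "gap \<beta> \<alpha> u = sqrt (\<beta>\<^sup>2 + \<alpha>\<^sup>2 * u)"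

text \<open>The (s, s) entry of the spectral projection of the symbol onto the eigenvalue branch
  with sign \<tau>.\<close>

definition wt :: "real \<Rightarrow> real \<Rightarrow> 2 \<Rightarrow> real \<Rightarrow> real \<Rightarrow> real" where
  "wt \<beta> \<alpha> s \<tau> u = (1 + \<tau> * spin s * \<beta> / gap \<beta> \<alpha> u) / 2"

definition plane_sq :: "real^3 \<Rightarrow> real" where
  "plane_sq p = (p $ 1)\<^sup>2 + (p $ 2)\<^sup>2"

text \<open>This is f(H(p)). The symbol is x + V with V traceless and V^2 = D^2, so every function
  of it is a + b V, where a is the mean of f over the two eigenvalues and b its divided
  difference.\<close>

definition spec_mat :: "real \<Rightarrow> real \<Rightarrow> (real \<Rightarrow> complex) \<Rightarrow> real^3 \<Rightarrow> complex^2^2" where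
  "spec_mat \<beta> \<alpha> f p =
     (let x = (norm p)\<^sup>2; D = gap \<beta> \<alpha> (plane_sq p);
          a = (f (x + D) + f (x - D)) / 2; b = (f (x + D) - f (x - D)) / (2 * of_real D);
          v = of_real \<alpha> * Complex (p $ 2) (p $ 1)
      in vector [vector [a + b * of_real \<beta>, b * v], vector [b * cnj v, a - b * of_real \<beta>]])"

lemma plane_sq_nonneg: "plane_sq p \<ge> 0"
  by (simp add: plane_sq_def)

lemma norm_pow2_cart3: "(norm (p :: real^3))\<^sup>2 = plane_sq p + (p $ 3)\<^sup>2"
  unfolding power2_norm_eq_inner by (simp add: inner_vec_def sum_3 plane_sq_def power2_eq_square)

lemma gap_ge: "\<beta> > 0 \<Longrightarrow> u \<ge> 0 \<Longrightarrow> gap \<beta> \<alpha> u \<ge> \<beta>"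
  unfolding gap_def by (rule real_le_rsqrt) auto

lemma gap_pos: "\<beta> > 0 \<Longrightarrow> u \<ge> 0 \<Longrightarrow> gap \<beta> \<alpha> u > 0"
  using gap_ge by (metis order_less_le_trans)

lemma gap_sq: "u \<ge> 0 \<Longrightarrow> (gap \<beta> \<alpha> u)\<^sup>2 = \<beta>\<^sup>2 + \<alpha>\<^sup>2 * u"
  by (simp add: gap_def)

lemma spec_mat_off_norm:
  "(of_real \<alpha> * Complex (p $ 2) (p $ 1)) * cnj (of_real \<alpha> * Complex (p $ 2) (p $ 1)) =
     (of_real (gap \<beta> \<alpha> (plane_sq p)))\<^sup>2 - (of_real \<beta>)\<^sup>2"
  unfolding of_real_power[symmetric] gap_sq[OF plane_sq_nonneg]
  by (simp add: complex_eq_iff plane_sq_def power2_eq_square algebra_simps)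

lemma mult_2x2_commuting:
  fixes a b c d v v' B :: complex
  shows "(vector [vector [a + b * B, b * v], vector [b * v', a - b * B]] :: complex^2^2) **
      (vector [vector [c + d * B, d * v], vector [d * v', c - d * B]] :: complex^2^2) =
    vector [vector [(a * c + b * d * (v * v' + B\<^sup>2)) + (a * d + b * c) * B, (a * d + b * c) * v],
      vector [(a * d + b * c) * v', (a * c + b * d * (v * v' + B\<^sup>2)) - (a * d + b * c) * B]]"
  by (simp add: vec_eq_iff forall_2 matrix_matrix_mult_def sum_2 algebra_simps power2_eq_square)

text \<open>Interpolation at the two eigenvalues respects products because the traceless part of the
  symbol squares to D^2. With \<open>spec_mat_const\<close> and \<open>spec_mat_add\<close> this
  makes every matrix inverse below a pointwise reciprocal.\<close>

lemma spec_mat_mult: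
  assumes "\<beta> > 0"
  shows "spec_mat \<beta> \<alpha> f p ** spec_mat \<beta> \<alpha> g p = spec_mat \<beta> \<alpha> (\<lambda>l. f l * g l) p"
proof -
  define x where "x = (norm p)\<^sup>2"
  define D where "D = gap \<beta> \<alpha> (plane_sq p)"
  define v where "v = of_real \<alpha> * Complex (p $ 2) (p $ 1)"
  have D: "complex_of_real D \<noteq> 0"
    using gap_pos[OF assms plane_sq_nonneg] by (simp add: D_def less_imp_neq[symmetric])
  have v: "v * cnj v + (of_real \<beta>)\<^sup>2 = (of_real D)\<^sup>2"
    unfolding v_def D_def by (subst spec_mat_off_norm[of \<alpha> p \<beta>]) simp
  have *: "(fp + fm) / 2 * ((gp + gm) / 2) + (fp - fm) / (2 * d) * ((gp - gm) / (2 * d)) * d\<^sup>2 = (fp * gp + fm * gm) / 2"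
    "(fp + fm) / 2 * ((gp - gm) / (2 * d)) + (fp - fm) / (2 * d) * ((gp + gm) / 2) = (fp * gp - fm * gm) / (2 * d)"
    if "d \<noteq> 0" for fp fm gp gm d :: complex
    using that by (simp_all add: field_simps power2_eq_square)
  show ?thesis
    unfolding spec_mat_def Let_def x_def[symmetric] D_def[symmetric] v_def[symmetric]
      mult_2x2_commuting v *[OF D] ..
qed

lemma spec_mat_const: "spec_mat \<beta> \<alpha> (\<lambda>_. c) p = mat c"
  by (simp add: spec_mat_def Let_def vec_eq_iff forall_2 mat_def)

lemma spec_mat_add:
  "spec_mat \<beta> \<alpha> f p + spec_mat \<beta> \<alpha> g p = spec_mat \<beta> \<alpha> (\<lambda>l. f l + g l) p"
  by (simp add: spec_mat_def Let_def vec_eq_iff forall_2 add_divide_distrib diff_divide_distrib algebra_simps)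

lemma H_symbol_eq_spec_mat:
  assumes "\<beta> > 0"
  shows "H_symbol \<beta> \<alpha> p = spec_mat \<beta> \<alpha> of_real p"
proof -
  define D where "D = gap \<beta> \<alpha> (plane_sq p)"
  have D: "D \<noteq> 0"
    using gap_pos[OF assms plane_sq_nonneg] by (simp add: D_def less_imp_neq[symmetric])
  have *: "(complex_of_real (x + D) + complex_of_real (x - D)) / 2 = of_real x"
    "(complex_of_real (x + D) - complex_of_real (x - D)) / (2 * of_real D) = 1" for x
    using D by (simp_all add: field_simps)
  show ?thesis
    unfolding spec_mat_def Let_def D_def[symmetric] *
    by (simp add: H_symbol_def vec_eq_iff forall_2 mat_def pauli1_def pauli2_def pauli3_def complex_eq_iff)
qed

lemma matrix_inv_unique_eq:
  assumes "A ** B = mat 1" "B ** A = mat 1"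
  shows "matrix_inv A = B"
proof -
  have "A ** matrix_inv A = mat 1 \<and> matrix_inv A ** A = mat 1"
    unfolding matrix_inv_def by (rule someI[of _ B]) (use assms in auto)
  then show ?thesis
    by (metis assms(2) matrix_mul_assoc matrix_mul_lid matrix_mul_rid)
qed

lemma spec_mat_cong:
  assumes "\<And>l. l = (norm p)\<^sup>2 + gap \<beta> \<alpha> (plane_sq p) \<or> l = (norm p)\<^sup>2 - gap \<beta> \<alpha> (plane_sq p) \<Longrightarrow> f l = g l"
  shows "spec_mat \<beta> \<alpha> f p = spec_mat \<beta> \<alpha> g p"
  using assms by (simp add: spec_mat_def Let_def)

lemma matrix_inv_spec_mat:
  assumes "\<beta> > 0"
    and "\<And>l. l = (norm p)\<^sup>2 + gap \<beta> \<alpha> (plane_sq p) \<or> l = (norm p)\<^sup>2 - gap \<beta> \<alpha> (plane_sq p) \<Longrightarrow> f l \<noteq> 0"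
  shows "matrix_inv (spec_mat \<beta> \<alpha> f p) = spec_mat \<beta> \<alpha> (\<lambda>l. 1 / f l) p"
  by (rule matrix_inv_unique_eq; unfold spec_mat_mult[OF assms(1)] spec_mat_const[symmetric, of _ \<beta> \<alpha> p];
      rule spec_mat_cong) (use assms(2) in auto)

text \<open>(u + \<beta>)^2 exceeds the square of the gap by u^2 + (2 \<beta> - \<alpha>^2) u. The
  bound on \<alpha>^2 is thus what keeps the lower branch, and with it the spectrum, above
  -\<beta>.\<close>

lemma branch_ge:
  assumes "\<beta> > 0" "\<alpha>\<^sup>2 \<le> 2 * \<beta>" "u \<ge> 0"
  shows "u - gap \<beta> \<alpha> u \<ge> - \<beta>" "u + gap \<beta> \<alpha> u \<ge> \<beta>"
proof -
  have "\<alpha>\<^sup>2 * u \<le> 2 * \<beta> * u"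
    using assms by (intro mult_right_mono) auto
  then have "\<beta>\<^sup>2 + \<alpha>\<^sup>2 * u \<le> (u + \<beta>)\<^sup>2"
    using zero_le_square[of u] by (simp add: power2_eq_square algebra_simps del: zero_le_square)
  then have "gap \<beta> \<alpha> u \<le> u + \<beta>"
    unfolding gap_def by (intro real_le_lsqrt) (use assms in auto)
  then show "u - gap \<beta> \<alpha> u \<ge> - \<beta>"
    by simp
  show "u + gap \<beta> \<alpha> u \<ge> \<beta>"
    using gap_ge[of \<beta> u \<alpha>] assms by auto
qed

definition res_set :: "real \<Rightarrow> complex set" where
  "res_set \<beta> = {z. Im z \<noteq> 0 \<or> Re z < - \<beta>}"

lemma res_set_neq: "z \<in> res_set \<beta> \<Longrightarrow> l \<ge> - \<beta> \<Longrightarrow> of_real l - z \<noteq> 0"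
  by (auto simp: res_set_def complex_eq_iff)

lemma branch_values_ge:
  assumes "\<beta> > 0" "\<alpha>\<^sup>2 \<le> 2 * \<beta>"
    and "l = (norm p)\<^sup>2 + gap \<beta> \<alpha> (plane_sq p) \<or> l = (norm p)\<^sup>2 - gap \<beta> \<alpha> (plane_sq p)"
  shows "l \<ge> - \<beta>"
  using branch_ge[OF assms(1,2) plane_sq_nonneg[of p]] assms(1,3) unfolding norm_pow2_cart3 
  by (smt (verit) zero_le_power2)

lemma H_resolvent_eq_spec_mat:
  assumes "\<beta> > 0" "\<alpha>\<^sup>2 \<le> 2 * \<beta>" "z \<in> res_set \<beta>"
  shows "H_resolvent \<beta> \<alpha> z p = spec_mat \<beta> \<alpha> (\<lambda>l. 1 / (of_real l - z)) p"
proof -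
  have "H_symbol \<beta> \<alpha> p - mat z = H_symbol \<beta> \<alpha> p + mat (- z)"
    by (simp add: vec_eq_iff mat_def)
  also have "\<dots> = spec_mat \<beta> \<alpha> (\<lambda>l. of_real l - z) p"
    by (simp add: H_symbol_eq_spec_mat[OF assms(1)] spec_mat_const[symmetric, of "-z" \<beta> \<alpha> p] spec_mat_add)
  finally show ?thesis
    unfolding H_resolvent_def
    using matrix_inv_spec_mat[OF assms(1), of p \<alpha> "\<lambda>l. of_real l - z"]
      res_set_neq[OF assms(3)] branch_values_ge[OF assms(1,2)] by auto
qed

definition phi :: "complex \<Rightarrow> real \<Rightarrow> complex" where
  "phi z l = (1 + z * of_real l) / ((of_real l - z) * ((of_real l)\<^sup>2 + 1))"

lemma of_real_sq_plus_1_neq_0: "(of_real l)\<^sup>2 + 1 \<noteq> (0 :: complex)"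
proof -
  have "(of_real l)\<^sup>2 + 1 = complex_of_real (l\<^sup>2 + 1)" by simp
  then show ?thesis by (smt (verit) of_real_eq_0_iff zero_le_power2)
qed

lemma Q_integrand_eq_spec_mat:
  assumes "\<beta> > 0" "\<alpha>\<^sup>2 \<le> 2 * \<beta>" "z \<in> res_set \<beta>"
  shows "(mat 1 + mat z ** H_symbol \<beta> \<alpha> p) ** H_resolvent \<beta> \<alpha> z p **
          matrix_inv (H_symbol \<beta> \<alpha> p ** H_symbol \<beta> \<alpha> p + mat 1) = spec_mat \<beta> \<alpha> (phi z) p"
proof -
  have sq: "(of_real l)\<^sup>2 + 1 \<noteq> (0::complex)" for l by (rule of_real_sq_plus_1_neq_0)
  have "H_symbol \<beta> \<alpha> p ** H_symbol \<beta> \<alpha> p + mat 1 = spec_mat \<beta> \<alpha> (\<lambda>l. (of_real l)\<^sup>2 + 1) p"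
    by (simp add: H_symbol_eq_spec_mat[OF assms(1)] spec_mat_const[symmetric, of 1 \<beta> \<alpha> p] spec_mat_add
        spec_mat_mult[OF assms(1)] power2_eq_square)
  then have "matrix_inv (H_symbol \<beta> \<alpha> p ** H_symbol \<beta> \<alpha> p + mat 1) = spec_mat \<beta> \<alpha> (\<lambda>l. 1 / ((of_real l)\<^sup>2 + 1)) p"
    by (simp add: matrix_inv_spec_mat[OF assms(1)] sq)
  moreover have "mat 1 + mat z ** H_symbol \<beta> \<alpha> p = spec_mat \<beta> \<alpha> (\<lambda>l. 1 + z * of_real l) p"
    by (simp add: H_symbol_eq_spec_mat[OF assms(1)] spec_mat_const[symmetric, of _ \<beta> \<alpha> p] spec_mat_add
        spec_mat_mult[OF assms(1)])
  ultimately show ?thesis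
    by (simp add: H_resolvent_eq_spec_mat[OF assms] spec_mat_mult[OF assms(1)] phi_def[abs_def])
qed

text \<open>The diagonal entry of f(H(p)) in the coordinates u, the squared plane radius, and t, the
  third component. Polymorphic because it serves complex functions in Q and real squared moduli in
  the normalisation.\<close>

definition spec_avg :: "real \<Rightarrow> real \<Rightarrow> 2 \<Rightarrow> (real \<Rightarrow> 'a::real_vector) \<Rightarrow> real \<times> real \<Rightarrow> 'a" where
  "spec_avg \<beta> \<alpha> s f = (\<lambda>(u, t).
     wt \<beta> \<alpha> s 1 u *\<^sub>R f (u + t\<^sup>2 + gap \<beta> \<alpha> u) + wt \<beta> \<alpha> s (-1) u *\<^sub>R f (u + t\<^sup>2 - gap \<beta> \<alpha> u))"

lemma spec_mat_diag:
  assumes "\<beta> > 0"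
  shows "spec_mat \<beta> \<alpha> f p $ s $ s = spec_avg \<beta> \<alpha> s f (plane_sq p, p $ 3)"
proof -
  define D where "D = gap \<beta> \<alpha> (plane_sq p)"
  have D: "complex_of_real D \<noteq> 0"
    using gap_pos[OF assms plane_sq_nonneg] by (simp add: D_def less_imp_neq[symmetric])
  show ?thesis
    using D exhaust_2[of s] unfolding spec_mat_def spec_avg_def Let_def prod.case D_def[symmetric] norm_pow2_cart3 wt_def
    by (auto simp: spin_def scaleR_conv_of_real field_simps)
qed

text \<open>The squared norm of a column of f(H) is a diagonal entry of the adjoint of f(H) times
  f(H), that is, of the function |f|^2 of H.\<close>

lemma spec_mat_column_norm:
  assumes "\<beta> > 0"
  shows "(norm (spec_mat \<beta> \<alpha> f p *v axis s 1))\<^sup>2 =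
     spec_avg \<beta> \<alpha> s (\<lambda>l. (cmod (f l))\<^sup>2) (plane_sq p, p $ 3)"
proof -
  define D where "D = gap \<beta> \<alpha> (plane_sq p)"
  define x where "x = (norm p)\<^sup>2"
  have D: "D \<noteq> 0"
    using gap_pos[OF assms plane_sq_nonneg] by (simp add: D_def less_imp_neq[symmetric])
  define fp fm where "fp = f (x + D)" and "fm = f (x - D)"
  define a b where "a = (fp + fm) / 2" and "b = (fp - fm) / (2 * of_real D)"
  have fp: "fp = a + b * of_real D" and fm: "fm = a - b * of_real D"
    using D by (simp_all add: a_def b_def field_simps)
  have v: "(cmod (of_real \<alpha> * Complex (p $ 2) (p $ 1)))\<^sup>2 = D\<^sup>2 - \<beta>\<^sup>2"
  proof -
    have "complex_of_real ((cmod (of_real \<alpha> * Complex (p $ 2) (p $ 1)))\<^sup>2) = of_real (D\<^sup>2 - \<beta>\<^sup>2)"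
      using spec_mat_off_norm[of \<alpha> p \<beta>] unfolding complex_norm_square D_def by simp
    then show ?thesis by (simp only: of_real_eq_iff)
  qed
  have n: "(norm (M *v axis s 1))\<^sup>2 = (cmod (M $ 1 $ s))\<^sup>2 + (cmod (M $ 2 $ s))\<^sup>2" for M :: "complex^2^2"
    using exhaust_2[of s]
    by (auto simp: power2_norm_eq_inner inner_vec_def sum_2 matrix_vector_mult_def axis_def)
  have v': "(cmod (b * (of_real \<alpha> * Complex (p $ 2) (p $ 1))))\<^sup>2 = (cmod b)\<^sup>2 * (D\<^sup>2 - \<beta>\<^sup>2)"
     "(cmod (b * cnj (of_real \<alpha> * Complex (p $ 2) (p $ 1))))\<^sup>2 = (cmod b)\<^sup>2 * (D\<^sup>2 - \<beta>\<^sup>2)"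
    using v by (simp_all only: norm_mult power_mult_distrib complex_mod_cnj)
  have key: "(cmod (a + \<sigma> *\<^sub>R (b * of_real \<beta>)))\<^sup>2 + (cmod b)\<^sup>2 * (D\<^sup>2 - \<beta>\<^sup>2) =
      (1 + \<sigma> * \<beta> / D) / 2 * (cmod fp)\<^sup>2 + (1 - \<sigma> * \<beta> / D) / 2 * (cmod fm)\<^sup>2" if "\<sigma> = 1 \<or> \<sigma> = -1" for \<sigma>
    using D that unfolding fp fm cmod_power2 
    by (auto simp: field_simps power2_eq_square)
  show ?thesis
    using key[of "spin s"] exhaust_2[of s]
    unfolding n spec_mat_def spec_avg_def Let_def prod.case D_def[symmetric] x_def[symmetric] fp_def[symmetric] fm_def[symmetric]
      a_def[symmetric] b_def[symmetric] wt_def norm_pow2_cart3[symmetric]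
    by (auto simp: spin_def v' simp del: complex_cnj_mult)
qed

section \<open>Line integrals of the resolvent\<close>

lemma Re_csqrt_pos:
  assumes "a \<notin> \<real>\<^sub>\<le>\<^sub>0"
  shows "Re (csqrt a) > 0"
proof (rule ccontr)
  assume "\<not> Re (csqrt a) > 0"
  then have "Re (csqrt a) = 0" using Re_csqrt[of a] by auto
  then have "(csqrt a)\<^sup>2 = of_real (- (Im (csqrt a))\<^sup>2)"
    by (simp add: complex_eq_iff power2_eq_square)
  then have "a = of_real (- (Im (csqrt a))\<^sup>2)" by simp
  then have "a \<in> \<real>\<^sub>\<le>\<^sub>0"
    by (metis neg_le_0_iff_le nonpos_Reals_of_real_iff zero_le_power2)
  then show False using assms by simp
qed

lemma sum_sq_factor:
  "(of_real t)\<^sup>2 + (a::complex) = (of_real t - \<i> * csqrt a) * (of_real t + \<i> * csqrt a)"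
proof -
  have "(of_real t - \<i> * csqrt a) * (of_real t + \<i> * csqrt a) = (of_real t)\<^sup>2 + (csqrt a)\<^sup>2"
    by (simp add: algebra_simps power2_eq_square)
  then show ?thesis by simp
qed

lemma sum_sq_neq_0:
  fixes a :: complex
  assumes "a \<notin> \<real>\<^sub>\<le>\<^sub>0"
  shows "(of_real t)\<^sup>2 + a \<noteq> 0"
proof -
  define c where "c = csqrt a"
  have "Re c > 0" using Re_csqrt_pos[OF assms] by (simp add: c_def)
  then show ?thesis
    unfolding sum_sq_factor c_def[symmetric] by (auto simp: complex_eq_iff)
qed

text \<open>For large t the term t^2 dominates. For the remaining t both factors of
  \<open>sum_sq_factor\<close> have imaginary part of modulus Re (csqrt a), which is positive off
  the cut. The constant C adds up the two cases.\<close>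

lemma sum_sq_lower_bound:
  fixes a :: complex
  assumes "a \<notin> \<real>\<^sub>\<le>\<^sub>0"
  obtains C where "C > 0" "\<And>t. 1 + t\<^sup>2 \<le> C * cmod ((of_real t)\<^sup>2 + a)"
proof -
  define r where "r = Re (csqrt a)"
  have r: "r > 0" using Re_csqrt_pos[OF assms] by (simp add: r_def)
  define C where "C = 2 + (2 * cmod a + 2) / r\<^sup>2"
  have "1 + t\<^sup>2 \<le> C * cmod ((of_real t)\<^sup>2 + a)" for t
  proof (cases "t\<^sup>2 \<ge> 2 * cmod a + 1")
    case True
    have "cmod ((of_real t)\<^sup>2 + a) \<ge> cmod ((of_real t)\<^sup>2) - cmod a"
      by (metis norm_diff_ineq)
    then have "cmod ((of_real t)\<^sup>2 + a) \<ge> t\<^sup>2 - cmod a"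
      by (simp add: norm_power)
    then have "2 * cmod ((of_real t)\<^sup>2 + a) \<ge> 1 + t\<^sup>2" using True by simp
    also have "2 * cmod ((of_real t)\<^sup>2 + a) \<le> C * cmod ((of_real t)\<^sup>2 + a)"
      by (rule mult_right_mono) (auto simp: C_def)
    finally show ?thesis .
  next
    case False
    have "\<bar>Im (of_real t - \<i> * csqrt a)\<bar> \<le> cmod (of_real t - \<i> * csqrt a)"
      "\<bar>Im (of_real t + \<i> * csqrt a)\<bar> \<le> cmod (of_real t + \<i> * csqrt a)"
      by (rule abs_Im_le_cmod)+
    then have "r \<le> cmod (of_real t - \<i> * csqrt a)" "r \<le> cmod (of_real t + \<i> * csqrt a)"
      using r by (simp_all add: r_def)
    then have "r * r \<le> cmod ((of_real t)\<^sup>2 + a)"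
      unfolding sum_sq_factor norm_mult using r by (intro mult_mono) auto
    then have "(2 * cmod a + 2) / r\<^sup>2 * r\<^sup>2 \<le> C * cmod ((of_real t)\<^sup>2 + a)"
      using r by (intro mult_mono) (auto simp: C_def power2_eq_square)
    then show ?thesis using False r by simp
  qed
  moreover have "C > 0"
    unfolding C_def using r by (intro add_pos_nonneg) auto
  ultimately show thesis using that by blast
qed

lemma integrable_inverse_1_plus_sq: "integrable lborel (\<lambda>t::real. 1 / (1 + t\<^sup>2))"
  using integrable_inverse_1_plus_square by (simp add: set_integrable_def inverse_eq_divide)

lemma integrable_sum_sq:
  fixes a :: complex
  assumes "a \<notin> \<real>\<^sub>\<le>\<^sub>0"
  shows "integrable lborel (\<lambda>t::real. 1 / ((of_real t)\<^sup>2 + a))"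
proof -
  obtain C where C: "C > 0" "\<And>t. 1 + t\<^sup>2 \<le> C * cmod ((of_real t)\<^sup>2 + a)"
    using sum_sq_lower_bound[OF assms] by blast
  show ?thesis
  proof (rule Bochner_Integration.integrable_bound)
    show "integrable lborel (\<lambda>t::real. C * (1 / (1 + t\<^sup>2)))"
      by (intro integrable_mult_right integrable_inverse_1_plus_sq)
    have "norm (1 / ((of_real t)\<^sup>2 + a)) \<le> norm (C * (1 / (1 + t\<^sup>2)))" for t
    proof -
      have p: "cmod ((of_real t)\<^sup>2 + a) > 0" using sum_sq_neq_0[OF assms] by simp
      have q: "1 + t\<^sup>2 > 0" by (smt (verit) zero_le_power2)
      have "1 / cmod ((of_real t)\<^sup>2 + a) \<le> C / (1 + t\<^sup>2)"
        using C(2)[of t] p q by (simp add: field_simps)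
      then show ?thesis using C(1) q by (simp add: norm_divide)
    qed
    then show "AE t in lborel. norm (1 / ((of_real t)\<^sup>2 + a)) \<le> norm (C * (1 / (1 + t\<^sup>2)))" by simp
  qed simp
qed

text \<open>Each logarithm diverges, but division of its argument by t > 0 splits off the same term
  ln t from both and leaves arguments tending to 1.\<close>

lemma Ln_diff_conj_tendsto:
  fixes b :: complex
  assumes "Re b > 0"
  shows "((\<lambda>t::real. Ln (of_real t - \<i> * b) - Ln (of_real t + \<i> * b)) \<longlongrightarrow> 0) at_top"
proof -
  have "((\<lambda>t::real. (of_real t - \<i> * b) / of_real t) \<longlongrightarrow> 1) at_top"
    "((\<lambda>t::real. (of_real t + \<i> * b) / of_real t) \<longlongrightarrow> 1) at_top"
  proof -
    have 1: "((\<lambda>t::real. 1 - \<i> * b / of_real t) \<longlongrightarrow> 1 - 0) at_top"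
      "((\<lambda>t::real. 1 + \<i> * b / of_real t) \<longlongrightarrow> 1 + 0) at_top"
      by (intro tendsto_intros tendsto_divide_0[OF tendsto_const] filterlim_of_real_at_infinity)+
    have ev: "eventually (\<lambda>t::real. t > 0) at_top" by (rule eventually_gt_at_top)
    show "((\<lambda>t::real. (of_real t - \<i> * b) / of_real t) \<longlongrightarrow> 1) at_top"
      by (rule Lim_transform_eventually[OF 1(1)[simplified]], rule eventually_mono[OF ev]) (auto simp: field_simps)
    show "((\<lambda>t::real. (of_real t + \<i> * b) / of_real t) \<longlongrightarrow> 1) at_top"
      by (rule Lim_transform_eventually[OF 1(2)[simplified]], rule eventually_mono[OF ev]) (auto simp: field_simps)
  qed
  then have "((\<lambda>t::real. Ln ((of_real t - \<i> * b) / of_real t) - Ln ((of_real t + \<i> * b) / of_real t)) \<longlongrightarrow> Ln 1 - Ln 1) at_top"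
    by (intro tendsto_intros) auto
  then have "((\<lambda>t::real. Ln ((of_real t - \<i> * b) / of_real t) - Ln ((of_real t + \<i> * b) / of_real t)) \<longlongrightarrow> 0) at_top"
    by simp
  then show ?thesis
  proof (rule Lim_transform_eventually)
    show "\<forall>\<^sub>F t::real in at_top. Ln ((of_real t - \<i> * b) / of_real t) - Ln ((of_real t + \<i> * b) / of_real t) =
        Ln (of_real t - \<i> * b) - Ln (of_real t + \<i> * b)"
      using eventually_gt_at_top[of 0]
    proof eventually_elim
      case (elim t)
      have "of_real t - \<i> * b \<noteq> 0" "of_real t + \<i> * b \<noteq> 0"
        using assms by (auto simp: complex_eq_iff)
      then show ?case using elim
        Ln_times_of_real[of "1 / t" "of_real t - \<i> * b"] Ln_times_of_real[of "1 / t" "of_real t + \<i> * b"] by simp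
    qed
  qed
qed

text \<open>The antiderivative \<open>F\<close> is a difference of logarithms whose arguments stay
  in the lower and in the upper half plane, so the cut of \<open>Ln\<close> is never met on the real
  line. The whole value comes from the end at minus infinity, where reflection adds -\<i> pi to the
  first and \<i> pi to the second logarithm.\<close>

lemma integral_sum_sq:
  assumes a: "a \<notin> \<real>\<^sub>\<le>\<^sub>0"
  shows "(LINT t|lborel. 1 / ((of_real t)\<^sup>2 + a)) = of_real pi / csqrt a"
proof -
  define b where "b = csqrt a"
  have b: "Re b > 0" "b \<noteq> 0" using Re_csqrt_pos[OF a] by (auto simp: b_def)
  define F where "F = (\<lambda>t::real. (Ln (of_real t - \<i> * b) - Ln (of_real t + \<i> * b)) / (2 * \<i> * b))"
  have nz: "of_real t - \<i> * b \<noteq> 0" "of_real t + \<i> * b \<noteq> 0" for t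
    using b by (auto simp: complex_eq_iff)
  have pf: "(1 / p - 1 / q) / c = 1 / (p * q)" if "q - p = c" "p \<noteq> 0" "q \<noteq> 0" "c \<noteq> 0" for p q c :: complex
    using that(2-) unfolding that(1)[symmetric] by (simp add: field_simps)
  have "(LBINT t=-\<infinity>..\<infinity>. 1 / ((of_real t)\<^sup>2 + a)) = 0 - (- (of_real pi / b))"
  proof (rule interval_integral_FTC_integrable)
    show "((F \<circ> real_of_ereal) \<longlongrightarrow> 0) (at_left \<infinity>)"
      unfolding ereal_tendsto_simps F_def
      using tendsto_divide[OF Ln_diff_conj_tendsto[OF b(1)] tendsto_const[of "2 * \<i> * b"]] b by simp
    have "((\<lambda>t::real. ((Ln (of_real t + \<i> * b) - \<i> * pi) - (Ln (of_real t - \<i> * b) + \<i> * pi)) / (2 * \<i> * b)) \<longlongrightarrow> - (of_real pi / b)) at_top"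
    proof -
      have "((\<lambda>t::real. (- (Ln (of_real t - \<i> * b) - Ln (of_real t + \<i> * b)) - 2 * \<i> * pi) / (2 * \<i> * b)) \<longlongrightarrow> (- 0 - 2 * \<i> * pi) / (2 * \<i> * b)) at_top"
        using b by (intro tendsto_intros Ln_diff_conj_tendsto) auto
      moreover have "(- 0 - 2 * \<i> * pi) / (2 * \<i> * b) = - (of_real pi / b)"
        using b by (simp add: field_simps)
      ultimately show ?thesis by (simp add: algebra_simps)
    qed
    moreover have "F (- t) = ((Ln (of_real t + \<i> * b) - \<i> * pi) - (Ln (of_real t - \<i> * b) + \<i> * pi)) / (2 * \<i> * b)" for t
    proof -
      have "Ln (- (of_real t + \<i> * b)) = Ln (of_real t + \<i> * b) - \<i> * pi"
        "Ln (- (of_real t - \<i> * b)) = Ln (of_real t - \<i> * b) + \<i> * pi"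
        using b nz by (subst Ln_minus; auto)+
      then show ?thesis unfolding F_def by (simp add: algebra_simps)
    qed
    ultimately show "((F \<circ> real_of_ereal) \<longlongrightarrow> - (of_real pi / b)) (at_right (-\<infinity>))"
      unfolding ereal_tendsto_simps at_bot_mirror filterlim_filtermap by simp
    show "set_integrable lborel (einterval (-\<infinity>) \<infinity>) (\<lambda>t. 1 / ((complex_of_real t)\<^sup>2 + a))"
      using integrable_sum_sq[OF a] by (simp add: set_integrable_def)
    fix x :: real
    have "((\<lambda>w. (Ln (w - \<i> * b) - Ln (w + \<i> * b)) / (2 * \<i> * b)) has_field_derivative 1 / ((of_real x)\<^sup>2 + a)) (at (of_real x))"
    proof -
      have "1 / ((of_real x)\<^sup>2 + a) = (1 / (of_real x - \<i> * b) - 1 / (of_real x + \<i> * b)) / (2 * \<i> * b)"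
        unfolding sum_sq_factor b_def[symmetric] by (rule pf[symmetric]) (use nz b in auto)
      moreover have "((\<lambda>w. (Ln (w - \<i> * b) - Ln (w + \<i> * b)) / (2 * \<i> * b)) has_field_derivative
          (1 / (of_real x - \<i> * b) - 1 / (of_real x + \<i> * b)) / (2 * \<i> * b)) (at (of_real x))"
        by (rule DERIV_cdivide, rule DERIV_diff)
          (use b in \<open>auto intro!: derivative_eq_intros simp: complex_nonpos_Reals_iff inverse_eq_divide\<close>)
      ultimately show ?thesis by simp
    qed
    then show "(F has_vector_derivative 1 / ((of_real x)\<^sup>2 + a)) (at x)"
      unfolding F_def by (rule has_vector_derivative_real_field)
    show "isCont (\<lambda>x. 1 / ((complex_of_real x)\<^sup>2 + a)) x"
      using sum_sq_neq_0[OF a] by (intro continuous_intros) auto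
  qed simp
  then show ?thesis
    by (simp add: interval_lebesgue_integral_def set_lebesgue_integral_def b_def)
qed

section \<open>The antiderivative in the transversal variable\<close>

definition root_br :: "real \<Rightarrow> real \<Rightarrow> complex \<Rightarrow> real \<Rightarrow> real \<Rightarrow> complex" where
  "root_br \<beta> \<alpha> z \<tau> u = csqrt (of_real (u + \<tau> * gap \<beta> \<alpha> u) - z)"

definition root_sum :: "real \<Rightarrow> real \<Rightarrow> complex \<Rightarrow> real \<Rightarrow> complex" where
  "root_sum \<beta> \<alpha> z u = root_br \<beta> \<alpha> z 1 u + root_br \<beta> \<alpha> z (-1) u"

text \<open>\<open>Th \<alpha> X\<close> is \<open>2 artanh (\<alpha> / X) / \<alpha>\<close>, with its limit at \<open>\<alpha> = 0\<close>.\<close>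

definition Th :: "real \<Rightarrow> complex \<Rightarrow> complex" where
  "Th \<alpha> X = (if \<alpha> = 0 then 2 / X else Ln ((X + of_real \<alpha>) / (X - of_real \<alpha>)) / of_real \<alpha>)"

text \<open>The primitive of (X^2 - 2 s \<beta>)/(X^2 - \<alpha>^2) that suits the integrals below:
  along \<open>root_sum\<close> its derivative in u becomes the weighted sum of inverse
  roots.\<close>

definition KX :: "real \<Rightarrow> real \<Rightarrow> 2 \<Rightarrow> complex \<Rightarrow> complex" where
  "KX \<beta> \<alpha> s X = X + of_real (spin s * \<beta> - \<alpha>\<^sup>2 / 2) * Th \<alpha> X"

definition X0 :: "real \<Rightarrow> complex \<Rightarrow> complex" where
  "X0 \<beta> z = csqrt (of_real \<beta> - z) + csqrt (- of_real \<beta> - z)"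

definition KK :: "real \<Rightarrow> real \<Rightarrow> 2 \<Rightarrow> complex \<Rightarrow> complex" where
  "KK \<beta> \<alpha> s z = KX \<beta> \<alpha> s (X0 \<beta> z)"

text \<open>A region that contains all values of \<open>root_sum\<close> and on which the argument
  of the logarithm in \<open>Th\<close> stays off the cut.\<close>

definition X_dom :: "real \<Rightarrow> complex set" where
  "X_dom \<alpha> = {X. Im X \<noteq> 0 \<or> Re X > \<alpha>}"

lemma X_dom_cayley:
  assumes "X \<in> X_dom \<alpha>" "\<alpha> \<ge> 0"
  shows "X \<noteq> 0" "X - of_real \<alpha> \<noteq> 0" "X + of_real \<alpha> \<noteq> 0" "(X + of_real \<alpha>) / (X - of_real \<alpha>) \<notin> \<real>\<^sub>\<le>\<^sub>0"
proof -
  show nz: "X \<noteq> 0" "X - of_real \<alpha> \<noteq> 0" "X + of_real \<alpha> \<noteq> 0"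
    using assms by (auto simp: X_dom_def complex_eq_iff)
  show "(X + of_real \<alpha>) / (X - of_real \<alpha>) \<notin> \<real>\<^sub>\<le>\<^sub>0"
  proof
    assume "(X + of_real \<alpha>) / (X - of_real \<alpha>) \<in> \<real>\<^sub>\<le>\<^sub>0"
    then obtain r where r: "(X + of_real \<alpha>) / (X - of_real \<alpha>) = of_real r" "r \<le> 0"
      by (auto elim: nonpos_Reals_cases)
    then have "X + of_real \<alpha> = of_real r * (X - of_real \<alpha>)" using nz by (simp add: field_simps)
    then have eq: "Re X + \<alpha> = r * (Re X - \<alpha>)" "Im X = r * Im X"
      by (simp_all add: complex_eq_iff)
    then have "Im X = 0" using r(2) by (smt (verit) mult_right_cancel mult_minus_left zero_less_mult_iff mult_cancel_right1)
    then have "Re X > \<alpha>" using assms by (simp add: X_dom_def)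
    then have "r * (Re X - \<alpha>) \<le> 0" using r(2) by (simp add: mult_nonpos_nonneg)
    then show False using eq \<open>Re X > \<alpha>\<close> assms by linarith
  qed
qed

lemma has_field_derivative_Th:
  assumes "X \<in> X_dom \<alpha>" "\<alpha> \<ge> 0"
  shows "(Th \<alpha> has_field_derivative - 2 / (X\<^sup>2 - (of_real \<alpha>)\<^sup>2)) (at X)"
proof (cases "\<alpha> = 0")
  case True
  have "((\<lambda>X. 2 / X) has_field_derivative - 2 / X\<^sup>2) (at X)"
    using X_dom_cayley(1)[OF assms] by (auto intro!: derivative_eq_intros simp: power2_eq_square field_simps)
  then show ?thesis using True by (simp add: Th_def[abs_def])
next
  case False
  define a where "a = complex_of_real \<alpha>"
  note nz = X_dom_cayley[OF assms, folded a_def]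
  have a: "a \<noteq> 0" using False by (simp add: a_def)
  have "((\<lambda>X. Ln ((X + a) / (X - a)) / a) has_field_derivative
      (1 * (X - a) - (X + a) * 1) / ((X - a) * (X - a)) / ((X + a) / (X - a)) / a) (at X)"
    using nz a by (auto intro!: derivative_eq_intros)
  also have "(1 * (X - a) - (X + a) * 1) / ((X - a) * (X - a)) / ((X + a) / (X - a)) / a = - 2 / (X\<^sup>2 - a\<^sup>2)"
  proof -
    have "(1 * (X - a) - (X + a) * 1) / ((X - a) * (X - a)) / ((X + a) / (X - a)) / a = - 2 / ((X - a) * (X + a))"
      using nz a by (simp add: divide_simps)
    also have "(X - a) * (X + a) = X\<^sup>2 - a\<^sup>2" by (simp add: algebra_simps power2_eq_square)
    finally show ?thesis .
  qed
  finally show ?thesis using False by (simp add: Th_def[abs_def] a_def)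
qed

lemma has_field_derivative_KX:
  assumes "X \<in> X_dom \<alpha>" "\<alpha> \<ge> 0"
  shows "(KX \<beta> \<alpha> s has_field_derivative (X\<^sup>2 - of_real (2 * spin s * \<beta>)) / (X\<^sup>2 - (of_real \<alpha>)\<^sup>2)) (at X)"
proof -
  have nz: "X\<^sup>2 - (of_real \<alpha>)\<^sup>2 \<noteq> 0"
  proof -
    have "X\<^sup>2 - (of_real \<alpha>)\<^sup>2 = (X - of_real \<alpha>) * (X + of_real \<alpha>)"
      by (simp add: algebra_simps power2_eq_square)
    then show ?thesis using X_dom_cayley(2,3)[OF assms] by simp
  qed
  have "(KX \<beta> \<alpha> s has_field_derivative 1 + of_real (spin s * \<beta> - \<alpha>\<^sup>2 / 2) * (- 2 / (X\<^sup>2 - (of_real \<alpha>)\<^sup>2))) (at X)"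
    unfolding KX_def[abs_def] by (intro DERIV_add DERIV_ident DERIV_cmult has_field_derivative_Th assms)
  also have "1 + of_real (spin s * \<beta> - \<alpha>\<^sup>2 / 2) * (- 2 / (X\<^sup>2 - (of_real \<alpha>)\<^sup>2)) =
      (X\<^sup>2 - of_real (2 * spin s * \<beta>)) / (X\<^sup>2 - (of_real \<alpha>)\<^sup>2)"
    using nz by (simp add: field_simps)
  finally show ?thesis .
qed

lemma gap_le:
  assumes "\<beta> > 0" "u \<ge> 0"
  shows "gap \<beta> \<alpha> u \<le> \<beta> + \<alpha>\<^sup>2 * u / (2 * \<beta>)"
  unfolding gap_def
proof (rule real_le_lsqrt)
  have "(\<beta> + \<alpha>\<^sup>2 * u / (2 * \<beta>))\<^sup>2 = \<beta>\<^sup>2 + \<alpha>\<^sup>2 * u + (\<alpha>\<^sup>2 * u / (2 * \<beta>))\<^sup>2"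
    using assms by (simp add: power2_sum)
  then show "\<beta>\<^sup>2 + \<alpha>\<^sup>2 * u \<le> (\<beta> + \<alpha>\<^sup>2 * u / (2 * \<beta>))\<^sup>2" by simp
qed (use assms in auto)

lemma notin_nonpos_Reals_shift:
  assumes "z \<in> res_set \<beta>" "c \<ge> - \<beta>"
  shows "of_real c - z \<notin> \<real>\<^sub>\<le>\<^sub>0"
  using assms by (auto simp: res_set_def complex_nonpos_Reals_iff)

lemma branch_notin_nonpos:
  assumes "\<beta> > 0" "\<alpha>\<^sup>2 \<le> 2 * \<beta>" "u \<ge> 0" "z \<in> res_set \<beta>" "\<tau> = 1 \<or> \<tau> = -1"
  shows "of_real (u + \<tau> * gap \<beta> \<alpha> u) - z \<notin> \<real>\<^sub>\<le>\<^sub>0"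
  using branch_ge[OF assms(1-3)] assms(1,5) by (intro notin_nonpos_Reals_shift[OF assms(4)]) auto

lemma Im_csqrt_neg:
  assumes "Im w < 0" shows "Im (csqrt w) < 0"
proof -
  define c where "c = csqrt w"
  have "Im (c\<^sup>2) < 0" "Re c \<ge> 0"
    using assms Re_csqrt[of w] by (simp_all add: c_def del: csqrt.sel)
  then show ?thesis
    unfolding c_def[symmetric] by (auto simp: power2_eq_square zero_less_mult_iff mult_less_0_iff)
qed

lemma Im_csqrt_pos:
  assumes "Im w > 0" shows "Im (csqrt w) > 0"
proof -
  define c where "c = csqrt w"
  have "Im (c\<^sup>2) > 0" "Re c \<ge> 0"
    using assms Re_csqrt[of w] by (simp_all add: c_def del: csqrt.sel)
  then show ?thesis
    unfolding c_def[symmetric] by (auto simp: power2_eq_square zero_less_mult_iff mult_less_0_iff)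
qed

text \<open>Off the real axis both roots have imaginary parts of the same strict sign, so their sum
  is not real. For real z < -\<beta> the upper root alone exceeds \<alpha>, since its radicand is
  larger than 2 \<beta>, and the lower root has nonnegative real part.\<close>

lemma root_sum_in_X_dom:
  assumes "\<beta> > 0" "\<alpha> \<ge> 0" "\<alpha>\<^sup>2 \<le> 2 * \<beta>" "u \<ge> 0" "z \<in> res_set \<beta>"
  shows "root_sum \<beta> \<alpha> z u \<in> X_dom \<alpha>"
proof -
  consider "Im z > 0" | "Im z < 0" | "Im z = 0" "Re z < - \<beta>"
    using assms(5) unfolding res_set_def by fastforce
  then show ?thesis
  proof cases
    case 1
    then have "Im (root_br \<beta> \<alpha> z 1 u) < 0" "Im (root_br \<beta> \<alpha> z (-1) u) < 0"
      unfolding root_br_def by (intro Im_csqrt_neg; simp)+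
    then show ?thesis by (simp add: X_dom_def root_sum_def)
  next
    case 2
    then have "Im (root_br \<beta> \<alpha> z 1 u) > 0" "Im (root_br \<beta> \<alpha> z (-1) u) > 0"
      unfolding root_br_def by (intro Im_csqrt_pos; simp)+
    then show ?thesis by (simp add: X_dom_def root_sum_def)
  next
    case 3
    have "u + gap \<beta> \<alpha> u - Re z > 2 * \<beta>"
      using branch_ge(2)[OF assms(1,3,4)] 3 by linarith
    then have "u + gap \<beta> \<alpha> u - Re z > \<alpha>\<^sup>2" using assms(3) by linarith
    then have "sqrt (u + gap \<beta> \<alpha> u - Re z) > \<alpha>"
      using assms(2) by (intro real_less_rsqrt) auto
    moreover have "u + gap \<beta> \<alpha> u - Re z > 0"
      using \<open>u + gap \<beta> \<alpha> u - Re z > 2 * \<beta>\<close> assms(1) by linarith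
    then have "root_br \<beta> \<alpha> z 1 u = of_real (sqrt (u + gap \<beta> \<alpha> u - Re z))"
      using 3 unfolding root_br_def by (subst csqrt_of_real_nonneg) auto
    moreover have "Re (root_br \<beta> \<alpha> z (-1) u) \<ge> 0"
      unfolding root_br_def by (rule Re_csqrt)
    ultimately have "Re (root_sum \<beta> \<alpha> z u) > \<alpha>"
      by (simp add: root_sum_def)
    then show ?thesis by (simp add: X_dom_def)
  qed
qed

lemma gap_0: "\<beta> > 0 \<Longrightarrow> gap \<beta> \<alpha> 0 = \<beta>"
  by (simp add: gap_def)

lemma X0_eq_root_sum: "\<beta> > 0 \<Longrightarrow> X0 \<beta> z = root_sum \<beta> \<alpha> z 0"
  by (simp add: X0_def root_sum_def root_br_def gap_0)

text \<open>P and M stand for the two roots, D for the gap, a for \<alpha> and b for s \<beta>. The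
  first factor is the derivative of X = P + M in u, and by \<open>e\<close> with c = a^2 it equals
  (X^2 - a^2)/(2 P M X). Its numerator cancels the denominator of the derivative of
  \<open>KX\<close>; what remains is \<open>e\<close> with c = 2 b, the weighted sum of inverse
  roots.\<close>

lemma antiderivative_identity:
  fixes P M D a b :: complex
  assumes "P \<noteq> 0" "M \<noteq> 0" "P + M \<noteq> 0" "D \<noteq> 0" "P\<^sup>2 - M\<^sup>2 = 2 * D" "(P + M)\<^sup>2 - a\<^sup>2 \<noteq> 0"
  shows "((1 + a\<^sup>2 / (2 * D)) / (2 * P) + (1 - a\<^sup>2 / (2 * D)) / (2 * M)) *
      (((P + M)\<^sup>2 - 2 * b) / ((P + M)\<^sup>2 - a\<^sup>2)) = (1 + b / D) / 2 / P + (1 - b / D) / 2 / M"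
proof -
  have D: "2 * D = (P - M) * (P + M)" using assms(5) by (simp add: algebra_simps power2_eq_square)
  have PM: "P - M \<noteq> 0" using D assms(4) by auto
  have e: "(1 + c / (2 * D)) / (2 * P) + (1 - c / (2 * D)) / (2 * M) = ((P + M)\<^sup>2 - c) / (2 * P * M * (P + M))" for c
  proof -
    have "(1 + c / (2 * D)) / (2 * P) + (1 - c / (2 * D)) / (2 * M) = ((P + M) - c / (2 * D) * (P - M)) / (2 * P * M)"
      using assms(1,2) by (simp add: divide_simps) (simp add: algebra_simps)
    also have "c / (2 * D) * (P - M) = c / (P + M)"
      unfolding D using PM assms(3) by simp
    also have "(P + M) - c / (P + M) = ((P + M)\<^sup>2 - c) / (P + M)"
      using assms(3) by (simp add: diff_divide_distrib power2_eq_square)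
    finally show ?thesis by (simp add: mult_ac)
  qed
  have "(1 + b / D) / 2 / P + (1 - b / D) / 2 / M = (1 + 2 * b / (2 * D)) / (2 * P) + (1 - 2 * b / (2 * D)) / (2 * M)"
    by simp
  then show ?thesis
    unfolding e using assms(6) by simp
qed

lemma has_real_derivative_gap:
  assumes "\<beta> > 0" "u \<ge> 0"
  shows "(gap \<beta> \<alpha> has_real_derivative \<alpha>\<^sup>2 / (2 * gap \<beta> \<alpha> u)) (at u)"
proof -
  have "\<beta>\<^sup>2 + \<alpha>\<^sup>2 * u > 0" using assms by (intro add_pos_nonneg) auto
  then show ?thesis
    unfolding gap_def[abs_def] by (auto intro!: derivative_eq_intros simp: field_simps)
qed

lemma has_vector_derivative_root_br:
  assumes "\<beta> > 0" "\<alpha>\<^sup>2 \<le> 2 * \<beta>" "u \<ge> 0" "z \<in> res_set \<beta>" "\<tau> = 1 \<or> \<tau> = -1"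
  shows "(root_br \<beta> \<alpha> z \<tau> has_vector_derivative
     (1 + of_real \<tau> * ((of_real \<alpha>)\<^sup>2 / (2 * of_real (gap \<beta> \<alpha> u)))) / (2 * root_br \<beta> \<alpha> z \<tau> u)) (at u)"
proof -
  have "((\<lambda>u. u + \<tau> * gap \<beta> \<alpha> u) has_real_derivative 1 + \<tau> * (\<alpha>\<^sup>2 / (2 * gap \<beta> \<alpha> u))) (at u)"
    by (intro DERIV_add DERIV_ident DERIV_cmult has_real_derivative_gap assms)
  then have "((\<lambda>u. of_real (u + \<tau> * gap \<beta> \<alpha> u) - z) has_vector_derivative
      of_real (1 + \<tau> * (\<alpha>\<^sup>2 / (2 * gap \<beta> \<alpha> u)))) (at u)"
    using has_vector_derivative_diff[OF has_vector_derivative_of_real has_vector_derivative_const[of z]]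
    by (fastforce simp: has_real_derivative_iff_has_vector_derivative)
  from field_vector_diff_chain_at[OF this has_field_derivative_csqrt[OF branch_notin_nonpos[OF assms]]]
  show ?thesis
    by (simp add: o_def root_br_def[abs_def] field_simps)
qed

lemma root_br_sq: "(root_br \<beta> \<alpha> z \<tau> u)\<^sup>2 = of_real (u + \<tau> * gap \<beta> \<alpha> u) - z"
  by (simp add: root_br_def)

lemma root_br_neq_0:
  assumes "\<beta> > 0" "\<alpha>\<^sup>2 \<le> 2 * \<beta>" "u \<ge> 0" "z \<in> res_set \<beta>" "\<tau> = 1 \<or> \<tau> = -1"
  shows "root_br \<beta> \<alpha> z \<tau> u \<noteq> 0"
  using branch_notin_nonpos[OF assms] unfolding root_br_def by force

lemma has_vector_derivative_KX_root_sum: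
  assumes "\<beta> > 0" "\<alpha> \<ge> 0" "\<alpha>\<^sup>2 \<le> 2 * \<beta>" "u \<ge> 0" "z \<in> res_set \<beta>"
  shows "((\<lambda>u. KX \<beta> \<alpha> s (root_sum \<beta> \<alpha> z u)) has_vector_derivative
     of_real (wt \<beta> \<alpha> s 1 u) / root_br \<beta> \<alpha> z 1 u + of_real (wt \<beta> \<alpha> s (-1) u) / root_br \<beta> \<alpha> z (-1) u) (at u)"
proof -
  define P M where "P = root_br \<beta> \<alpha> z 1 u" and "M = root_br \<beta> \<alpha> z (-1) u"
  define D where "D = complex_of_real (gap \<beta> \<alpha> u)"
  have X: "P + M \<in> X_dom \<alpha>"
    using root_sum_in_X_dom[OF assms] by (simp add: P_def M_def root_sum_def)
  have nz: "P \<noteq> 0" "M \<noteq> 0" "D \<noteq> 0"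
    unfolding P_def M_def D_def using root_br_neq_0[OF assms(1,3-5)] gap_pos[OF assms(1,4), of \<alpha>] by auto
  have D: "P\<^sup>2 - M\<^sup>2 = 2 * D" by (simp add: P_def M_def D_def root_br_sq)
  have nz2: "(P + M)\<^sup>2 - (of_real \<alpha>)\<^sup>2 \<noteq> 0"
  proof -
    have "(P + M)\<^sup>2 - (of_real \<alpha>)\<^sup>2 = (P + M - of_real \<alpha>) * (P + M + of_real \<alpha>)"
      by (simp add: algebra_simps power2_eq_square)
    then show ?thesis using X_dom_cayley(2,3)[OF X assms(2)] by simp
  qed
  have "(root_sum \<beta> \<alpha> z has_vector_derivative
      (1 + (of_real \<alpha>)\<^sup>2 / (2 * D)) / (2 * P) + (1 - (of_real \<alpha>)\<^sup>2 / (2 * D)) / (2 * M)) (at u)"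
    unfolding root_sum_def[abs_def]
    using has_vector_derivative_add[OF has_vector_derivative_root_br[OF assms(1,3-5), of 1]
        has_vector_derivative_root_br[OF assms(1,3-5), of "-1"]]
    by (simp add: P_def M_def D_def)
  from field_vector_diff_chain_at[OF this has_field_derivative_KX[OF _ assms(2), of _ \<beta> s]]
  have "((\<lambda>u. KX \<beta> \<alpha> s (root_sum \<beta> \<alpha> z u)) has_vector_derivative
     ((1 + (of_real \<alpha>)\<^sup>2 / (2 * D)) / (2 * P) + (1 - (of_real \<alpha>)\<^sup>2 / (2 * D)) / (2 * M)) *
      (((P + M)\<^sup>2 - 2 * of_real (spin s * \<beta>)) / ((P + M)\<^sup>2 - (of_real \<alpha>)\<^sup>2))) (at u)"
    using X by (simp add: o_def P_def[symmetric] M_def[symmetric] root_sum_def mult.assoc)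
  also have "((1 + (of_real \<alpha>)\<^sup>2 / (2 * D)) / (2 * P) + (1 - (of_real \<alpha>)\<^sup>2 / (2 * D)) / (2 * M)) *
      (((P + M)\<^sup>2 - 2 * of_real (spin s * \<beta>)) / ((P + M)\<^sup>2 - (of_real \<alpha>)\<^sup>2)) =
      (1 + of_real (spin s * \<beta>) / D) / 2 / P + (1 - of_real (spin s * \<beta>) / D) / 2 / M"
    using nz X_dom_cayley(1)[OF X assms(2)] D nz2 by (intro antiderivative_identity) auto
  finally show ?thesis
    by (simp add: wt_def P_def M_def D_def)
qed

section \<open>Decay of the integrand of Q and evaluation of its integral\<close>

lemma i_in_res_set: "\<i> \<in> res_set \<beta>" "- \<i> \<in> res_set \<beta>"
  by (simp_all add: res_set_def)

text \<open>Subtracting the mean of the resolvents at \<i> and -\<i> improves the decay from 1/l to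
  1/l^2, which gives convergence in three dimensions, while each single term has an explicit
  integral along lines.\<close>

lemma phi_partial_fractions:
  assumes "z \<in> res_set \<beta>" "l \<ge> - \<beta>"
  shows "phi z l = 1 / (of_real l - z) - (1 / (of_real l - \<i>) + 1 / (of_real l + \<i>)) / 2"
proof -
  have nz: "of_real l - z \<noteq> 0" "of_real l - \<i> \<noteq> 0" "of_real l + \<i> \<noteq> 0"
    using res_set_neq[OF assms] by (auto simp: complex_eq_iff)
  have *: "(of_real l)\<^sup>2 + 1 = (of_real l - \<i>) * (of_real l + \<i>)"
    by (simp add: algebra_simps power2_eq_square)
  have "(1 / (of_real l - \<i>) + 1 / (of_real l + \<i>)) / 2 = of_real l / ((of_real l)\<^sup>2 + 1)"
  proof -
    have "1 / (of_real l - \<i>) + 1 / (of_real l + \<i>) = 2 * of_real l / ((of_real l - \<i>) * (of_real l + \<i>))"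
      using nz(2,3) by (simp add: add_frac_eq)
    then show ?thesis unfolding * by simp
  qed
  moreover have "phi z l = 1 / (of_real l - z) - of_real l / ((of_real l)\<^sup>2 + 1)"
    unfolding phi_def diff_frac_eq[OF nz(1) of_real_sq_plus_1_neq_0]
    by (simp add: algebra_simps power2_eq_square)
  ultimately show ?thesis by (simp only:)
qed

text \<open>The number d is a positive lower bound for the distance from z to the half line l \<ge>
  -\<beta>. The numerator is z (l - z) + (1 + z^2), so its quotient by l - z is bounded, and l^2 + 1
  supplies the decay.\<close>

lemma phi_bound:
  assumes "z \<in> res_set \<beta>"
  obtains C where "C > 0" "\<And>l. l \<ge> - \<beta> \<Longrightarrow> cmod (phi z l) \<le> C / (1 + l\<^sup>2)"
proof -
  obtain d where d: "d > 0" "\<And>l. l \<ge> - \<beta> \<Longrightarrow> cmod (of_real l - z) \<ge> d"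
  proof (cases "Im z = 0")
    case True
    show ?thesis
    proof (rule that[of "- \<beta> - Re z"])
      show "- \<beta> - Re z > 0" using True assms by (simp add: res_set_def)
      show "cmod (of_real l - z) \<ge> - \<beta> - Re z" if "l \<ge> - \<beta>" for l
        using complex_Re_le_cmod[of "of_real l - z"] that by simp
    qed
  next
    case False
    show ?thesis
      by (rule that[of "\<bar>Im z\<bar>"]) (use False abs_Im_le_cmod[of "of_real _ - z"] in auto)
  qed
  define C where "C = cmod z + (1 + (cmod z)\<^sup>2) / d"
  have "C > 0" unfolding C_def using d(1) by (intro add_nonneg_pos divide_pos_pos add_pos_nonneg) auto
  moreover have "cmod (phi z l) \<le> C / (1 + l\<^sup>2)" if "l \<ge> - \<beta>" for l
  proof -
    define w where "w = of_real l - z"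
    have w1: "cmod w \<ge> d" using d(2)[OF that] by (simp add: w_def)
    then have w: "cmod w \<ge> d" "cmod w > 0" using d(1) by linarith+
    have "1 + z * of_real l = z * w + (1 + z\<^sup>2)" by (simp add: w_def algebra_simps power2_eq_square)
    then have "cmod (1 + z * of_real l) \<le> cmod z * cmod w + (1 + (cmod z)\<^sup>2)"
      by (metis norm_mult norm_one norm_power norm_triangle_ineq norm_triangle_mono order_refl)
    then have "cmod (1 + z * of_real l) / cmod w \<le> cmod z + (1 + (cmod z)\<^sup>2) / cmod w"
      using w by (simp add: field_simps)
    also have "\<dots> \<le> C" unfolding C_def using w d(1) by (intro add_left_mono divide_left_mono) (auto simp: add_pos_nonneg)
    finally have *: "cmod (1 + z * of_real l) / cmod w \<le> C" .
    have "cmod ((of_real l)\<^sup>2 + 1) = 1 + l\<^sup>2"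
    proof -
      have "(of_real l)\<^sup>2 + 1 = complex_of_real (1 + l\<^sup>2)" by simp
      then show ?thesis by (metis norm_of_real abs_of_nonneg add_nonneg_nonneg zero_le_one zero_le_power2)
    qed
    then have "cmod (phi z l) = cmod (1 + z * of_real l) / cmod w / (1 + l\<^sup>2)"
      by (simp add: phi_def norm_divide norm_mult w_def)
    also have "\<dots> \<le> C / (1 + l\<^sup>2)" using * by (intro divide_right_mono) auto
    finally show ?thesis .
  qed
  ultimately show thesis using that by blast
qed

lemma wt_bounds:
  assumes "\<beta> > 0" "u \<ge> 0" "\<tau> = 1 \<or> \<tau> = -1"
  shows "0 \<le> wt \<beta> \<alpha> s \<tau> u" "wt \<beta> \<alpha> s \<tau> u \<le> 1"
proof -
  have "\<beta> / gap \<beta> \<alpha> u \<le> 1" "\<beta> / gap \<beta> \<alpha> u \<ge> 0"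
    using gap_ge[OF assms(1,2), of \<alpha>] gap_pos[OF assms(1,2), of \<alpha>] assms(1) by auto
  then show "0 \<le> wt \<beta> \<alpha> s \<tau> u" "wt \<beta> \<alpha> s \<tau> u \<le> 1"
    using assms(3) unfolding wt_def spin_def by (auto simp: field_simps)
qed

lemma gap_slope:
  assumes "\<beta> > 0" "\<alpha>\<^sup>2 < 2 * \<beta>" "u \<ge> 0"
  shows "1 - \<alpha>\<^sup>2 / (2 * \<beta>) > 0" "u - gap \<beta> \<alpha> u \<ge> (1 - \<alpha>\<^sup>2 / (2 * \<beta>)) * u - \<beta>"
  using assms gap_le[OF assms(1,3), of \<alpha>] by (simp_all add: field_simps)

text \<open>The tangent bound for \<open>gap\<close> leaves the lower branch with slope at least
  \<theta> = 1 - \<alpha>^2/(2 \<beta>), positive because the inequality is strict. Hence on both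
  branches a fixed multiple of 1 + l^2 dominates (1 + |p|^2)^2.\<close>

lemma branch_growth:
  assumes "\<beta> > 0" "\<alpha>\<^sup>2 < 2 * \<beta>"
  obtains c where "c > 0" 
    "\<And>u t \<tau>. u \<ge> 0 \<Longrightarrow> \<tau> = 1 \<or> \<tau> = -1 \<Longrightarrow> (1 + u + t\<^sup>2)\<^sup>2 \<le> c * (1 + (u + t\<^sup>2 + \<tau> * gap \<beta> \<alpha> u)\<^sup>2)"
proof -
  define \<theta> where "\<theta> = 1 - \<alpha>\<^sup>2 / (2 * \<beta>)"
  have th: "\<theta> > 0" "\<theta> \<le> 1" using gap_slope(1)[OF assms order_refl] assms by (auto simp: \<theta>_def)
  define A where "A = 1 + \<beta>"
  have A: "A \<ge> 1" using assms by (simp add: A_def)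
  have "(1 + u + t\<^sup>2)\<^sup>2 \<le> (2 * A\<^sup>2 / \<theta>\<^sup>2) * (1 + (u + t\<^sup>2 + \<tau> * gap \<beta> \<alpha> u)\<^sup>2)" 
    if u: "u \<ge> 0" and t: "\<tau> = 1 \<or> \<tau> = -1" for u t \<tau>
  proof -
    define l where "l = u + t\<^sup>2 + \<tau> * gap \<beta> \<alpha> u"
    have "\<tau> * gap \<beta> \<alpha> u \<ge> - gap \<beta> \<alpha> u" using t gap_pos[OF assms(1) u, of \<alpha>] by auto
    then have "l \<ge> (\<theta> * u - \<beta>) + t\<^sup>2"
      using gap_slope(2)[OF assms u] by (simp add: l_def \<theta>_def)
    moreover have "\<theta> * t\<^sup>2 \<le> t\<^sup>2" using th by (simp add: mult_left_le_one_le)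
    ultimately have "\<theta> * (1 + u + t\<^sup>2) \<le> A + \<bar>l\<bar>"
      using th by (simp add: A_def algebra_simps)
    then have "(\<theta> * (1 + u + t\<^sup>2))\<^sup>2 \<le> (A + \<bar>l\<bar>)\<^sup>2"
      using th u by (intro power_mono) auto
    also have "\<dots> \<le> 2 * A\<^sup>2 + 2 * l\<^sup>2"
      using sum_squares_bound[of A "\<bar>l\<bar>"] by (simp add: power2_sum)
    also have "\<dots> \<le> 2 * A\<^sup>2 * (1 + l\<^sup>2)"
    proof -
      have "A\<^sup>2 \<ge> 1" using A by simp
      then have "1 * l\<^sup>2 \<le> A\<^sup>2 * l\<^sup>2" by (intro mult_right_mono) auto
      then show ?thesis by (simp add: algebra_simps)
    qed
    finally have "\<theta>\<^sup>2 * (1 + u + t\<^sup>2)\<^sup>2 \<le> 2 * A\<^sup>2 * (1 + l\<^sup>2)" by (simp only: power_mult_distrib)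
    then show ?thesis using th unfolding l_def[symmetric] by (simp add: pos_le_divide_eq mult.commute)
  qed
  moreover have "2 * A\<^sup>2 / \<theta>\<^sup>2 > 0" using A th by simp
  ultimately show thesis using that by blast
qed

text \<open>\<open>disc_area\<close> does not charge negative u; the cut-off makes the pointwise
  bounds valid for all u, also where the two branches are not controlled.\<close>

definition cyl :: "real \<Rightarrow> real \<Rightarrow> 2 \<Rightarrow> (real \<Rightarrow> complex) \<Rightarrow> real \<times> real \<Rightarrow> complex" where
  "cyl \<beta> \<alpha> s f = (\<lambda>q. indicator {0..} (fst q) *\<^sub>R spec_avg \<beta> \<alpha> s f q)"

lemma integrable_inverse_1_plus_powr:
  "set_integrable lborel {0<..} (\<lambda>u::real. 1 / ((1 + u) * sqrt (1 + u)))"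
proof -
  have "set_integrable lborel (einterval 0 \<infinity>) (\<lambda>u::real. 1 / ((1 + u) * sqrt (1 + u)))"
  proof (rule interval_integral_FTC_nonneg(1)[where F = "\<lambda>u. - 2 / sqrt (1 + u)" and A = "-2" and B = 0])
    show "((\<lambda>u. - 2 / sqrt (1 + u)) has_real_derivative 1 / ((1 + x) * sqrt (1 + x))) (at x)" if "0 < ereal x" for x
      using that by (auto intro!: derivative_eq_intros simp: field_simps)
    show "isCont (\<lambda>u. 1 / ((1 + u) * sqrt (1 + u))) x" if "0 < ereal x" for x
      using that by (intro continuous_intros) auto
    show "(((\<lambda>u. - 2 / sqrt (1 + u)) \<circ> real_of_ereal) \<longlongrightarrow> - 2) (at_right 0)"
      unfolding zero_ereal_def ereal_tendsto_simps by real_asymp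
    show "(((\<lambda>u. - 2 / sqrt (1 + u)) \<circ> real_of_ereal) \<longlongrightarrow> 0) (at_left \<infinity>)"
      unfolding ereal_tendsto_simps by real_asymp
  qed (auto simp: zero_ereal_def)
  then show ?thesis by (simp add: zero_ereal_def)
qed

lemma measurable_wt [measurable]: "wt \<beta> \<alpha> s \<tau> \<in> borel_measurable borel"
  unfolding wt_def[abs_def] gap_def by measurable

lemma measurable_gap [measurable]: "gap \<beta> \<alpha> \<in> borel_measurable borel"
  unfolding gap_def[abs_def] by measurable

lemma measurable_cyl:
  assumes [measurable]: "f \<in> borel_measurable borel"
  shows "cyl \<beta> \<alpha> s f \<in> borel_measurable (borel \<Otimes>\<^sub>M borel)"
  unfolding cyl_def spec_avg_def case_prod_unfold by measurable

lemma cyl_bound: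
  assumes "\<beta> > 0" "\<alpha>\<^sup>2 < 2 * \<beta>" "C \<ge> 0" "\<And>l. l \<ge> - \<beta> \<Longrightarrow> cmod (f l) \<le> C / (1 + l\<^sup>2)"
  obtains C' where "C' > 0" "\<And>u t. cmod (cyl \<beta> \<alpha> s f (u, t)) \<le> C' / (1 + \<bar>u\<bar> + t\<^sup>2)\<^sup>2"
proof -
  obtain c where c: "c > 0" 
    "\<And>u t \<tau>. u \<ge> 0 \<Longrightarrow> \<tau> = 1 \<or> \<tau> = -1 \<Longrightarrow> (1 + u + t\<^sup>2)\<^sup>2 \<le> c * (1 + (u + t\<^sup>2 + \<tau> * gap \<beta> \<alpha> u)\<^sup>2)"
    using branch_growth[OF assms(1,2)] by blast
  have "cmod (cyl \<beta> \<alpha> s f (u, t)) \<le> (2 * C * c + 1) / (1 + \<bar>u\<bar> + t\<^sup>2)\<^sup>2" for u t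
  proof (cases "u \<ge> 0")
    case True
    have le: "cmod (f (u + t\<^sup>2 + \<tau> * gap \<beta> \<alpha> u)) \<le> C * c / (1 + u + t\<^sup>2)\<^sup>2" if "\<tau> = 1 \<or> \<tau> = -1" for \<tau>
    proof -
      have ge: "u + t\<^sup>2 + \<tau> * gap \<beta> \<alpha> u \<ge> - \<beta>"
        using branch_ge[OF assms(1) less_imp_le[OF assms(2)] True] that assms(1) zero_le_power2[of t]
        by (elim disjE) (hypsubst, linarith)+
      have "cmod (f (u + t\<^sup>2 + \<tau> * gap \<beta> \<alpha> u)) \<le> C / (1 + (u + t\<^sup>2 + \<tau> * gap \<beta> \<alpha> u)\<^sup>2)"
        by (rule assms(4)[OF ge])
      also have "\<dots> \<le> C * c / (1 + u + t\<^sup>2)\<^sup>2"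
      proof -
        have "1 / (1 + (u + t\<^sup>2 + \<tau> * gap \<beta> \<alpha> u)\<^sup>2) \<le> c / (1 + u + t\<^sup>2)\<^sup>2"
          using c(2)[OF True that, of t] True by (simp add: divide_simps add_pos_nonneg mult.commute add_nonneg_eq_0_iff)
        from mult_left_mono[OF this assms(3)] show ?thesis by simp
      qed
      finally show ?thesis .
    qed
    have "cmod (cyl \<beta> \<alpha> s f (u, t)) \<le> cmod (wt \<beta> \<alpha> s 1 u *\<^sub>R f (u + t\<^sup>2 + gap \<beta> \<alpha> u)) +
        cmod (wt \<beta> \<alpha> s (-1) u *\<^sub>R f (u + t\<^sup>2 - gap \<beta> \<alpha> u))"
    proof -
      have "cyl \<beta> \<alpha> s f (u, t) = wt \<beta> \<alpha> s 1 u *\<^sub>R f (u + t\<^sup>2 + gap \<beta> \<alpha> u) + wt \<beta> \<alpha> s (-1) u *\<^sub>R f (u + t\<^sup>2 - gap \<beta> \<alpha> u)"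
        using True by (simp add: cyl_def spec_avg_def)
      then show ?thesis by (simp only: norm_triangle_ineq)
    qed
    also have "\<dots> \<le> 1 * (C * c / (1 + u + t\<^sup>2)\<^sup>2) + 1 * (C * c / (1 + u + t\<^sup>2)\<^sup>2)"
      unfolding norm_scaleR using le[of 1] le[of "-1"] wt_bounds[OF assms(1) True, of 1 \<alpha> s] wt_bounds[OF assms(1) True, of "-1" \<alpha> s]
      by (intro add_mono mult_mono) auto
    also have "\<dots> \<le> (2 * C * c + 1) / (1 + \<bar>u\<bar> + t\<^sup>2)\<^sup>2"
      using True by (simp add: add_divide_distrib[symmetric] divide_right_mono)
    finally show ?thesis .
  next
    case False
    then show ?thesis using assms(3) c(1) by (simp add: cyl_def)
  qed
  moreover have "2 * C * c + 1 > 0" using assms(3) c(1) by (simp add: add_nonneg_pos)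
  ultimately show thesis using that by blast
qed

text \<open>One of the two factors 1 + |u| + t^2 in the bound is weakened to 1 + |u|. The t-integral
  is then explicit and leaves a multiple of (1 + |u|) to the power -3/2, which is integrable in
  u.\<close>

lemma integrable_cyl:
  assumes "\<beta> > 0" "\<alpha>\<^sup>2 < 2 * \<beta>" "C \<ge> 0" "\<And>l. l \<ge> - \<beta> \<Longrightarrow> cmod (f l) \<le> C / (1 + l\<^sup>2)"
    and m: "f \<in> borel_measurable borel"
  shows "integrable (disc_area \<Otimes>\<^sub>M lborel) (cyl \<beta> \<alpha> s f)"
proof -
  interpret D: sigma_finite_measure disc_area by (rule sigma_finite_disc_area)
  interpret DL: pair_sigma_finite disc_area lborel ..
  obtain C' where C': "C' > 0" "\<And>u t. cmod (cyl \<beta> \<alpha> s f (u, t)) \<le> C' / (1 + \<bar>u\<bar> + t\<^sup>2)\<^sup>2"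
    using cyl_bound[OF assms(1-4)] by blast
  have le: "cmod (cyl \<beta> \<alpha> s f (u, t)) \<le> C' / (1 + \<bar>u\<bar>) * cmod (1 / ((of_real t)\<^sup>2 + of_real (1 + \<bar>u\<bar>)))" for u t
  proof -
    have pos: "1 + \<bar>u\<bar> + t\<^sup>2 > 0"
      by (intro add_pos_nonneg) auto
    have "(1 + \<bar>u\<bar>) * (1 + \<bar>u\<bar> + t\<^sup>2) \<le> (1 + \<bar>u\<bar> + t\<^sup>2)\<^sup>2"
      unfolding power2_eq_square[of "1 + \<bar>u\<bar> + t\<^sup>2"] by (intro mult_right_mono) auto
    then have "C' / (1 + \<bar>u\<bar> + t\<^sup>2)\<^sup>2 \<le> C' / ((1 + \<bar>u\<bar>) * (1 + \<bar>u\<bar> + t\<^sup>2))"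
      using C'(1) pos by (intro divide_left_mono mult_pos_pos) auto
    moreover have "cmod (1 / ((of_real t)\<^sup>2 + of_real (1 + \<bar>u\<bar>))) = 1 / (1 + \<bar>u\<bar> + t\<^sup>2)"
    proof -
      have "1 / ((of_real t)\<^sup>2 + of_real (1 + \<bar>u\<bar>)) = complex_of_real (1 / (1 + \<bar>u\<bar> + t\<^sup>2))" by simp
      then show ?thesis by (simp only: norm_of_real) simp
    qed
    ultimately show ?thesis using C'(2)[of u t] by (simp only: times_divide_times_eq mult_1_right)
  qed
  have np: "complex_of_real (1 + \<bar>u\<bar>) \<notin> \<real>\<^sub>\<le>\<^sub>0" for u by (simp add: complex_nonpos_Reals_iff)
  have int1: "integrable lborel (\<lambda>t. C' / (1 + \<bar>u\<bar>) * cmod (1 / ((of_real t)\<^sup>2 + of_real (1 + \<bar>u\<bar>))))" for u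
    by (intro integrable_mult_right integrable_norm integrable_sum_sq np)
  have m2: "cyl \<beta> \<alpha> s f \<in> borel_measurable (disc_area \<Otimes>\<^sub>M lborel)"
    using measurable_cyl[OF m] by (simp cong: measurable_cong_sets sets_pair_measure_cong)
  have int2: "integrable lborel (\<lambda>t. cyl \<beta> \<alpha> s f (u, t))" for u
  proof (rule Bochner_Integration.integrable_bound[OF int1[of u]])
    show "(\<lambda>t. cyl \<beta> \<alpha> s f (u, t)) \<in> borel_measurable lborel"
      using m2 by (rule measurable_compose_Pair1[rotated]) simp
    show "AE t in lborel. cmod (cyl \<beta> \<alpha> s f (u, t)) \<le>
       norm (C' / (1 + \<bar>u\<bar>) * cmod (1 / ((of_real t)\<^sup>2 + of_real (1 + \<bar>u\<bar>))))"
      using le C'(1) by (auto simp: abs_mult)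
  qed
  have val: "(LINT t|lborel. C' / (1 + \<bar>u\<bar>) * cmod (1 / ((of_real t)\<^sup>2 + of_real (1 + \<bar>u\<bar>)))) =
     C' * pi * (1 / ((1 + \<bar>u\<bar>) * sqrt (1 + \<bar>u\<bar>)))" for u
  proof -
    have "complex_of_real (LINT t|lborel. cmod (1 / ((of_real t)\<^sup>2 + of_real (1 + \<bar>u\<bar>)))) = 
        (LINT t|lborel. 1 / ((of_real t)\<^sup>2 + of_real (1 + \<bar>u\<bar>)))"
    proof (subst integral_complex_of_real[symmetric], rule Bochner_Integration.integral_cong)
      fix t :: real
      have "1 / ((of_real t)\<^sup>2 + of_real (1 + \<bar>u\<bar>)) = complex_of_real (1 / (1 + \<bar>u\<bar> + t\<^sup>2))" by simp
      then show "complex_of_real (cmod (1 / ((of_real t)\<^sup>2 + of_real (1 + \<bar>u\<bar>)))) = 1 / ((of_real t)\<^sup>2 + of_real (1 + \<bar>u\<bar>))"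
        by (simp only: norm_of_real) simp
    qed simp
    also have "\<dots> = of_real (pi / sqrt (1 + \<bar>u\<bar>))"
      by (subst integral_sum_sq[OF np]) (simp add: csqrt_of_real)
    finally have "(LINT t|lborel. cmod (1 / ((of_real t)\<^sup>2 + of_real (1 + \<bar>u\<bar>)))) = pi / sqrt (1 + \<bar>u\<bar>)"
      by (simp only: of_real_eq_iff)
    then show ?thesis by (subst integral_mult_right_zero) simp
  qed
  have int3: "integrable disc_area (\<lambda>u. C' * pi * (1 / ((1 + \<bar>u\<bar>) * sqrt (1 + \<bar>u\<bar>))))"
  proof -
    have "integrable lborel (\<lambda>u. (C' * pi * pi) * (indicator {0<..} u *\<^sub>R (1 / ((1 + u) * sqrt (1 + u)))))"
      using integrable_inverse_1_plus_powr unfolding set_integrable_def by (rule integrable_mult_right)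
    also have "(\<lambda>u. (C' * pi * pi) * (indicator {0<..} u *\<^sub>R (1 / ((1 + u) * sqrt (1 + u))))) =
        (\<lambda>u. (pi * indicator {0<..} u) *\<^sub>R (C' * pi * (1 / ((1 + \<bar>u\<bar>) * sqrt (1 + \<bar>u\<bar>)))))"
      by (auto simp: fun_eq_iff indicator_def)
    finally show ?thesis
      unfolding disc_area_def by (subst integrable_density) auto
  qed
  show ?thesis
  proof (rule DL.Fubini_integrable[OF m2])
    show "AE u in disc_area. integrable lborel (\<lambda>t. cyl \<beta> \<alpha> s f (u, t))" using int2 by simp
    show "integrable disc_area (\<lambda>u. LINT t|lborel. cmod (cyl \<beta> \<alpha> s f (u, t)))"
    proof (rule Bochner_Integration.integrable_bound[OF int3])
      show "(\<lambda>u. LINT t|lborel. cmod (cyl \<beta> \<alpha> s f (u, t))) \<in> borel_measurable disc_area"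
        using m2 by measurable
      have "(LINT t|lborel. cmod (cyl \<beta> \<alpha> s f (u, t))) \<le> C' * pi * (1 / ((1 + \<bar>u\<bar>) * sqrt (1 + \<bar>u\<bar>)))" for u
        unfolding val[symmetric] by (intro integral_mono integrable_norm int2 int1 le)
      then show "AE u in disc_area. norm (LINT t|lborel. cmod (cyl \<beta> \<alpha> s f (u, t))) \<le>
          norm (C' * pi * (1 / ((1 + \<bar>u\<bar>) * sqrt (1 + \<bar>u\<bar>))))"
        using C'(1) by (auto intro!: order_trans[OF _ abs_ge_self])
    qed
  qed
qed

definition G_avg :: "real \<Rightarrow> real \<Rightarrow> 2 \<Rightarrow> complex \<Rightarrow> real \<Rightarrow> complex" where
  "G_avg \<beta> \<alpha> s z u =
     of_real (wt \<beta> \<alpha> s 1 u) / root_br \<beta> \<alpha> z 1 u + of_real (wt \<beta> \<alpha> s (-1) u) / root_br \<beta> \<alpha> z (-1) u"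

lemma measurable_phi [measurable]: "phi z \<in> borel_measurable borel"
  unfolding phi_def[abs_def] by measurable

text \<open>Along a line each of the three resolvent terms is integrable by itself, so they are
  integrated one by one. Afterwards the inverse roots have to stay together: each decays in u only
  like a power -1/2.\<close>

lemma integral_phi_line:
  assumes "\<beta> > 0" "\<alpha>\<^sup>2 \<le> 2 * \<beta>" "u \<ge> 0" "z \<in> res_set \<beta>" "\<tau> = 1 \<or> \<tau> = -1"
  shows "integrable lborel (\<lambda>t. phi z (u + t\<^sup>2 + \<tau> * gap \<beta> \<alpha> u))"
    and "(LINT t|lborel. phi z (u + t\<^sup>2 + \<tau> * gap \<beta> \<alpha> u)) =
      of_real pi * (1 / root_br \<beta> \<alpha> z \<tau> u - (1 / root_br \<beta> \<alpha> \<i> \<tau> u + 1 / root_br \<beta> \<alpha> (- \<i>) \<tau> u) / 2)"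
proof -
  define c where "c = u + \<tau> * gap \<beta> \<alpha> u"
  have c: "c \<ge> - \<beta>"
    using branch_ge[OF assms(1-3)] assms(1,5) by (auto simp: c_def)
  have np: "of_real c - w \<notin> \<real>\<^sub>\<le>\<^sub>0" if "w \<in> res_set \<beta>" for w
    using notin_nonpos_Reals_shift[OF that c] .
  have eq: "phi z (u + t\<^sup>2 + \<tau> * gap \<beta> \<alpha> u) = 1 / ((of_real t)\<^sup>2 + (of_real c - z)) -
      (1 / ((of_real t)\<^sup>2 + (of_real c - \<i>)) + 1 / ((of_real t)\<^sup>2 + (of_real c - (- \<i>)))) / 2" for t
  proof -
    have l: "u + t\<^sup>2 + \<tau> * gap \<beta> \<alpha> u = t\<^sup>2 + c" by (simp add: c_def)
    have "t\<^sup>2 + c \<ge> - \<beta>" using c zero_le_power2[of t] by linarith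
    then show ?thesis
      unfolding l using phi_partial_fractions[OF assms(4), of "t\<^sup>2 + c"] by (simp add: algebra_simps)
  qed
  note I = integrable_sum_sq[OF np[OF assms(4)]] integrable_sum_sq[OF np[OF i_in_res_set(1)]]
    integrable_sum_sq[OF np[OF i_in_res_set(2)]]
  show "integrable lborel (\<lambda>t. phi z (u + t\<^sup>2 + \<tau> * gap \<beta> \<alpha> u))"
    unfolding eq using I by (intro Bochner_Integration.integrable_diff Bochner_Integration.integrable_add integrable_divide_zero) auto
  have "(LINT t|lborel. phi z (u + t\<^sup>2 + \<tau> * gap \<beta> \<alpha> u)) = of_real pi / csqrt (of_real c - z) -
     (of_real pi / csqrt (of_real c - \<i>) + of_real pi / csqrt (of_real c - (- \<i>))) / 2"
    unfolding eq
    using I np[OF assms(4)] np[OF i_in_res_set(1)] np[OF i_in_res_set(2)]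
    by (subst Bochner_Integration.integral_diff, simp, simp, subst integral_divide_zero, 
       subst Bochner_Integration.integral_add, simp, simp) (simp only: integral_sum_sq)
  then show "(LINT t|lborel. phi z (u + t\<^sup>2 + \<tau> * gap \<beta> \<alpha> u)) =
      of_real pi * (1 / root_br \<beta> \<alpha> z \<tau> u - (1 / root_br \<beta> \<alpha> \<i> \<tau> u + 1 / root_br \<beta> \<alpha> (- \<i>) \<tau> u) / 2)"
    unfolding root_br_def c_def[symmetric] by (simp add: algebra_simps add_divide_distrib)
qed

lemma integral_cyl_phi_line:
  assumes "\<beta> > 0" "\<alpha>\<^sup>2 \<le> 2 * \<beta>" "u \<ge> 0" "z \<in> res_set \<beta>"
  shows "(LINT t|lborel. cyl \<beta> \<alpha> s (phi z) (u, t)) =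
      of_real pi * (G_avg \<beta> \<alpha> s z u - (G_avg \<beta> \<alpha> s \<i> u + G_avg \<beta> \<alpha> s (- \<i>) u) / 2)"
proof -
  note p = integral_phi_line[OF assms, of 1, simplified] and m = integral_phi_line[OF assms, of "-1", simplified]
  have "(LINT t|lborel. cyl \<beta> \<alpha> s (phi z) (u, t)) =
    (LINT t|lborel. wt \<beta> \<alpha> s 1 u *\<^sub>R phi z (u + t\<^sup>2 + gap \<beta> \<alpha> u) + wt \<beta> \<alpha> s (-1) u *\<^sub>R phi z (u + t\<^sup>2 - gap \<beta> \<alpha> u))"
    using assms(3) by (simp add: cyl_def spec_avg_def)
  also have "\<dots> = wt \<beta> \<alpha> s 1 u *\<^sub>R (LINT t|lborel. phi z (u + t\<^sup>2 + gap \<beta> \<alpha> u)) +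
      wt \<beta> \<alpha> s (-1) u *\<^sub>R (LINT t|lborel. phi z (u + t\<^sup>2 - gap \<beta> \<alpha> u))"
    using p(1) m(1) by (subst Bochner_Integration.integral_add) auto
  finally show ?thesis
    unfolding p(2) m(2) G_avg_def by (simp add: scaleR_conv_of_real algebra_simps add_divide_distrib)
qed

lemma filterlim_branch_at_top:
  assumes "\<beta> > 0" "\<alpha>\<^sup>2 < 2 * \<beta>" "\<tau> = 1 \<or> \<tau> = -1"
  shows "filterlim (\<lambda>u. u + \<tau> * gap \<beta> \<alpha> u) at_top at_top"
proof (rule filterlim_at_top_mono)
  have "1 - \<alpha>\<^sup>2 / (2 * \<beta>) > 0" using gap_slope(1)[OF assms(1,2) order_refl] .
  then show "filterlim (\<lambda>u. - \<beta> + (1 - \<alpha>\<^sup>2 / (2 * \<beta>)) * u) at_top at_top"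
    by (intro filterlim_tendsto_add_at_top[OF tendsto_const] filterlim_tendsto_pos_mult_at_top[OF tendsto_const]) (auto intro: filterlim_ident)
  show "eventually (\<lambda>u. - \<beta> + (1 - \<alpha>\<^sup>2 / (2 * \<beta>)) * u \<le> u + \<tau> * gap \<beta> \<alpha> u) at_top"
    using eventually_ge_at_top[of 0]
  proof eventually_elim
    case (elim u)
    have "- gap \<beta> \<alpha> u \<le> \<tau> * gap \<beta> \<alpha> u"
      using gap_pos[OF assms(1) elim, of \<alpha>] assms(3) by auto
    then show ?case using gap_slope(2)[OF assms(1,2) elim] by linarith
  qed
qed

lemma filterlim_Re_root_br:
  assumes "\<beta> > 0" "\<alpha>\<^sup>2 < 2 * \<beta>" "\<tau> = 1 \<or> \<tau> = -1"
  shows "filterlim (\<lambda>u. Re (root_br \<beta> \<alpha> z \<tau> u)) at_top at_top"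
proof (rule filterlim_at_top_mono)
  show "filterlim (\<lambda>u. sqrt (- Re z + (u + \<tau> * gap \<beta> \<alpha> u))) at_top at_top"
    by (rule filterlim_compose[OF sqrt_at_top])
      (intro filterlim_tendsto_add_at_top[OF tendsto_const] filterlim_branch_at_top[OF assms])
  show "eventually (\<lambda>u. sqrt (- Re z + (u + \<tau> * gap \<beta> \<alpha> u)) \<le> Re (root_br \<beta> \<alpha> z \<tau> u)) at_top"
  proof (rule always_eventually, rule allI)
    fix u
    define w where "w = complex_of_real (u + \<tau> * gap \<beta> \<alpha> u) - z"
    have "Re w \<le> (cmod w + Re w) / 2" using complex_Re_le_cmod[of w] by simp
    then show "sqrt (- Re z + (u + \<tau> * gap \<beta> \<alpha> u)) \<le> Re (root_br \<beta> \<alpha> z \<tau> u)"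
      unfolding root_br_def w_def[symmetric] by (simp add: w_def)
  qed
qed

text \<open>The difference of the squares of the roots is the constant z' - z, so the difference of
  the roots is that constant divided by their sum, and the real part of the sum tends to
  infinity.\<close>

lemma root_br_diff_tendsto_0:
  assumes "\<beta> > 0" "\<alpha>\<^sup>2 < 2 * \<beta>" "\<tau> = 1 \<or> \<tau> = -1"
  shows "((\<lambda>u. root_br \<beta> \<alpha> z \<tau> u - root_br \<beta> \<alpha> z' \<tau> u) \<longlongrightarrow> 0) at_top"
proof -
  have inf: "filterlim (\<lambda>u. root_br \<beta> \<alpha> z \<tau> u + root_br \<beta> \<alpha> z' \<tau> u) at_infinity at_top"
  proof (rule filterlim_norm_at_top_imp_at_infinity)
    show "filterlim (\<lambda>u. cmod (root_br \<beta> \<alpha> z \<tau> u + root_br \<beta> \<alpha> z' \<tau> u)) at_top at_top"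
    proof (rule filterlim_at_top_mono)
      show "filterlim (\<lambda>u. Re (root_br \<beta> \<alpha> z \<tau> u) + Re (root_br \<beta> \<alpha> z' \<tau> u)) at_top at_top"
        by (intro filterlim_at_top_add_at_top filterlim_Re_root_br assms)
      show "\<forall>\<^sub>F u in at_top. Re (root_br \<beta> \<alpha> z \<tau> u) + Re (root_br \<beta> \<alpha> z' \<tau> u) \<le>
          cmod (root_br \<beta> \<alpha> z \<tau> u + root_br \<beta> \<alpha> z' \<tau> u)"
        by (rule always_eventually) (metis complex_Re_le_cmod plus_complex.simps(1))
    qed
  qed
  have "((\<lambda>u. (z' - z) / (root_br \<beta> \<alpha> z \<tau> u + root_br \<beta> \<alpha> z' \<tau> u)) \<longlongrightarrow> 0) at_top"
    by (rule tendsto_divide_0[OF tendsto_const inf])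
  moreover have "eventually (\<lambda>u. root_br \<beta> \<alpha> z \<tau> u + root_br \<beta> \<alpha> z' \<tau> u \<noteq> 0) at_top"
    using inf by (rule filterlim_at_infinity_imp_eventually_ne)
  then have "eventually (\<lambda>u. (z' - z) / (root_br \<beta> \<alpha> z \<tau> u + root_br \<beta> \<alpha> z' \<tau> u) =
      root_br \<beta> \<alpha> z \<tau> u - root_br \<beta> \<alpha> z' \<tau> u) at_top"
  proof eventually_elim
    case (elim u)
    have "(root_br \<beta> \<alpha> z \<tau> u - root_br \<beta> \<alpha> z' \<tau> u) * (root_br \<beta> \<alpha> z \<tau> u + root_br \<beta> \<alpha> z' \<tau> u) =
        (root_br \<beta> \<alpha> z \<tau> u)\<^sup>2 - (root_br \<beta> \<alpha> z' \<tau> u)\<^sup>2"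
      by (simp add: algebra_simps power2_eq_square)
    also have "\<dots> = z' - z" by (simp add: root_br_sq)
    finally show ?case using elim by (simp add: field_simps)
  qed
  ultimately show ?thesis by (rule Lim_transform_eventually)
qed

lemma Th_tendsto_0: "(Th \<alpha> \<longlongrightarrow> 0) at_infinity"
proof (cases "\<alpha> = 0")
  case True
  have "((\<lambda>X. 2 / X) \<longlongrightarrow> (0::complex)) at_infinity"
    by (rule tendsto_divide_0[OF tendsto_const filterlim_ident])
  then show ?thesis using True by (simp add: Th_def[abs_def])
next
  case False
  have inf: "filterlim (\<lambda>X::complex. X - of_real \<alpha>) at_infinity at_infinity"
    using tendsto_add_filterlim_at_infinity'[OF filterlim_ident tendsto_const[of "- of_real \<alpha>"]] by simp
  have "((\<lambda>X. 1 + 2 * of_real \<alpha> / (X - of_real \<alpha>)) \<longlongrightarrow> 1 + (0::complex)) at_infinity"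
    by (intro tendsto_intros tendsto_divide_0[OF tendsto_const inf])
  then have "((\<lambda>X. 1 + 2 * of_real \<alpha> / (X - of_real \<alpha>)) \<longlongrightarrow> (1::complex)) at_infinity" by simp
  then have "((\<lambda>X. (X + of_real \<alpha>) / (X - of_real \<alpha>)) \<longlongrightarrow> (1::complex)) at_infinity"
  proof (rule Lim_transform_eventually)
    show "\<forall>\<^sub>F X in at_infinity. 1 + 2 * of_real \<alpha> / (X - of_real \<alpha>) = (X + of_real \<alpha>) / (X - complex_of_real \<alpha>)"
      using filterlim_at_infinity_imp_eventually_ne[OF inf, of 0]
      by eventually_elim (simp add: field_simps)
  qed
  then have "((\<lambda>X. Ln ((X + of_real \<alpha>) / (X - of_real \<alpha>)) / of_real \<alpha>) \<longlongrightarrow> Ln 1 / of_real \<alpha>) at_infinity"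
    using False by (intro tendsto_intros) auto
  then show ?thesis using False by (simp add: Th_def[abs_def])
qed

text \<open>\<open>KX\<close> grows with X, but its linear part enters only through differences of
  roots on the same branch, and \<open>Th\<close> tends to 0.\<close>

lemma KX_root_sum_diff_tendsto_0:
  assumes "\<beta> > 0" "\<alpha>\<^sup>2 < 2 * \<beta>"
  shows "((\<lambda>u. KX \<beta> \<alpha> s (root_sum \<beta> \<alpha> z u) - KX \<beta> \<alpha> s (root_sum \<beta> \<alpha> z' u)) \<longlongrightarrow> 0) at_top"
proof -
  have inf: "filterlim (root_sum \<beta> \<alpha> w) at_infinity at_top" for w
  proof (rule filterlim_norm_at_top_imp_at_infinity, rule filterlim_at_top_mono)
    show "filterlim (\<lambda>u. Re (root_br \<beta> \<alpha> w 1 u) + Re (root_br \<beta> \<alpha> w (-1) u)) at_top at_top"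
      using assms by (intro filterlim_at_top_add_at_top filterlim_Re_root_br) auto
    show "\<forall>\<^sub>F u in at_top. Re (root_br \<beta> \<alpha> w 1 u) + Re (root_br \<beta> \<alpha> w (-1) u) \<le> cmod (root_sum \<beta> \<alpha> w u)"
      unfolding root_sum_def by (rule always_eventually) (metis complex_Re_le_cmod plus_complex.simps(1))
  qed
  have T: "((\<lambda>u. Th \<alpha> (root_sum \<beta> \<alpha> w u)) \<longlongrightarrow> 0) at_top" for w
    using filterlim_compose[OF Th_tendsto_0 inf] .
  have "((\<lambda>u. ((root_br \<beta> \<alpha> z 1 u - root_br \<beta> \<alpha> z' 1 u) + (root_br \<beta> \<alpha> z (-1) u - root_br \<beta> \<alpha> z' (-1) u)) +
     of_real (spin s * \<beta> - \<alpha>\<^sup>2 / 2) * (Th \<alpha> (root_sum \<beta> \<alpha> z u) - Th \<alpha> (root_sum \<beta> \<alpha> z' u)))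
     \<longlongrightarrow> (0 + 0) + of_real (spin s * \<beta> - \<alpha>\<^sup>2 / 2) * (0 - 0)) at_top"
    using assms by (intro tendsto_intros root_br_diff_tendsto_0 T) auto
  then show ?thesis
    by (simp add: KX_def root_sum_def algebra_simps)
qed

text \<open>The t-integral leaves pi times the combination \<open>g\<close> of weighted inverse
  roots, and \<open>F\<close> is the same combination of the functions \<open>KX\<close>. Its
  coefficients 1, -1/2, -1/2 add up to zero, so \<open>F\<close> vanishes at infinity and the
  integral of \<open>g\<close> is -F 0. One factor pi comes from the line integral, the other from
  the area of the disc.\<close>

lemma integral_phi_entry:
  assumes "\<beta> > 0" "\<alpha> \<ge> 0" "\<alpha>\<^sup>2 < 2 * \<beta>" "z \<in> res_set \<beta>"
  shows "(LINT p|lborel. spec_mat \<beta> \<alpha> (phi z) p $ s $ s) =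
     of_real (pi\<^sup>2) * ((KK \<beta> \<alpha> s \<i> + KK \<beta> \<alpha> s (- \<i>)) / 2 - KK \<beta> \<alpha> s z)"
proof -
  note le = less_imp_le[OF assms(3)]
  obtain C where C: "C > 0" "\<And>l. l \<ge> - \<beta> \<Longrightarrow> cmod (phi z l) \<le> C / (1 + l\<^sup>2)"
    using phi_bound[OF assms(4)] by blast
  have int: "integrable (disc_area \<Otimes>\<^sub>M lborel) (cyl \<beta> \<alpha> s (phi z))"
    by (rule integrable_cyl[OF assms(1,3) less_imp_le[OF C(1)] C(2)]) auto
  define g where "g u = G_avg \<beta> \<alpha> s z u - (G_avg \<beta> \<alpha> s \<i> u + G_avg \<beta> \<alpha> s (- \<i>) u) / 2" for u
  define F where "F u = KX \<beta> \<alpha> s (root_sum \<beta> \<alpha> z u) - (KX \<beta> \<alpha> s (root_sum \<beta> \<alpha> \<i> u) + KX \<beta> \<alpha> s (root_sum \<beta> \<alpha> (- \<i>) u)) / 2" for u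
  have F0: "F 0 = KK \<beta> \<alpha> s z - (KK \<beta> \<alpha> s \<i> + KK \<beta> \<alpha> s (- \<i>)) / 2"
    by (simp add: F_def KK_def X0_eq_root_sum[OF assms(1), of _ \<alpha>])
  have dF: "(F has_vector_derivative g u) (at u)" if "u \<ge> 0" for u
    unfolding F_def[abs_def] g_def G_avg_def
    by (intro has_vector_derivative_diff has_vector_derivative_divide has_vector_derivative_add
        has_vector_derivative_KX_root_sum assms le that i_in_res_set)
  have "(LINT p|lborel. spec_mat \<beta> \<alpha> (phi z) p $ s $ s) =
      (LINT p|lborel. cyl \<beta> \<alpha> s (phi z) ((p $ 1)\<^sup>2 + (p $ 2)\<^sup>2, p $ (3::3)))"
    by (simp add: spec_mat_diag[OF assms(1)] cyl_def plane_sq_def)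
  also have "\<dots> = of_real pi * (LINT u:{0<..}|lborel. LINT t|lborel. cyl \<beta> \<alpha> s (phi z) (u, t))"
    by (rule integral_cylindrical(1)[OF int])
  also have "(LINT u:{0<..}|lborel. LINT t|lborel. cyl \<beta> \<alpha> s (phi z) (u, t)) =
      (LINT u:{0<..}|lborel. of_real pi * g u)"
    using integral_cyl_phi_line[OF assms(1) le _ assms(4), of _ s] unfolding g_def
    by (intro set_lebesgue_integral_cong) auto
  also have "\<dots> = of_real pi * (LINT u:{0<..}|lborel. g u)"
    by (rule set_integral_mult_right)
  also have "(LINT u:{0<..}|lborel. g u) = (LBINT u=0..\<infinity>. g u)"
    unfolding zero_ereal_def by (rule interval_integral_to_infinity_eq[symmetric])
  also have "\<dots> = 0 - F 0"
  proof (rule interval_integral_FTC_integrable)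
    show "(F has_vector_derivative g x) (at x)" if "0 < ereal x" for x
      using that by (intro dF) (simp add: zero_ereal_def)
    show "isCont g x" if "0 < ereal x" for x
    proof -
      have x: "x > 0" using that by (simp add: zero_ereal_def)
      have r: "isCont (root_br \<beta> \<alpha> w \<tau>) x" "root_br \<beta> \<alpha> w \<tau> x \<noteq> 0" if "w \<in> res_set \<beta>" "\<tau> = 1 \<or> \<tau> = -1" for w \<tau>
        using has_vector_derivative_continuous[OF has_vector_derivative_root_br[OF assms(1) le less_imp_le[OF x] that]]
          root_br_neq_0[OF assms(1) le less_imp_le[OF x] that] by auto
      have w: "isCont (wt \<beta> \<alpha> s \<tau>) x" for \<tau>
        unfolding wt_def[abs_def] 
        using DERIV_isCont[OF has_real_derivative_gap[OF assms(1) less_imp_le[OF x], of \<alpha>]] gap_pos[OF assms(1) less_imp_le[OF x], of \<alpha>]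
        by (intro continuous_intros) auto
      have G: "isCont (G_avg \<beta> \<alpha> s w) x" if "w \<in> res_set \<beta>" for w
        unfolding G_avg_def[abs_def] using r[OF that] w by (intro continuous_intros) auto
      show ?thesis
        unfolding g_def[abs_def] using G assms(4) i_in_res_set by (intro continuous_intros) auto
    qed
    have "set_integrable lborel {0<..} (\<lambda>u. LINT t|lborel. cyl \<beta> \<alpha> s (phi z) (u, t))"
      by (rule integral_cylindrical(2)[OF int])
    then have "set_integrable lborel {0<..} (\<lambda>u. of_real pi * g u)"
      by (rule set_integrable_cong[THEN iffD1, rotated -1])
        (use integral_cyl_phi_line[OF assms(1) le _ assms(4), of _ s] in \<open>auto simp: g_def\<close>)
    then have "set_integrable lborel {0<..} (\<lambda>u. (1 / of_real pi) * (of_real pi * g u))"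
      by (rule set_integrable_mult_right[rotated])
    then show "set_integrable lborel (einterval 0 \<infinity>) g"
      by (simp add: zero_ereal_def)
    have "(F \<longlongrightarrow> F 0) (at_right 0)"
      using has_vector_derivative_continuous[OF dF[OF order_refl]]
      by (meson continuous_at_imp_continuous_at_within continuous_within)
    then show "((F \<circ> real_of_ereal) \<longlongrightarrow> F 0) (at_right 0)"
      unfolding zero_ereal_def ereal_tendsto_simps .
    have "((\<lambda>u. ((KX \<beta> \<alpha> s (root_sum \<beta> \<alpha> z u) - KX \<beta> \<alpha> s (root_sum \<beta> \<alpha> \<i> u)) +
        (KX \<beta> \<alpha> s (root_sum \<beta> \<alpha> z u) - KX \<beta> \<alpha> s (root_sum \<beta> \<alpha> (- \<i>) u))) / 2) \<longlongrightarrow> (0 + 0) / 2) at_top"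
      using assms by (intro tendsto_intros KX_root_sum_diff_tendsto_0) auto
    then have "(F \<longlongrightarrow> 0) at_top"
      by (simp add: F_def[abs_def] field_simps)
    then show "((F \<circ> real_of_ereal) \<longlongrightarrow> 0) (at_left \<infinity>)"
      unfolding ereal_tendsto_simps .
  qed simp
  finally show ?thesis
    by (simp add: F0 power2_eq_square)
qed

section \<open>Conjugation symmetry and the sign of the imaginary part\<close>

lemma root_br_cnj:
  assumes "\<beta> > 0" "\<alpha>\<^sup>2 \<le> 2 * \<beta>" "u \<ge> 0" "z \<in> res_set \<beta>" "\<tau> = 1 \<or> \<tau> = -1"
  shows "root_br \<beta> \<alpha> (cnj z) \<tau> u = cnj (root_br \<beta> \<alpha> z \<tau> u)"
  unfolding root_br_def using cnj_csqrt[OF branch_notin_nonpos[OF assms]] by simp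

lemma Th_cnj:
  assumes "X \<in> X_dom \<alpha>" "\<alpha> \<ge> 0"
  shows "Th \<alpha> (cnj X) = cnj (Th \<alpha> X)"
  using cnj_Ln[OF X_dom_cayley(4)[OF assms]] by (simp add: Th_def)

lemma KX_root_sum_cnj:
  assumes "\<beta> > 0" "\<alpha> \<ge> 0" "\<alpha>\<^sup>2 \<le> 2 * \<beta>" "u \<ge> 0" "z \<in> res_set \<beta>"
  shows "KX \<beta> \<alpha> s (root_sum \<beta> \<alpha> (cnj z) u) = cnj (KX \<beta> \<alpha> s (root_sum \<beta> \<alpha> z u))"
proof -
  have "root_sum \<beta> \<alpha> (cnj z) u = cnj (root_sum \<beta> \<alpha> z u)"
    by (simp add: root_sum_def root_br_cnj[OF assms(1,3-5)])
  then show ?thesis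
    by (simp add: KX_def Th_cnj[OF root_sum_in_X_dom[OF assms] assms(2)])
qed

lemma KK_eq_KX: "\<beta> > 0 \<Longrightarrow> KK \<beta> \<alpha> s z = KX \<beta> \<alpha> s (root_sum \<beta> \<alpha> z 0)"
  by (simp add: KK_def X0_eq_root_sum[of _ _ \<alpha>])

lemma KK_cnj:
  assumes "\<beta> > 0" "\<alpha> \<ge> 0" "\<alpha>\<^sup>2 \<le> 2 * \<beta>" "z \<in> res_set \<beta>"
  shows "KK \<beta> \<alpha> s (cnj z) = cnj (KK \<beta> \<alpha> s z)"
  unfolding KK_eq_KX[OF assms(1)] by (rule KX_root_sum_cnj[OF assms(1-3) order_refl assms(4)])

lemma Im_inverse_csqrt:
  assumes "Im w < 0"
  shows "Im (1 / csqrt w) = sqrt ((cmod w - Re w) / 2) / cmod w" "Im (1 / csqrt w) > 0"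
proof -
  have "Im (1 / csqrt w) = - Im (csqrt w) / (cmod (csqrt w))\<^sup>2"
    by (simp add: Im_divide cmod_power2 del: csqrt.sel norm_csqrt)
  also have "\<dots> = - Im (csqrt w) / cmod w" by simp
  finally have eq: "Im (1 / csqrt w) = - Im (csqrt w) / cmod w" .
  then show "Im (1 / csqrt w) = sqrt ((cmod w - Re w) / 2) / cmod w"
    using assms by simp
  have "cmod w > 0" using assms by auto
  then show "Im (1 / csqrt w) > 0"
    unfolding eq using Im_csqrt_neg[OF assms] by (intro divide_pos_pos) (simp_all del: csqrt.sel)
qed

text \<open>Followed as a function of u: for Im z > 0 it increases to 0 at infinity, and its value
  at u = 0 is the imaginary part of \<open>KK\<close>. Lower bounds for the derivative thus become
  upper bounds for Im K.\<close>

definition ImK :: "real \<Rightarrow> real \<Rightarrow> 2 \<Rightarrow> complex \<Rightarrow> real \<Rightarrow> real" where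
  "ImK \<beta> \<alpha> s z u = Im (KX \<beta> \<alpha> s (root_sum \<beta> \<alpha> z u))"

definition ImK' :: "real \<Rightarrow> real \<Rightarrow> 2 \<Rightarrow> complex \<Rightarrow> real \<Rightarrow> real" where
  "ImK' \<beta> \<alpha> s z u = wt \<beta> \<alpha> s 1 u * Im (1 / root_br \<beta> \<alpha> z 1 u) + wt \<beta> \<alpha> s (-1) u * Im (1 / root_br \<beta> \<alpha> z (-1) u)"

lemma DERIV_ImK:
  assumes "\<beta> > 0" "\<alpha> \<ge> 0" "\<alpha>\<^sup>2 \<le> 2 * \<beta>" "u \<ge> 0" "z \<in> res_set \<beta>"
  shows "(ImK \<beta> \<alpha> s z has_real_derivative ImK' \<beta> \<alpha> s z u) (at u)"
proof -
  have "(ImK \<beta> \<alpha> s z has_vector_derivative Im (of_real (wt \<beta> \<alpha> s 1 u) / root_br \<beta> \<alpha> z 1 u + of_real (wt \<beta> \<alpha> s (-1) u) / root_br \<beta> \<alpha> z (-1) u)) (at u)"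
    unfolding ImK_def[abs_def]
    by (rule bounded_linear.has_vector_derivative[OF bounded_linear_Im has_vector_derivative_KX_root_sum[OF assms]])
  moreover have "Im (of_real a / b) = a * Im (1 / b)" for a b
    by (simp add: Im_divide)
  ultimately show ?thesis
    by (simp add: has_real_derivative_iff_has_vector_derivative ImK'_def)
qed

lemma wt_sum: "wt \<beta> \<alpha> s 1 u + wt \<beta> \<alpha> s (-1) u = 1"
  by (simp add: wt_def add_divide_distrib[symmetric])

text \<open>For Im z > 0 both radicands lie in the lower half plane, so both inverse roots have
  positive imaginary part. The weights are nonnegative with sum 1, so at least one term is strictly
  positive.\<close>

lemma ImK'_ge:
  assumes "\<beta> > 0" "u \<ge> 0" "Im z > 0"
  shows "ImK' \<beta> \<alpha> s z u > 0" "ImK' \<beta> \<alpha> s z u \<ge> wt \<beta> \<alpha> s (-1) u * Im (1 / root_br \<beta> \<alpha> z (-1) u)"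
proof -
  have p: "Im (1 / root_br \<beta> \<alpha> z \<tau> u) > 0" for \<tau>
    unfolding root_br_def using assms by (intro Im_inverse_csqrt(2)) simp
  have w: "wt \<beta> \<alpha> s 1 u \<ge> 0" "wt \<beta> \<alpha> s (-1) u \<ge> 0"
    using wt_bounds[OF assms(1,2)] by auto
  show "ImK' \<beta> \<alpha> s z u \<ge> wt \<beta> \<alpha> s (-1) u * Im (1 / root_br \<beta> \<alpha> z (-1) u)"
    unfolding ImK'_def using w p[of 1] by simp
  have "wt \<beta> \<alpha> s 1 u > 0 \<or> wt \<beta> \<alpha> s (-1) u > 0"
    using wt_sum[of \<beta> \<alpha> s u] by linarith
  then show "ImK' \<beta> \<alpha> s z u > 0"
    unfolding ImK'_def using w p[of 1] p[of "-1"]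
    by (elim disjE) (auto intro: add_pos_nonneg add_nonneg_pos mult_pos_pos mult_nonneg_nonneg less_imp_le)
qed

text \<open>\<open>KX\<close> has no limit at infinity, but the difference between z and its
  conjugate tends to 0, and by conjugation symmetry that difference is 2 \<i> times the imaginary
  part. An increasing function with limit 0 is nonpositive.\<close>

lemma ImK_nonpos:
  assumes "\<beta> > 0" "\<alpha> \<ge> 0" "\<alpha>\<^sup>2 < 2 * \<beta>" "u \<ge> 0" "Im z > 0"
  shows "ImK \<beta> \<alpha> s z u \<le> 0"
proof -
  have z: "z \<in> res_set \<beta>" using assms(5) by (simp add: res_set_def)
  have "((\<lambda>u. KX \<beta> \<alpha> s (root_sum \<beta> \<alpha> z u) - KX \<beta> \<alpha> s (root_sum \<beta> \<alpha> (cnj z) u)) \<longlongrightarrow> 0) at_top"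
    by (rule KX_root_sum_diff_tendsto_0[OF assms(1,3)])
  then have "((\<lambda>u. Im (KX \<beta> \<alpha> s (root_sum \<beta> \<alpha> z u) - KX \<beta> \<alpha> s (root_sum \<beta> \<alpha> (cnj z) u)) / 2) \<longlongrightarrow> Im 0 / 2) at_top"
    by (intro tendsto_intros) auto
  moreover have "eventually (\<lambda>u. Im (KX \<beta> \<alpha> s (root_sum \<beta> \<alpha> z u) - KX \<beta> \<alpha> s (root_sum \<beta> \<alpha> (cnj z) u)) / 2 = ImK \<beta> \<alpha> s z u) at_top"
    using eventually_ge_at_top[of 0]
    by eventually_elim (simp add: ImK_def KX_root_sum_cnj[OF assms(1,2) less_imp_le[OF assms(3)] _ z])
  ultimately have "(ImK \<beta> \<alpha> s z \<longlongrightarrow> 0) at_top"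
    by (simp add: filterlim_cong)
  then show ?thesis
  proof (rule tendsto_lowerbound)
    show "\<forall>\<^sub>F v in at_top. ImK \<beta> \<alpha> s z u \<le> ImK \<beta> \<alpha> s z v"
      using eventually_ge_at_top[of u]
    proof eventually_elim
      case (elim v)
      show ?case
        by (rule DERIV_nonneg_imp_nondecreasing[OF elim])
          (use DERIV_ImK[OF assms(1,2) less_imp_le[OF assms(3)] _ z] ImK'_ge(1)[OF assms(1) _ assms(5)] assms(4) in
            \<open>meson less_imp_le order_trans\<close>)
    qed
  qed simp
qed

text \<open>\<open>ImK\<close> does not decrease before u1 and is nonpositive at u2, so minus its
  value at 0 is at least the increase over the interval from u1 to u2, which the mean value theorem
  bounds from below.\<close>

lemma ImK_increment:
  assumes "\<beta> > 0" "\<alpha> \<ge> 0" "\<alpha>\<^sup>2 < 2 * \<beta>" "0 \<le> u1" "u1 < u2" "Im z > 0"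
    and "\<And>u. u1 \<le> u \<Longrightarrow> u \<le> u2 \<Longrightarrow> ImK' \<beta> \<alpha> s z u \<ge> c"
  shows "Im (KK \<beta> \<alpha> s z) \<le> - (u2 - u1) * c"
proof -
  have z: "z \<in> res_set \<beta>" using assms(6) by (simp add: res_set_def)
  note D = DERIV_ImK[OF assms(1,2) less_imp_le[OF assms(3)] _ z, of _ s]
  have "ImK \<beta> \<alpha> s z 0 \<le> ImK \<beta> \<alpha> s z u1"
    by (rule DERIV_nonneg_imp_nondecreasing[OF assms(4)])
       (use D ImK'_ge(1)[OF assms(1) _ assms(6)] in \<open>meson less_imp_le order_trans\<close>)
  moreover obtain u where "u1 < u" "u < u2" "ImK \<beta> \<alpha> s z u2 - ImK \<beta> \<alpha> s z u1 = (u2 - u1) * ImK' \<beta> \<alpha> s z u"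
    using MVT2[OF assms(5), of "ImK \<beta> \<alpha> s z" "ImK' \<beta> \<alpha> s z"] D assms(4) by (meson order_trans)
  moreover have "(u2 - u1) * c \<le> (u2 - u1) * ImK' \<beta> \<alpha> s z u"
    using assms(5,7) \<open>u1 < u\<close> \<open>u < u2\<close> by (intro mult_left_mono) auto
  moreover have "ImK \<beta> \<alpha> s z u2 \<le> 0"
    using assms by (intro ImK_nonpos) auto
  ultimately have "ImK \<beta> \<alpha> s z 0 \<le> - ((u2 - u1) * c)" by linarith
  then show ?thesis by (simp add: ImK_def KK_eq_KX[OF assms(1)] algebra_simps)
qed

lemma Im_KK_neg:
  assumes "\<beta> > 0" "\<alpha> \<ge> 0" "\<alpha>\<^sup>2 < 2 * \<beta>" "Im z > 0"
  shows "Im (KK \<beta> \<alpha> s z) < 0"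
proof -
  have z: "z \<in> res_set \<beta>" using assms(4) by (simp add: res_set_def)
  have "ImK \<beta> \<alpha> s z 0 < ImK \<beta> \<alpha> s z 1"
    by (rule DERIV_pos_imp_increasing[of 0 1])
      (use DERIV_ImK[OF assms(1,2) less_imp_le[OF assms(3)] _ z] ImK'_ge(1)[OF assms(1) _ assms(4)] in \<open>simp, meson\<close>)
  also have "\<dots> \<le> 0" using assms by (intro ImK_nonpos) auto
  finally show ?thesis by (simp add: ImK_def KK_eq_KX[OF assms(1)])
qed

text \<open>Above the threshold the imaginary part stays away from \<open>0\<close> when the spectrum is approached
  from above: the lower branch \<open>u - gap \<beta> \<alpha> u\<close> takes values below \<open>E\<close> on an interval of \<open>u\<close> where,
  because of \<open>\<alpha> \<noteq> 0\<close>, both spin directions have positive weight.\<close>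

lemma Im_KK_above_threshold:
  assumes "\<beta> > 0" "\<alpha> > 0" "\<alpha>\<^sup>2 < 2 * \<beta>" "E > - \<beta>"
  obtains m where "m > 0" "\<And>\<epsilon>. 0 < \<epsilon> \<Longrightarrow> \<epsilon> \<le> 1 \<Longrightarrow> Im (KK \<beta> \<alpha> s (Complex E \<epsilon>)) \<le> - m"
proof -
  \<comment> \<open>For u \<le> u2 the lower branch is at most -\<beta> + u2 = E - \<eta>. Starting
    at u1 > 0 keeps its weight away from 0, and B bounds the modulus of the radicand as long as
    \<epsilon> \<le> 1.\<close>
  define u1 u2 \<eta> B where "u1 = (E + \<beta>) / 4" and "u2 = (E + \<beta>) / 2" and "\<eta> = (E + \<beta>) / 2" and "B = E + \<beta> + 1"
  have pos: "0 < u1" "u1 < u2" "\<eta> > 0" "B > 0" using assms by (auto simp: u1_def u2_def \<eta>_def B_def)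
  define w0 where "w0 = (1 - \<beta> / gap \<beta> \<alpha> u1) / 2"
  have "\<beta>\<^sup>2 < \<beta>\<^sup>2 + \<alpha>\<^sup>2 * u1" using assms(2) pos by simp
  then have "gap \<beta> \<alpha> u1 > \<beta>" unfolding gap_def by (rule real_less_rsqrt)
  then have w0: "w0 > 0" using assms(1) by (simp add: w0_def)
  have wt: "wt \<beta> \<alpha> s (-1) u \<ge> w0" if "u1 \<le> u" for u
  proof -
    have "gap \<beta> \<alpha> u1 \<le> gap \<beta> \<alpha> u" unfolding gap_def using that by (simp add: mult_left_mono)
    then have "\<beta> / gap \<beta> \<alpha> u \<le> \<beta> / gap \<beta> \<alpha> u1"
      using \<open>gap \<beta> \<alpha> u1 > \<beta>\<close> assms(1) by (intro divide_left_mono mult_pos_pos) auto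
    moreover have "\<beta> / gap \<beta> \<alpha> u \<ge> 0" "\<beta> / gap \<beta> \<alpha> u1 \<ge> 0"
      using assms(1) gap_pos[OF assms(1)] pos that by (auto intro!: divide_nonneg_pos)
    moreover have "spin s = 1 \<or> spin s = -1" by (simp add: spin_def)
    ultimately have "spin s * (\<beta> / gap \<beta> \<alpha> u) \<le> \<beta> / gap \<beta> \<alpha> u1"
      by (elim disjE) (simp only: mult_1 mult_minus1, linarith?)+
    then have "w0 \<le> (1 - spin s * (\<beta> / gap \<beta> \<alpha> u)) / 2"
      unfolding w0_def by (intro divide_right_mono diff_left_mono) auto
    also have "(1 - spin s * (\<beta> / gap \<beta> \<alpha> u)) / 2 = wt \<beta> \<alpha> s (-1) u"
      by (simp add: wt_def)
    finally show ?thesis .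
  qed
  define m where "m = (u2 - u1) * (w0 * (sqrt \<eta> / B))"
  have "m > 0" unfolding m_def using pos w0 by (intro mult_pos_pos divide_pos_pos) auto
  moreover have "Im (KK \<beta> \<alpha> s (Complex E \<epsilon>)) \<le> - m" if e: "0 < \<epsilon>" "\<epsilon> \<le> 1" for \<epsilon>
  proof -
    have "Im (KK \<beta> \<alpha> s (Complex E \<epsilon>)) \<le> - (u2 - u1) * (w0 * (sqrt \<eta> / B))"
    proof (rule ImK_increment)
      fix u assume u: "u1 \<le> u" "u \<le> u2"
      then have u0: "u \<ge> 0" using pos by simp
      define w where "w = complex_of_real (u - gap \<beta> \<alpha> u) - Complex E \<epsilon>"
      have im: "Im w < 0" using e by (simp add: w_def)
      have re: "Re w \<le> - \<eta>"
      proof -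
        have "Re w = u - gap \<beta> \<alpha> u - E" by (simp add: w_def)
        then show ?thesis
          using gap_ge[OF assms(1) u0, of \<alpha>] u(2) unfolding u2_def \<eta>_def by argo
      qed
      have "- Re w \<le> E + \<beta>"
        using branch_ge(1)[OF assms(1) less_imp_le[OF assms(3)] u0] by (simp add: w_def)
      then have "cmod w \<le> B"
        using cmod_le[of w] re pos(3) e by (simp add: w_def B_def)
      moreover have "(cmod w - Re w) / 2 \<ge> \<eta>"
        using re abs_Re_le_cmod[of w] by simp
      ultimately have "sqrt \<eta> / B \<le> sqrt ((cmod w - Re w) / 2) / cmod w"
        using im pos by (intro frac_le) auto
      then have "sqrt \<eta> / B \<le> Im (1 / root_br \<beta> \<alpha> (Complex E \<epsilon>) (-1) u)"
        using Im_inverse_csqrt(1)[OF im] by (simp add: root_br_def w_def)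
      then have "w0 * (sqrt \<eta> / B) \<le> wt \<beta> \<alpha> s (-1) u * Im (1 / root_br \<beta> \<alpha> (Complex E \<epsilon>) (-1) u)"
        using wt[OF u(1)] w0 pos by (intro mult_mono) auto
      also have "\<dots> \<le> ImK' \<beta> \<alpha> s (Complex E \<epsilon>) u"
        using e by (intro ImK'_ge(2)[OF assms(1) u0]) auto
      finally show "w0 * (sqrt \<eta> / B) \<le> ImK' \<beta> \<alpha> s (Complex E \<epsilon>) u" .
    qed (use assms pos e in auto)
    then show ?thesis by (simp only: m_def mult_minus_left)
  qed
  ultimately show thesis using that by blast
qed

section \<open>The secular equation\<close>

text \<open>For real l one has |1/(l - \<i>)|^2 = 1/(l^2 + 1) = -\<i> phi \<i> l. The normalisation
  is therefore the integral already evaluated, taken at z = \<i>.\<close>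

lemma integral_column_norm:
  assumes "\<beta> > 0" "\<alpha> \<ge> 0" "\<alpha>\<^sup>2 < 2 * \<beta>"
  shows "(LINT p|lborel. (norm (H_resolvent \<beta> \<alpha> \<i> p *v axis s 1))\<^sup>2) = - pi\<^sup>2 * Im (KK \<beta> \<alpha> s \<i>)"
proof -
  note le = less_imp_le[OF assms(3)]
  have ph: "complex_of_real ((cmod (1 / (of_real l - \<i>)))\<^sup>2) = - \<i> * phi \<i> l" for l
  proof -
    have nz: "of_real l - \<i> \<noteq> 0" "of_real l + \<i> \<noteq> 0" by (auto simp: complex_eq_iff)
    have "complex_of_real ((cmod (1 / (of_real l - \<i>)))\<^sup>2) = 1 / ((of_real l - \<i>) * (of_real l + \<i>))"
      unfolding complex_norm_square by simp
    also have "(of_real l - \<i>) * (of_real l + \<i>) = (of_real l)\<^sup>2 + (1::complex)"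
      by (simp add: algebra_simps power2_eq_square)
    also have "1 / ((of_real l)\<^sup>2 + 1) = - \<i> * phi \<i> l"
    proof -
      have "1 + \<i> * of_real l = \<i> * (of_real l - \<i>)" by (simp add: algebra_simps)
      then show ?thesis using nz by (simp add: phi_def)
    qed
    finally show ?thesis .
  qed
  have "complex_of_real ((norm (H_resolvent \<beta> \<alpha> \<i> p *v axis s 1))\<^sup>2) = - \<i> * (spec_mat \<beta> \<alpha> (phi \<i>) p $ s $ s)" for p
  proof -
    have "(norm (H_resolvent \<beta> \<alpha> \<i> p *v axis s 1))\<^sup>2 = 
        spec_avg \<beta> \<alpha> s (\<lambda>l. (cmod (1 / (of_real l - \<i>)))\<^sup>2) (plane_sq p, p $ 3)"
      by (simp only: H_resolvent_eq_spec_mat[OF assms(1) le i_in_res_set(1)] spec_mat_column_norm[OF assms(1)])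
    then have "complex_of_real ((norm (H_resolvent \<beta> \<alpha> \<i> p *v axis s 1))\<^sup>2) =
        spec_avg \<beta> \<alpha> s (\<lambda>l. complex_of_real ((cmod (1 / (of_real l - \<i>)))\<^sup>2)) (plane_sq p, p $ 3)"
      by (simp add: spec_avg_def scaleR_conv_of_real)
    also have "\<dots> = - \<i> * spec_avg \<beta> \<alpha> s (phi \<i>) (plane_sq p, p $ 3)"
      unfolding ph by (simp add: spec_avg_def scaleR_conv_of_real algebra_simps)
    finally show ?thesis by (simp only: spec_mat_diag[OF assms(1)])
  qed
  then have "complex_of_real (LINT p|lborel. (norm (H_resolvent \<beta> \<alpha> \<i> p *v axis s 1))\<^sup>2) =
      (LINT p|lborel. - \<i> * (spec_mat \<beta> \<alpha> (phi \<i>) p $ s $ s))"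
    by (simp only: integral_complex_of_real[symmetric])
  also have "\<dots> = - \<i> * (of_real (pi\<^sup>2) * ((KK \<beta> \<alpha> s \<i> + KK \<beta> \<alpha> s (- \<i>)) / 2 - KK \<beta> \<alpha> s \<i>))"
    by (subst integral_mult_right_zero) (simp only: integral_phi_entry[OF assms i_in_res_set(1)])
  also have "KK \<beta> \<alpha> s (- \<i>) = cnj (KK \<beta> \<alpha> s \<i>)"
    using KK_cnj[OF assms(1,2) le i_in_res_set(1)] by simp
  also have "- \<i> * (of_real (pi\<^sup>2) * ((KK \<beta> \<alpha> s \<i> + cnj (KK \<beta> \<alpha> s \<i>)) / 2 - KK \<beta> \<alpha> s \<i>)) =
      of_real (- pi\<^sup>2 * Im (KK \<beta> \<alpha> s \<i>))"
    by (simp add: complex_eq_iff power2_eq_square)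
  finally show ?thesis by (simp only: of_real_eq_iff)
qed

lemma psi_norm_pos_sq:
  assumes "\<beta> > 0" "\<alpha> \<ge> 0" "\<alpha>\<^sup>2 < 2 * \<beta>"
  shows "psi_norm \<beta> \<alpha> s > 0" "(psi_norm \<beta> \<alpha> s)\<^sup>2 = 8 * pi / (- Im (KK \<beta> \<alpha> s \<i>))"
proof -
  define k where "k = - Im (KK \<beta> \<alpha> s \<i>)"
  have k: "k > 0" using Im_KK_neg[OF assms, of \<i> s] by (simp add: k_def)
  have "psi_norm \<beta> \<alpha> s = 1 / sqrt (pi\<^sup>2 * k / (2 * pi) ^ 3)"
    by (simp add: psi_norm_def integral_column_norm[OF assms] k_def)
  also have "pi\<^sup>2 * k / (2 * pi) ^ 3 = k / (8 * pi)"
    by (simp add: power2_eq_square power3_eq_cube)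
  finally have eq: "psi_norm \<beta> \<alpha> s = 1 / sqrt (k / (8 * pi))" .
  show "psi_norm \<beta> \<alpha> s > 0" using k by (simp add: eq)
  show "(psi_norm \<beta> \<alpha> s)\<^sup>2 = 8 * pi / (- Im (KK \<beta> \<alpha> s \<i>))"
    unfolding eq k_def[symmetric] using k by (simp add: power_divide)
qed

text \<open>The normalisation absorbs all factors of pi and leaves the reciprocal of -Im K(\<i>). A
  check on the constants: the formula gives Q(\<i>) = \<i> on the diagonal.\<close>

lemma Q_matrix_diag:
  assumes "\<beta> > 0" "\<alpha> \<ge> 0" "\<alpha>\<^sup>2 < 2 * \<beta>" "z \<in> res_set \<beta>"
  shows "Q_matrix \<beta> \<alpha> z $ s $ s = (KK \<beta> \<alpha> s z - of_real (Re (KK \<beta> \<alpha> s \<i>))) / of_real (Im (KK \<beta> \<alpha> s \<i>))"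
proof -
  note le = less_imp_le[OF assms(3)]
  define k where "k = - Im (KK \<beta> \<alpha> s \<i>)"
  have k: "k > 0" using Im_KK_neg[OF assms(1-3), of \<i> s] by (simp add: k_def)
  have c: "KK \<beta> \<alpha> s \<i> + KK \<beta> \<alpha> s (- \<i>) = 2 * of_real (Re (KK \<beta> \<alpha> s \<i>))"
    using KK_cnj[OF assms(1,2) le i_in_res_set(1), of s] by (simp add: complex_eq_iff)
  have "Q_matrix \<beta> \<alpha> z $ s $ s = of_real ((psi_norm \<beta> \<alpha> s)\<^sup>2 / (2 * pi) ^ 3) *
     (of_real (pi\<^sup>2) * (of_real (Re (KK \<beta> \<alpha> s \<i>)) - KK \<beta> \<alpha> s z))"
    unfolding Q_matrix_def
    by (simp add: Q_integrand_eq_spec_mat[OF assms(1) le assms(4)] integral_phi_entry[OF assms] c power2_eq_square)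
  also have "\<dots> = of_real ((psi_norm \<beta> \<alpha> s)\<^sup>2 / (2 * pi) ^ 3 * pi\<^sup>2) * (of_real (Re (KK \<beta> \<alpha> s \<i>)) - KK \<beta> \<alpha> s z)"
    by (simp add: mult.assoc)
  also have "(psi_norm \<beta> \<alpha> s)\<^sup>2 / (2 * pi) ^ 3 * pi\<^sup>2 = 1 / k"
    unfolding psi_norm_pos_sq(2)[OF assms(1-3)] k_def[symmetric] using k
    by (simp add: power2_eq_square power3_eq_cube)
  finally show ?thesis
    using k by (simp add: k_def divide_simps)
qed

text \<open>The off-diagonal entries are a function of the squared lengths times a linear form in p,
  hence odd in p.\<close>

lemma Q_matrix_offdiag:
  assumes "\<beta> > 0" "\<alpha>\<^sup>2 \<le> 2 * \<beta>" "z \<in> res_set \<beta>" "s \<noteq> s'"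
  shows "Q_matrix \<beta> \<alpha> z $ s $ s' = 0"
proof -
  have "spec_mat \<beta> \<alpha> (phi z) (- p) $ s $ s' = - (spec_mat \<beta> \<alpha> (phi z) p $ s $ s')" for p
  proof -
    have "plane_sq (- p) = plane_sq p" by (simp add: plane_sq_def)
    moreover have "Complex (- a) (- b) = - Complex a b" for a b by (simp add: complex_eq_iff)
    ultimately show ?thesis
      using assms(4) exhaust_2[of s] exhaust_2[of s'] by (auto simp: spec_mat_def Let_def)
  qed
  then have "(LINT p|lborel. spec_mat \<beta> \<alpha> (phi z) p $ s $ s') = 0"
    by (rule integral_odd_eq_0)
  then show ?thesis
    unfolding Q_matrix_def by (simp add: Q_integrand_eq_spec_mat[OF assms(1-3)])
qed

text \<open>Clearing the denominators Im K(\<i>) in the determinant turns each diagonal entry into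
  -(K + \<open>shift\<close>). At \<alpha> = 0 the value of \<open>shift\<close> is 2 \<omega>, and
  that of \<open>coupling\<close> below is 4 \<gamma>.\<close>

definition shift :: "real \<Rightarrow> real \<Rightarrow> complex^2^2 \<Rightarrow> 2 \<Rightarrow> real" where
  "shift \<beta> \<alpha> \<Gamma> s = - (Re (KK \<beta> \<alpha> s \<i>) + Re (\<Gamma> $ s $ s) * Im (KK \<beta> \<alpha> s \<i>))"

definition coupling :: "real \<Rightarrow> real \<Rightarrow> complex^2^2 \<Rightarrow> real" where
  "coupling \<beta> \<alpha> \<Gamma> = (cmod (\<Gamma> $ 1 $ 2))\<^sup>2 * (Im (KK \<beta> \<alpha> 1 \<i>) * Im (KK \<beta> \<alpha> 2 \<i>))"

lemma det_secular:
  assumes "\<beta> > 0" "\<alpha> \<ge> 0" "\<alpha>\<^sup>2 < 2 * \<beta>" "z \<in> res_set \<beta>" "hermitian_mat \<Gamma>"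
  shows "of_real (Im (KK \<beta> \<alpha> 1 \<i>) * Im (KK \<beta> \<alpha> 2 \<i>)) * det (\<Gamma> - Q_matrix \<beta> \<alpha> z) =
    (KK \<beta> \<alpha> 1 z + of_real (shift \<beta> \<alpha> \<Gamma> 1)) * (KK \<beta> \<alpha> 2 z + of_real (shift \<beta> \<alpha> \<Gamma> 2)) - of_real (coupling \<beta> \<alpha> \<Gamma>)"
proof -
  note le = less_imp_le[OF assms(3)]
  have h: "\<Gamma> $ i $ j = cnj (\<Gamma> $ j $ i)" for i j using assms(5) unfolding hermitian_mat_def by blast
  have real: "\<Gamma> $ s $ s = of_real (Re (\<Gamma> $ s $ s))" for s
  proof -
    have "Im (\<Gamma> $ s $ s) = - Im (\<Gamma> $ s $ s)"
      using arg_cong[OF h[of s s], of Im] by (simp only: cnj.sel)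
    then show ?thesis by (simp add: complex_eq_iff)
  qed
  have entry: "of_real (Im (KK \<beta> \<alpha> s \<i>)) * (\<Gamma> $ s $ s - Q_matrix \<beta> \<alpha> z $ s $ s) = - (KK \<beta> \<alpha> s z + of_real (shift \<beta> \<alpha> \<Gamma> s))" for s
  proof -
    obtain g where g: "\<Gamma> $ s $ s = of_real g" using real[of s] by blast
    have "Im (KK \<beta> \<alpha> s \<i>) \<noteq> 0" using Im_KK_neg[OF assms(1-3), of \<i> s] by simp
    then show ?thesis
      unfolding Q_matrix_diag[OF assms(1-4)] shift_def g by (simp add: field_simps)
  qed
  have off: "\<Gamma> $ 1 $ 2 * \<Gamma> $ 2 $ 1 = of_real ((cmod (\<Gamma> $ 1 $ 2))\<^sup>2)"
    unfolding h[of 2 1] complex_norm_square ..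
  have "of_real (Im (KK \<beta> \<alpha> 1 \<i>) * Im (KK \<beta> \<alpha> 2 \<i>)) * det (\<Gamma> - Q_matrix \<beta> \<alpha> z) =
    (of_real (Im (KK \<beta> \<alpha> 1 \<i>)) * (\<Gamma> $ 1 $ 1 - Q_matrix \<beta> \<alpha> z $ 1 $ 1)) *
    (of_real (Im (KK \<beta> \<alpha> 2 \<i>)) * (\<Gamma> $ 2 $ 2 - Q_matrix \<beta> \<alpha> z $ 2 $ 2)) -
    of_real (Im (KK \<beta> \<alpha> 1 \<i>) * Im (KK \<beta> \<alpha> 2 \<i>)) * (\<Gamma> $ 1 $ 2 * \<Gamma> $ 2 $ 1)"
    by (simp add: det_2 Q_matrix_offdiag[OF assms(1) le assms(4)] algebra_simps)
  then show ?thesis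
    unfolding entry off minus_mult_minus by (simp add: coupling_def mult_ac)
qed

lemma Complex_in_res_set: "\<epsilon> > 0 \<Longrightarrow> Complex E \<epsilon> \<in> res_set \<beta>"
  by (simp add: res_set_def)

lemma coupling_nonneg:
  assumes "\<beta> > 0" "\<alpha> \<ge> 0" "\<alpha>\<^sup>2 < 2 * \<beta>"
  shows "coupling \<beta> \<alpha> \<Gamma> \<ge> 0"
  unfolding coupling_def using Im_KK_neg[OF assms, of \<i> 1] Im_KK_neg[OF assms, of \<i> 2]
  by (intro mult_nonneg_nonneg mult_nonpos_nonpos) auto

text \<open>Factor out a: since Im a < 0, the number g/a has nonnegative imaginary part, so
  subtracting it from b moves b further into the lower half plane. A nonnegative coupling therefore
  cannot cancel the product of the two factors.\<close>

lemma norm_product_minus_real_ge: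
  assumes "Im a \<le> - m" "Im b \<le> - m'" "m > 0" "m' > 0" "g \<ge> 0"
  shows "cmod (a * b - of_real g) \<ge> m * m'"
proof -
  have a: "cmod a \<ge> m" using abs_Im_le_cmod[of a] assms by linarith
  have a0: "a \<noteq> 0" using a assms by auto
  have "Im (of_real g / a) = - g * Im a / (cmod a)\<^sup>2"
    by (simp add: Im_divide cmod_power2)
  also have "\<dots> \<ge> 0" using assms by (intro divide_nonneg_nonneg) (auto simp: mult_nonneg_nonpos)
  finally have "Im (b - of_real g / a) \<le> - m'" using assms by simp
  then have "cmod (b - of_real g / a) \<ge> m'" using abs_Im_le_cmod[of "b - of_real g / a"] assms by linarith
  then have "m * m' \<le> cmod a * cmod (b - of_real g / a)" using a assms by (intro mult_mono) auto
  also have "\<dots> = cmod (a * b - of_real g)"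
    using a0 by (simp add: norm_mult[symmetric] right_diff_distrib)
  finally show ?thesis .
qed

lemma notin_singular_spectrum_above_threshold:
  assumes "\<beta> > 0" "\<alpha> > 0" "\<alpha>\<^sup>2 < 2 * \<beta>" "hermitian_mat \<Gamma>" "E > - \<beta>"
  shows "E \<notin> singular_spectrum \<beta> \<alpha> \<Gamma>"
proof
  assume "E \<in> singular_spectrum \<beta> \<alpha> \<Gamma>"
  then have lim: "((\<lambda>\<epsilon>. det (\<Gamma> - Q_matrix \<beta> \<alpha> (Complex E \<epsilon>))) \<longlongrightarrow> 0) (at_right 0)"
    using assms(5) by (simp add: singular_spectrum_def)
  note a0 = less_imp_le[OF assms(2)]
  obtain m where m: "m > 0" "\<And>\<epsilon>. 0 < \<epsilon> \<Longrightarrow> \<epsilon> \<le> 1 \<Longrightarrow> Im (KK \<beta> \<alpha> 1 (Complex E \<epsilon>)) \<le> - m"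
    using Im_KK_above_threshold[OF assms(1-3,5), of 1] by blast
  obtain m' where m': "m' > 0" "\<And>\<epsilon>. 0 < \<epsilon> \<Longrightarrow> \<epsilon> \<le> 1 \<Longrightarrow> Im (KK \<beta> \<alpha> 2 (Complex E \<epsilon>)) \<le> - m'"
    using Im_KK_above_threshold[OF assms(1-3,5), of 2] by blast
  define c where "c = complex_of_real (Im (KK \<beta> \<alpha> 1 \<i>) * Im (KK \<beta> \<alpha> 2 \<i>))"
  have "((\<lambda>\<epsilon>. cmod (c * det (\<Gamma> - Q_matrix \<beta> \<alpha> (Complex E \<epsilon>)))) \<longlongrightarrow> cmod (c * 0)) (at_right 0)"
    by (intro tendsto_intros lim)
  then have "((\<lambda>\<epsilon>. cmod (c * det (\<Gamma> - Q_matrix \<beta> \<alpha> (Complex E \<epsilon>)))) \<longlongrightarrow> 0) (at_right 0)"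
    by simp
  moreover have "eventually (\<lambda>\<epsilon>. m * m' \<le> cmod (c * det (\<Gamma> - Q_matrix \<beta> \<alpha> (Complex E \<epsilon>)))) (at_right 0)"
  proof -
    have "eventually (\<lambda>\<epsilon>. 0 < \<epsilon> \<and> \<epsilon> < (1::real)) (at_right 0)"
      by (auto simp: eventually_at_right_field intro: exI[of _ 1])
    then show ?thesis
    proof eventually_elim
      case (elim \<epsilon>)
      show ?case
        unfolding c_def det_secular[OF assms(1) a0 assms(3) Complex_in_res_set[OF conjunct1[OF elim]] assms(4)]
        using m m' elim coupling_nonneg[OF assms(1) a0 assms(3)]
        by (intro norm_product_minus_real_ge) auto
    qed
  qed
  ultimately have "m * m' \<le> 0"
    by (intro tendsto_lowerbound[of _ 0 "at_right 0"]) auto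
  then show False using mult_pos_pos[OF m(1) m'(1)] by linarith
qed

text \<open>Below the threshold \<open>xr \<beta> E\<close> is \<open>1 / \<xi>(E)\<close>, and \<open>FS\<close> is twice the corresponding factor of the secular
  equation.\<close>

definition TR :: "real \<Rightarrow> real \<Rightarrow> real" where
  "TR \<alpha> x = (if \<alpha> = 0 then 2 / x else ln ((x + \<alpha>) / (x - \<alpha>)) / \<alpha>)"

definition KR :: "real \<Rightarrow> real \<Rightarrow> 2 \<Rightarrow> real \<Rightarrow> real" where
  "KR \<beta> \<alpha> s x = x + (spin s * \<beta> - \<alpha>\<^sup>2 / 2) * TR \<alpha> x"

definition xr :: "real \<Rightarrow> real \<Rightarrow> real" where
  "xr \<beta> E = sqrt (\<beta> - E) + sqrt (- \<beta> - E)"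

definition FS :: "real \<Rightarrow> complex^2^2 \<Rightarrow> 2 \<Rightarrow> real \<Rightarrow> real \<Rightarrow> real" where
  "FS \<beta> \<Gamma> s E \<alpha> = KR \<beta> \<alpha> s (xr \<beta> E) + shift \<beta> \<alpha> \<Gamma> s"

section \<open>Real values of K up to the threshold\<close>

lemma KX_of_real:
  assumes "x > \<alpha>" "\<alpha> \<ge> 0"
  shows "KX \<beta> \<alpha> s (of_real x) = of_real (KR \<beta> \<alpha> s x)"
proof -
  have "Th \<alpha> (of_real x) = of_real (TR \<alpha> x)"
  proof (cases "\<alpha> = 0")
    case False
    have "(x + \<alpha>) / (x - \<alpha>) > 0" using assms by simp
    then have "Ln (of_real ((x + \<alpha>) / (x - \<alpha>))) = of_real (ln ((x + \<alpha>) / (x - \<alpha>)))"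
      by (rule Ln_of_real)
    then show ?thesis using False by (simp add: Th_def TR_def)
  qed (simp add: Th_def TR_def)
  then show ?thesis by (simp add: KX_def KR_def)
qed

lemma xr_ge:
  assumes "\<beta> > 0" "E \<le> - \<beta>"
  shows "xr \<beta> E \<ge> sqrt (2 * \<beta>)"
proof -
  have "sqrt (2 * \<beta>) \<le> sqrt (\<beta> - E)" using assms by simp
  moreover have "sqrt (- \<beta> - E) \<ge> 0" using assms by simp
  ultimately show ?thesis unfolding xr_def by linarith
qed

lemma xr_gt:
  assumes "\<beta> > 0" "\<alpha> \<ge> 0" "\<alpha>\<^sup>2 < 2 * \<beta>" "E \<le> - \<beta>"
  shows "xr \<beta> E > \<alpha>"
  using xr_ge[OF assms(1,4)] real_less_rsqrt[OF assms(3)] by linarith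

lemma X0_of_real:
  assumes "\<beta> > 0" "E \<le> - \<beta>"
  shows "X0 \<beta> (of_real E) = of_real (xr \<beta> E)"
  using assms by (simp add: X0_def xr_def)

lemma KK_of_real:
  assumes "\<beta> > 0" "\<alpha> \<ge> 0" "\<alpha>\<^sup>2 < 2 * \<beta>" "E \<le> - \<beta>"
  shows "KK \<beta> \<alpha> s (of_real E) = of_real (KR \<beta> \<alpha> s (xr \<beta> E))"
  unfolding KK_def X0_of_real[OF assms(1,4)] by (rule KX_of_real[OF xr_gt[OF assms] assms(2)])

text \<open>\<open>csqrt\<close> jumps across the negative axis, but the modulus of the root is the
  root of the modulus, so it is continuous at 0. At the threshold the radicand of the lower root
  tends to exactly this point.\<close>

lemma csqrt_tendsto_0: "(f \<longlongrightarrow> 0) F \<Longrightarrow> ((\<lambda>x. csqrt (f x)) \<longlongrightarrow> 0) F"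
  using tendsto_real_sqrt[of "\<lambda>x. cmod (f x)" 0 F] by (simp add: tendsto_norm_zero_iff[symmetric, of "\<lambda>x. csqrt (f x)"] tendsto_norm_zero)

lemma KK_tendsto_threshold:
  assumes "\<beta> > 0" "\<alpha> \<ge> 0" "\<alpha>\<^sup>2 < 2 * \<beta>"
  shows "((\<lambda>\<epsilon>. KK \<beta> \<alpha> s (Complex (- \<beta>) \<epsilon>)) \<longlongrightarrow> of_real (KR \<beta> \<alpha> s (xr \<beta> (- \<beta>)))) (at_right 0)"
proof -
  have C: "((\<lambda>\<epsilon>. Complex (- \<beta>) \<epsilon>) \<longlongrightarrow> Complex (- \<beta>) 0) (at_right 0)"
    by (intro tendsto_Complex tendsto_intros)
  have "((\<lambda>\<epsilon>. of_real \<beta> - Complex (- \<beta>) \<epsilon>) \<longlongrightarrow> of_real \<beta> - Complex (- \<beta>) 0) (at_right 0)"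
    by (intro tendsto_intros C)
  moreover have "of_real \<beta> - Complex (- \<beta>) 0 = of_real (2 * \<beta>)" by (simp add: complex_eq_iff)
  ultimately have 1: "((\<lambda>\<epsilon>. of_real \<beta> - Complex (- \<beta>) \<epsilon>) \<longlongrightarrow> of_real (2 * \<beta>)) (at_right 0)" by simp
  have np: "complex_of_real (2 * \<beta>) \<notin> \<real>\<^sub>\<le>\<^sub>0" using assms(1) by (simp add: complex_nonpos_Reals_iff)
  have "((\<lambda>\<epsilon>. csqrt (of_real \<beta> - Complex (- \<beta>) \<epsilon>)) \<longlongrightarrow> csqrt (of_real (2 * \<beta>))) (at_right 0)"
    by (rule isCont_tendsto_compose[OF continuous_at_csqrt[OF np] 1])
  moreover have "((\<lambda>\<epsilon>. csqrt (- of_real \<beta> - Complex (- \<beta>) \<epsilon>)) \<longlongrightarrow> 0) (at_right 0)"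
  proof (rule csqrt_tendsto_0)
    have "((\<lambda>\<epsilon>. - of_real \<beta> - Complex (- \<beta>) \<epsilon>) \<longlongrightarrow> - of_real \<beta> - Complex (- \<beta>) 0) (at_right 0)"
      by (intro tendsto_intros C)
    moreover have "- of_real \<beta> - Complex (- \<beta>) 0 = 0" by (simp add: complex_eq_iff)
    ultimately show "((\<lambda>\<epsilon>. - of_real \<beta> - Complex (- \<beta>) \<epsilon>) \<longlongrightarrow> 0) (at_right 0)" by simp
  qed
  ultimately have "((\<lambda>\<epsilon>. X0 \<beta> (Complex (- \<beta>) \<epsilon>)) \<longlongrightarrow> csqrt (of_real (2 * \<beta>)) + 0) (at_right 0)"
    unfolding X0_def by (rule tendsto_add)
  then have X: "((\<lambda>\<epsilon>. X0 \<beta> (Complex (- \<beta>) \<epsilon>)) \<longlongrightarrow> of_real (xr \<beta> (- \<beta>))) (at_right 0)"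
    using assms(1) by (simp add: xr_def)
  have gt: "xr \<beta> (- \<beta>) > \<alpha>" using xr_gt[OF assms] by simp
  then have "of_real (xr \<beta> (- \<beta>)) \<in> X_dom \<alpha>" by (simp add: X_dom_def)
  from isCont_tendsto_compose[OF DERIV_isCont[OF has_field_derivative_KX[OF this assms(2)]] X]
  show ?thesis unfolding KK_def KX_of_real[OF gt assms(2)] .
qed

text \<open>The determinant is the secular expression divided by the nonzero constant
  \<open>c\<close>. At E = -\<beta> the expression converges to its real value along E + \<i>
  \<epsilon>, so the determinant tends to 0 exactly if that value is 0.\<close>

lemma singular_spectrum_iff:
  assumes "\<beta> > 0" "\<alpha> \<ge> 0" "\<alpha>\<^sup>2 < 2 * \<beta>" "hermitian_mat \<Gamma>" "E \<le> - \<beta>"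
  shows "E \<in> singular_spectrum \<beta> \<alpha> \<Gamma> \<longleftrightarrow> FS \<beta> \<Gamma> 1 E \<alpha> * FS \<beta> \<Gamma> 2 E \<alpha> = coupling \<beta> \<alpha> \<Gamma>"
proof -
  define c where "c = complex_of_real (Im (KK \<beta> \<alpha> 1 \<i>) * Im (KK \<beta> \<alpha> 2 \<i>))"
  have c: "c \<noteq> 0"
    using Im_KK_neg[OF assms(1-3), of \<i> 1] Im_KK_neg[OF assms(1-3), of \<i> 2] by (simp add: c_def)
  have val: "(of_real (KR \<beta> \<alpha> 1 (xr \<beta> E)) + of_real (shift \<beta> \<alpha> \<Gamma> 1)) *
      (of_real (KR \<beta> \<alpha> 2 (xr \<beta> E)) + of_real (shift \<beta> \<alpha> \<Gamma> 2)) - of_real (coupling \<beta> \<alpha> \<Gamma>) =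
      complex_of_real (FS \<beta> \<Gamma> 1 E \<alpha> * FS \<beta> \<Gamma> 2 E \<alpha> - coupling \<beta> \<alpha> \<Gamma>)"
    by (simp add: FS_def)
  show ?thesis
  proof (cases "E < - \<beta>")
    case True
    then have r: "of_real E \<in> res_set \<beta>" by (simp add: res_set_def)
    have "c * det (\<Gamma> - Q_matrix \<beta> \<alpha> (of_real E)) = complex_of_real (FS \<beta> \<Gamma> 1 E \<alpha> * FS \<beta> \<Gamma> 2 E \<alpha> - coupling \<beta> \<alpha> \<Gamma>)"
      unfolding c_def det_secular[OF assms(1-3) r assms(4)] KK_of_real[OF assms(1-3,5)] by (rule val)
    then have "det (\<Gamma> - Q_matrix \<beta> \<alpha> (of_real E)) = 0 \<longleftrightarrow> 
        complex_of_real (FS \<beta> \<Gamma> 1 E \<alpha> * FS \<beta> \<Gamma> 2 E \<alpha> - coupling \<beta> \<alpha> \<Gamma>) = 0"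
      using c by (metis mult_eq_0_iff)
    then show ?thesis using True by (simp only: of_real_eq_0_iff) (simp add: singular_spectrum_def)
  next
    case False
    then have E: "E = - \<beta>" using assms(5) by simp
    let ?d = "\<lambda>\<epsilon>. det (\<Gamma> - Q_matrix \<beta> \<alpha> (Complex E \<epsilon>))"
    let ?L = "complex_of_real (FS \<beta> \<Gamma> 1 E \<alpha> * FS \<beta> \<Gamma> 2 E \<alpha> - coupling \<beta> \<alpha> \<Gamma>)"
    have "((\<lambda>\<epsilon>. (KK \<beta> \<alpha> 1 (Complex E \<epsilon>) + of_real (shift \<beta> \<alpha> \<Gamma> 1)) * (KK \<beta> \<alpha> 2 (Complex E \<epsilon>) + of_real (shift \<beta> \<alpha> \<Gamma> 2)) - of_real (coupling \<beta> \<alpha> \<Gamma>)) \<longlongrightarrow> ?L) (at_right 0)"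
      unfolding val[symmetric] unfolding E by (intro tendsto_intros KK_tendsto_threshold assms)
    moreover have "eventually (\<lambda>\<epsilon>. (KK \<beta> \<alpha> 1 (Complex E \<epsilon>) + of_real (shift \<beta> \<alpha> \<Gamma> 1)) * (KK \<beta> \<alpha> 2 (Complex E \<epsilon>) + of_real (shift \<beta> \<alpha> \<Gamma> 2)) - of_real (coupling \<beta> \<alpha> \<Gamma>) = c * ?d \<epsilon>) (at_right 0)"
      using eventually_at_right_less[of 0]
      by eventually_elim (simp only: c_def det_secular[OF assms(1-3) Complex_in_res_set assms(4)])
    ultimately have lim: "((\<lambda>\<epsilon>. c * ?d \<epsilon>) \<longlongrightarrow> ?L) (at_right 0)"
      by (rule Lim_transform_eventually)
    have "(?d \<longlongrightarrow> 0) (at_right 0) \<longleftrightarrow> ?L = 0"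
    proof
      assume "(?d \<longlongrightarrow> 0) (at_right 0)"
      then have "((\<lambda>\<epsilon>. c * ?d \<epsilon>) \<longlongrightarrow> c * 0) (at_right 0)" by (intro tendsto_intros)
      then show "?L = 0" using tendsto_unique[OF _ lim] by fastforce
    next
      assume "?L = 0"
      with lim have "((\<lambda>\<epsilon>. c * ?d \<epsilon>) \<longlongrightarrow> 0) (at_right 0)" by simp
      then have "((\<lambda>\<epsilon>. (1 / c) * (c * ?d \<epsilon>)) \<longlongrightarrow> (1 / c) * 0) (at_right 0)" by (intro tendsto_intros)
      then show "(?d \<longlongrightarrow> 0) (at_right 0)" using c by simp
    qed
    then show ?thesis using False by (simp only: of_real_eq_0_iff) (simp add: singular_spectrum_def)
  qed
qed

section \<open>The spectrum at the threshold\<close>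

text \<open>The plane slit along the real x with |x| \<ge> 1, the natural domain of 2 artanh; that
  function is \<open>LL\<close> below.\<close>

definition cut_dom :: "complex set" where
  "cut_dom = {w. Im w \<noteq> 0 \<or> \<bar>Re w\<bar> < 1}"

definition LL :: "complex \<Rightarrow> complex" where
  "LL w = Ln ((1 + w) / (1 - w))"

lemma cut_dom_cayley:
  assumes "w \<in> cut_dom"
  shows "1 - w \<noteq> 0" "1 + w \<noteq> 0" "(1 + w) / (1 - w) \<notin> \<real>\<^sub>\<le>\<^sub>0"
proof -
  show nz: "1 - w \<noteq> 0" "1 + w \<noteq> 0" using assms by (auto simp: cut_dom_def complex_eq_iff)
  show "(1 + w) / (1 - w) \<notin> \<real>\<^sub>\<le>\<^sub>0"
  proof
    assume "(1 + w) / (1 - w) \<in> \<real>\<^sub>\<le>\<^sub>0"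
    then obtain r where r: "(1 + w) / (1 - w) = of_real r" "r \<le> 0"
      by (auto elim: nonpos_Reals_cases)
    then have "1 + w = of_real r * (1 - w)" using nz by (simp add: field_simps)
    then have eq: "1 + Re w = r * (1 - Re w)" "Im w = - r * Im w"
      by (simp_all add: complex_eq_iff)
    show False
    proof (cases "Im w = 0")
      case True
      then have "\<bar>Re w\<bar> < 1" using assms by (simp add: cut_dom_def)
      then have "r * (1 - Re w) \<le> 0" using r(2) by (simp add: mult_nonpos_nonneg)
      then show False using eq(1) \<open>\<bar>Re w\<bar> < 1\<close> by linarith
    next
      case False
      then have "r = -1" using eq(2) by (metis mult_cancel_right1 equation_minus_iff)
      then show False using eq(1) by simp
    qed
  qed
qed

lemma has_field_derivative_LL:
  assumes "w \<in> cut_dom"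
  shows "(LL has_field_derivative 2 / (1 - w\<^sup>2)) (at w)"
proof -
  note nz = cut_dom_cayley[OF assms]
  have "(LL has_field_derivative ((1 * (1 - w) - (1 + w) * (- 1)) / ((1 - w) * (1 - w))) / ((1 + w) / (1 - w))) (at w)"
    unfolding LL_def[abs_def] using nz by (auto intro!: derivative_eq_intros simp: mult_ac)
  also have "((1 * (1 - w) - (1 + w) * (- 1)) / ((1 - w) * (1 - w))) / ((1 + w) / (1 - w)) = 2 / ((1 - w) * (1 + w))"
  proof -
    have two: "(1 * (1 - w) - (1 + w) * (- 1)) = 2" by simp
    have h: "2 / (p * p) / (q / p) = 2 / (p * q)" if "p \<noteq> 0" "q \<noteq> 0" for p q :: complex
      using that by (simp add: field_simps)
    show ?thesis unfolding two by (rule h[OF nz(1,2)])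
  qed
  also have "(1 - w) * (1 + w) = 1 - w\<^sup>2" by (simp add: algebra_simps power2_eq_square)
  finally show ?thesis .
qed

lemma open_cut_dom: "open cut_dom"
proof -
  have eq: "cut_dom = {w. Im w < 0} \<union> {w. Im w > 0} \<union> ({w. Re w < 1} \<inter> {w. Re w > -1})"
    by (auto simp: cut_dom_def)
  show ?thesis
    unfolding eq by (intro open_Un open_Int open_halfspace_Re_lt open_halfspace_Re_gt open_halfspace_Im_lt open_halfspace_Im_gt)
qed

lemma LL_holomorphic: "LL holomorphic_on cut_dom"
  using has_field_derivative_LL open_cut_dom by (meson holomorphic_on_open)

lemma Th_eq_LL:
  assumes "X \<noteq> 0" "\<alpha> \<noteq> 0"
  shows "Th \<alpha> X = LL (of_real \<alpha> / X) / of_real \<alpha>"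
proof -
  have "(X + of_real \<alpha>) / (X - of_real \<alpha>) = (1 + of_real \<alpha> / X) / (1 - of_real \<alpha> / X)"
    using assms by (simp add: divide_simps)
  then show ?thesis using assms by (simp add: Th_def LL_def)
qed

text \<open>This is \<alpha> K with \<alpha> replaced by a complex a. The factor a removes the
  division by \<alpha>, which makes a = 0 an interior point of the domain of holomorphy.\<close>

definition kap :: "real \<Rightarrow> 2 \<Rightarrow> complex \<Rightarrow> complex \<Rightarrow> complex" where
  "kap \<beta> s X a = a * X + (of_real (spin s * \<beta>) - a\<^sup>2 / 2) * LL (a / X)"

lemma KX_eq_kap:
  assumes "X \<noteq> 0" "\<alpha> \<noteq> 0"
  shows "of_real \<alpha> * KX \<beta> \<alpha> s X = kap \<beta> s X (of_real \<alpha>)"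
  unfolding KX_def Th_eq_LL[OF assms] kap_def using assms by (simp add: algebra_simps)

lemma Im_X0_neg:
  assumes "Im z > 0" shows "Im (X0 \<beta> z) < 0"
  unfolding X0_def using assms Im_csqrt_neg[of "of_real \<beta> - z"] Im_csqrt_neg[of "- of_real \<beta> - z"]
  by (simp del: csqrt.sel)

lemma Im_X0_pos:
  assumes "Im z < 0" shows "Im (X0 \<beta> z) > 0"
  unfolding X0_def using assms Im_csqrt_pos[of "of_real \<beta> - z"] Im_csqrt_pos[of "- of_real \<beta> - z"]
  by (simp del: csqrt.sel)

lemma of_real_div_in_cut_dom:
  assumes "Im X \<noteq> 0" shows "of_real \<alpha> / X \<in> cut_dom"
proof (cases "\<alpha> = 0")
  case False
  have "X \<noteq> 0" using assms by auto
  then have "Im (of_real \<alpha> / X) \<noteq> 0"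
    using False assms by (simp add: Im_divide sum_power2_eq_zero_iff)
  then show ?thesis by (simp add: cut_dom_def)
qed (simp add: cut_dom_def)

text \<open>The parameters a at which \<open>kap \<beta> s X\<close> is holomorphic for all X in A
  simultaneously. It is star-shaped about 0, hence connected, as analytic continuation
  demands.\<close>

definition star_dom :: "complex set \<Rightarrow> complex set" where
  "star_dom A = {a. \<forall>X\<in>A. a / X \<in> cut_dom}"

lemma star_dom_props:
  assumes "finite A" "0 \<notin> A"
  shows "open (star_dom A)" "connected (star_dom A)" "0 \<in> star_dom A"
proof -
  have "star_dom A = (\<Inter>X\<in>A. (\<lambda>a. a / X) -` cut_dom)" by (auto simp: star_dom_def)
  moreover have "open ((\<lambda>a. a / X) -` cut_dom)" if "X \<in> A" for X
    using that assms by (intro open_vimage open_cut_dom continuous_intros) auto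
  ultimately show "open (star_dom A)" using assms by auto
  show "0 \<in> star_dom A" by (simp add: star_dom_def cut_dom_def)
  have "starlike (star_dom A)"
    unfolding starlike_def
  proof (intro bexI ballI subsetI)
    fix a b assume a: "a \<in> star_dom A" and "b \<in> closed_segment 0 a"
    then obtain t where t: "0 \<le> t" "t \<le> 1" "b = of_real t * a"
      by (auto simp: in_segment scaleR_conv_of_real)
    show "b \<in> star_dom A"
      unfolding star_dom_def
    proof (intro CollectI ballI)
      fix X assume "X \<in> A"
      then have w: "a / X \<in> cut_dom" using a by (simp add: star_dom_def)
      define c where "c = a / X"
      have b: "b / X = of_real t * c" using t by (simp add: c_def)
      show "b / X \<in> cut_dom"
      proof (cases "t = 0")
        case False
        have "\<bar>t * Re c\<bar> \<le> \<bar>Re c\<bar>"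
          using t by (simp add: abs_mult mult_left_le_one_le)
        then show ?thesis using w False unfolding b cut_dom_def c_def[symmetric] by auto
      qed (simp add: b cut_dom_def)
    qed
  qed (rule \<open>0 \<in> star_dom A\<close>)
  then show "connected (star_dom A)" by (rule starlike_imp_connected)
qed

lemma kap_holomorphic:
  assumes "X \<in> A" "0 \<notin> A"
  shows "kap \<beta> s X holomorphic_on star_dom A"
proof -
  have "(\<lambda>a. LL (a / X)) holomorphic_on star_dom A"
  proof -
    have "(\<lambda>a. a / X) holomorphic_on star_dom A" using assms by (intro holomorphic_intros) auto
    moreover have "(\<lambda>a. a / X) ` star_dom A \<subseteq> cut_dom" using assms(1) by (auto simp: star_dom_def)
    ultimately show ?thesis
      using holomorphic_on_compose_gen[of "\<lambda>a. a / X" "star_dom A" LL cut_dom] LL_holomorphic by (simp add: o_def)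
  qed
  then show ?thesis unfolding kap_def[abs_def] by (intro holomorphic_intros) auto
qed

text \<open>Identity theorem in the parameter. \<open>D\<close> continues \<alpha>^2 times the
  secular expression to complex \<alpha>, and its zeros accumulate at 0. The whole interval up to x
  = sqrt (2 \<beta>) lies in the connected domain, because a/x < 1 there and X0 is not real at \<i>
  and -\<i>.\<close>

lemma secular_threshold_identity:
  fixes \<Gamma> :: "complex^2^2"
  assumes b: "\<beta> > 0"
    and freq: "\<And>\<delta>. \<delta> > 0 \<Longrightarrow> \<exists>\<alpha>. 0 < \<alpha> \<and> \<alpha> < \<delta> \<and> \<alpha> < sqrt (2 * \<beta>) \<and>
      FS \<beta> \<Gamma> 1 (- \<beta>) \<alpha> * FS \<beta> \<Gamma> 2 (- \<beta>) \<alpha> = coupling \<beta> \<alpha> \<Gamma>"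
    and al: "0 < \<alpha>" "\<alpha> < sqrt (2 * \<beta>)"
  shows "FS \<beta> \<Gamma> 1 (- \<beta>) \<alpha> * FS \<beta> \<Gamma> 2 (- \<beta>) \<alpha> = coupling \<beta> \<alpha> \<Gamma>"
proof -
  define x where "x = sqrt (2 * \<beta>)"
  have x: "x > 0" "xr \<beta> (- \<beta>) = x" using b by (simp_all add: x_def xr_def)
  define X1 X2 where "X1 = X0 \<beta> \<i>" and "X2 = X0 \<beta> (- \<i>)"
  have im: "Im X1 < 0" "Im X2 > 0" unfolding X1_def X2_def by (simp_all add: Im_X0_neg Im_X0_pos)
  then have nz: "X1 \<noteq> 0" "X2 \<noteq> 0" by auto
  define A where "A = {of_real x, X1, X2}"
  have A: "finite A" "0 \<notin> A" using x nz by (auto simp: A_def)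
  have mem: "of_real a \<in> star_dom A" if "0 < a" "a < x" for a
    using that x im of_real_div_in_cut_dom[of X1 a] of_real_div_in_cut_dom[of X2 a]
    by (auto simp: star_dom_def A_def cut_dom_def simp flip: of_real_divide)
  \<comment> \<open>Real and imaginary parts are not holomorphic in a. They are replaced by the half
    sum and the half difference of the functions at \<i> and -\<i>, which for admissible real a are
    a times the real and the imaginary part of K(\<i>).\<close>
  define Rk Ik where "Rk s a = (kap \<beta> s X1 a + kap \<beta> s X2 a) / 2" 
    and "Ik s a = (kap \<beta> s X1 a - kap \<beta> s X2 a) / (2 * \<i>)" for s a
  define P where "P s a = kap \<beta> s (of_real x) a - (Rk s a + of_real (Re (\<Gamma> $ s $ s)) * Ik s a)" for s a
  define D where "D a = P 1 a * P 2 a - of_real ((cmod (\<Gamma> $ 1 $ 2))\<^sup>2) * (Ik 1 a * Ik 2 a)" for a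
  have hol: "D holomorphic_on star_dom A"
    unfolding D_def P_def Rk_def Ik_def
    by (intro holomorphic_intros kap_holomorphic A) (auto simp: A_def)
  have val: "D (of_real a) = of_real (a\<^sup>2 * (FS \<beta> \<Gamma> 1 (- \<beta>) a * FS \<beta> \<Gamma> 2 (- \<beta>) a - coupling \<beta> a \<Gamma>))"
    if a: "0 < a" "a < x" for a
  proof -
    have "a\<^sup>2 < x\<^sup>2" using a by (intro power_strict_mono) auto
    then have a2: "a\<^sup>2 < 2 * \<beta>" using b by (simp add: x_def)
    have c: "KK \<beta> a s (- \<i>) = cnj (KK \<beta> a s \<i>)" for s
      using KK_cnj[OF b less_imp_le[OF a(1)] less_imp_le[OF a2] i_in_res_set(1)] by simp
    have k: "kap \<beta> s X1 (of_real a) = of_real a * KK \<beta> a s \<i>" "kap \<beta> s X2 (of_real a) = of_real a * cnj (KK \<beta> a s \<i>)" for s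
      using KX_eq_kap[OF nz(1), of a \<beta> s] KX_eq_kap[OF nz(2), of a \<beta> s] a c[of s] by (auto simp: KK_def X1_def X2_def)
    have kx: "kap \<beta> s (of_real x) (of_real a) = of_real a * of_real (KR \<beta> a s x)" for s
      using KX_eq_kap[of "of_real x" a \<beta> s] KX_of_real[of a x \<beta> s] a x by simp
    have R: "Rk s (of_real a) = of_real (a * Re (KK \<beta> a s \<i>))" "Ik s (of_real a) = of_real (a * Im (KK \<beta> a s \<i>))" for s
      unfolding Rk_def Ik_def k by (simp_all add: complex_eq_iff)
    have P: "P s (of_real a) = of_real (a * FS \<beta> \<Gamma> s (- \<beta>) a)" for s
      unfolding P_def kx R FS_def shift_def x(2) by (simp add: algebra_simps)
    show ?thesis
      unfolding D_def P R by (simp add: coupling_def power2_eq_square algebra_simps)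
  qed
  have "D (of_real \<alpha>) = 0"
  proof (rule analytic_continuation[OF hol, where U = "{a \<in> star_dom A. D a = 0}" and \<xi> = 0])
    show "0 islimpt {a \<in> star_dom A. D a = 0}"
      unfolding islimpt_approachable
    proof (intro allI impI)
      fix e :: real assume "e > 0"
      then obtain a where a: "0 < a" "a < e" "a < x" "FS \<beta> \<Gamma> 1 (- \<beta>) a * FS \<beta> \<Gamma> 2 (- \<beta>) a = coupling \<beta> a \<Gamma>"
        using freq[of e] by (auto simp: x_def)
      show "\<exists>x'\<in>{a \<in> star_dom A. D a = 0}. x' \<noteq> 0 \<and> dist x' 0 < e"
        by (rule bexI[of _ "of_real a"]) (use a mem[of a] val[of a] in auto)
    qed
  qed (use star_dom_props[OF A] mem[of \<alpha>] al in \<open>auto simp: x_def\<close>)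
  then have "complex_of_real (\<alpha>\<^sup>2 * (FS \<beta> \<Gamma> 1 (- \<beta>) \<alpha> * FS \<beta> \<Gamma> 2 (- \<beta>) \<alpha> - coupling \<beta> \<alpha> \<Gamma>)) = 0"
    using val[of \<alpha>] al by (simp only: x_def)
  then show ?thesis unfolding of_real_eq_0_iff using al by simp
qed

text \<open>For nonreal z the number X is not real, so \<alpha> / X never reaches the cut. In
  particular \<open>shift\<close> and \<open>coupling\<close> are differentiable at \<alpha> = sqrt
  (2 \<beta>), and only the terms taken at the threshold are singular there.\<close>

lemma KK_vector_differentiable:
  assumes "Im z \<noteq> 0" "\<alpha> > 0"
  shows "\<exists>D. ((\<lambda>a. KK \<beta> a s z) has_vector_derivative D) (at \<alpha>)"
proof -
  define X where "X = X0 \<beta> z"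
  have im: "Im X \<noteq> 0"
    unfolding X_def using assms(1) Im_X0_neg[of z \<beta>] Im_X0_pos[of z \<beta>] by (cases "Im z > 0") auto
  then have X: "X \<noteq> 0" by auto
  have A: "finite {X}" "0 \<notin> {X}" using X by auto
  have mem: "of_real \<alpha> \<in> star_dom {X}"
    using of_real_div_in_cut_dom[OF im] by (simp add: star_dom_def)
  have "kap \<beta> s X holomorphic_on star_dom {X}" by (rule kap_holomorphic[OF _ A(2)]) simp
  then have "kap \<beta> s X field_differentiable at (of_real \<alpha>)"
    using holomorphic_on_imp_differentiable_at star_dom_props(1)[OF A] mem by blast
  then have "(\<lambda>a. kap \<beta> s X a / a) field_differentiable at (of_real \<alpha>)"
    using assms(2) by (intro derivative_intros) auto
  then obtain D where "((\<lambda>a. kap \<beta> s X a / a) has_field_derivative D) (at (of_real \<alpha>))"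
    by (auto simp: field_differentiable_def)
  then have "((\<lambda>a. kap \<beta> s X (of_real a) / of_real a) has_vector_derivative D) (at \<alpha>)"
    by (rule has_vector_derivative_real_field)
  then have "((\<lambda>a. KK \<beta> a s z) has_vector_derivative D) (at \<alpha>)"
  proof (rule has_vector_derivative_transform_within_open)
    show "kap \<beta> s X (of_real a) / of_real a = KK \<beta> a s z" if "a \<in> {0<..}" for a
      using KX_eq_kap[OF X, of a \<beta> s] that by (simp add: KK_def X_def field_simps)
  qed (use assms in auto)
  then show ?thesis by blast
qed

lemma Re_Im_KK_differentiable:
  assumes "\<alpha> > 0"
  shows "(\<lambda>a. Re (KK \<beta> a s \<i>)) differentiable (at \<alpha>)" "(\<lambda>a. Im (KK \<beta> a s \<i>)) differentiable (at \<alpha>)"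
proof -
  obtain D where D: "((\<lambda>a. KK \<beta> a s \<i>) has_vector_derivative D) (at \<alpha>)"
    using KK_vector_differentiable[of \<i> \<alpha> \<beta> s] assms by auto
  show "(\<lambda>a. Re (KK \<beta> a s \<i>)) differentiable (at \<alpha>)" "(\<lambda>a. Im (KK \<beta> a s \<i>)) differentiable (at \<alpha>)"
    using bounded_linear.has_vector_derivative[OF bounded_linear_Re D]
      bounded_linear.has_vector_derivative[OF bounded_linear_Im D]
    by (auto simp: has_vector_derivative_def differentiable_def)
qed

lemma shift_differentiable:
  assumes "\<alpha> > 0" shows "(\<lambda>a. shift \<beta> a \<Gamma> s) differentiable (at \<alpha>)"
  unfolding shift_def using Re_Im_KK_differentiable[OF assms] by (intro derivative_intros) auto

lemma coupling_differentiable: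
  assumes "\<alpha> > 0" shows "(\<lambda>a. coupling \<beta> a \<Gamma>) differentiable (at \<alpha>)"
  unfolding coupling_def using Re_Im_KK_differentiable[OF assms] by (intro derivative_intros) auto

lemma left_difference_quotient:
  fixes f :: "real \<Rightarrow> real"
  assumes "f differentiable (at x)"
  obtains d where "((\<lambda>t. (f (x - t) - f x) / t) \<longlongrightarrow> d) (at_right 0)" "((\<lambda>t. f (x - t)) \<longlongrightarrow> f x) (at_right 0)"
proof -
  obtain d where d: "(f has_real_derivative d) (at x)"
    using assms by (auto simp: real_differentiable_def)
  have "((\<lambda>t. f (x - t)) has_real_derivative - d) (at 0)"
    by (rule DERIV_chain2[where g = "\<lambda>t. x - t", THEN DERIV_cong]) (use d in \<open>auto intro!: derivative_eq_intros\<close>)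
  then have 1: "((\<lambda>t. (f (x - t) - f x) / t) \<longlongrightarrow> - d) (at 0)"
    by (simp add: DERIV_def)
  have "isCont (\<lambda>t. f (x - t)) 0"
    using \<open>((\<lambda>t. f (x - t)) has_real_derivative - d) (at 0)\<close> by (rule DERIV_isCont)
  then have 2: "((\<lambda>t. f (x - t)) \<longlongrightarrow> f x) (at 0)" by (simp add: isCont_def)
  show thesis
    by (rule that[of "- d"]) (use 1 2 in \<open>auto intro: filterlim_at_split[THEN iffD1, THEN conjunct2]\<close>)
qed

text \<open>Put \<alpha> = x - t with x = sqrt (2 \<beta>), and let t decrease to 0; the logarithm
  \<open>L t\<close> tends to infinity. F2 is of order L, F1 is a constant plus a term of order t L,
  and their product has a difference quotient that converges. The first two force the constant in F1
  to vanish, and then the product behaves like -x t L^2, whose quotient by t is unbounded.\<close>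

lemma secular_identity_impossible:
  fixes \<Gamma> :: "complex^2^2"
  assumes b: "\<beta> > 0"
    and H: "\<And>\<alpha>. 0 < \<alpha> \<Longrightarrow> \<alpha> < sqrt (2 * \<beta>) \<Longrightarrow>
       FS \<beta> \<Gamma> 1 (- \<beta>) \<alpha> * FS \<beta> \<Gamma> 2 (- \<beta>) \<alpha> = coupling \<beta> \<alpha> \<Gamma>"
  shows False
proof -
  define x where "x = sqrt (2 * \<beta>)"
  have x: "x > 0" "xr \<beta> (- \<beta>) = x" "\<beta> = x\<^sup>2 / 2" using b by (simp_all add: x_def xr_def)
  define L where "L t = ln ((2 * x - t) / t)" for t
  have L: "filterlim L at_top (at_right 0)" "((\<lambda>t. t * L t) \<longlongrightarrow> 0) (at_right 0)" "((\<lambda>t. t * (L t)\<^sup>2) \<longlongrightarrow> 0) (at_right 0)"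
    unfolding L_def using x(1) by real_asymp+
  have ev: "eventually (\<lambda>t. 0 < t \<and> t < x \<and> L t > 0) (at_right 0)"
  proof -
    have "eventually (\<lambda>t. 0 < t \<and> t < x) (at_right 0)"
      using x(1) by (auto simp: eventually_at_right_field intro: exI[of _ x])
    moreover have "eventually (\<lambda>t. L t > 0) (at_right 0)"
      using L(1) by (simp add: filterlim_at_top_dense)
    ultimately show ?thesis by eventually_elim auto
  qed
  define p1 p2 g where "p1 a = shift \<beta> a \<Gamma> 1" and "p2 a = shift \<beta> a \<Gamma> 2" and "g a = coupling \<beta> a \<Gamma>" for a
  obtain d1 where p1: "((\<lambda>t. (p1 (x - t) - p1 x) / t) \<longlongrightarrow> d1) (at_right 0)" "((\<lambda>t. p1 (x - t)) \<longlongrightarrow> p1 x) (at_right 0)"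
    using left_difference_quotient[OF shift_differentiable[OF x(1), of \<beta> \<Gamma> 1]] unfolding p1_def by blast
  have p2: "((\<lambda>t. p2 (x - t)) \<longlongrightarrow> p2 x) (at_right 0)"
    using left_difference_quotient[OF shift_differentiable[OF x(1), of \<beta> \<Gamma> 2]] unfolding p2_def by blast
  obtain dg where g: "((\<lambda>t. (g (x - t) - g x) / t) \<longlongrightarrow> dg) (at_right 0)" "((\<lambda>t. g (x - t)) \<longlongrightarrow> g x) (at_right 0)"
    using left_difference_quotient[OF coupling_differentiable[OF x(1), of \<beta> \<Gamma>]] unfolding g_def by blast
  define F1 F2 where "F1 t = FS \<beta> \<Gamma> 1 (- \<beta>) (x - t)" and "F2 t = FS \<beta> \<Gamma> 2 (- \<beta>) (x - t)" for t
  \<comment> \<open>With \<beta> = x^2/2 the prefactor \<beta> - \<alpha>^2/2 of the logarithm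
    contains the factor x - \<alpha> = t for spin +. For spin - the prefactor tends to a nonzero
    limit, so the logarithm survives undamped.\<close>
  have F1: "F1 t = x + (2 * x - t) / (2 * (x - t)) * (t * L t) + p1 (x - t)" if "0 < t" "t < x" for t
    using that unfolding F1_def FS_def KR_def TR_def x(2) L_def p1_def
    by (simp add: spin_def x(3)) (simp add: power2_eq_square field_simps)
  have F2: "F2 t = x - (x\<^sup>2 + (x - t)\<^sup>2) / (2 * (x - t)) * L t + p2 (x - t)" if "0 < t" "t < x" for t
    using that unfolding F2_def FS_def KR_def TR_def x(2) L_def p2_def
    by (simp add: spin_def x(3)) (simp add: power2_eq_square field_simps)
  have FF: "F1 t * F2 t = g (x - t)" if "0 < t" "t < x" for t
    using H[of "x - t"] that by (simp add: F1_def F2_def g_def x_def)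
  have invL: "((\<lambda>t. c t / L t) \<longlongrightarrow> 0) (at_right 0)" if "(c \<longlongrightarrow> l) (at_right 0)" for c l
    by (rule tendsto_divide_0[OF that]) (rule filterlim_at_top_imp_at_infinity[OF L(1)])
  have F2L: "((\<lambda>t. F2 t / L t) \<longlongrightarrow> - x) (at_right 0)"
  proof -
    have "((\<lambda>t. (x\<^sup>2 + (x - t)\<^sup>2) / (2 * (x - t))) \<longlongrightarrow> x) (at_right 0)"
      using x(1) by real_asymp (simp add: power2_eq_square)
    then have "((\<lambda>t. (x + p2 (x - t)) / L t - (x\<^sup>2 + (x - t)\<^sup>2) / (2 * (x - t))) \<longlongrightarrow> 0 - x) (at_right 0)"
      by (intro tendsto_diff invL[OF tendsto_add[OF tendsto_const p2]])
    moreover have "eventually (\<lambda>t. (x + p2 (x - t)) / L t - (x\<^sup>2 + (x - t)\<^sup>2) / (2 * (x - t)) = F2 t / L t) (at_right 0)"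
      using ev by eventually_elim (simp add: F2 diff_divide_distrib add_divide_distrib)
    ultimately show ?thesis by (simp add: filterlim_cong)
  qed
  have k: "((\<lambda>t. (2 * x - t) / (2 * (x - t))) \<longlongrightarrow> 1) (at_right 0)"
    using x(1) by real_asymp
  have F1l: "(F1 \<longlongrightarrow> x + p1 x) (at_right 0)"
  proof -
    have "((\<lambda>t. x + (2 * x - t) / (2 * (x - t)) * (t * L t) + p1 (x - t)) \<longlongrightarrow> x + 1 * 0 + p1 x) (at_right 0)"
      by (intro tendsto_intros k L p1)
    moreover have "eventually (\<lambda>t. x + (2 * x - t) / (2 * (x - t)) * (t * L t) + p1 (x - t) = F1 t) (at_right 0)"
      using ev by eventually_elim (simp add: F1)
    ultimately show ?thesis by (simp add: filterlim_cong)
  qed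
  \<comment> \<open>F2 diverges like -x L while the product converges, so the limit of F1 must be
    0.\<close>
  have c0: "x + p1 x = 0"
  proof -
    have "((\<lambda>t. F1 t * (F2 t / L t)) \<longlongrightarrow> (x + p1 x) * (- x)) (at_right 0)"
      by (intro tendsto_intros F1l F2L)
    moreover have "eventually (\<lambda>t. F1 t * (F2 t / L t) = g (x - t) / L t) (at_right 0)"
      using ev by eventually_elim (simp add: FF)
    ultimately have "((\<lambda>t. g (x - t) / L t) \<longlongrightarrow> (x + p1 x) * (- x)) (at_right 0)"
      by (rule Lim_transform_eventually)
    from tendsto_unique[OF _ this invL[OF g(2)]] x(1) show ?thesis by simp
  qed
  \<comment> \<open>The constant has dropped out and p1 contributes only order t, so t L is the
    leading term.\<close>
  have F1L: "((\<lambda>t. F1 t / (t * L t)) \<longlongrightarrow> 1) (at_right 0)"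
  proof -
    have "((\<lambda>t. (2 * x - t) / (2 * (x - t)) + ((p1 (x - t) - p1 x) / t) / L t) \<longlongrightarrow> 1 + 0) (at_right 0)"
      by (intro tendsto_intros k invL[OF p1(1)])
    moreover have "eventually (\<lambda>t. (2 * x - t) / (2 * (x - t)) + ((p1 (x - t) - p1 x) / t) / L t = F1 t / (t * L t)) (at_right 0)"
      using ev
    proof eventually_elim
      case (elim t)
      have "F1 t = (2 * x - t) / (2 * (x - t)) * (t * L t) + (p1 (x - t) - p1 x)"
        using elim c0 by (simp add: F1)
      then show ?case using elim by (simp add: add_divide_distrib)
    qed
    ultimately show ?thesis by (simp add: filterlim_cong)
  qed
  have lim: "((\<lambda>t. (F1 t / (t * L t)) * (F2 t / L t)) \<longlongrightarrow> 1 * (- x)) (at_right 0)"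
    by (intro tendsto_intros F1L F2L)
  \<comment> \<open>The product is of order t L^2, which tends to 0.\<close>
  have gx: "g x = 0"
  proof -
    have "((\<lambda>t. ((F1 t / (t * L t)) * (F2 t / L t)) * (t * (L t)\<^sup>2)) \<longlongrightarrow> (1 * (- x)) * 0) (at_right 0)"
      by (intro tendsto_mult[OF lim] L)
    moreover have "eventually (\<lambda>t. ((F1 t / (t * L t)) * (F2 t / L t)) * (t * (L t)\<^sup>2) = g (x - t)) (at_right 0)"
      using ev by eventually_elim (simp add: FF[symmetric] power2_eq_square)
    ultimately have "((\<lambda>t. g (x - t)) \<longlongrightarrow> (1 * (- x)) * 0) (at_right 0)"
      by (rule Lim_transform_eventually)
    from tendsto_unique[OF _ this g(2)] show ?thesis by simp
  qed
  \<comment> \<open>The difference quotient of g converges, so division by L^2 gives 0; by the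
    asymptotics of F1 and F2 the same expression tends to -x.\<close>
  have "((\<lambda>t. ((g (x - t) - g x) / t) / L t / L t) \<longlongrightarrow> 0) (at_right 0)"
    by (rule invL[OF invL[OF g(1)]])
  moreover have "eventually (\<lambda>t. (F1 t / (t * L t)) * (F2 t / L t) = ((g (x - t) - g x) / t) / L t / L t) (at_right 0)"
    using ev by eventually_elim (simp add: FF[symmetric] gx)
  then have "((\<lambda>t. ((g (x - t) - g x) / t) / L t / L t) \<longlongrightarrow> 1 * (- x)) (at_right 0)"
    by (rule Lim_transform_eventually[OF lim])
  ultimately have "1 * (- x) = 0"
    by (intro tendsto_unique[of "at_right 0"]) auto
  then show False using x(1) by simp
qed

lemma threshold_eventually_notin_singular_spectrum:
  assumes b: "\<beta> > 0" and h: "hermitian_mat \<Gamma>"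
  shows "\<exists>\<alpha>0\<in>{0<..sqrt (2 * \<beta>)}. \<forall>\<alpha>\<in>{0<..<\<alpha>0}. - \<beta> \<notin> singular_spectrum \<beta> \<alpha> \<Gamma>"
proof (rule ccontr)
  assume neg: "\<not> ?thesis"
  have freq: "\<exists>\<alpha>. 0 < \<alpha> \<and> \<alpha> < \<delta> \<and> \<alpha> < sqrt (2 * \<beta>) \<and>
      FS \<beta> \<Gamma> 1 (- \<beta>) \<alpha> * FS \<beta> \<Gamma> 2 (- \<beta>) \<alpha> = coupling \<beta> \<alpha> \<Gamma>" if d: "\<delta> > 0" for \<delta>
  proof -
    have "min \<delta> (sqrt (2 * \<beta>)) \<in> {0<..sqrt (2 * \<beta>)}" using d b by auto
    then obtain \<alpha> where a: "\<alpha> \<in> {0<..<min \<delta> (sqrt (2 * \<beta>))}" "- \<beta> \<in> singular_spectrum \<beta> \<alpha> \<Gamma>"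
      using neg by blast
    have "\<alpha>\<^sup>2 < (sqrt (2 * \<beta>))\<^sup>2" using a by (intro power_strict_mono) auto
    then have "\<alpha>\<^sup>2 < 2 * \<beta>" using b by simp
    then show ?thesis
      using singular_spectrum_iff[OF b _ _ h order_refl, of \<alpha>] a by auto
  qed
  from secular_threshold_identity[OF b freq] show False
    by (intro secular_identity_impossible[OF b]) auto
qed

section \<open>Expansion in powers of the coupling parameter\<close>

text \<open>The remainder has derivative 2 v^4/(1 - v^2), and |1 - v^2| \<ge> 3/4 for |v| \<le> 1/2;
  the constant is 2/(3/4).\<close>

lemma LL_taylor:
  assumes "cmod w \<le> 1 / 2"
  shows "cmod (LL w - (2 * w + 2 * w ^ 3 / 3)) \<le> 8 / 3 * cmod w ^ 5"
proof -
  define f where "f v = LL v - (2 * v + 2 * v ^ 3 / 3)" for v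
  have dom: "v \<in> cut_dom" if "cmod v \<le> 1 / 2" for v
    using that abs_Re_le_cmod[of v] by (auto simp: cut_dom_def)
  have "cmod (f w - f 0) \<le> (8 / 3 * cmod w ^ 4) * cmod (w - 0)"
  proof (rule field_differentiable_bound[where S = "cball 0 (cmod w)"])
    fix v assume "v \<in> cball (0::complex) (cmod w)"
    then have v: "cmod v \<le> cmod w" by simp
    then have v2: "cmod v \<le> 1 / 2" using assms by simp
    have "(cmod v)\<^sup>2 \<le> (1 / 2)\<^sup>2" using v2 by (intro power_mono) auto
    then have v3: "cmod (v\<^sup>2) \<le> 1 / 4" by (simp add: norm_power power_divide)
    have n1: "cmod (1 - v\<^sup>2) \<ge> 3 / 4" using norm_triangle_ineq2[of 1 "v\<^sup>2"] v3 by simp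
    then have nz: "1 - v\<^sup>2 \<noteq> 0" by auto
    have "(f has_field_derivative 2 / (1 - v\<^sup>2) - (2 * 1 + 2 * (of_nat 3 * (1 * v ^ (3 - Suc 0))) / 3)) (at v)"
      unfolding f_def[abs_def]
      by (intro DERIV_diff DERIV_add DERIV_cmult DERIV_cdivide DERIV_power DERIV_ident has_field_derivative_LL dom v2)
    also have "2 / (1 - v\<^sup>2) - (2 * 1 + 2 * (of_nat 3 * (1 * v ^ (3 - Suc 0))) / 3) = 2 * v ^ 4 / (1 - v\<^sup>2)"
      using nz by (simp add: divide_simps) (simp add: algebra_simps power2_eq_square power4_eq_xxxx)
    finally show "(f has_field_derivative 2 * v ^ 4 / (1 - v\<^sup>2)) (at v within cball 0 (cmod w))"
      by (rule has_field_derivative_at_within)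
    have "cmod (2 * v ^ 4 / (1 - v\<^sup>2)) = 2 * cmod v ^ 4 / cmod (1 - v\<^sup>2)"
      by (simp add: norm_divide norm_mult norm_power)
    also have "\<dots> \<le> 2 * cmod w ^ 4 / (3 / 4)"
      using n1 v by (intro frac_le mult_left_mono power_mono) auto
    finally show "cmod (2 * v ^ 4 / (1 - v\<^sup>2)) \<le> 8 / 3 * cmod w ^ 4" by simp
  qed auto
  then show ?thesis by (simp add: f_def LL_def power_numeral_reduce mult.assoc)
qed

text \<open>The coefficient of \<alpha>^2 in \<open>KX\<close>. Its first term comes from the cubic
  term of artanh, its second from the part -\<alpha>^2/2 of the prefactor times 2/X.\<close>

definition K1 :: "real \<Rightarrow> 2 \<Rightarrow> complex \<Rightarrow> complex" where
  "K1 \<beta> s X = of_real (2 * spin s * \<beta>) / (3 * X ^ 3) - 1 / X"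

lemma Th_expansion:
  assumes "m > 0" "cmod X \<ge> m" "0 < \<alpha>" "\<alpha> \<le> m / 2"
  shows "cmod (Th \<alpha> X - 2 / X - of_real (\<alpha>\<^sup>2) * (2 / (3 * X ^ 3))) \<le> (8 / (3 * m ^ 5)) * \<alpha> ^ 4"
proof -
  have X: "X \<noteq> 0" using assms by auto
  define w where "w = of_real \<alpha> / X"
  have w: "cmod w \<le> \<alpha> / m" unfolding w_def using assms by (simp add: norm_divide frac_le)
  also have "\<alpha> / m \<le> 1 / 2" using assms by (simp add: field_simps)
  finally have w2: "cmod w \<le> 1 / 2" .
  have "Th \<alpha> X - 2 / X - of_real (\<alpha>\<^sup>2) * (2 / (3 * X ^ 3)) = (LL w - (2 * w + 2 * w ^ 3 / 3)) / of_real \<alpha>"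
    using X assms(3) unfolding Th_eq_LL[OF X less_imp_neq[OF assms(3), symmetric]] w_def[symmetric]
    by (simp add: w_def diff_divide_distrib add_divide_distrib power_divide power2_eq_square power3_eq_cube mult_ac)
  then have "cmod (Th \<alpha> X - 2 / X - of_real (\<alpha>\<^sup>2) * (2 / (3 * X ^ 3))) = cmod (LL w - (2 * w + 2 * w ^ 3 / 3)) / \<alpha>"
    using assms by (simp add: norm_divide)
  also have "\<dots> \<le> 8 / 3 * cmod w ^ 5 / \<alpha>"
    using assms by (intro divide_right_mono LL_taylor w2) auto
  also have "\<dots> \<le> 8 / 3 * (\<alpha> / m) ^ 5 / \<alpha>"
    using w assms by (intro divide_right_mono mult_left_mono power_mono) auto
  also have "\<dots> = (8 / (3 * m ^ 5)) * \<alpha> ^ 4"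
    using assms by (simp add: field_simps power_numeral_reduce)
  finally show ?thesis .
qed

text \<open>The constant depends on X only through a lower bound for |X|. So one expansion serves
  the fixed point X0(\<i>) and, uniformly, all E \<le> -\<beta>, where X \<ge> sqrt (2
  \<beta>).\<close>

lemma KX_expansion:
  assumes "\<beta> > 0" "m > 0"
  obtains C where "C \<ge> 0" "\<And>X \<alpha>. cmod X \<ge> m \<Longrightarrow> 0 < \<alpha> \<Longrightarrow> \<alpha> \<le> m / 2 \<Longrightarrow>
     cmod (KX \<beta> \<alpha> s X - KX \<beta> 0 s X - of_real (\<alpha>\<^sup>2) * K1 \<beta> s X) \<le> C * \<alpha> ^ 4"
proof -
  define c where "c = 8 / (3 * m ^ 5)"
  define C where "C = (\<beta> + m\<^sup>2 / 8) * c + 1 / (3 * m ^ 3)"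
  have c: "c > 0" using assms by (simp add: c_def)
  have "cmod (KX \<beta> \<alpha> s X - KX \<beta> 0 s X - of_real (\<alpha>\<^sup>2) * K1 \<beta> s X) \<le> C * \<alpha> ^ 4"
    if X: "cmod X \<ge> m" and a: "0 < \<alpha>" "\<alpha> \<le> m / 2" for X \<alpha>
  proof -
    have X0: "X \<noteq> 0" using X assms by auto
    define r where "r = Th \<alpha> X - 2 / X - of_real (\<alpha>\<^sup>2) * (2 / (3 * X ^ 3))"
    have r: "cmod r \<le> c * \<alpha> ^ 4"
      unfolding r_def c_def by (rule Th_expansion[OF assms(2) X a])
    have T: "Th \<alpha> X = 2 / X + of_real (\<alpha>\<^sup>2) * (2 / (3 * X ^ 3)) + r" by (simp add: r_def)
    have "KX \<beta> \<alpha> s X - KX \<beta> 0 s X - of_real (\<alpha>\<^sup>2) * K1 \<beta> s X =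
        of_real (spin s * \<beta> - \<alpha>\<^sup>2 / 2) * r - of_real (\<alpha> ^ 4) / (3 * X ^ 3)"
      unfolding KX_def T K1_def using X0
      by (simp add: Th_def) (simp add: field_simps power_numeral_reduce)
    also have "cmod \<dots> \<le> \<bar>spin s * \<beta> - \<alpha>\<^sup>2 / 2\<bar> * cmod r + \<alpha> ^ 4 / (3 * cmod X ^ 3)"
      using norm_triangle_ineq4[of "of_real (spin s * \<beta> - \<alpha>\<^sup>2 / 2) * r" "of_real (\<alpha> ^ 4) / (3 * X ^ 3)"]
      by (simp only: norm_mult norm_divide norm_of_real norm_power norm_numeral) (simp add: norm_power)
    also have "\<dots> \<le> (\<beta> + m\<^sup>2 / 8) * (c * \<alpha> ^ 4) + \<alpha> ^ 4 / (3 * m ^ 3)"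
    proof (intro add_mono mult_mono frac_le mult_left_mono power_mono)
      have "\<alpha>\<^sup>2 \<le> (m / 2)\<^sup>2" using a by (intro power_mono) auto
      then have "\<alpha>\<^sup>2 / 2 \<le> m\<^sup>2 / 8" by (simp add: power2_eq_square)
      moreover have "\<bar>spin s * \<beta>\<bar> = \<beta>" using assms(1) by (simp add: spin_def)
      ultimately show "\<bar>spin s * \<beta> - \<alpha>\<^sup>2 / 2\<bar> \<le> \<beta> + m\<^sup>2 / 8"
        using abs_triangle_ineq4[of "spin s * \<beta>" "\<alpha>\<^sup>2 / 2"] by simp
    qed (use r X assms a in auto)
    also have "\<dots> = C * \<alpha> ^ 4" by (simp add: C_def algebra_simps)
    finally show ?thesis .
  qed
  moreover have "C \<ge> 0" unfolding C_def using assms c by simp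
  ultimately show thesis using that by blast
qed

section \<open>Closed forms of the coefficients at z = \<i>\<close>

lemma KX_0: "KX \<beta> 0 s X = X + of_real (2 * spin s * \<beta>) / X"
  by (simp add: KX_def Th_def)

text \<open>The root of s \<beta> - \<i> is \<open>pp\<close> of s minus \<i> times
  \<open>pp\<close> of the flipped spin; the two values of \<open>pp\<close> have product 1/2.
  \<open>sg\<close> and \<open>dl\<close> are their sum and difference, with product \<beta>, and
  X0(\<i>) = sg (1 - \<i>). In these quantities the nested radicals of the coefficients become
  rational expressions, up to one square root in \<open>N0\<close>.\<close>

definition cc :: "real \<Rightarrow> real" where "cc \<beta> = sqrt (1 + \<beta>\<^sup>2)"
definition pp :: "real \<Rightarrow> 2 \<Rightarrow> real" where "pp \<beta> s = sqrt ((cc \<beta> + spin s * \<beta>) / 2)"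
definition sg :: "real \<Rightarrow> real" where "sg \<beta> = sqrt (cc \<beta> + 1)"
definition dl :: "real \<Rightarrow> real" where "dl \<beta> = sqrt (cc \<beta> - 1)"

context
  fixes \<beta> :: real
  assumes b: "\<beta> > 0"
begin

lemma cc_gt: "cc \<beta> > 1" "cc \<beta> > \<beta>"
  unfolding cc_def using b by (auto intro!: real_less_rsqrt)

lemma pp_pos: "pp \<beta> s > 0"
  unfolding pp_def using cc_gt b by (simp add: spin_def)

lemma pp_sq: "(pp \<beta> s)\<^sup>2 = (cc \<beta> + spin s * \<beta>) / 2"
  unfolding pp_def using cc_gt b by (simp add: spin_def)

lemma pp_mult: "pp \<beta> 1 * pp \<beta> 2 = 1 / 2"
proof -
  have "(pp \<beta> 1 * pp \<beta> 2)\<^sup>2 = ((cc \<beta>)\<^sup>2 - \<beta>\<^sup>2) / 4"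
    by (simp add: power_mult_distrib pp_sq spin_def) (simp add: power2_eq_square algebra_simps)
  also have "\<dots> = (1 / 2)\<^sup>2" using b by (simp add: cc_def power2_eq_square)
  finally show ?thesis using pp_pos[of 1] pp_pos[of 2] 
    by (metis mult_pos_pos less_imp_le power2_eq_iff_nonneg zero_le_divide_1_iff zero_le_numeral)
qed

lemma sg_eq: "sg \<beta> = pp \<beta> 1 + pp \<beta> 2" and dl_eq: "dl \<beta> = pp \<beta> 1 - pp \<beta> 2"
proof -
  have e: "(pp \<beta> 1)\<^sup>2 + (pp \<beta> 2)\<^sup>2 = cc \<beta>"
    unfolding pp_sq by (simp add: spin_def add_divide_distrib[symmetric])
  have "(pp \<beta> 1 + pp \<beta> 2)\<^sup>2 = ((pp \<beta> 1)\<^sup>2 + (pp \<beta> 2)\<^sup>2) + 2 * (pp \<beta> 1 * pp \<beta> 2)"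
    "(pp \<beta> 1 - pp \<beta> 2)\<^sup>2 = ((pp \<beta> 1)\<^sup>2 + (pp \<beta> 2)\<^sup>2) - 2 * (pp \<beta> 1 * pp \<beta> 2)"
    by (simp_all add: power2_eq_square algebra_simps)
  then have sq: "(pp \<beta> 1 + pp \<beta> 2)\<^sup>2 = cc \<beta> + 1" "(pp \<beta> 1 - pp \<beta> 2)\<^sup>2 = cc \<beta> - 1"
    unfolding e pp_mult by simp_all
  have le: "pp \<beta> 2 \<le> pp \<beta> 1" unfolding pp_def using b by (simp add: spin_def)
  show "sg \<beta> = pp \<beta> 1 + pp \<beta> 2"
    unfolding sg_def by (rule real_sqrt_unique[OF sq(1)]) (use pp_pos[of 1] pp_pos[of 2] in simp)
  show "dl \<beta> = pp \<beta> 1 - pp \<beta> 2"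
    unfolding dl_def by (rule real_sqrt_unique[OF sq(2)]) (use le in simp)
qed

lemma sg_dl: "sg \<beta> > 0" "dl \<beta> > 0" "sg \<beta> * dl \<beta> = \<beta>" "(sg \<beta>)\<^sup>2 = cc \<beta> + 1" "(dl \<beta>)\<^sup>2 = cc \<beta> - 1"
proof -
  show "sg \<beta> > 0" "dl \<beta> > 0" "(sg \<beta>)\<^sup>2 = cc \<beta> + 1" "(dl \<beta>)\<^sup>2 = cc \<beta> - 1" using cc_gt by (simp_all add: sg_def dl_def)
  have "sg \<beta> * dl \<beta> = (pp \<beta> 1)\<^sup>2 - (pp \<beta> 2)\<^sup>2" by (simp add: sg_eq dl_eq power2_eq_square algebra_simps)
  then show "sg \<beta> * dl \<beta> = \<beta>" by (simp add: pp_sq spin_def field_simps)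
qed

lemma spin_beta: "spin s * \<beta> = spin s * dl \<beta> * sg \<beta>"
  using sg_dl(3) by (simp add: mult.commute)

lemma csqrt_spin:
  "csqrt (of_real (spin s * \<beta>) - \<i>) = Complex (pp \<beta> s) (- pp \<beta> (flip s))"
proof (rule csqrt_unique)
  have "pp \<beta> s * pp \<beta> (flip s) = 1 / 2"
    using pp_mult exhaust_2[of s] by (auto simp: flip_def mult.commute)
  then show "(Complex (pp \<beta> s) (- pp \<beta> (flip s)))\<^sup>2 = of_real (spin s * \<beta>) - \<i>"
    using pp_sq[of s] pp_sq[of "flip s"] exhaust_2[of s]
    by (auto simp: complex_eq_iff power2_eq_square spin_def flip_def mult.commute)
qed (use pp_pos in auto)

lemma X0_i: "X0 \<beta> \<i> = of_real (sg \<beta>) * (1 - \<i>)"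
  using csqrt_spin[of 1] csqrt_spin[of 2]
  by (simp add: X0_def spin_def flip_def complex_eq_iff sg_eq del: csqrt.sel)

lemma KK_0_i: "KK \<beta> 0 s \<i> = 2 * Complex (pp \<beta> s) (- pp \<beta> (flip s))"
proof -
  have X: "X0 \<beta> \<i> \<noteq> 0" using X0_i sg_dl by (simp add: complex_eq_iff)
  have "2 * of_real (spin s * \<beta>) / X0 \<beta> \<i> = of_real (spin s * dl \<beta>) * (1 + \<i>)"
  proof -
    have "of_real (spin s * dl \<beta>) * (1 + \<i>) * X0 \<beta> \<i> = 2 * of_real (spin s * \<beta>)"
      unfolding X0_i spin_beta by (simp add: complex_eq_iff)
    then show ?thesis using X by (simp add: field_simps)
  qed
  then show ?thesis
    unfolding KK_def KX_0 unfolding X0_i sg_eq dl_eq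
    using exhaust_2[of s] by (auto simp: complex_eq_iff spin_def flip_def)
qed

lemma K1_i: "K1 \<beta> s (X0 \<beta> \<i>) = 
   Complex (- (spin s * dl \<beta> / (6 * (sg \<beta>)\<^sup>2)) - 1 / (2 * sg \<beta>)) (spin s * dl \<beta> / (6 * (sg \<beta>)\<^sup>2) - 1 / (2 * sg \<beta>))"
proof -
  have sgnz: "complex_of_real (sg \<beta>) \<noteq> 0" using sg_dl by simp
  have a: "1 / X0 \<beta> \<i> = (1 + \<i>) / (2 * of_real (sg \<beta>))"
  proof -
    have "(1 + \<i>) * (1 - \<i>) = 2" by (simp add: complex_eq_iff)
    then have "(1 + \<i>) / 2 = 1 / (1 - \<i>)" by (subst frac_eq_eq) (auto simp: complex_eq_iff)
    then have "(1 + \<i>) / 2 / of_real (sg \<beta>) = 1 / (1 - \<i>) / of_real (sg \<beta>)" by (simp only:)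
    then show ?thesis unfolding X0_i by (simp add: mult.commute)
  qed
  have "(1 / X0 \<beta> \<i>) ^ 3 = (1 + \<i>) ^ 3 / (2 * of_real (sg \<beta>)) ^ 3"
    unfolding a by (simp add: power_divide)
  also have "(1 + \<i>) ^ 3 = 2 * (\<i> - 1)" by (simp add: power3_eq_cube complex_eq_iff)
  also have "2 * (\<i> - 1) / (2 * of_real (sg \<beta>)) ^ 3 = (\<i> - 1) / (4 * (of_real (sg \<beta>)) ^ 3)"
  proof -
    have "(2 * of_real (sg \<beta>)) ^ 3 = 2 * (4 * complex_of_real (sg \<beta>) ^ 3)"
      by (simp add: power_mult_distrib)
    then show ?thesis by (simp only: mult_divide_mult_cancel_left[OF zero_neq_numeral[symmetric]])
  qed
  finally have c: "1 / X0 \<beta> \<i> ^ 3 = (\<i> - 1) / (4 * (of_real (sg \<beta>)) ^ 3)" by (simp add: power_divide)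
  have "K1 \<beta> s (X0 \<beta> \<i>) = of_real (2 * spin s * \<beta> / 3) * (1 / X0 \<beta> \<i> ^ 3) - 1 / X0 \<beta> \<i>"
    by (simp add: K1_def)
  also have "\<dots> = of_real (2 * spin s * \<beta> / 3) * ((\<i> - 1) / of_real (4 * sg \<beta> ^ 3)) - (1 + \<i>) / of_real (2 * sg \<beta>)"
    unfolding a c by simp
  also have "\<dots> = Complex (- (spin s * \<beta> / (6 * sg \<beta> ^ 3)) - 1 / (2 * sg \<beta>)) (spin s * \<beta> / (6 * sg \<beta> ^ 3) - 1 / (2 * sg \<beta>))"
    by (simp add: complex_eq_iff)
  also have "spin s * \<beta> / (6 * sg \<beta> ^ 3) = spin s * dl \<beta> / (6 * (sg \<beta>)\<^sup>2)"
    using sg_dl(1) unfolding spin_beta by (simp add: power2_eq_square power3_eq_cube)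
  finally show ?thesis .
qed

lemma root4_eq: "y \<ge> 0 \<Longrightarrow> root 4 y = sqrt (sqrt y)"
  using real_root_mult_exp[of 2 2 y] by (simp add: sqrt_def)

lemma root4_cc: "root 4 (cc \<beta> + spin s * \<beta>) = sqrt (sqrt 2 * pp \<beta> s)"
proof -
  have "sqrt (cc \<beta> + spin s * \<beta>) = sqrt 2 * pp \<beta> s"
    unfolding pp_def by (simp add: real_sqrt_mult[symmetric])
  moreover have "cc \<beta> + spin s * \<beta> \<ge> 0" using cc_gt b by (simp add: spin_def)
  ultimately show ?thesis by (simp add: root4_eq)
qed

lemma N0_eq: "N0 \<beta> s = sqrt (8 * pi * pp \<beta> s)"
proof -
  have "N0 \<beta> s = 2 * sqrt (sqrt 2) * sqrt pi * sqrt (sqrt 2 * pp \<beta> s)"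
    using root4_cc[of s] by (simp add: N0_def cc_def root4_eq)
  also have "\<dots> = sqrt (8 * pi * pp \<beta> s)"
  proof (rule real_sqrt_unique[symmetric])
    have "(2 * sqrt (sqrt 2) * sqrt pi * sqrt (sqrt 2 * pp \<beta> s))\<^sup>2 = 4 * sqrt 2 * pi * (sqrt 2 * pp \<beta> s)"
      using pp_pos[of s] by (simp add: power_mult_distrib)
    then show "(2 * sqrt (sqrt 2) * sqrt pi * sqrt (sqrt 2 * pp \<beta> s))\<^sup>2 = 8 * pi * pp \<beta> s" by simp
    show "0 \<le> 2 * sqrt (sqrt 2) * sqrt pi * sqrt (sqrt 2 * pp \<beta> s)" using pp_pos[of s] by simp
  qed
  finally show ?thesis .
qed

lemma N0_pos: "N0 \<beta> s > 0"
  using pp_pos[of s] by (simp add: N0_eq)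

text \<open>By \<open>KK_0_i\<close> the right-hand side is -Im K(\<i>) at \<alpha> = 0. This
  identifies \<open>N0\<close> with the normalisation constant of the unperturbed problem.\<close>

lemma N0_sq: "8 * pi / (N0 \<beta> s)\<^sup>2 = 2 * pp \<beta> (flip s)"
proof -
  have "pp \<beta> s * pp \<beta> (flip s) = 1 / 2"
    using pp_mult exhaust_2[of s] by (auto simp: flip_def mult.commute)
  then show ?thesis
    using pp_pos[of s] by (simp add: N0_eq field_simps)
qed

lemma root4_dl: "root 4 (2 + \<beta>\<^sup>2 - 2 * cc \<beta>) = dl \<beta>"
proof -
  have "2 + \<beta>\<^sup>2 - 2 * cc \<beta> = (cc \<beta> - 1)\<^sup>2"
    using b by (simp add: cc_def power2_diff)
  then show ?thesis using cc_gt by (simp add: root4_eq dl_def)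
qed

text \<open>In the quotient the fourth roots r and y survive only as r^2 and y^2, where sqrt 2
  cancels, and \<beta> = sg dl removes the apparent pole at \<beta> = 0.\<close>

lemma N1_N0: "N1 \<beta> s / N0 \<beta> s = (3 * sg \<beta> - spin s * dl \<beta>) * pp \<beta> s / (12 * (sg \<beta>)\<^sup>2)"
proof -
  define y where "y = sqrt (sqrt 2 * pp \<beta> s)"
  have y: "y > 0" "y\<^sup>2 = sqrt 2 * pp \<beta> s" using pp_pos[of s] by (simp_all add: y_def)
  define r where "r = sqrt (sqrt (2::real))"
  have r: "r > 0" "r\<^sup>2 = sqrt 2" by (simp_all add: r_def)
  have simplify: "c / (6 * r * (g\<^sup>2 * d\<^sup>2)) * (A * d) * d * y ^ 3 / (2 * r * c * y) = A * y\<^sup>2 / (12 * r\<^sup>2 * g\<^sup>2)"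
    if "g > 0" "d > 0" "y > 0" "r > 0" "c > 0" for g d y r c A :: real
    using that by (simp add: divide_simps power2_eq_square power3_eq_cube)
  have N0: "N0 \<beta> s = 2 * r * sqrt pi * y"
    using root4_cc[of s] by (simp add: N0_def cc_def root4_eq r_def y_def)
  have "N1 \<beta> s = sqrt pi / (6 * r * \<beta>\<^sup>2) * (3 * \<beta> + spin s * (1 - cc \<beta>)) * dl \<beta> * y ^ 3"
    using root4_cc[of s] root4_dl by (simp add: N1_def cc_def root4_eq r_def y_def)
  also have "3 * \<beta> + spin s * (1 - cc \<beta>) = (3 * sg \<beta> - spin s * dl \<beta>) * dl \<beta>"
  proof -
    have "\<beta> = sg \<beta> * dl \<beta>" "cc \<beta> = dl \<beta> * dl \<beta> + 1" using sg_dl(3,5) by (simp_all add: power2_eq_square)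
    then show ?thesis by (simp add: algebra_simps)
  qed
  also have "\<beta>\<^sup>2 = (sg \<beta>)\<^sup>2 * (dl \<beta>)\<^sup>2" using sg_dl(3) by (simp add: power_mult_distrib[symmetric])
  finally have "N1 \<beta> s = sqrt pi / (6 * r * ((sg \<beta>)\<^sup>2 * (dl \<beta>)\<^sup>2)) * ((3 * sg \<beta> - spin s * dl \<beta>) * dl \<beta>) * dl \<beta> * y ^ 3" .
  then have "N1 \<beta> s / N0 \<beta> s = (3 * sg \<beta> - spin s * dl \<beta>) * y\<^sup>2 / (12 * r\<^sup>2 * (sg \<beta>)\<^sup>2)"
    unfolding N0
    using simplify[OF sg_dl(1,2) y(1) r(1), of "sqrt pi" "3 * sg \<beta> - spin s * dl \<beta>"] by simp
  then show ?thesis unfolding y(2) r(2) by simp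
qed

text \<open>With N = N0 - \<alpha>^2 N1 the quantity 8 pi/N^2 changes, to first order in \<alpha>^2,
  by the factor 1 + \<alpha>^2 \<open>eta \<beta> s s\<close>. It equals -Im K(\<i>), so the change
  has to match that of the imaginary part.\<close>

lemma eta_N0_sq: "8 * pi * eta \<beta> s s / (N0 \<beta> s)\<^sup>2 = - Im (K1 \<beta> s (X0 \<beta> \<i>))"
proof -
  have "pp \<beta> s * pp \<beta> (flip s) = 1 / 2"
    using pp_mult exhaust_2[of s] by (auto simp: flip_def mult.commute)
  have "8 * pi * eta \<beta> s s / (N0 \<beta> s)\<^sup>2 = eta \<beta> s s * (8 * pi / (N0 \<beta> s)\<^sup>2)" by simp
  also have "\<dots> = (3 * sg \<beta> - spin s * dl \<beta>) / (3 * (sg \<beta>)\<^sup>2) * (pp \<beta> s * pp \<beta> (flip s))"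
    unfolding N0_sq eta_def N1_N0 by simp
  also have "\<dots> = - Im (K1 \<beta> s (X0 \<beta> \<i>))"
    unfolding \<open>pp \<beta> s * pp \<beta> (flip s) = 1 / 2\<close> K1_i using sg_dl(1)
    by (simp add: field_simps power2_eq_square)
  finally show ?thesis .
qed

lemma Lam0_eq: "8 * pi * Lam0 \<beta> s = - Re (KK \<beta> 0 s \<i>)"
proof -
  have "8 * pi * Lam0 \<beta> s = - (sg \<beta> + spin s * dl \<beta>)"
    by (simp add: Lam0_def cc_def[symmetric] sg_def[symmetric] dl_def[symmetric])
  then show ?thesis
    unfolding KK_0_i using exhaust_2[of s] by (auto simp: sg_eq dl_eq spin_def)
qed

lemma Lam1_eq: "8 * pi * Lam1 \<beta> s = - Re (K1 \<beta> s (X0 \<beta> \<i>))"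
proof -
  have "Lam1 \<beta> s = 1 / (48 * pi * \<beta>\<^sup>2) * (3 * \<beta> - spin s * (1 - cc \<beta>)) * dl \<beta>"
    using root4_dl by (simp add: Lam1_def cc_def)
  also have "3 * \<beta> - spin s * (1 - cc \<beta>) = (3 * sg \<beta> + spin s * dl \<beta>) * dl \<beta>"
  proof -
    have "\<beta> = sg \<beta> * dl \<beta>" "cc \<beta> = dl \<beta> * dl \<beta> + 1" using sg_dl(3,5) by (simp_all add: power2_eq_square)
    then show ?thesis by (simp add: algebra_simps)
  qed
  also have "\<beta>\<^sup>2 = (sg \<beta>)\<^sup>2 * (dl \<beta>)\<^sup>2" using sg_dl(3) by (simp add: power_mult_distrib[symmetric])
  finally have L: "Lam1 \<beta> s = 1 / (48 * pi * ((sg \<beta>)\<^sup>2 * (dl \<beta>)\<^sup>2)) * ((3 * sg \<beta> + spin s * dl \<beta>) * dl \<beta>) * dl \<beta>" .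
  have "8 * pi * Lam1 \<beta> s = (3 * sg \<beta> + spin s * dl \<beta>) / (6 * (sg \<beta>)\<^sup>2)"
  proof -
    have "8 * pi * (1 / (48 * pi * (g\<^sup>2 * d\<^sup>2)) * (A * d) * d) = A / (6 * g\<^sup>2)" if "g > 0" "d > 0" for g d A :: real
      using that by (simp add: field_simps power2_eq_square)
    from this[OF sg_dl(1,2)] show ?thesis unfolding L .
  qed
  then show ?thesis
    unfolding K1_i using sg_dl(1) by (simp add: field_simps power2_eq_square)
qed

end

section \<open>Perturbation of roots below the threshold\<close>

text \<open>The intermediate value theorem yields a zero near z, and injectivity its uniqueness. The
  asymptotics take two rounds: the linear lower bound for G0 gives a displacement of order a^2, and
  this inserted into the quadratic bound for G0 and the Lipschitz bound for G1 leaves an error of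
  order a^4.\<close>

lemma perturbed_root_local:
  fixes G :: "real \<Rightarrow> real \<Rightarrow> real" and G0 G1 :: "real \<Rightarrow> real"
  assumes C: "C \<ge> 0" and B: "B \<ge> 0" and K: "K \<ge> 0" and d: "d \<noteq> 0" and r: "r > 0" "K * r \<le> \<bar>d\<bar> / 2"
    and exp: "eventually (\<lambda>a. \<forall>E. \<bar>E - z\<bar> \<le> r \<longrightarrow> \<bar>G E a - G0 E - a\<^sup>2 * G1 E\<bar> \<le> C * a ^ 4) (at_right 0)"
    and G1: "\<And>E. \<bar>E - z\<bar> \<le> r \<Longrightarrow> \<bar>G1 E\<bar> \<le> B"
    and quad: "\<And>E. \<bar>E - z\<bar> \<le> r \<Longrightarrow> \<bar>G0 E - d * (E - z)\<bar> \<le> K * (E - z)\<^sup>2"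
    and lip: "\<And>E. \<bar>E - z\<bar> \<le> r \<Longrightarrow> \<bar>G1 E - G1 z\<bar> \<le> K * \<bar>E - z\<bar>"
    and cont: "eventually (\<lambda>a. continuous_on {z - r..z + r} (\<lambda>E. G E a)) (at_right 0)"
    and inj: "eventually (\<lambda>a. inj_on (\<lambda>E. G E a) {z - r..z + r}) (at_right 0)"
  shows "\<exists>e. (\<lambda>a. e a - (z + a\<^sup>2 * (- G1 z / d))) \<in> O[at_right 0](\<lambda>a. a ^ 4) \<and>
     eventually (\<lambda>a. \<bar>e a - z\<bar> \<le> r \<and> G (e a) a = 0 \<and> (\<forall>E. \<bar>E - z\<bar> \<le> r \<longrightarrow> G E a = 0 \<longrightarrow> E = e a)) (at_right 0)"
proof -
  define e where "e a = (SOME E. \<bar>E - z\<bar> \<le> r \<and> G E a = 0)" for a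
  have lin: "\<bar>d\<bar> / 2 * \<bar>h\<bar> \<le> \<bar>G0 (z + h)\<bar>" "\<bar>G0 (z + h) - d * h\<bar> \<le> \<bar>d\<bar> / 2 * \<bar>h\<bar>" if "\<bar>h\<bar> \<le> r" for h
  proof -
    have "\<bar>G0 (z + h) - d * h\<bar> \<le> K * h\<^sup>2" using quad[of "z + h"] that by simp
    also have "K * h\<^sup>2 = (K * \<bar>h\<bar>) * \<bar>h\<bar>" by (simp add: power2_eq_square flip: abs_mult)
    also have "\<dots> \<le> (\<bar>d\<bar> / 2) * \<bar>h\<bar>"
      using r(2) that K by (intro mult_right_mono order_trans[OF mult_left_mono r(2)]) auto
    finally show 1: "\<bar>G0 (z + h) - d * h\<bar> \<le> \<bar>d\<bar> / 2 * \<bar>h\<bar>" .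
    have "\<bar>d * h\<bar> = \<bar>d\<bar> * \<bar>h\<bar>" by (rule abs_mult)
    then show "\<bar>d\<bar> / 2 * \<bar>h\<bar> \<le> \<bar>G0 (z + h)\<bar>" using 1 by argo
  qed
  \<comment> \<open>The perturbation is at most (B + C) a^2. Below |d| r/2 it cannot change the sign
    of G0 at z - r and z + r, which is the sign of -d and of d.\<close>
  have small: "eventually (\<lambda>a::real. 0 < a \<and> a < 1 \<and> (B + C) * a\<^sup>2 < \<bar>d\<bar> / 2 * r) (at_right 0)"
  proof -
    have "((\<lambda>a::real. (B + C) * a\<^sup>2) \<longlongrightarrow> (B + C) * 0\<^sup>2) (at_right 0)" by (intro tendsto_intros)
    then have "eventually (\<lambda>a::real. (B + C) * a\<^sup>2 < \<bar>d\<bar> / 2 * r) (at_right 0)"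
      using d r by (intro order_tendstoD) auto
    moreover have "eventually (\<lambda>a::real. 0 < a \<and> a < 1) (at_right 0)"
      by (auto simp: eventually_at_right_field intro: exI[of _ 1])
    ultimately show ?thesis by eventually_elim auto
  qed
  \<comment> \<open>\<open>H a^2\<close> bounds the displacement after the first round;
    \<open>A\<close> collects the three errors of the second round, divided by the slope.\<close>
  define H where "H = 2 * (B + C) / \<bar>d\<bar>"
  define A where "A = (K * H\<^sup>2 + C + K * H) / \<bar>d\<bar>"
  have H0: "H \<ge> 0" using B C by (simp add: H_def)
  have main: "eventually (\<lambda>a. \<bar>e a - z\<bar> \<le> r \<and> G (e a) a = 0 \<and> (\<forall>E. \<bar>E - z\<bar> \<le> r \<longrightarrow> G E a = 0 \<longrightarrow> E = e a) \<and>
      \<bar>e a - (z + a\<^sup>2 * (- G1 z / d))\<bar> \<le> A * \<bar>a ^ 4\<bar>) (at_right 0)"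
    using exp cont inj small
  proof eventually_elim
    case (elim a)
    have a4: "a ^ 4 \<le> a\<^sup>2" using elim by (intro power_decreasing) auto
    have GG0: "\<bar>G E a - G0 E\<bar> \<le> (B + C) * a\<^sup>2" if E: "\<bar>E - z\<bar> \<le> r" for E
    proof -
      have "\<bar>G E a - G0 E\<bar> \<le> \<bar>G E a - G0 E - a\<^sup>2 * G1 E\<bar> + \<bar>a\<^sup>2 * G1 E\<bar>" by linarith
      also have "\<dots> \<le> C * a ^ 4 + a\<^sup>2 * B"
        using elim(1) E G1[OF E] by (intro add_mono) (auto simp: abs_mult mult_left_mono)
      also have "\<dots> \<le> C * a\<^sup>2 + a\<^sup>2 * B" using a4 C by (simp add: mult_left_mono)
      finally show ?thesis by (simp add: algebra_simps)
    qed
    have "\<exists>E. z - r \<le> E \<and> E \<le> z + r \<and> G E a = 0"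
    proof -
      have R: "\<bar>G0 (z + r) - d * r\<bar> \<le> \<bar>d\<bar> / 2 * r" "\<bar>G0 (z - r) + d * r\<bar> \<le> \<bar>d\<bar> / 2 * r"
        using lin(2)[of r] lin(2)[of "- r"] r by auto
      have S: "\<bar>G (z + r) a - G0 (z + r)\<bar> < \<bar>d\<bar> / 2 * r" "\<bar>G (z - r) a - G0 (z - r)\<bar> < \<bar>d\<bar> / 2 * r"
        using GG0[of "z + r"] GG0[of "z - r"] elim(4) r by auto
      show ?thesis
      proof (cases "d > 0")
        case True
        then have "G (z - r) a \<le> 0" "0 \<le> G (z + r) a" using R S r by (auto simp: abs_if split: if_splits)
        then show ?thesis using IVT'[of "\<lambda>E. G E a" "z - r" 0 "z + r"] elim(2) r by auto
      next
        case False
        then have d': "\<bar>d\<bar> = - d" by simp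
        have "G (z + r) a \<le> 0" "0 \<le> G (z - r) a" using R S r unfolding d' by (auto simp: abs_if split: if_splits)
        then show ?thesis using IVT2'[of "\<lambda>E. G E a" "z + r" 0 "z - r"] elim(2) r by auto
      qed
    qed
    then obtain E where "z - r \<le> E" "E \<le> z + r" "G E a = 0" by blast
    then have "\<exists>E. \<bar>E - z\<bar> \<le> r \<and> G E a = 0" by (intro exI[of _ E]) (auto simp: abs_le_iff)
    from someI_ex[OF this] have e: "\<bar>e a - z\<bar> \<le> r" "G (e a) a = 0" by (simp_all add: e_def)
    have uniq: "E = e a" if "\<bar>E - z\<bar> \<le> r" "G E a = 0" for E
      using inj_onD[OF elim(3), of E "e a"] e that by (auto simp: abs_le_iff)
    define h where "h = e a - z"
    have eh: "e a = z + h" by (simp add: h_def)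
    have hr: "\<bar>h\<bar> \<le> r" using e by (simp add: h_def)
    have "\<bar>d\<bar> / 2 * \<bar>h\<bar> \<le> (B + C) * a\<^sup>2"
      using lin(1)[OF hr] GG0[OF e(1)] e(2) by (simp add: eh)
    then have h: "\<bar>h\<bar> \<le> H * a\<^sup>2" using d by (simp add: H_def field_simps)
    have "\<bar>d * h + a\<^sup>2 * G1 z\<bar> \<le> \<bar>G0 (e a) - d * h\<bar> + \<bar>G (e a) a - G0 (e a) - a\<^sup>2 * G1 (e a)\<bar> + a\<^sup>2 * \<bar>G1 (e a) - G1 z\<bar>"
    proof -
      have "d * h + a\<^sup>2 * G1 z = - (G0 (e a) - d * h) - (G (e a) a - G0 (e a) - a\<^sup>2 * G1 (e a)) - a\<^sup>2 * (G1 (e a) - G1 z)"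
        using e(2) by (simp add: algebra_simps)
      moreover have "\<bar>a\<^sup>2 * (G1 (e a) - G1 z)\<bar> = a\<^sup>2 * \<bar>G1 (e a) - G1 z\<bar>" by (simp add: abs_mult)
      ultimately show ?thesis by linarith
    qed
    also have "\<dots> \<le> K * (H * a\<^sup>2)\<^sup>2 + C * a ^ 4 + a\<^sup>2 * (K * (H * a\<^sup>2))"
    proof (intro add_mono mult_left_mono)
      have "\<bar>G0 (e a) - d * h\<bar> \<le> K * h\<^sup>2" using quad[OF e(1)] by (simp add: h_def)
      also have "h\<^sup>2 \<le> (H * a\<^sup>2)\<^sup>2" using h by (metis abs_ge_zero power2_abs power_mono)
      finally show "\<bar>G0 (e a) - d * h\<bar> \<le> K * (H * a\<^sup>2)\<^sup>2" using K by (simp add: mult_left_mono)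
      have "\<bar>G1 (e a) - G1 z\<bar> \<le> K * \<bar>h\<bar>" using lip[OF e(1)] by (simp add: h_def)
      also have "\<dots> \<le> K * (H * a\<^sup>2)" using h K by (rule mult_left_mono)
      finally show "\<bar>G1 (e a) - G1 z\<bar> \<le> K * (H * a\<^sup>2)" .
    qed (use elim(1) e(1) in auto)
    also have "\<dots> = (K * H\<^sup>2 + C + K * H) * a ^ 4"
      by (simp add: algebra_simps power_mult_distrib power_numeral_reduce)
    finally have "\<bar>d * h + a\<^sup>2 * G1 z\<bar> \<le> (K * H\<^sup>2 + C + K * H) * a ^ 4" .
    then have "\<bar>d * h + a\<^sup>2 * G1 z\<bar> / \<bar>d\<bar> \<le> (K * H\<^sup>2 + C + K * H) * a ^ 4 / \<bar>d\<bar>"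
      by (rule divide_right_mono) simp
    moreover have "e a - (z + a\<^sup>2 * (- G1 z / d)) = (d * h + a\<^sup>2 * G1 z) / d"
      using d by (simp add: h_def field_simps)
    ultimately have "\<bar>e a - (z + a\<^sup>2 * (- G1 z / d))\<bar> \<le> A * a ^ 4"
      by (simp add: A_def abs_divide)
    then have "\<bar>e a - (z + a\<^sup>2 * (- G1 z / d))\<bar> \<le> A * \<bar>a ^ 4\<bar>" by simp
    with e uniq show ?case by blast
  qed
  have "(\<lambda>a. e a - (z + a\<^sup>2 * (- G1 z / d))) \<in> O[at_right 0](\<lambda>a. a ^ 4)"
    by (rule bigoI[where c = A], rule eventually_mono[OF main]) (simp only: real_norm_def)
  moreover have "eventually (\<lambda>a. \<bar>e a - z\<bar> \<le> r \<and> G (e a) a = 0 \<and> (\<forall>E. \<bar>E - z\<bar> \<le> r \<longrightarrow> G E a = 0 \<longrightarrow> E = e a)) (at_right 0)"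
    using main by eventually_elim blast
  ultimately show ?thesis by blast
qed

text \<open>Away from the zeros of G0 compactness gives a positive lower bound for |G0|, which a
  small perturbation cannot cancel; the range below M is excluded by hypothesis. The end b may
  itself be a zero of G0, and then zeros of G close to b are out of control. Hence completeness
  below b - \<delta> in general, and up to b only if G0 b is not 0.\<close>

lemma perturbed_roots:
  fixes G :: "real \<Rightarrow> real \<Rightarrow> real" and G0 G1 d :: "real \<Rightarrow> real" and b M :: real
  defines "Z \<equiv> {E. E < b \<and> G0 E = 0}"
  assumes C: "C \<ge> 0" and B: "B \<ge> 0"
    and exp: "eventually (\<lambda>a. \<forall>E. M \<le> E \<longrightarrow> E < b \<longrightarrow> \<bar>G E a - G0 E - a\<^sup>2 * G1 E\<bar> \<le> C * a ^ 4) (at_right 0)"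
    and G1: "\<And>E. M \<le> E \<Longrightarrow> E < b \<Longrightarrow> \<bar>G1 E\<bar> \<le> B"
    and cont0: "continuous_on {M..b} G0"
    and far: "eventually (\<lambda>a. \<forall>E<M. G E a \<noteq> 0) (at_right 0)" "\<And>E. E \<le> M \<Longrightarrow> G0 E \<noteq> 0"
    and fin: "finite Z"
    and loc: "\<And>z. z \<in> Z \<Longrightarrow> d z \<noteq> 0 \<and> (\<exists>K r. K \<ge> 0 \<and> r > 0 \<and> (\<forall>E. \<bar>E - z\<bar> \<le> r \<longrightarrow>
        \<bar>G0 E - d z * (E - z)\<bar> \<le> K * (E - z)\<^sup>2 \<and> \<bar>G1 E - G1 z\<bar> \<le> K * \<bar>E - z\<bar>))"
    and cont: "eventually (\<lambda>a. continuous_on {M..<b} (\<lambda>E. G E a)) (at_right 0)"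
    and inj: "\<And>z. z \<in> Z \<Longrightarrow> \<exists>r>0. eventually (\<lambda>a. inj_on (\<lambda>E. G E a) {z - r..z + r}) (at_right 0)"
  shows "\<exists>e. (\<forall>z\<in>Z. (\<lambda>a. e z a - (z + a\<^sup>2 * (- G1 z / d z))) \<in> O[at_right 0](\<lambda>a. a ^ 4) \<and>
       eventually (\<lambda>a. e z a < b \<and> G (e z a) a = 0) (at_right 0)) \<and>
     (\<forall>\<delta>>0. eventually (\<lambda>a. \<forall>E<b - \<delta>. G E a = 0 \<longrightarrow> E \<in> (\<lambda>z. e z a) ` Z) (at_right 0)) \<and>
     (G0 b \<noteq> 0 \<longrightarrow> eventually (\<lambda>a. \<forall>E<b. G E a = 0 \<longrightarrow> E \<in> (\<lambda>z. e z a) ` Z) (at_right 0))"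
proof -
  have ZM: "M < z" "z < b" if "z \<in> Z" for z
    using that far(2)[of z] by (auto simp: Z_def not_le[symmetric])
  define P where "P z e r \<longleftrightarrow> r > 0 \<and> z + r < b \<and> (\<lambda>a. e a - (z + a\<^sup>2 * (- G1 z / d z))) \<in> O[at_right 0](\<lambda>a. a ^ 4) \<and>
     eventually (\<lambda>a. \<bar>e a - z\<bar> \<le> r \<and> G (e a) a = 0 \<and> (\<forall>E. \<bar>E - z\<bar> \<le> r \<longrightarrow> G E a = 0 \<longrightarrow> E = e a)) (at_right 0)" for z e r
  have ex: "\<exists>e r. P z e r"
    if z: "z \<in> Z" for z
  proof -
    obtain K r1 where K: "d z \<noteq> 0" "K \<ge> 0" "r1 > 0" "\<And>E. \<bar>E - z\<bar> \<le> r1 \<Longrightarrow>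
        \<bar>G0 E - d z * (E - z)\<bar> \<le> K * (E - z)\<^sup>2 \<and> \<bar>G1 E - G1 z\<bar> \<le> K * \<bar>E - z\<bar>"
      using loc[OF z] by blast
    obtain r2 where r2: "r2 > 0" "eventually (\<lambda>a. inj_on (\<lambda>E. G E a) {z - r2..z + r2}) (at_right 0)"
      using inj[OF z] by blast
    \<comment> \<open>Small enough for the local bounds, for injectivity, to stay between M and b,
      and for K r \<le> |d z|/2; K + 1 guards against K = 0.\<close>
    define r where "r = min (min r1 r2) (min (min ((z - M) / 2) ((b - z) / 2)) (\<bar>d z\<bar> / (2 * (K + 1))))"
    have rle: "r \<le> r1" "r \<le> r2" "r \<le> (z - M) / 2" "r \<le> (b - z) / 2" "r \<le> \<bar>d z\<bar> / (2 * (K + 1))"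
      unfolding r_def by (simp_all only: min_le_iff_disj order_refl simp_thms)
    have rpos: "r > 0" using K r2 ZM[OF z] by (auto simp: r_def)
    note r = rpos rle
    have Kr: "K * r \<le> \<bar>d z\<bar> / 2"
    proof -
      have "K * r \<le> (K + 1) * r" using r by (simp add: algebra_simps)
      also have "\<dots> \<le> (K + 1) * (\<bar>d z\<bar> / (2 * (K + 1)))" using r K by (intro mult_left_mono) auto
      also have "\<dots> = \<bar>d z\<bar> / 2" using K by (simp add: field_simps)
      finally show ?thesis .
    qed
    have inside: "M \<le> E \<and> E < b" if "\<bar>E - z\<bar> \<le> r" for E
      using that r ZM[OF z] by (auto simp: abs_le_iff field_simps)
    have "\<exists>e. (\<lambda>a. e a - (z + a\<^sup>2 * (- G1 z / d z))) \<in> O[at_right 0](\<lambda>a. a ^ 4) \<and>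
     eventually (\<lambda>a. \<bar>e a - z\<bar> \<le> r \<and> G (e a) a = 0 \<and> (\<forall>E. \<bar>E - z\<bar> \<le> r \<longrightarrow> G E a = 0 \<longrightarrow> E = e a)) (at_right 0)"
    proof (rule perturbed_root_local[OF C B K(2,1) r(1) Kr])
      show "eventually (\<lambda>a. \<forall>E. \<bar>E - z\<bar> \<le> r \<longrightarrow> \<bar>G E a - G0 E - a\<^sup>2 * G1 E\<bar> \<le> C * a ^ 4) (at_right 0)"
        using exp by eventually_elim (use inside in blast)
      show "eventually (\<lambda>a. continuous_on {z - r..z + r} (\<lambda>E. G E a)) (at_right 0)"
        using cont 
      proof eventually_elim
        case (elim a)
        show ?case by (rule continuous_on_subset[OF elim]) (use inside in \<open>force simp: abs_le_iff\<close>)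
      qed
      show "eventually (\<lambda>a. inj_on (\<lambda>E. G E a) {z - r..z + r}) (at_right 0)"
        using r2(2) by eventually_elim (rule inj_on_subset, assumption, use r in auto)
    qed (use inside G1 K(4) r in auto)
    moreover have "z + r < b" using r ZM[OF z] by (simp add: field_simps)
    ultimately show ?thesis using r(1) unfolding P_def by blast
  qed
  obtain e r where "\<And>z. z \<in> Z \<Longrightarrow> P z (e z) (r z)"
    using ex by metis
  note er = this[unfolded P_def]
  have ev: "eventually (\<lambda>a. \<forall>z\<in>Z. \<bar>e z a - z\<bar> \<le> r z \<and> G (e z a) a = 0 \<and> (\<forall>E. \<bar>E - z\<bar> \<le> r z \<longrightarrow> G E a = 0 \<longrightarrow> E = e z a)) (at_right 0)"
    using er by (intro eventually_ball_finite[OF fin]) blast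
  \<comment> \<open>One statement for both forms of completeness: it is applied with T = {M..b -
    \<delta>} and with T = {M..b}.\<close>
  have compl: "eventually (\<lambda>a. \<forall>E\<in>T. E < b \<longrightarrow> G E a = 0 \<longrightarrow> E \<in> (\<lambda>z. e z a) ` Z) (at_right 0)"
    if T: "compact T" "T \<subseteq> {M..b}" "\<And>E. E \<in> T \<Longrightarrow> G0 E = 0 \<Longrightarrow> E < b" for T
  proof -
    define S where "S = T - (\<Union>z\<in>Z. ball z (r z))"
    have S: "compact S" unfolding S_def by (intro compact_diff T open_UN ballI open_ball)
    have nz: "G0 E \<noteq> 0" if "E \<in> S" for E
    proof
      assume "G0 E = 0"
      then have "E \<in> Z" using that T(3) by (auto simp: S_def Z_def)
      then show False using that er[of E] by (auto simp: S_def)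
    qed
    obtain m where m: "m > 0" "\<And>E. E \<in> S \<Longrightarrow> \<bar>G0 E\<bar> \<ge> m"
    proof (cases "S = {}")
      case True then show ?thesis using that[of 1] by auto
    next
      case False
      have "continuous_on S (\<lambda>E. \<bar>G0 E\<bar>)"
        using continuous_on_subset[OF cont0, of S] T(2) by (intro continuous_intros) (auto simp: S_def)
      then obtain E0 where "E0 \<in> S" "\<And>E. E \<in> S \<Longrightarrow> \<bar>G0 E0\<bar> \<le> \<bar>G0 E\<bar>"
        using continuous_attains_inf[OF S False] by blast
      then show ?thesis using that[of "\<bar>G0 E0\<bar>"] nz by auto
    qed
    have "((\<lambda>a::real. C * a ^ 4 + a\<^sup>2 * B) \<longlongrightarrow> C * 0 ^ 4 + 0\<^sup>2 * B) (at_right 0)" by (intro tendsto_intros)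
    then have "eventually (\<lambda>a::real. C * a ^ 4 + a\<^sup>2 * B < m) (at_right 0)"
      using m by (intro order_tendstoD) auto
    then show ?thesis
      using ev exp
    proof eventually_elim
      case (elim a)
      show ?case
      proof (intro ballI impI)
        fix E assume E: "E \<in> T" "E < b" "G E a = 0"
        have "E \<notin> S"
        proof
          assume "E \<in> S"
          have ME: "M \<le> E" using E T(2) by auto
          have "\<bar>G E a - G0 E - a\<^sup>2 * G1 E\<bar> \<le> C * a ^ 4" using elim(3) ME E by blast
          moreover have "\<bar>a\<^sup>2 * G1 E\<bar> \<le> a\<^sup>2 * B" using G1[OF ME E(2)] by (simp add: abs_mult mult_left_mono)
          ultimately have "\<bar>G0 E\<bar> \<le> C * a ^ 4 + a\<^sup>2 * B" using E(3) by linarith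
          then show False using m(2)[OF \<open>E \<in> S\<close>] elim(1) by linarith
        qed
        then obtain z where z: "z \<in> Z" "E \<in> ball z (r z)" using E by (auto simp: S_def)
        then have "\<bar>E - z\<bar> \<le> r z" by (auto simp: dist_real_def abs_minus_commute)
        then show "E \<in> (\<lambda>z. e z a) ` Z" using elim(2) z(1) E(3) by blast
      qed
    qed
  qed
  show ?thesis
  proof (intro exI[of _ e] conjI ballI allI impI)
    fix z assume z: "z \<in> Z"
    show "(\<lambda>a. e z a - (z + a\<^sup>2 * (- G1 z / d z))) \<in> O[at_right 0](\<lambda>a. a ^ 4)" using er[OF z] by blast
    show "eventually (\<lambda>a. e z a < b \<and> G (e z a) a = 0) (at_right 0)"
      using ev
    proof eventually_elim
      case (elim a)
      have "z + r z < b" using er[OF z] by blast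
      moreover have "\<bar>e z a - z\<bar> \<le> r z" "G (e z a) a = 0" using elim z by blast+
      ultimately show ?case by linarith
    qed
  next
    fix \<delta> :: real assume "\<delta> > 0"
    then have "eventually (\<lambda>a. \<forall>E\<in>{M..b - \<delta>}. E < b \<longrightarrow> G E a = 0 \<longrightarrow> E \<in> (\<lambda>z. e z a) ` Z) (at_right 0)"
      by (intro compl) auto
    then show "eventually (\<lambda>a. \<forall>E<b - \<delta>. G E a = 0 \<longrightarrow> E \<in> (\<lambda>z. e z a) ` Z) (at_right 0)"
      using far(1)
    proof eventually_elim
      case (elim a)
      show ?case
      proof (intro allI impI)
        fix E assume E: "E < b - \<delta>" "G E a = 0"
        then have "M \<le> E" using elim(2) by (cases "M \<le> E") (auto simp: not_le)
        then show "E \<in> (\<lambda>z. e z a) ` Z" using elim(1) E \<open>\<delta> > 0\<close> by auto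
      qed
    qed
  next
    assume "G0 b \<noteq> 0"
    then have "eventually (\<lambda>a. \<forall>E\<in>{M..b}. E < b \<longrightarrow> G E a = 0 \<longrightarrow> E \<in> (\<lambda>z. e z a) ` Z) (at_right 0)"
      by (intro compl) (auto simp: less_le)
    then show "eventually (\<lambda>a. \<forall>E<b. G E a = 0 \<longrightarrow> E \<in> (\<lambda>z. e z a) ` Z) (at_right 0)"
      using far(1)
    proof eventually_elim
      case (elim a)
      show ?case
      proof (intro allI impI)
        fix E assume E: "E < b" "G E a = 0"
        then have "M \<le> E" using elim(2) by (cases "M \<le> E") (auto simp: not_le)
        then show "E \<in> (\<lambda>z. e z a) ` Z" using elim(1) E by auto
      qed
    qed
  qed
qed

section \<open>Expansions of the secular equation\<close>

lemma eventually_small_at_right_0: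
  "\<epsilon> > 0 \<Longrightarrow> eventually (\<lambda>a::real. 0 < a \<and> a < \<epsilon>) (at_right 0)"
  by (auto simp: eventually_at_right_field intro: exI[of _ \<epsilon>])

lemma KK_i_expansion:
  assumes b: "\<beta> > 0"
  obtains C where "C \<ge> 0" "eventually (\<lambda>\<alpha>. cmod (KK \<beta> \<alpha> s \<i> - KK \<beta> 0 s \<i> - of_real (\<alpha>\<^sup>2) * K1 \<beta> s (X0 \<beta> \<i>)) \<le> C * \<alpha> ^ 4) (at_right 0)"
proof -
  have m: "cmod (X0 \<beta> \<i>) > 0" using Im_X0_neg[of \<i> \<beta>] by auto
  obtain C where C: "C \<ge> 0" "\<And>X \<alpha>. cmod X \<ge> cmod (X0 \<beta> \<i>) \<Longrightarrow> 0 < \<alpha> \<Longrightarrow> \<alpha> \<le> cmod (X0 \<beta> \<i>) / 2 \<Longrightarrow>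
     cmod (KX \<beta> \<alpha> s X - KX \<beta> 0 s X - of_real (\<alpha>\<^sup>2) * K1 \<beta> s X) \<le> C * \<alpha> ^ 4"
    using KX_expansion[OF b m] by blast
  have "eventually (\<lambda>\<alpha>. 0 < \<alpha> \<and> \<alpha> < cmod (X0 \<beta> \<i>) / 2) (at_right 0)"
    using m by (intro eventually_small_at_right_0) auto
  then have "eventually (\<lambda>\<alpha>. cmod (KK \<beta> \<alpha> s \<i> - KK \<beta> 0 s \<i> - of_real (\<alpha>\<^sup>2) * K1 \<beta> s (X0 \<beta> \<i>)) \<le> C * \<alpha> ^ 4) (at_right 0)"
    unfolding KK_def by eventually_elim (intro C(2), auto)
  then show thesis using that C(1) by blast
qed

lemma Re_Gam0: "Re (Gam0 \<beta> \<Gamma> s s) = Re (\<Gamma> $ s $ s) / (N0 \<beta> s)\<^sup>2"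
  by (simp add: Gam0_def power2_eq_square flip: of_real_mult)

lemma om0_eq:
  assumes b: "\<beta> > 0"
  shows "2 * om0 \<beta> \<Gamma> s = shift \<beta> 0 \<Gamma> s"
proof -
  have "2 * om0 \<beta> \<Gamma> s = Re (\<Gamma> $ s $ s) * (8 * pi / (N0 \<beta> s)\<^sup>2) + 8 * pi * Lam0 \<beta> s"
    by (simp add: om0_def Re_Gam0 algebra_simps)
  then show ?thesis
    unfolding N0_sq[OF b] Lam0_eq[OF b] shift_def KK_0_i[OF b] by (simp add: algebra_simps)
qed

lemma om1_eq:
  assumes b: "\<beta> > 0"
  shows "2 * om1 \<beta> \<Gamma> s = - (Re (K1 \<beta> s (X0 \<beta> \<i>)) + Re (\<Gamma> $ s $ s) * Im (K1 \<beta> s (X0 \<beta> \<i>)))"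
proof -
  have "2 * om1 \<beta> \<Gamma> s = Re (\<Gamma> $ s $ s) * (8 * pi * eta \<beta> s s / (N0 \<beta> s)\<^sup>2) + 8 * pi * Lam1 \<beta> s"
    by (simp add: om1_def Re_Gam0 algebra_simps)
  then show ?thesis
    unfolding eta_N0_sq[OF b] Lam1_eq[OF b] by (simp add: algebra_simps)
qed

lemma shift_expansion:
  assumes b: "\<beta> > 0"
  obtains C where "C \<ge> 0" "eventually (\<lambda>\<alpha>. \<bar>shift \<beta> \<alpha> \<Gamma> s - 2 * om0 \<beta> \<Gamma> s - \<alpha>\<^sup>2 * (2 * om1 \<beta> \<Gamma> s)\<bar> \<le> C * \<alpha> ^ 4) (at_right 0)"
proof -
  obtain C where C: "C \<ge> 0" "eventually (\<lambda>\<alpha>. cmod (KK \<beta> \<alpha> s \<i> - KK \<beta> 0 s \<i> - of_real (\<alpha>\<^sup>2) * K1 \<beta> s (X0 \<beta> \<i>)) \<le> C * \<alpha> ^ 4) (at_right 0)"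
    using KK_i_expansion[OF b] by blast
  define g where "g = Re (\<Gamma> $ s $ s)"
  have "eventually (\<lambda>\<alpha>. \<bar>shift \<beta> \<alpha> \<Gamma> s - 2 * om0 \<beta> \<Gamma> s - \<alpha>\<^sup>2 * (2 * om1 \<beta> \<Gamma> s)\<bar> \<le> (1 + \<bar>g\<bar>) * C * \<alpha> ^ 4) (at_right 0)"
    using C(2)
  proof eventually_elim
    case (elim \<alpha>)
    define w where "w = KK \<beta> \<alpha> s \<i> - KK \<beta> 0 s \<i> - of_real (\<alpha>\<^sup>2) * K1 \<beta> s (X0 \<beta> \<i>)"
    have "shift \<beta> \<alpha> \<Gamma> s - 2 * om0 \<beta> \<Gamma> s - \<alpha>\<^sup>2 * (2 * om1 \<beta> \<Gamma> s) = - (Re w + g * Im w)"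
      unfolding om0_eq[OF b] om1_eq[OF b] shift_def w_def g_def by (simp add: algebra_simps)
    also have "\<bar>- (Re w + g * Im w)\<bar> \<le> \<bar>Re w\<bar> + \<bar>g\<bar> * \<bar>Im w\<bar>"
      using abs_triangle_ineq[of "Re w" "g * Im w"] by (simp add: abs_mult)
    also have "\<dots> \<le> cmod w + \<bar>g\<bar> * cmod w"
      by (intro add_mono mult_left_mono abs_Re_le_cmod abs_Im_le_cmod) auto
    also have "\<dots> = (1 + \<bar>g\<bar>) * cmod w" by (simp add: algebra_simps)
    also have "\<dots> \<le> (1 + \<bar>g\<bar>) * (C * \<alpha> ^ 4)"
      using elim by (intro mult_left_mono) (auto simp: w_def)
    finally show ?case by (simp add: mult.assoc)
  qed
  then show thesis using that[of "(1 + \<bar>g\<bar>) * C"] C(1) by simp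
qed

lemma product_expansion_bound:
  fixes x y x0 x1 y0 y1 a C D R :: real
  assumes "\<bar>x - x0 - a\<^sup>2 * x1\<bar> \<le> C * a ^ 4" "\<bar>y - y0 - a\<^sup>2 * y1\<bar> \<le> D * a ^ 4" "0 \<le> C" "0 \<le> D" "\<bar>a\<bar> \<le> 1"
    and "\<bar>x0\<bar> \<le> R" "\<bar>x1\<bar> \<le> R" "\<bar>y0\<bar> \<le> R" "\<bar>y1\<bar> \<le> R"
  shows "\<bar>x * y - x0 * y0 - a\<^sup>2 * (x1 * y0 + x0 * y1)\<bar> \<le> (R * R + C * (2 * R) + D * (2 * R) + C * D) * a ^ 4"
proof -
  define r q where "r = x - x0 - a\<^sup>2 * x1" and "q = y - y0 - a\<^sup>2 * y1"
  have R: "R \<ge> 0" using assms(6) by linarith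
  have a4: "0 \<le> a ^ 4" "a ^ 4 \<le> 1" using power_le_one[of "\<bar>a\<bar>" 4] assms(5) by auto
  have a2: "a\<^sup>2 \<le> 1" using power_le_one[of "\<bar>a\<bar>" 2] assms(5) by auto
  have bx: "\<bar>x0 + a\<^sup>2 * x1\<bar> \<le> 2 * R" "\<bar>y0 + a\<^sup>2 * y1\<bar> \<le> 2 * R"
  proof -
    have "\<bar>a\<^sup>2 * x1\<bar> \<le> 1 * R" "\<bar>a\<^sup>2 * y1\<bar> \<le> 1 * R"
      unfolding abs_mult using a2 assms by (intro mult_mono; simp)+
    then show "\<bar>x0 + a\<^sup>2 * x1\<bar> \<le> 2 * R" "\<bar>y0 + a\<^sup>2 * y1\<bar> \<le> 2 * R" using assms by linarith+
  qed
  have "x * y - x0 * y0 - a\<^sup>2 * (x1 * y0 + x0 * y1) =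
      a ^ 4 * (x1 * y1) + r * (y0 + a\<^sup>2 * y1) + (x0 + a\<^sup>2 * x1) * q + r * q"
    by (simp add: r_def q_def algebra_simps power_numeral_reduce)
  also have "\<bar>\<dots>\<bar> \<le> a ^ 4 * \<bar>x1 * y1\<bar> + \<bar>r * (y0 + a\<^sup>2 * y1)\<bar> + \<bar>(x0 + a\<^sup>2 * x1) * q\<bar> + \<bar>r * q\<bar>"
  proof -
    have "\<bar>a ^ 4 * (x1 * y1)\<bar> = a ^ 4 * \<bar>x1 * y1\<bar>" using a4 by (simp add: abs_mult)
    then show ?thesis by linarith
  qed
  also have "\<dots> \<le> a ^ 4 * (R * R) + (C * a ^ 4) * (2 * R) + (2 * R) * (D * a ^ 4) + (C * a ^ 4) * (D * 1)"
  proof (intro add_mono)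
    show "a ^ 4 * \<bar>x1 * y1\<bar> \<le> a ^ 4 * (R * R)"
      using a4 assms R unfolding abs_mult by (intro mult_left_mono mult_mono) auto
    show "\<bar>r * (y0 + a\<^sup>2 * y1)\<bar> \<le> C * a ^ 4 * (2 * R)"
      unfolding abs_mult using assms(1,3) bx a4 by (intro mult_mono) (auto simp: r_def)
    show "\<bar>(x0 + a\<^sup>2 * x1) * q\<bar> \<le> 2 * R * (D * a ^ 4)"
      unfolding abs_mult using assms(2,4) bx a4 R by (intro mult_mono) (auto simp: q_def)
    have "\<bar>q\<bar> \<le> D * 1"
      using order_trans[OF assms(2) mult_left_mono[OF a4(2) assms(4)]] by (simp add: q_def)
    then show "\<bar>r * q\<bar> \<le> C * a ^ 4 * (D * 1)"
      unfolding abs_mult using assms(1,3,4) a4 by (intro mult_mono) (auto simp: r_def)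
  qed
  also have "\<dots> = (R * R + C * (2 * R) + D * (2 * R) + C * D) * a ^ 4" by (simp add: algebra_simps)
  finally show ?thesis .
qed

text \<open>The coupling contains one normalisation factor for each spin, so its relative change at
  order \<alpha>^2 is \<open>eta \<beta> 1 1 + eta \<beta> 2 2\<close>, which equals 2
  \<open>eta \<beta> 1 2\<close>. This turns the 4 of the first identity into the 8 of the
  second.\<close>

lemma gam0_eq:
  assumes b: "\<beta> > 0"
  shows "4 * gam0 \<beta> \<Gamma> = coupling \<beta> 0 \<Gamma>"
    and "8 * eta \<beta> 1 2 * gam0 \<beta> \<Gamma> = (cmod (\<Gamma> $ 1 $ 2))\<^sup>2 *
      (Im (K1 \<beta> 1 (X0 \<beta> \<i>)) * Im (KK \<beta> 0 2 \<i>) + Im (KK \<beta> 0 1 \<i>) * Im (K1 \<beta> 2 (X0 \<beta> \<i>)))"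
proof -
  define n where "n s = 8 * pi / (N0 \<beta> s)\<^sup>2" for s
  have I0: "Im (KK \<beta> 0 s \<i>) = - n s" for s
    unfolding n_def N0_sq[OF b] KK_0_i[OF b] by simp
  have I1: "Im (K1 \<beta> s (X0 \<beta> \<i>)) = - (eta \<beta> s s * n s)" for s
    using eta_N0_sq[OF b, of s] by (simp add: n_def mult_ac)
  have N: "N0 \<beta> s \<noteq> 0" for s using N0_pos[OF b, of s] by simp
  have g: "4 * gam0 \<beta> \<Gamma> = (cmod (\<Gamma> $ 1 $ 2))\<^sup>2 * (n 1 * n 2)"
    using N0_pos[OF b] unfolding gam0_def Gam0_def n_def
    by (simp add: norm_divide norm_mult power_mult_distrib power_divide power2_eq_square abs_mult less_imp_le mult_ac)
  then show "4 * gam0 \<beta> \<Gamma> = coupling \<beta> 0 \<Gamma>" by (simp add: coupling_def I0)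
  have "8 * eta \<beta> 1 2 * gam0 \<beta> \<Gamma> = (eta \<beta> 1 1 + eta \<beta> 2 2) * (4 * gam0 \<beta> \<Gamma>)"
    by (simp add: eta_def algebra_simps)
  then show "8 * eta \<beta> 1 2 * gam0 \<beta> \<Gamma> = (cmod (\<Gamma> $ 1 $ 2))\<^sup>2 *
      (Im (K1 \<beta> 1 (X0 \<beta> \<i>)) * Im (KK \<beta> 0 2 \<i>) + Im (KK \<beta> 0 1 \<i>) * Im (K1 \<beta> 2 (X0 \<beta> \<i>)))"
    unfolding g I0 I1 by (simp add: algebra_simps)
qed

lemma coupling_expansion:
  assumes b: "\<beta> > 0"
  obtains C where "C \<ge> 0" "eventually (\<lambda>\<alpha>. \<bar>coupling \<beta> \<alpha> \<Gamma> - 4 * gam0 \<beta> \<Gamma> - \<alpha>\<^sup>2 * (8 * eta \<beta> 1 2 * gam0 \<beta> \<Gamma>)\<bar> \<le> C * \<alpha> ^ 4) (at_right 0)"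
proof -
  define x0 x1 y0 y1 where "x0 = Im (KK \<beta> 0 1 \<i>)" and "x1 = Im (K1 \<beta> 1 (X0 \<beta> \<i>))"
    and "y0 = Im (KK \<beta> 0 2 \<i>)" and "y1 = Im (K1 \<beta> 2 (X0 \<beta> \<i>))"
  define R where "R = \<bar>x0\<bar> + \<bar>x1\<bar> + \<bar>y0\<bar> + \<bar>y1\<bar>"
  define g where "g = (cmod (\<Gamma> $ 1 $ 2))\<^sup>2"
  obtain C where C: "C \<ge> 0" "eventually (\<lambda>\<alpha>. cmod (KK \<beta> \<alpha> 1 \<i> - KK \<beta> 0 1 \<i> - of_real (\<alpha>\<^sup>2) * K1 \<beta> 1 (X0 \<beta> \<i>)) \<le> C * \<alpha> ^ 4) (at_right 0)"
    using KK_i_expansion[OF b] by blast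
  obtain D where D: "D \<ge> 0" "eventually (\<lambda>\<alpha>. cmod (KK \<beta> \<alpha> 2 \<i> - KK \<beta> 0 2 \<i> - of_real (\<alpha>\<^sup>2) * K1 \<beta> 2 (X0 \<beta> \<i>)) \<le> D * \<alpha> ^ 4) (at_right 0)"
    using KK_i_expansion[OF b] by blast
  define W where "W = R * R + C * (2 * R) + D * (2 * R) + C * D"
  have "eventually (\<lambda>\<alpha>. \<bar>coupling \<beta> \<alpha> \<Gamma> - 4 * gam0 \<beta> \<Gamma> - \<alpha>\<^sup>2 * (8 * eta \<beta> 1 2 * gam0 \<beta> \<Gamma>)\<bar> \<le> (g * W) * \<alpha> ^ 4) (at_right 0)"
    using C(2) D(2) eventually_small_at_right_0[OF zero_less_one]
  proof eventually_elim
    case (elim \<alpha>)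
    have im: "\<bar>Im w\<bar> \<le> c" if "cmod w \<le> c" for w c using that abs_Im_le_cmod[of w] by linarith
    have 1: "\<bar>Im (KK \<beta> \<alpha> 1 \<i>) - x0 - \<alpha>\<^sup>2 * x1\<bar> \<le> C * \<alpha> ^ 4"
      using im[OF elim(1)] by (simp add: x0_def x1_def)
    have 2: "\<bar>Im (KK \<beta> \<alpha> 2 \<i>) - y0 - \<alpha>\<^sup>2 * y1\<bar> \<le> D * \<alpha> ^ 4"
      using im[OF elim(2)] by (simp add: y0_def y1_def)
    have 3: "\<bar>Im (KK \<beta> \<alpha> 1 \<i>) * Im (KK \<beta> \<alpha> 2 \<i>) - x0 * y0 - \<alpha>\<^sup>2 * (x1 * y0 + x0 * y1)\<bar> \<le> W * \<alpha> ^ 4"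
      unfolding W_def by (rule product_expansion_bound[OF 1 2 C(1) D(1)]) (use elim(3) in \<open>auto simp: R_def\<close>)
    have "coupling \<beta> \<alpha> \<Gamma> - 4 * gam0 \<beta> \<Gamma> - \<alpha>\<^sup>2 * (8 * eta \<beta> 1 2 * gam0 \<beta> \<Gamma>) =
        g * (Im (KK \<beta> \<alpha> 1 \<i>) * Im (KK \<beta> \<alpha> 2 \<i>) - x0 * y0 - \<alpha>\<^sup>2 * (x1 * y0 + x0 * y1))"
      unfolding gam0_eq[OF b] coupling_def g_def x0_def x1_def y0_def y1_def by (simp add: algebra_simps)
    also have "\<bar>\<dots>\<bar> = g * \<bar>Im (KK \<beta> \<alpha> 1 \<i>) * Im (KK \<beta> \<alpha> 2 \<i>) - x0 * y0 - \<alpha>\<^sup>2 * (x1 * y0 + x0 * y1)\<bar>"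
      by (simp add: abs_mult g_def)
    also have "\<dots> \<le> g * (W * \<alpha> ^ 4)" using 3 by (intro mult_left_mono) (auto simp: g_def)
    finally show ?case by (simp add: mult.assoc)
  qed
  moreover have "g * W \<ge> 0" using C(1) D(1) unfolding g_def W_def R_def by (intro mult_nonneg_nonneg add_nonneg_nonneg) auto
  ultimately show thesis using that by blast
qed

lemma xr_minus:
  assumes "\<beta> > 0" "E \<le> - \<beta>"
  shows "2 * \<beta> / xr \<beta> E = sqrt (\<beta> - E) - sqrt (- \<beta> - E)"
proof -
  have "xr \<beta> E * (sqrt (\<beta> - E) - sqrt (- \<beta> - E)) = (sqrt (\<beta> - E))\<^sup>2 - (sqrt (- \<beta> - E))\<^sup>2"
    by (simp add: xr_def algebra_simps power2_eq_square)
  also have "\<dots> = 2 * \<beta>" using assms by simp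
  finally show ?thesis
    using xr_gt[OF assms(1) order_refl _ assms(2)] assms by (simp add: field_simps)
qed

text \<open>With A = sqrt (\<beta> - E) and B = sqrt (-\<beta> - E) one has X = A + B and 2
  \<beta>/X = A - B. Their sum is 2 A and their difference 2 B, so at \<alpha> = 0 each factor
  involves a single root.\<close>

lemma KR_0_xr:
  assumes "\<beta> > 0" "E \<le> - \<beta>"
  shows "KR \<beta> 0 s (xr \<beta> E) = 2 * sqrt (spin s * \<beta> - E)"
proof -
  have "KR \<beta> 0 s (xr \<beta> E) = xr \<beta> E + spin s * (2 * \<beta> / xr \<beta> E)"
    by (simp add: KR_def TR_def)
  then show ?thesis
    unfolding xr_minus[OF assms] using exhaust_2[of s] by (auto simp: spin_def xr_def)
qed

definition f0 :: "real \<Rightarrow> complex^2^2 \<Rightarrow> 2 \<Rightarrow> real \<Rightarrow> real" where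
  "f0 \<beta> \<Gamma> s E = 2 * (om0 \<beta> \<Gamma> s + sqrt (spin s * \<beta> - E))"

text \<open>The \<alpha>^2 coefficient of \<open>FS\<close>, twice \<open>q0\<close> below the
  threshold. Writing it with 1/xr in place of \<open>xi\<close> allows E = -\<beta> and uniform
  bounds up to that point.\<close>

definition f1 :: "real \<Rightarrow> complex^2^2 \<Rightarrow> 2 \<Rightarrow> real \<Rightarrow> real" where
  "f1 \<beta> \<Gamma> s E = 2 * (om1 \<beta> \<Gamma> s - (1 / xr \<beta> E) * (1 / 2 - 1 / 3 * spin s * \<beta> * (1 / xr \<beta> E)\<^sup>2))"

lemma FS_0:
  assumes "\<beta> > 0" "E \<le> - \<beta>"
  shows "FS \<beta> \<Gamma> s E 0 = f0 \<beta> \<Gamma> s E"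
  unfolding FS_def KR_0_xr[OF assms] om0_eq[OF assms(1), symmetric] f0_def by simp

lemma FS_expansion:
  assumes b: "\<beta> > 0"
  obtains C where "C \<ge> 0" "eventually (\<lambda>\<alpha>. \<forall>E\<le>- \<beta>. \<bar>FS \<beta> \<Gamma> s E \<alpha> - f0 \<beta> \<Gamma> s E - \<alpha>\<^sup>2 * f1 \<beta> \<Gamma> s E\<bar> \<le> C * \<alpha> ^ 4) (at_right 0)"
proof -
  define m where "m = sqrt (2 * \<beta>)"
  have m: "m > 0" using b by (simp add: m_def)
  obtain D where D: "D \<ge> 0" "eventually (\<lambda>\<alpha>. \<bar>shift \<beta> \<alpha> \<Gamma> s - 2 * om0 \<beta> \<Gamma> s - \<alpha>\<^sup>2 * (2 * om1 \<beta> \<Gamma> s)\<bar> \<le> D * \<alpha> ^ 4) (at_right 0)"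
    using shift_expansion[OF b] by blast
  obtain C where C: "C \<ge> 0" "\<And>X \<alpha>. cmod X \<ge> m \<Longrightarrow> 0 < \<alpha> \<Longrightarrow> \<alpha> \<le> m / 2 \<Longrightarrow>
     cmod (KX \<beta> \<alpha> s X - KX \<beta> 0 s X - of_real (\<alpha>\<^sup>2) * K1 \<beta> s X) \<le> C * \<alpha> ^ 4"
    using KX_expansion[OF b m] by blast
  have "eventually (\<lambda>\<alpha>. 0 < \<alpha> \<and> \<alpha> < m / 2) (at_right 0)"
    using m by (intro eventually_small_at_right_0) auto
  with D(2) have "eventually (\<lambda>\<alpha>. \<forall>E\<le>- \<beta>. \<bar>FS \<beta> \<Gamma> s E \<alpha> - f0 \<beta> \<Gamma> s E - \<alpha>\<^sup>2 * f1 \<beta> \<Gamma> s E\<bar> \<le> (C + D) * \<alpha> ^ 4) (at_right 0)"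
  proof eventually_elim
    case (elim \<alpha>)
    show ?case
    proof (intro allI impI)
      fix E assume E: "E \<le> - \<beta>"
      define x where "x = xr \<beta> E"
      have x: "x \<ge> m" using xr_ge[OF b E] by (simp add: x_def m_def)
      then have x2: "x > \<alpha>" "x > 0" using elim m by auto
      have K1r: "K1 \<beta> s (of_real x) = of_real (2 * spin s * \<beta> / (3 * x ^ 3) - 1 / x)"
        by (simp add: K1_def)
      have "cmod (KX \<beta> \<alpha> s (of_real x) - KX \<beta> 0 s (of_real x) - of_real (\<alpha>\<^sup>2) * K1 \<beta> s (of_real x)) \<le> C * \<alpha> ^ 4"
        using x x2 elim by (intro C(2)) auto
      also have "KX \<beta> \<alpha> s (of_real x) - KX \<beta> 0 s (of_real x) - of_real (\<alpha>\<^sup>2) * K1 \<beta> s (of_real x) =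
          of_real (KR \<beta> \<alpha> s x - KR \<beta> 0 s x - \<alpha>\<^sup>2 * (2 * spin s * \<beta> / (3 * x ^ 3) - 1 / x))"
        unfolding K1r using KX_of_real[of \<alpha> x \<beta> s] KX_of_real[of 0 x \<beta> s] x2 elim by simp
      finally have 1: "\<bar>KR \<beta> \<alpha> s x - KR \<beta> 0 s x - \<alpha>\<^sup>2 * (2 * spin s * \<beta> / (3 * x ^ 3) - 1 / x)\<bar> \<le> C * \<alpha> ^ 4"
        by (simp only: norm_of_real)
      have f1: "f1 \<beta> \<Gamma> s E = 2 * om1 \<beta> \<Gamma> s + (2 * spin s * \<beta> / (3 * x ^ 3) - 1 / x)"
        unfolding f1_def x_def[symmetric] using x2 by (simp add: field_simps power2_eq_square power3_eq_cube)
      have "FS \<beta> \<Gamma> s E \<alpha> - f0 \<beta> \<Gamma> s E - \<alpha>\<^sup>2 * f1 \<beta> \<Gamma> s E =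
         (KR \<beta> \<alpha> s x - KR \<beta> 0 s x - \<alpha>\<^sup>2 * (2 * spin s * \<beta> / (3 * x ^ 3) - 1 / x)) +
         (shift \<beta> \<alpha> \<Gamma> s - 2 * om0 \<beta> \<Gamma> s - \<alpha>\<^sup>2 * (2 * om1 \<beta> \<Gamma> s))"
        unfolding f1 FS_0[OF b E, symmetric] FS_def x_def[symmetric] om0_eq[OF b, symmetric] by (simp add: algebra_simps)
      then show "\<bar>FS \<beta> \<Gamma> s E \<alpha> - f0 \<beta> \<Gamma> s E - \<alpha>\<^sup>2 * f1 \<beta> \<Gamma> s E\<bar> \<le> (C + D) * \<alpha> ^ 4"
        using 1 elim(1) by (simp add: algebra_simps)
    qed
  qed
  then show thesis using that[of "C + D"] C(1) D(1) by simp
qed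

text \<open>The nested radical resolves because its radicand is the square of (A - B)/2, with A and
  B the two roots that make up \<open>xr\<close>.\<close>

lemma xi_eq:
  assumes "\<beta> > 0" "E < - \<beta>"
  shows "xi \<beta> E = 1 / xr \<beta> E"
proof -
  define A B where "A = sqrt (\<beta> - E)" and "B = sqrt (- \<beta> - E)"
  have AB: "A\<^sup>2 = \<beta> - E" "B\<^sup>2 = - \<beta> - E" "A > 0" "B > 0" "A > B" using assms by (simp_all add: A_def B_def)
  have E: "E < 0" using assms by linarith
  have "sqrt (1 - (\<beta> / E)\<^sup>2) = A * B / (- E)"
  proof (rule real_sqrt_unique)
    have "(A * B / (- E))\<^sup>2 = (A\<^sup>2 * B\<^sup>2) / E\<^sup>2" by (simp add: power_divide power_mult_distrib)
    also have "\<dots> = (E\<^sup>2 - \<beta>\<^sup>2) / E\<^sup>2" unfolding AB(1,2) by (simp add: algebra_simps power2_eq_square)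
    also have "\<dots> = 1 - (\<beta> / E)\<^sup>2" using E by (simp add: diff_divide_distrib power_divide)
    finally show "(A * B / (- E))\<^sup>2 = 1 - (\<beta> / E)\<^sup>2" .
    show "0 \<le> A * B / (- E)" using AB E by (intro divide_nonneg_nonneg) auto
  qed
  then have "- E / 2 * (1 - sqrt (1 - (\<beta> / E)\<^sup>2)) = ((A - B) / 2)\<^sup>2"
  proof -
    assume h: "sqrt (1 - (\<beta> / E)\<^sup>2) = A * B / (- E)"
    have "- E / 2 * (1 - sqrt (1 - (\<beta> / E)\<^sup>2)) = (- E - A * B) / 2"
      unfolding h using E by (simp add: field_simps)
    also have "\<dots> = (A\<^sup>2 + B\<^sup>2 - 2 * A * B) / 4" unfolding AB(1,2) by (simp add: field_simps)
    also have "\<dots> = ((A - B) / 2)\<^sup>2" by (simp add: power2_diff power_divide)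
    finally show ?thesis .
  qed
  then have "xi \<beta> E = (A - B) / 2 / \<beta>" unfolding xi_def using AB by (simp add: real_sqrt_abs)
  also have "A - B = 2 * \<beta> / xr \<beta> E"
    using xr_minus[of \<beta> E] assms by (simp add: A_def B_def)
  finally show ?thesis using assms by simp
qed

lemma f1_eq_q0:
  assumes "\<beta> > 0" "E < - \<beta>"
  shows "f1 \<beta> \<Gamma> s E = 2 * q0 \<beta> \<Gamma> E s"
  by (simp add: f1_def q0_def xi_eq[OF assms])

section \<open>Monotonicity and bounds below the threshold\<close>

lemma DERIV_KR:
  assumes "x > \<alpha>" "\<alpha> \<ge> 0"
  shows "(KR \<beta> \<alpha> s has_real_derivative (x\<^sup>2 - 2 * spin s * \<beta>) / (x\<^sup>2 - \<alpha>\<^sup>2)) (at x)"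
proof -
  have "complex_of_real x \<in> X_dom \<alpha>" using assms by (simp add: X_dom_def)
  from has_vector_derivative_real_field[OF has_field_derivative_KX[OF this assms(2), of \<beta> s]]
  have "((\<lambda>x. KX \<beta> \<alpha> s (of_real x)) has_vector_derivative of_real ((x\<^sup>2 - 2 * spin s * \<beta>) / (x\<^sup>2 - \<alpha>\<^sup>2))) (at x)"
    by simp
  then have "((\<lambda>x. complex_of_real (KR \<beta> \<alpha> s x)) has_vector_derivative of_real ((x\<^sup>2 - 2 * spin s * \<beta>) / (x\<^sup>2 - \<alpha>\<^sup>2))) (at x)"
    by (rule has_vector_derivative_transform_within_open[where S = "{\<alpha><..}"])
      (use assms KX_of_real in auto)
  from bounded_linear.has_vector_derivative[OF bounded_linear_Re this]
  show ?thesis by (simp add: has_real_derivative_iff_has_vector_derivative)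
qed

text \<open>The derivative (x^2 - 2 s \<beta>)/(x^2 - \<alpha>^2) is positive for x > sqrt (2
  \<beta>). For s = + it vanishes at the endpoint, hence the rule that asks for positivity on the
  open interval and continuity on the closed one.\<close>

lemma KR_strict_mono:
  assumes "\<beta> > 0" "\<alpha> \<ge> 0" "\<alpha>\<^sup>2 < 2 * \<beta>" "sqrt (2 * \<beta>) \<le> x" "x < y"
  shows "KR \<beta> \<alpha> s x < KR \<beta> \<alpha> s y"
proof (rule DERIV_pos_imp_increasing_open[OF assms(5)])
  have a: "\<alpha> < sqrt (2 * \<beta>)" using assms(3) by (rule real_less_rsqrt)
  show "\<exists>l. (KR \<beta> \<alpha> s has_real_derivative l) (at t) \<and> 0 < l" if "x < t" "t < y" for t
  proof (intro exI conjI)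
    have t: "sqrt (2 * \<beta>) < t" using that assms(4) by linarith
    then show "(KR \<beta> \<alpha> s has_real_derivative (t\<^sup>2 - 2 * spin s * \<beta>) / (t\<^sup>2 - \<alpha>\<^sup>2)) (at t)"
      using a assms(2) by (intro DERIV_KR) auto
    have "(sqrt (2 * \<beta>))\<^sup>2 < t\<^sup>2" using t assms(1) by (intro power_strict_mono) auto
    then have "2 * \<beta> < t\<^sup>2" using assms(1) by simp
    moreover have "2 * spin s * \<beta> \<le> 2 * \<beta>" using assms(1) by (simp add: spin_def)
    ultimately show "0 < (t\<^sup>2 - 2 * spin s * \<beta>) / (t\<^sup>2 - \<alpha>\<^sup>2)"
      using assms(3) by (intro divide_pos_pos) auto
  qed
  show "continuous_on {x..y} (KR \<beta> \<alpha> s)"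
    using a assms(2,4) by (intro DERIV_continuous_on[OF has_field_derivative_at_within[OF DERIV_KR]]) auto
qed

lemma xr_strict_antimono:
  assumes "E < E'" "E' \<le> - \<beta>"
  shows "xr \<beta> E' < xr \<beta> E"
  unfolding xr_def using assms by (intro add_strict_mono) auto

lemma FS_strict_antimono:
  assumes "\<beta> > 0" "\<alpha> \<ge> 0" "\<alpha>\<^sup>2 < 2 * \<beta>" "E < E'" "E' \<le> - \<beta>"
  shows "FS \<beta> \<Gamma> s E' \<alpha> < FS \<beta> \<Gamma> s E \<alpha>"
  unfolding FS_def using KR_strict_mono[OF assms(1-3) xr_ge[OF assms(1,5)] xr_strict_antimono[OF assms(4,5)]] by simp

lemma continuous_on_FS:
  assumes "\<beta> > 0" "\<alpha> \<ge> 0" "\<alpha>\<^sup>2 < 2 * \<beta>"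
  shows "continuous_on {..- \<beta>} (\<lambda>E. FS \<beta> \<Gamma> s E \<alpha>)"
proof -
  have a: "\<alpha> < sqrt (2 * \<beta>)" using assms(3) by (rule real_less_rsqrt)
  have "continuous_on {sqrt (2 * \<beta>)..} (KR \<beta> \<alpha> s)"
    using a assms(2) by (intro DERIV_continuous_on[OF has_field_derivative_at_within[OF DERIV_KR]]) auto
  moreover have "continuous_on {..- \<beta>} (xr \<beta>)"
    unfolding xr_def by (intro continuous_intros)
  ultimately have "continuous_on {..- \<beta>} (\<lambda>E. KR \<beta> \<alpha> s (xr \<beta> E))"
    by (rule continuous_on_compose2) (use xr_ge[OF assms(1)] in auto)
  then show ?thesis unfolding FS_def by (intro continuous_intros)
qed

lemma eventually_admissible:
  assumes "\<beta> > 0"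
  shows "eventually (\<lambda>\<alpha>::real. 0 < \<alpha> \<and> \<alpha>\<^sup>2 < 2 * \<beta>) (at_right 0)"
proof -
  have "eventually (\<lambda>\<alpha>. 0 < \<alpha> \<and> \<alpha> < sqrt (2 * \<beta>)) (at_right 0)"
    using assms by (intro eventually_small_at_right_0) auto
  then show ?thesis
  proof eventually_elim
    case (elim \<alpha>)
    then have "\<alpha>\<^sup>2 < (sqrt (2 * \<beta>))\<^sup>2" by (intro power_strict_mono) auto
    then show ?case using elim assms by simp
  qed
qed

lemma f0_strict_antimono: "E < E' \<Longrightarrow> f0 \<beta> \<Gamma> s E' < f0 \<beta> \<Gamma> s E"
  by (simp add: f0_def)

lemma continuous_on_f0: "continuous_on A (f0 \<beta> \<Gamma> s)"
  unfolding f0_def by (intro continuous_intros)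

lemma f0_far:
  assumes "\<beta> > 0" "T \<ge> 0" "E \<le> - \<beta> - T\<^sup>2"
  shows "f0 \<beta> \<Gamma> s E \<ge> 2 * (T - \<bar>om0 \<beta> \<Gamma> s\<bar>)"
proof -
  have "T\<^sup>2 \<le> spin s * \<beta> - E" using assms by (simp add: spin_def)
  then have "T \<le> sqrt (spin s * \<beta> - E)" by (rule real_le_rsqrt)
  moreover have "2 * (T - \<bar>w\<bar>) \<le> 2 * (w + q)" if "T \<le> q" for w q :: real
    using that abs_ge_minus_self[of w] by argo
  ultimately show ?thesis unfolding f0_def by blast
qed

text \<open>With p and q the two roots, E - z = (q - p) (q + p). The error of the linearisation is
  exactly -(p - q)^2/(2 q), so the second bound is the square of the first.\<close>

lemma sqrt_lipschitz:
  assumes "z < c" "E \<le> c"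
  shows "\<bar>sqrt (c - E) - sqrt (c - z)\<bar> \<le> \<bar>E - z\<bar> / sqrt (c - z)"
    and "\<bar>sqrt (c - E) - sqrt (c - z) + (E - z) / (2 * sqrt (c - z))\<bar> \<le> (E - z)\<^sup>2 / (2 * (sqrt (c - z)) ^ 3)"
proof -
  define p q where "p = sqrt (c - E)" and "q = sqrt (c - z)"
  have q: "q > 0" "p \<ge> 0" "p\<^sup>2 = c - E" "q\<^sup>2 = c - z" using assms by (simp_all add: p_def q_def)
  have e: "E - z = (q - p) * (q + p)" using q(3,4) by (simp add: algebra_simps power2_eq_square)
  have "\<bar>p - q\<bar> * q \<le> \<bar>q - p\<bar> * (q + p)" using q by (simp add: abs_minus_commute mult_left_mono)
  also have "\<dots> = \<bar>E - z\<bar>" unfolding e abs_mult using q by simp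
  finally show 1: "\<bar>p - q\<bar> \<le> \<bar>E - z\<bar> / q" using q by (simp add: field_simps)
  have "p - q + (E - z) / (2 * q) = - ((p - q)\<^sup>2 / (2 * q))"
    unfolding e using q by (simp add: field_simps power2_eq_square)
  then have "\<bar>p - q + (E - z) / (2 * q)\<bar> = \<bar>p - q\<bar>\<^sup>2 / (2 * q)" using q by simp
  also have "\<dots> \<le> (\<bar>E - z\<bar> / q)\<^sup>2 / (2 * q)"
    using 1 q by (intro divide_right_mono power_mono) auto
  also have "\<dots> = (E - z)\<^sup>2 / (2 * q ^ 3)" by (simp add: power_divide power2_eq_square power3_eq_cube)
  finally show "\<bar>p - q + (E - z) / (2 * q)\<bar> \<le> (E - z)\<^sup>2 / (2 * q ^ 3)" .
qed

lemma f0_quadratic: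
  assumes "z < - \<beta>" "E \<le> - \<beta>" "\<beta> > 0"
  shows "\<bar>f0 \<beta> \<Gamma> s E - f0 \<beta> \<Gamma> s z - (- 1 / sqrt (spin s * \<beta> - z)) * (E - z)\<bar> \<le>
     (1 / (sqrt (spin s * \<beta> - z)) ^ 3) * (E - z)\<^sup>2"
proof -
  have c: "z < spin s * \<beta>" "E \<le> spin s * \<beta>" using assms by (auto simp: spin_def)
  have "f0 \<beta> \<Gamma> s E - f0 \<beta> \<Gamma> s z - (- 1 / sqrt (spin s * \<beta> - z)) * (E - z) =
     2 * (sqrt (spin s * \<beta> - E) - sqrt (spin s * \<beta> - z) + (E - z) / (2 * sqrt (spin s * \<beta> - z)))"
  proof -
    have "2 * (w + p) - 2 * (w + q) - (- 1 / q) * h = 2 * (p - q + h / (2 * q))" for w p q h :: real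
      by (simp add: algebra_simps)
    then show ?thesis unfolding f0_def .
  qed
  then have "\<bar>f0 \<beta> \<Gamma> s E - f0 \<beta> \<Gamma> s z - (- 1 / sqrt (spin s * \<beta> - z)) * (E - z)\<bar> =
     2 * \<bar>sqrt (spin s * \<beta> - E) - sqrt (spin s * \<beta> - z) + (E - z) / (2 * sqrt (spin s * \<beta> - z))\<bar>"
    by (simp only: abs_mult abs_numeral)
  also have "\<dots> \<le> 2 * ((E - z)\<^sup>2 / (2 * (sqrt (spin s * \<beta> - z)) ^ 3))"
    by (intro mult_left_mono sqrt_lipschitz(2)[OF c]) simp
  finally show ?thesis by simp
qed

lemma f1_bounded:
  assumes "\<beta> > 0"
  obtains B where "B \<ge> 0" "\<And>E. E \<le> - \<beta> \<Longrightarrow> \<bar>f1 \<beta> \<Gamma> s E\<bar> \<le> B"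
proof -
  define m where "m = 1 / sqrt (2 * \<beta>)"
  have m: "m > 0" using assms by (simp add: m_def)
  have "\<bar>f1 \<beta> \<Gamma> s E\<bar> \<le> 2 * (\<bar>om1 \<beta> \<Gamma> s\<bar> + m * (1 / 2 + 1 / 3 * \<beta> * m\<^sup>2))" if E: "E \<le> - \<beta>" for E
  proof -
    define u where "u = 1 / xr \<beta> E"
    have m0: "sqrt (2 * \<beta>) > 0" using assms by simp
    then have x0: "xr \<beta> E > 0" using xr_ge[OF assms E] by linarith
    have u: "0 \<le> u" "u \<le> m" unfolding u_def m_def using xr_ge[OF assms E] m0 x0
      by (simp, intro divide_left_mono mult_pos_pos) auto
    have "\<bar>u * (1 / 2 - 1 / 3 * spin s * \<beta> * u\<^sup>2)\<bar> \<le> m * (1 / 2 + 1 / 3 * \<beta> * m\<^sup>2)"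
      unfolding abs_mult
    proof (intro mult_mono)
      have "\<bar>1 / 3 * spin s * \<beta> * u\<^sup>2\<bar> = 1 / 3 * \<beta> * u\<^sup>2"
        using assms by (simp add: abs_mult spin_def)
      also have "\<dots> \<le> 1 / 3 * \<beta> * m\<^sup>2" using u assms by (intro mult_left_mono power_mono) auto
      finally show "\<bar>1 / 2 - 1 / 3 * spin s * \<beta> * u\<^sup>2\<bar> \<le> 1 / 2 + 1 / 3 * \<beta> * m\<^sup>2"
        using abs_triangle_ineq4[of "1 / 2" "1 / 3 * spin s * \<beta> * u\<^sup>2"] by linarith
    qed (use u m in auto)
    then have "\<bar>om1 \<beta> \<Gamma> s - u * (1 / 2 - 1 / 3 * spin s * \<beta> * u\<^sup>2)\<bar> \<le> \<bar>om1 \<beta> \<Gamma> s\<bar> + m * (1 / 2 + 1 / 3 * \<beta> * m\<^sup>2)"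
      by linarith
    then show ?thesis unfolding f1_def u_def[symmetric] by (simp only: abs_mult abs_numeral mult_left_mono zero_le_numeral)
  qed
  moreover have "2 * (\<bar>om1 \<beta> \<Gamma> s\<bar> + m * (1 / 2 + 1 / 3 * \<beta> * m\<^sup>2)) \<ge> 0" using m assms by simp
  ultimately show thesis using that by blast
qed

text \<open>\<open>f1\<close> is a cubic polynomial in u = 1/X, so its increment has the factor u -
  v. The map from E to X is Lipschitz relative to z because z < -\<beta> keeps both roots at z
  positive.\<close>

lemma f1_lipschitz:
  assumes "\<beta> > 0" "z < - \<beta>"
  obtains K where "K \<ge> 0" "\<And>E. E \<le> - \<beta> \<Longrightarrow> \<bar>f1 \<beta> \<Gamma> s E - f1 \<beta> \<Gamma> s z\<bar> \<le> K * \<bar>E - z\<bar>"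
proof -
  define m where "m = sqrt (2 * \<beta>)"
  have m: "m > 0" using assms by (simp add: m_def)
  define L where "L = 1 / sqrt (\<beta> - z) + 1 / sqrt (- \<beta> - z)"
  have L: "L \<ge> 0" using assms by (simp add: L_def)
  define N where "N = 1 + 2 / 3 * \<beta> * (3 / m\<^sup>2)"
  have N: "N \<ge> 0" using m assms by (simp add: N_def)
  have "\<bar>f1 \<beta> \<Gamma> s E - f1 \<beta> \<Gamma> s z\<bar> \<le> (N * (L / m\<^sup>2)) * \<bar>E - z\<bar>" if E: "E \<le> - \<beta>" for E
  proof -
    define x y where "x = xr \<beta> E" and "y = xr \<beta> z"
    define u v where "u = 1 / x" and "v = 1 / y"
    have xy: "x \<ge> m" "y \<ge> m" using xr_ge[OF assms(1)] E assms(2) by (simp_all add: x_def y_def m_def)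
    have uv: "0 \<le> u" "u \<le> 1 / m" "0 \<le> v" "v \<le> 1 / m"
      unfolding u_def v_def using xy m by (auto intro!: divide_left_mono)
    have "\<bar>x - y\<bar> \<le> \<bar>sqrt (\<beta> - E) - sqrt (\<beta> - z)\<bar> + \<bar>sqrt (- \<beta> - E) - sqrt (- \<beta> - z)\<bar>"
      unfolding x_def y_def xr_def by linarith
    also have "\<dots> \<le> \<bar>E - z\<bar> / sqrt (\<beta> - z) + \<bar>E - z\<bar> / sqrt (- \<beta> - z)"
      using assms E by (intro add_mono sqrt_lipschitz(1)) auto
    finally have xL: "\<bar>x - y\<bar> \<le> L * \<bar>E - z\<bar>" by (simp add: L_def algebra_simps)
    have "u - v = (y - x) / (x * y)" using xy m by (simp add: u_def v_def field_simps)
    then have "\<bar>u - v\<bar> = \<bar>x - y\<bar> / (x * y)" using xy m by (simp add: abs_divide abs_mult abs_minus_commute)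
    also have "\<dots> \<le> \<bar>x - y\<bar> / (m * m)" using xy m by (intro divide_left_mono mult_mono mult_pos_pos) auto
    also have "\<dots> \<le> (L * \<bar>E - z\<bar>) / (m * m)" using xL m by (intro divide_right_mono) auto
    finally have d: "\<bar>u - v\<bar> \<le> L / m\<^sup>2 * \<bar>E - z\<bar>" by (simp add: power2_eq_square)
    have "\<bar>u\<^sup>2 + u * v + v\<^sup>2\<bar> \<le> 3 / m\<^sup>2"
    proof -
      have "u\<^sup>2 \<le> (1 / m)\<^sup>2" "v\<^sup>2 \<le> (1 / m)\<^sup>2" using uv m by (auto intro: power_mono)
      moreover have "u * v \<le> (1 / m) * (1 / m)" using uv m by (intro mult_mono) auto
      moreover have "0 \<le> u\<^sup>2 + u * v + v\<^sup>2" using uv by simp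
      ultimately show ?thesis by (simp add: power2_eq_square)
    qed
    then have b: "\<bar>1 - 2 / 3 * spin s * \<beta> * (u\<^sup>2 + u * v + v\<^sup>2)\<bar> \<le> N"
    proof -
      assume h: "\<bar>u\<^sup>2 + u * v + v\<^sup>2\<bar> \<le> 3 / m\<^sup>2"
      have "\<bar>2 / 3 * spin s * \<beta> * (u\<^sup>2 + u * v + v\<^sup>2)\<bar> = 2 / 3 * \<beta> * \<bar>u\<^sup>2 + u * v + v\<^sup>2\<bar>"
        using assms by (simp add: abs_mult spin_def)
      also have "\<dots> \<le> 2 / 3 * \<beta> * (3 / m\<^sup>2)" using h assms by (intro mult_left_mono) auto
      finally show ?thesis
        using abs_triangle_ineq4[of 1 "2 / 3 * spin s * \<beta> * (u\<^sup>2 + u * v + v\<^sup>2)"] unfolding N_def by linarith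
    qed
    have "f1 \<beta> \<Gamma> s E - f1 \<beta> \<Gamma> s z = - ((1 - 2 / 3 * spin s * \<beta> * (u\<^sup>2 + u * v + v\<^sup>2)) * (u - v))"
      unfolding f1_def x_def[symmetric] y_def[symmetric] u_def[symmetric] v_def[symmetric]
      by (simp add: field_simps power2_eq_square)
    then have "\<bar>f1 \<beta> \<Gamma> s E - f1 \<beta> \<Gamma> s z\<bar> = \<bar>1 - 2 / 3 * spin s * \<beta> * (u\<^sup>2 + u * v + v\<^sup>2)\<bar> * \<bar>u - v\<bar>"
      by (simp only: abs_minus_cancel abs_mult)
    also have "\<dots> \<le> N * (L / m\<^sup>2 * \<bar>E - z\<bar>)" using b d N by (intro mult_mono) auto
    finally show ?thesis by (simp add: mult.assoc)
  qed
  moreover have "N * (L / m\<^sup>2) \<ge> 0" using N L by simp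
  ultimately show thesis using that by blast
qed

text \<open>Uniform down to E at minus infinity, since \<open>f1\<close> is bounded there. This is
  what rules out zeros in the unbounded range far below the threshold.\<close>

lemma FS_close:
  assumes b: "\<beta> > 0" and "\<eta> > 0"
  shows "eventually (\<lambda>\<alpha>. \<forall>E\<le>- \<beta>. \<bar>FS \<beta> \<Gamma> s E \<alpha> - f0 \<beta> \<Gamma> s E\<bar> < \<eta>) (at_right 0)"
proof -
  obtain C where C: "C \<ge> 0" "eventually (\<lambda>\<alpha>. \<forall>E\<le>- \<beta>. \<bar>FS \<beta> \<Gamma> s E \<alpha> - f0 \<beta> \<Gamma> s E - \<alpha>\<^sup>2 * f1 \<beta> \<Gamma> s E\<bar> \<le> C * \<alpha> ^ 4) (at_right 0)"
    using FS_expansion[OF b] by blast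
  obtain B where B: "B \<ge> 0" "\<And>E. E \<le> - \<beta> \<Longrightarrow> \<bar>f1 \<beta> \<Gamma> s E\<bar> \<le> B"
    using f1_bounded[OF b] by blast
  have "((\<lambda>a::real. C * a ^ 4 + a\<^sup>2 * B) \<longlongrightarrow> C * 0 ^ 4 + 0\<^sup>2 * B) (at_right 0)" by (intro tendsto_intros)
  then have "eventually (\<lambda>a::real. C * a ^ 4 + a\<^sup>2 * B < \<eta>) (at_right 0)"
    using assms(2) by (intro order_tendstoD) auto
  then show ?thesis using C(2)
  proof eventually_elim
    case (elim \<alpha>)
    show ?case
    proof (intro allI impI)
      fix E assume E: "E \<le> - \<beta>"
      have 1: "\<bar>FS \<beta> \<Gamma> s E \<alpha> - f0 \<beta> \<Gamma> s E - \<alpha>\<^sup>2 * f1 \<beta> \<Gamma> s E\<bar> \<le> C * \<alpha> ^ 4" using elim(2) E by blast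
      have "\<bar>\<alpha>\<^sup>2 * f1 \<beta> \<Gamma> s E\<bar> \<le> \<alpha>\<^sup>2 * B" using B(2)[OF E] by (simp add: abs_mult mult_left_mono)
      with 1 show "\<bar>FS \<beta> \<Gamma> s E \<alpha> - f0 \<beta> \<Gamma> s E\<bar> < \<eta>" using elim(1) by linarith
    qed
  qed
qed

text \<open>The conclusion of \<open>perturbed_roots\<close> with c as the coefficient of a^2, a
  common interface for the decoupled and the coupled case.\<close>

definition root_family :: "real \<Rightarrow> (real \<Rightarrow> real \<Rightarrow> real) \<Rightarrow> (real \<Rightarrow> real) \<Rightarrow> (real \<Rightarrow> real) \<Rightarrow> (real \<Rightarrow> real \<Rightarrow> real) \<Rightarrow> bool" where
  "root_family b G G0 c e \<longleftrightarrow>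
     (\<forall>z\<in>{E. E < b \<and> G0 E = 0}. (\<lambda>a. e z a - (z + a\<^sup>2 * c z)) \<in> O[at_right 0](\<lambda>a. a ^ 4) \<and>
       eventually (\<lambda>a. e z a < b \<and> G (e z a) a = 0) (at_right 0)) \<and>
     (\<forall>\<delta>>0. eventually (\<lambda>a. \<forall>E<b - \<delta>. G E a = 0 \<longrightarrow> E \<in> (\<lambda>z. e z a) ` {E. E < b \<and> G0 E = 0}) (at_right 0)) \<and>
     (G0 b \<noteq> 0 \<longrightarrow> eventually (\<lambda>a. \<forall>E<b. G E a = 0 \<longrightarrow> E \<in> (\<lambda>z. e z a) ` {E. E < b \<and> G0 E = 0}) (at_right 0))"

section \<open>Roots without coupling\<close>

lemma finite_f0_zeros: "finite {E. E < b \<and> f0 \<beta> \<Gamma> s E = 0}"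
proof (rule finite_subset)
  show "{E. E < b \<and> f0 \<beta> \<Gamma> s E = 0} \<subseteq> {SOME E. f0 \<beta> \<Gamma> s E = 0}"
  proof
    fix E assume "E \<in> {E. E < b \<and> f0 \<beta> \<Gamma> s E = 0}"
    then have 1: "f0 \<beta> \<Gamma> s E = 0" by simp
    then have 2: "f0 \<beta> \<Gamma> s (SOME E. f0 \<beta> \<Gamma> s E = 0) = 0" by (rule someI)
    show "E \<in> {SOME E. f0 \<beta> \<Gamma> s E = 0}"
      using 1 2 f0_strict_antimono[of E "SOME E. f0 \<beta> \<Gamma> s E = 0" \<beta> \<Gamma> s]
        f0_strict_antimono[of "SOME E. f0 \<beta> \<Gamma> s E = 0" E \<beta> \<Gamma> s] by (cases E "SOME E. f0 \<beta> \<Gamma> s E = 0" rule: linorder_cases) auto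
  qed
qed simp

text \<open>A single factor always has simple zeros: its unperturbed slope is -1/sqrt (s \<beta> -
  z), and it is strictly decreasing for every admissible \<alpha>. The product of both factors could
  have a double zero, outside the scope of the perturbation lemma.\<close>

lemma decoupled_roots:
  assumes b: "\<beta> > 0"
  shows "\<exists>e. root_family (- \<beta>) (\<lambda>E a. FS \<beta> \<Gamma> s E a) (f0 \<beta> \<Gamma> s)
     (\<lambda>z. - f1 \<beta> \<Gamma> s z / (- 1 / sqrt (spin s * \<beta> - z))) e"
proof -
  obtain C where C: "C \<ge> 0" "eventually (\<lambda>\<alpha>. \<forall>E\<le>- \<beta>. \<bar>FS \<beta> \<Gamma> s E \<alpha> - f0 \<beta> \<Gamma> s E - \<alpha>\<^sup>2 * f1 \<beta> \<Gamma> s E\<bar> \<le> C * \<alpha> ^ 4) (at_right 0)"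
    using FS_expansion[OF b] by blast
  obtain B where B: "B \<ge> 0" "\<And>E. E \<le> - \<beta> \<Longrightarrow> \<bar>f1 \<beta> \<Gamma> s E\<bar> \<le> B"
    using f1_bounded[OF b] by blast
  \<comment> \<open>Below M = -\<beta> - T^2 the root outweighs \<omega> and f0 is at least 2, out
    of reach of a perturbation smaller than 1.\<close>
  define T where "T = \<bar>om0 \<beta> \<Gamma> s\<bar> + 1"
  define M where "M = - \<beta> - T\<^sup>2"
  have T: "T > 0" by (simp add: T_def)
  have M: "M \<le> - \<beta>" by (simp add: M_def)
  have big: "f0 \<beta> \<Gamma> s E \<ge> 2" if "E \<le> M" for E
    using f0_far[OF b less_imp_le[OF T], of E \<Gamma> s] that by (simp add: M_def T_def)
  show ?thesis
    unfolding root_family_def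
  proof (rule perturbed_roots[OF C(1) B(1), where M = M])
    show "eventually (\<lambda>a. \<forall>E. M \<le> E \<longrightarrow> E < - \<beta> \<longrightarrow> \<bar>FS \<beta> \<Gamma> s E a - f0 \<beta> \<Gamma> s E - a\<^sup>2 * f1 \<beta> \<Gamma> s E\<bar> \<le> C * a ^ 4) (at_right 0)"
      using C(2) by eventually_elim auto
    show "\<bar>f1 \<beta> \<Gamma> s E\<bar> \<le> B" if "M \<le> E" "E < - \<beta>" for E using that B(2) by simp
    show "continuous_on {M..- \<beta>} (f0 \<beta> \<Gamma> s)" by (rule continuous_on_f0)
    show "eventually (\<lambda>a. \<forall>E<M. FS \<beta> \<Gamma> s E a \<noteq> 0) (at_right 0)"
      using FS_close[OF b zero_less_one, of \<Gamma> s]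
    proof eventually_elim
      case (elim a)
      show ?case
      proof (intro allI impI)
        fix E assume E: "E < M"
        then have "E \<le> - \<beta>" using M by simp
        then have "\<bar>FS \<beta> \<Gamma> s E a - f0 \<beta> \<Gamma> s E\<bar> < 1" using elim by blast
        then show "FS \<beta> \<Gamma> s E a \<noteq> 0" using big[of E] E by auto
      qed
    qed
    show "f0 \<beta> \<Gamma> s E \<noteq> 0" if "E \<le> M" for E using big[OF that] by auto
    show "finite {E. E < - \<beta> \<and> f0 \<beta> \<Gamma> s E = 0}" by (rule finite_f0_zeros)
    show "eventually (\<lambda>a. continuous_on {M..<- \<beta>} (\<lambda>E. FS \<beta> \<Gamma> s E a)) (at_right 0)"
      using eventually_admissible[OF b]
    proof eventually_elim
      case (elim a)
      show ?case by (rule continuous_on_subset[OF continuous_on_FS[OF b]]) (use elim in auto)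
    qed
  next
    fix z assume "z \<in> {E. E < - \<beta> \<and> f0 \<beta> \<Gamma> s E = 0}"
    then have z: "z < - \<beta>" "f0 \<beta> \<Gamma> s z = 0" by auto
    have q: "sqrt (spin s * \<beta> - z) > 0" using z b by (simp add: spin_def)
    obtain K where K: "K \<ge> 0" "\<And>E. E \<le> - \<beta> \<Longrightarrow> \<bar>f1 \<beta> \<Gamma> s E - f1 \<beta> \<Gamma> s z\<bar> \<le> K * \<bar>E - z\<bar>"
      using f1_lipschitz[OF b z(1)] by blast
    define K' where "K' = max K (1 / (sqrt (spin s * \<beta> - z)) ^ 3)"
    have *: "\<bar>f0 \<beta> \<Gamma> s E - - 1 / sqrt (spin s * \<beta> - z) * (E - z)\<bar> \<le> K' * (E - z)\<^sup>2 \<and>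
        \<bar>f1 \<beta> \<Gamma> s E - f1 \<beta> \<Gamma> s z\<bar> \<le> K' * \<bar>E - z\<bar>" if "\<bar>E - z\<bar> \<le> - \<beta> - z" for E
    proof
      have E: "E \<le> - \<beta>" using that by linarith
      have "\<bar>f0 \<beta> \<Gamma> s E - - 1 / sqrt (spin s * \<beta> - z) * (E - z)\<bar> \<le> (1 / (sqrt (spin s * \<beta> - z)) ^ 3) * (E - z)\<^sup>2"
        using f0_quadratic[OF z(1) E b, of \<Gamma> s] z(2) by simp
      also have "\<dots> \<le> K' * (E - z)\<^sup>2" by (intro mult_right_mono) (auto simp: K'_def)
      finally show "\<bar>f0 \<beta> \<Gamma> s E - - 1 / sqrt (spin s * \<beta> - z) * (E - z)\<bar> \<le> K' * (E - z)\<^sup>2" .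
      have "\<bar>f1 \<beta> \<Gamma> s E - f1 \<beta> \<Gamma> s z\<bar> \<le> K * \<bar>E - z\<bar>" by (rule K(2)[OF E])
      also have "\<dots> \<le> K' * \<bar>E - z\<bar>" by (intro mult_right_mono) (auto simp: K'_def)
      finally show "\<bar>f1 \<beta> \<Gamma> s E - f1 \<beta> \<Gamma> s z\<bar> \<le> K' * \<bar>E - z\<bar>" .
    qed
    show "- 1 / sqrt (spin s * \<beta> - z) \<noteq> 0 \<and> (\<exists>K r. K \<ge> 0 \<and> r > 0 \<and> (\<forall>E. \<bar>E - z\<bar> \<le> r \<longrightarrow>
        \<bar>f0 \<beta> \<Gamma> s E - - 1 / sqrt (spin s * \<beta> - z) * (E - z)\<bar> \<le> K * (E - z)\<^sup>2 \<and>
        \<bar>f1 \<beta> \<Gamma> s E - f1 \<beta> \<Gamma> s z\<bar> \<le> K * \<bar>E - z\<bar>))"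
    proof
      show "- 1 / sqrt (spin s * \<beta> - z) \<noteq> 0" using q by auto
      have "K' \<ge> 0" "- \<beta> - z > 0" using K z by (auto simp: K'_def)
      with * show "\<exists>K r. K \<ge> 0 \<and> r > 0 \<and> (\<forall>E. \<bar>E - z\<bar> \<le> r \<longrightarrow>
        \<bar>f0 \<beta> \<Gamma> s E - - 1 / sqrt (spin s * \<beta> - z) * (E - z)\<bar> \<le> K * (E - z)\<^sup>2 \<and>
        \<bar>f1 \<beta> \<Gamma> s E - f1 \<beta> \<Gamma> s z\<bar> \<le> K * \<bar>E - z\<bar>)"
        by blast
    qed
    show "\<exists>r>0. eventually (\<lambda>a. inj_on (\<lambda>E. FS \<beta> \<Gamma> s E a) {z - r..z + r}) (at_right 0)"
    proof (intro exI[of _ "- \<beta> - z"] conjI)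
      show "eventually (\<lambda>a. inj_on (\<lambda>E. FS \<beta> \<Gamma> s E a) {z - (- \<beta> - z)..z + (- \<beta> - z)}) (at_right 0)"
        using eventually_admissible[OF b]
      proof eventually_elim
        case (elim a)
        show ?case
        proof (rule linorder_inj_onI)
          fix x y assume "x < y" "x \<in> {z - (- \<beta> - z)..z + (- \<beta> - z)}" "y \<in> {z - (- \<beta> - z)..z + (- \<beta> - z)}"
          then show "FS \<beta> \<Gamma> s x a \<noteq> FS \<beta> \<Gamma> s y a"
            using FS_strict_antimono[OF b _ _, of a x y \<Gamma> s] elim by auto
        qed auto
      qed
    qed (use z in auto)
  qed
qed

section \<open>Roots with coupling\<close>

lemma quad_product:
  fixes x y X Y dx dy h K L :: real
  assumes "\<bar>x - X - dx * h\<bar> \<le> K * h\<^sup>2" "\<bar>y - Y - dy * h\<bar> \<le> L * h\<^sup>2" "K \<ge> 0" "L \<ge> 0" "\<bar>h\<bar> \<le> 1"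
  shows "\<bar>x * y - X * Y - (dx * Y + X * dy) * h\<bar> \<le> (K * \<bar>Y\<bar> + L * \<bar>X\<bar> + (\<bar>dx\<bar> + K) * (\<bar>dy\<bar> + L)) * h\<^sup>2"
proof -
  have h2: "h\<^sup>2 = \<bar>h\<bar> * \<bar>h\<bar>" by (simp add: power2_eq_square flip: abs_mult)
  have "h\<^sup>2 \<le> \<bar>h\<bar>" unfolding h2 using mult_left_mono[OF assms(5) abs_ge_zero[of h]] by (simp only: mult_1_right)
  have lip: "\<bar>x - X\<bar> \<le> (\<bar>dx\<bar> + K) * \<bar>h\<bar>" if "\<bar>x - X - dx * h\<bar> \<le> K * h\<^sup>2" "K \<ge> 0" for x X dx K
  proof -
    have "\<bar>x - X\<bar> \<le> \<bar>x - X - dx * h\<bar> + \<bar>dx * h\<bar>" by linarith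
    also have "\<dots> \<le> K * \<bar>h\<bar> + \<bar>dx\<bar> * \<bar>h\<bar>"
      using that \<open>h\<^sup>2 \<le> \<bar>h\<bar>\<close> by (intro add_mono order_trans[OF that(1)] mult_left_mono) (auto simp: abs_mult)
    finally show ?thesis by (simp add: algebra_simps)
  qed
  have "x * y - X * Y - (dx * Y + X * dy) * h = (x - X - dx * h) * Y + X * (y - Y - dy * h) + (x - X) * (y - Y)"
    by (simp add: algebra_simps)
  also have "\<bar>\<dots>\<bar> \<le> \<bar>(x - X - dx * h) * Y\<bar> + \<bar>X * (y - Y - dy * h)\<bar> + \<bar>(x - X) * (y - Y)\<bar>" by linarith
  also have "\<dots> \<le> (K * h\<^sup>2) * \<bar>Y\<bar> + \<bar>X\<bar> * (L * h\<^sup>2) + ((\<bar>dx\<bar> + K) * \<bar>h\<bar>) * ((\<bar>dy\<bar> + L) * \<bar>h\<bar>)"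
    unfolding abs_mult using assms by (intro add_mono mult_mono lip) auto
  also have "\<dots> = (K * \<bar>Y\<bar> + L * \<bar>X\<bar> + (\<bar>dx\<bar> + K) * (\<bar>dy\<bar> + L)) * h\<^sup>2"
    unfolding h2 by (simp add: algebra_simps)
  finally show ?thesis .
qed

lemma lip_product:
  fixes x y X Y h K L :: real
  assumes "\<bar>x - X\<bar> \<le> K * \<bar>h\<bar>" "\<bar>y - Y\<bar> \<le> L * \<bar>h\<bar>" "K \<ge> 0" "L \<ge> 0" "\<bar>h\<bar> \<le> 1"
  shows "\<bar>x * y - X * Y\<bar> \<le> (K * \<bar>Y\<bar> + L * \<bar>X\<bar> + K * L) * \<bar>h\<bar>"
proof -
  have hh: "\<bar>h\<bar> * \<bar>h\<bar> \<le> \<bar>h\<bar>" using mult_left_mono[OF assms(5) abs_ge_zero[of h]] by (simp only: mult_1_right)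
  have "x * y - X * Y = (x - X) * Y + X * (y - Y) + (x - X) * (y - Y)" by (simp add: algebra_simps)
  also have "\<bar>\<dots>\<bar> \<le> \<bar>(x - X) * Y\<bar> + \<bar>X * (y - Y)\<bar> + \<bar>(x - X) * (y - Y)\<bar>" by linarith
  also have "\<dots> \<le> (K * \<bar>h\<bar>) * \<bar>Y\<bar> + \<bar>X\<bar> * (L * \<bar>h\<bar>) + (K * \<bar>h\<bar>) * (L * \<bar>h\<bar>)"
    unfolding abs_mult using assms by (intro add_mono mult_mono) auto
  also have "\<dots> = K * \<bar>Y\<bar> * \<bar>h\<bar> + L * \<bar>X\<bar> * \<bar>h\<bar> + (K * L) * (\<bar>h\<bar> * \<bar>h\<bar>)" by (simp add: algebra_simps)
  also have "\<dots> \<le> K * \<bar>Y\<bar> * \<bar>h\<bar> + L * \<bar>X\<bar> * \<bar>h\<bar> + (K * L) * \<bar>h\<bar>"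
    using hh assms by (intro add_left_mono mult_left_mono) auto
  finally show ?thesis by (simp add: algebra_simps)
qed

text \<open>\<open>C0\<close> and \<open>C1\<close> are the coefficients of \<alpha>^0 and
  \<alpha>^2 in the secular function with doubled factors; \<open>dC\<close> is the derivative of
  \<open>C0\<close> in E.\<close>

definition C0 :: "real \<Rightarrow> complex^2^2 \<Rightarrow> real \<Rightarrow> real" where
  "C0 \<beta> \<Gamma> E = f0 \<beta> \<Gamma> 1 E * f0 \<beta> \<Gamma> 2 E - 4 * gam0 \<beta> \<Gamma>"

definition C1 :: "real \<Rightarrow> complex^2^2 \<Rightarrow> real \<Rightarrow> real" where
  "C1 \<beta> \<Gamma> E = f1 \<beta> \<Gamma> 1 E * f0 \<beta> \<Gamma> 2 E + f0 \<beta> \<Gamma> 1 E * f1 \<beta> \<Gamma> 2 E - 8 * eta \<beta> 1 2 * gam0 \<beta> \<Gamma>"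

definition dC :: "real \<Rightarrow> complex^2^2 \<Rightarrow> real \<Rightarrow> real" where
  "dC \<beta> \<Gamma> z = (- 1 / sqrt (spin 1 * \<beta> - z)) * f0 \<beta> \<Gamma> 2 z + f0 \<beta> \<Gamma> 1 z * (- 1 / sqrt (spin 2 * \<beta> - z))"

lemma same_sign_mono_product:
  fixes a b c d :: real
  assumes "a < b" "c < d"
  shows "0 < a \<Longrightarrow> 0 < c \<Longrightarrow> a * c < b * d" "b < 0 \<Longrightarrow> d < 0 \<Longrightarrow> b * d < a * c"
proof -
  show "a * c < b * d" if "0 < a" "0 < c" using assms that by (intro mult_strict_mono) auto
  show "b * d < a * c" if "b < 0" "d < 0"
    using mult_strict_mono[of "- b" "- a" "- d" "- c"] assms that by auto
qed

lemma gam0_nonneg: "gam0 \<beta> \<Gamma> \<ge> 0"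
  by (simp add: gam0_def)

text \<open>At a zero the product of the factors equals 4 \<gamma> > 0. The equal signs are the
  source of simplicity of the zeros, of their finiteness, and of the monotonicity of the product
  near them.\<close>

lemma C0_zero_signs:
  assumes "gam0 \<beta> \<Gamma> \<noteq> 0" "C0 \<beta> \<Gamma> z = 0"
  shows "f0 \<beta> \<Gamma> 1 z > 0 \<and> f0 \<beta> \<Gamma> 2 z > 0 \<or> f0 \<beta> \<Gamma> 1 z < 0 \<and> f0 \<beta> \<Gamma> 2 z < 0"
proof -
  have "f0 \<beta> \<Gamma> 1 z * f0 \<beta> \<Gamma> 2 z > 0"
    using assms gam0_nonneg[of \<beta> \<Gamma>] by (simp add: C0_def)
  then show ?thesis by (simp add: zero_less_mult_iff)
qed

text \<open>Both factors strictly decrease in E, so two zeros at which the factors have the same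
  sign would have different products. The sign of the first factor thus injects the zeros into a
  two-element set.\<close>

lemma finite_C0_zeros:
  assumes "gam0 \<beta> \<Gamma> \<noteq> 0"
  shows "finite {E. E < b \<and> C0 \<beta> \<Gamma> E = 0}"
proof (rule finite_imageD)
  let ?Z = "{E. E < b \<and> C0 \<beta> \<Gamma> E = 0}"
  show "finite ((\<lambda>E. f0 \<beta> \<Gamma> 1 E > 0) ` ?Z)" by simp
  show "inj_on (\<lambda>E. f0 \<beta> \<Gamma> 1 E > 0) ?Z"
  proof (rule linorder_inj_onI)
    fix x y assume xy: "x < y" "x \<in> ?Z" "y \<in> ?Z"
    have lt: "f0 \<beta> \<Gamma> 1 y < f0 \<beta> \<Gamma> 1 x" "f0 \<beta> \<Gamma> 2 y < f0 \<beta> \<Gamma> 2 x"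
      using xy(1) f0_strict_antimono by auto
    have eq: "f0 \<beta> \<Gamma> 1 x * f0 \<beta> \<Gamma> 2 x = f0 \<beta> \<Gamma> 1 y * f0 \<beta> \<Gamma> 2 y" using xy by (simp add: C0_def)
    show "(f0 \<beta> \<Gamma> 1 x > 0) \<noteq> (f0 \<beta> \<Gamma> 1 y > 0)"
      using C0_zero_signs[OF assms, of x] C0_zero_signs[OF assms, of y] xy eq
        same_sign_mono_product[OF lt] by auto
  qed auto
qed

lemma coupled_expansion:
  assumes b: "\<beta> > 0"
  obtains C where "C \<ge> 0" "eventually (\<lambda>a. \<forall>E. M \<le> E \<longrightarrow> E < - \<beta> \<longrightarrow>
     \<bar>(FS \<beta> \<Gamma> 1 E a * FS \<beta> \<Gamma> 2 E a - coupling \<beta> a \<Gamma>) - C0 \<beta> \<Gamma> E - a\<^sup>2 * C1 \<beta> \<Gamma> E\<bar> \<le> C * a ^ 4) (at_right 0)"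
proof -
  obtain P where P: "P \<ge> 0" "eventually (\<lambda>\<alpha>. \<forall>E\<le>- \<beta>. \<bar>FS \<beta> \<Gamma> 1 E \<alpha> - f0 \<beta> \<Gamma> 1 E - \<alpha>\<^sup>2 * f1 \<beta> \<Gamma> 1 E\<bar> \<le> P * \<alpha> ^ 4) (at_right 0)"
    using FS_expansion[OF b] by blast
  obtain Q where Q: "Q \<ge> 0" "eventually (\<lambda>\<alpha>. \<forall>E\<le>- \<beta>. \<bar>FS \<beta> \<Gamma> 2 E \<alpha> - f0 \<beta> \<Gamma> 2 E - \<alpha>\<^sup>2 * f1 \<beta> \<Gamma> 2 E\<bar> \<le> Q * \<alpha> ^ 4) (at_right 0)"
    using FS_expansion[OF b] by blast
  obtain D where D: "D \<ge> 0" "eventually (\<lambda>\<alpha>. \<bar>coupling \<beta> \<alpha> \<Gamma> - 4 * gam0 \<beta> \<Gamma> - \<alpha>\<^sup>2 * (8 * eta \<beta> 1 2 * gam0 \<beta> \<Gamma>)\<bar> \<le> D * \<alpha> ^ 4) (at_right 0)"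
    using coupling_expansion[OF b] by blast
  obtain B1 where B1: "B1 \<ge> 0" "\<And>E. E \<le> - \<beta> \<Longrightarrow> \<bar>f1 \<beta> \<Gamma> 1 E\<bar> \<le> B1" using f1_bounded[OF b] by blast
  obtain B2 where B2: "B2 \<ge> 0" "\<And>E. E \<le> - \<beta> \<Longrightarrow> \<bar>f1 \<beta> \<Gamma> 2 E\<bar> \<le> B2" using f1_bounded[OF b] by blast
  have f0b: "\<exists>R. \<forall>E. M \<le> E \<longrightarrow> E \<le> - \<beta> \<longrightarrow> \<bar>f0 \<beta> \<Gamma> s E\<bar> \<le> R" for s
  proof -
    have "\<bar>f0 \<beta> \<Gamma> s E\<bar> \<le> \<bar>f0 \<beta> \<Gamma> s M\<bar> + \<bar>f0 \<beta> \<Gamma> s (- \<beta>)\<bar>" if "M \<le> E" "E \<le> - \<beta>" for E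
    proof -
      have "f0 \<beta> \<Gamma> s E \<le> f0 \<beta> \<Gamma> s M" "f0 \<beta> \<Gamma> s (- \<beta>) \<le> f0 \<beta> \<Gamma> s E"
        using that f0_strict_antimono[of M E \<beta> \<Gamma> s] f0_strict_antimono[of E "- \<beta>" \<beta> \<Gamma> s] by (auto simp: le_less)
      then show ?thesis by linarith
    qed
    then show ?thesis by blast
  qed
  obtain R1 where R1: "\<And>E. M \<le> E \<Longrightarrow> E \<le> - \<beta> \<Longrightarrow> \<bar>f0 \<beta> \<Gamma> 1 E\<bar> \<le> R1" using f0b[of 1] by blast
  obtain R2 where R2: "\<And>E. M \<le> E \<Longrightarrow> E \<le> - \<beta> \<Longrightarrow> \<bar>f0 \<beta> \<Gamma> 2 E\<bar> \<le> R2" using f0b[of 2] by blast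
  define R where "R = max (max R1 R2) (max B1 B2)"
  have R: "R \<ge> R1" "R \<ge> R2" "R \<ge> B1" "R \<ge> B2" by (auto simp: R_def)
  define W where "W = R * R + P * (2 * R) + Q * (2 * R) + P * Q"
  have "eventually (\<lambda>a. \<forall>E. M \<le> E \<longrightarrow> E < - \<beta> \<longrightarrow>
     \<bar>(FS \<beta> \<Gamma> 1 E a * FS \<beta> \<Gamma> 2 E a - coupling \<beta> a \<Gamma>) - C0 \<beta> \<Gamma> E - a\<^sup>2 * C1 \<beta> \<Gamma> E\<bar> \<le> (W + D) * a ^ 4) (at_right 0)"
    using P(2) Q(2) D(2) eventually_small_at_right_0[OF zero_less_one]
  proof eventually_elim
    case (elim a)
    show ?case
    proof (intro allI impI)
      fix E assume E: "M \<le> E" "E < - \<beta>"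
      then have E': "E \<le> - \<beta>" by simp
      have 1: "\<bar>FS \<beta> \<Gamma> 1 E a - f0 \<beta> \<Gamma> 1 E - a\<^sup>2 * f1 \<beta> \<Gamma> 1 E\<bar> \<le> P * a ^ 4" using elim(1) E' by blast
      have 2: "\<bar>FS \<beta> \<Gamma> 2 E a - f0 \<beta> \<Gamma> 2 E - a\<^sup>2 * f1 \<beta> \<Gamma> 2 E\<bar> \<le> Q * a ^ 4" using elim(2) E' by blast
      have "\<bar>FS \<beta> \<Gamma> 1 E a * FS \<beta> \<Gamma> 2 E a - f0 \<beta> \<Gamma> 1 E * f0 \<beta> \<Gamma> 2 E -
          a\<^sup>2 * (f1 \<beta> \<Gamma> 1 E * f0 \<beta> \<Gamma> 2 E + f0 \<beta> \<Gamma> 1 E * f1 \<beta> \<Gamma> 2 E)\<bar> \<le> W * a ^ 4"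
        unfolding W_def
      proof (rule product_expansion_bound[OF 1 2 P(1) Q(1)])
        show "\<bar>f0 \<beta> \<Gamma> 1 E\<bar> \<le> R" "\<bar>f0 \<beta> \<Gamma> 2 E\<bar> \<le> R" "\<bar>f1 \<beta> \<Gamma> 1 E\<bar> \<le> R" "\<bar>f1 \<beta> \<Gamma> 2 E\<bar> \<le> R"
          using R1[OF E(1) E'] R2[OF E(1) E'] B1(2)[OF E'] B2(2)[OF E'] R by linarith+
      qed (use elim(4) in auto)
      moreover have "(FS \<beta> \<Gamma> 1 E a * FS \<beta> \<Gamma> 2 E a - coupling \<beta> a \<Gamma>) - C0 \<beta> \<Gamma> E - a\<^sup>2 * C1 \<beta> \<Gamma> E =
          (FS \<beta> \<Gamma> 1 E a * FS \<beta> \<Gamma> 2 E a - f0 \<beta> \<Gamma> 1 E * f0 \<beta> \<Gamma> 2 E -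
          a\<^sup>2 * (f1 \<beta> \<Gamma> 1 E * f0 \<beta> \<Gamma> 2 E + f0 \<beta> \<Gamma> 1 E * f1 \<beta> \<Gamma> 2 E)) -
          (coupling \<beta> a \<Gamma> - 4 * gam0 \<beta> \<Gamma> - a\<^sup>2 * (8 * eta \<beta> 1 2 * gam0 \<beta> \<Gamma>))"
        by (simp add: C0_def C1_def algebra_simps)
      moreover have "\<bar>x - y\<bar> \<le> (W + D) * a ^ 4" if "\<bar>x\<bar> \<le> W * a ^ 4" "\<bar>y\<bar> \<le> D * a ^ 4" for x y
        unfolding distrib_right using that by linarith
      ultimately show "\<bar>(FS \<beta> \<Gamma> 1 E a * FS \<beta> \<Gamma> 2 E a - coupling \<beta> a \<Gamma>) - C0 \<beta> \<Gamma> E - a\<^sup>2 * C1 \<beta> \<Gamma> E\<bar> \<le> (W + D) * a ^ 4"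
        using elim(3) by presburger
    qed
  qed
  moreover have "W + D \<ge> 0" using P(1) Q(1) D(1) B1(1) R by (simp add: W_def)
  ultimately show thesis using that by blast
qed

lemma C1_bounded:
  assumes b: "\<beta> > 0"
  obtains B where "B \<ge> 0" "\<And>E. M \<le> E \<Longrightarrow> E < - \<beta> \<Longrightarrow> \<bar>C1 \<beta> \<Gamma> E\<bar> \<le> B"
proof -
  obtain B1 where B1: "B1 \<ge> 0" "\<And>E. E \<le> - \<beta> \<Longrightarrow> \<bar>f1 \<beta> \<Gamma> 1 E\<bar> \<le> B1" using f1_bounded[OF b] by blast
  obtain B2 where B2: "B2 \<ge> 0" "\<And>E. E \<le> - \<beta> \<Longrightarrow> \<bar>f1 \<beta> \<Gamma> 2 E\<bar> \<le> B2" using f1_bounded[OF b] by blast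
  define R where "R s = \<bar>f0 \<beta> \<Gamma> s M\<bar> + \<bar>f0 \<beta> \<Gamma> s (- \<beta>)\<bar>" for s
  have R: "\<bar>f0 \<beta> \<Gamma> s E\<bar> \<le> R s" if "M \<le> E" "E < - \<beta>" for E s
  proof -
    have "f0 \<beta> \<Gamma> s E \<le> f0 \<beta> \<Gamma> s M" "f0 \<beta> \<Gamma> s (- \<beta>) \<le> f0 \<beta> \<Gamma> s E"
      using that f0_strict_antimono[of M E \<beta> \<Gamma> s] f0_strict_antimono[of E "- \<beta>" \<beta> \<Gamma> s] by (auto simp: le_less)
    then show ?thesis unfolding R_def by linarith
  qed
  have "\<bar>C1 \<beta> \<Gamma> E\<bar> \<le> B1 * R 2 + R 1 * B2 + \<bar>8 * eta \<beta> 1 2 * gam0 \<beta> \<Gamma>\<bar>" if E: "M \<le> E" "E < - \<beta>" for E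
  proof -
    have "\<bar>C1 \<beta> \<Gamma> E\<bar> \<le> \<bar>f1 \<beta> \<Gamma> 1 E * f0 \<beta> \<Gamma> 2 E\<bar> + \<bar>f0 \<beta> \<Gamma> 1 E * f1 \<beta> \<Gamma> 2 E\<bar> + \<bar>8 * eta \<beta> 1 2 * gam0 \<beta> \<Gamma>\<bar>"
      unfolding C1_def by linarith
    also have "\<dots> \<le> B1 * R 2 + R 1 * B2 + \<bar>8 * eta \<beta> 1 2 * gam0 \<beta> \<Gamma>\<bar>"
      unfolding abs_mult[of "f1 \<beta> \<Gamma> 1 E"] abs_mult[of "f0 \<beta> \<Gamma> 1 E"]
      using B1 B2 R[OF E] E by (intro add_mono mult_mono) (auto simp: R_def)
    finally show ?thesis .
  qed
  moreover have "B1 * R 2 + R 1 * B2 + \<bar>8 * eta \<beta> 1 2 * gam0 \<beta> \<Gamma>\<bar> \<ge> 0" using B1(1) B2(1) by (simp add: R_def)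
  ultimately show thesis using that by blast
qed

lemma dC_neq_0:
  assumes "\<beta> > 0" "z < - \<beta>" "gam0 \<beta> \<Gamma> \<noteq> 0" "C0 \<beta> \<Gamma> z = 0"
  shows "dC \<beta> \<Gamma> z \<noteq> 0"
proof -
  have p: "1 / sqrt (spin 1 * \<beta> - z) > 0" "1 / sqrt (spin 2 * \<beta> - z) > 0"
    using assms(1,2) by (simp_all add: spin_def)
  have "dC \<beta> \<Gamma> z = - (1 / sqrt (spin 1 * \<beta> - z) * f0 \<beta> \<Gamma> 2 z + 1 / sqrt (spin 2 * \<beta> - z) * f0 \<beta> \<Gamma> 1 z)"
    by (simp add: dC_def)
  moreover have nz: "x * u + y * v \<noteq> 0" if "x > 0" "y > 0" "(v > 0 \<and> u > 0) \<or> (v < 0 \<and> u < 0)" for x y u v :: real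
    using that(3)
  proof
    assume "v > 0 \<and> u > 0"
    then have "x * u > 0" "y * v > 0" using that by simp_all
    then show ?thesis by linarith
  next
    assume "v < 0 \<and> u < 0"
    then have "x * u < 0" "y * v < 0" using that by (simp_all add: mult_pos_neg)
    then show ?thesis by linarith
  qed
  ultimately show ?thesis using nz[OF p C0_zero_signs[OF assms(3,4)]] by (simp only: neg_equal_0_iff_equal not_False_eq_True)
qed

lemma coupled_local:
  assumes b: "\<beta> > 0" and z: "z < - \<beta>" "C0 \<beta> \<Gamma> z = 0"
  shows "\<exists>K r. K \<ge> 0 \<and> r > 0 \<and> (\<forall>E. \<bar>E - z\<bar> \<le> r \<longrightarrow>
        \<bar>C0 \<beta> \<Gamma> E - dC \<beta> \<Gamma> z * (E - z)\<bar> \<le> K * (E - z)\<^sup>2 \<and> \<bar>C1 \<beta> \<Gamma> E - C1 \<beta> \<Gamma> z\<bar> \<le> K * \<bar>E - z\<bar>)"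
proof -
  obtain L1 where L1: "L1 \<ge> 0" "\<And>E. E \<le> - \<beta> \<Longrightarrow> \<bar>f1 \<beta> \<Gamma> 1 E - f1 \<beta> \<Gamma> 1 z\<bar> \<le> L1 * \<bar>E - z\<bar>"
    using f1_lipschitz[OF b z(1)] by blast
  obtain L2 where L2: "L2 \<ge> 0" "\<And>E. E \<le> - \<beta> \<Longrightarrow> \<bar>f1 \<beta> \<Gamma> 2 E - f1 \<beta> \<Gamma> 2 z\<bar> \<le> L2 * \<bar>E - z\<bar>"
    using f1_lipschitz[OF b z(1)] by blast
  define d where "d s = - 1 / sqrt (spin s * \<beta> - z)" for s
  define k where "k s = 1 / (sqrt (spin s * \<beta> - z)) ^ 3" for s
  have k0: "k s \<ge> 0" for s
  proof -
    have "spin s * \<beta> - z \<ge> 0" using z(1) b by (simp add: spin_def)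
    then show ?thesis by (simp add: k_def)
  qed
  have quad: "\<bar>f0 \<beta> \<Gamma> s E - f0 \<beta> \<Gamma> s z - d s * (E - z)\<bar> \<le> k s * (E - z)\<^sup>2" if "E \<le> - \<beta>" for s E
    unfolding d_def k_def by (rule f0_quadratic[OF z(1) that b])
  have lip: "\<bar>f0 \<beta> \<Gamma> s E - f0 \<beta> \<Gamma> s z\<bar> \<le> (\<bar>d s\<bar> + k s) * \<bar>E - z\<bar>" if "E \<le> - \<beta>" "\<bar>E - z\<bar> \<le> 1" for s E
  proof -
    have "(E - z)\<^sup>2 = \<bar>E - z\<bar> * \<bar>E - z\<bar>" by (simp add: power2_eq_square flip: abs_mult)
    also have "\<dots> \<le> \<bar>E - z\<bar>" using mult_left_mono[OF that(2) abs_ge_zero[of "E - z"]] by (simp only: mult_1_right)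
    finally have "k s * (E - z)\<^sup>2 \<le> k s * \<bar>E - z\<bar>" using k0 by (intro mult_left_mono) auto
    moreover have "\<bar>d s * (E - z)\<bar> = \<bar>d s\<bar> * \<bar>E - z\<bar>" by (rule abs_mult)
    ultimately show ?thesis using quad[OF that(1), of s] unfolding distrib_right by linarith
  qed
  define K0 where "K0 = k 1 * \<bar>f0 \<beta> \<Gamma> 2 z\<bar> + k 2 * \<bar>f0 \<beta> \<Gamma> 1 z\<bar> + (\<bar>d 1\<bar> + k 1) * (\<bar>d 2\<bar> + k 2)"
  define Ka where "Ka = L1 * \<bar>f0 \<beta> \<Gamma> 2 z\<bar> + (\<bar>d 2\<bar> + k 2) * \<bar>f1 \<beta> \<Gamma> 1 z\<bar> + L1 * (\<bar>d 2\<bar> + k 2)"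
  define Kb where "Kb = (\<bar>d 1\<bar> + k 1) * \<bar>f1 \<beta> \<Gamma> 2 z\<bar> + L2 * \<bar>f0 \<beta> \<Gamma> 1 z\<bar> + (\<bar>d 1\<bar> + k 1) * L2"
  define K where "K = max K0 (Ka + Kb)"
  define r where "r = min 1 (- \<beta> - z)"
  have r: "r > 0" using z by (simp add: r_def)
  have K: "K \<ge> 0" using k0[of 1] k0[of 2] by (auto simp: K_def K0_def le_max_iff_disj)
  have "\<bar>C0 \<beta> \<Gamma> E - dC \<beta> \<Gamma> z * (E - z)\<bar> \<le> K * (E - z)\<^sup>2 \<and> \<bar>C1 \<beta> \<Gamma> E - C1 \<beta> \<Gamma> z\<bar> \<le> K * \<bar>E - z\<bar>" if "\<bar>E - z\<bar> \<le> r" for E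
  proof
    have E: "E \<le> - \<beta>" "\<bar>E - z\<bar> \<le> 1" using that by (auto simp: r_def)
    have "\<bar>f0 \<beta> \<Gamma> 1 E * f0 \<beta> \<Gamma> 2 E - f0 \<beta> \<Gamma> 1 z * f0 \<beta> \<Gamma> 2 z - (d 1 * f0 \<beta> \<Gamma> 2 z + f0 \<beta> \<Gamma> 1 z * d 2) * (E - z)\<bar> \<le> K0 * (E - z)\<^sup>2"
      unfolding K0_def by (rule quad_product[OF quad[OF E(1)] quad[OF E(1)] k0 k0 E(2)])
    also have "f0 \<beta> \<Gamma> 1 E * f0 \<beta> \<Gamma> 2 E - f0 \<beta> \<Gamma> 1 z * f0 \<beta> \<Gamma> 2 z - (d 1 * f0 \<beta> \<Gamma> 2 z + f0 \<beta> \<Gamma> 1 z * d 2) * (E - z) =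
        C0 \<beta> \<Gamma> E - dC \<beta> \<Gamma> z * (E - z)"
      using z(2) by (simp add: C0_def dC_def d_def)
    also have "K0 * (E - z)\<^sup>2 \<le> K * (E - z)\<^sup>2" by (intro mult_right_mono) (auto simp: K_def)
    finally show "\<bar>C0 \<beta> \<Gamma> E - dC \<beta> \<Gamma> z * (E - z)\<bar> \<le> K * (E - z)\<^sup>2" .
    have dk: "\<bar>d s\<bar> + k s \<ge> 0" for s using k0[of s] by simp
    have 1: "\<bar>f1 \<beta> \<Gamma> 1 E * f0 \<beta> \<Gamma> 2 E - f1 \<beta> \<Gamma> 1 z * f0 \<beta> \<Gamma> 2 z\<bar> \<le> Ka * \<bar>E - z\<bar>"
      unfolding Ka_def by (rule lip_product[OF L1(2)[OF E(1)] lip[OF E] L1(1) dk E(2)])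
    have 2: "\<bar>f0 \<beta> \<Gamma> 1 E * f1 \<beta> \<Gamma> 2 E - f0 \<beta> \<Gamma> 1 z * f1 \<beta> \<Gamma> 2 z\<bar> \<le> Kb * \<bar>E - z\<bar>"
      unfolding Kb_def by (rule lip_product[OF lip[OF E] L2(2)[OF E(1)] dk L2(1) E(2)])
    have "\<bar>C1 \<beta> \<Gamma> E - C1 \<beta> \<Gamma> z\<bar> \<le> (Ka + Kb) * \<bar>E - z\<bar>"
      using 1 2 unfolding C1_def distrib_right by linarith
    also have "\<dots> \<le> K * \<bar>E - z\<bar>" by (intro mult_right_mono) (auto simp: K_def)
    finally show "\<bar>C1 \<beta> \<Gamma> E - C1 \<beta> \<Gamma> z\<bar> \<le> K * \<bar>E - z\<bar>" .
  qed
  then show ?thesis using K r by blast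
qed

text \<open>Near z and for small \<alpha> both factors keep the signs they have at z without
  perturbation. These signs are equal, and two strictly decreasing factors of one sign have a
  strictly monotone product.\<close>

lemma coupled_inj:
  assumes b: "\<beta> > 0" and z: "z < - \<beta>" "C0 \<beta> \<Gamma> z = 0" and g: "gam0 \<beta> \<Gamma> \<noteq> 0"
  shows "\<exists>r>0. eventually (\<lambda>a. inj_on (\<lambda>E. FS \<beta> \<Gamma> 1 E a * FS \<beta> \<Gamma> 2 E a - coupling \<beta> a \<Gamma>) {z - r..z + r}) (at_right 0)"
proof -
  \<comment> \<open>One half of the size of the factor pays for the variation of f0 near z, the
    other half for the passage from f0 to \<open>FS\<close>.\<close>
  define h where "h s = \<bar>f0 \<beta> \<Gamma> s z\<bar> / 2" for s
  have h: "h 1 > 0" "h 2 > 0" using C0_zero_signs[OF g z(2)] by (auto simp: h_def)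
  have "\<exists>r>0. \<forall>E. \<bar>E - z\<bar> < r \<longrightarrow> \<bar>f0 \<beta> \<Gamma> s E - f0 \<beta> \<Gamma> s z\<bar> < h s" if "h s > 0" for s
    using continuous_on_f0[of UNIV \<beta> \<Gamma> s] that
    unfolding continuous_on_iff dist_real_def by blast
  then obtain r1 r2 where r12: "r1 > 0" "\<And>E. \<bar>E - z\<bar> < r1 \<Longrightarrow> \<bar>f0 \<beta> \<Gamma> 1 E - f0 \<beta> \<Gamma> 1 z\<bar> < h 1"
    "r2 > 0" "\<And>E. \<bar>E - z\<bar> < r2 \<Longrightarrow> \<bar>f0 \<beta> \<Gamma> 2 E - f0 \<beta> \<Gamma> 2 z\<bar> < h 2"
    using h by meson
  define r where "r = min (min r1 r2) (- \<beta> - z) / 2"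
  have "min (min r1 r2) (- \<beta> - z) \<le> - \<beta> - z" by simp
  then have "z + r \<le> - \<beta>" unfolding r_def using z(1) by argo
  moreover have "r > 0" "r < r1" "r < r2" using r12 z by (auto simp: r_def)
  ultimately have r: "r > 0" "r < r1" "r < r2" "z + r \<le> - \<beta>" by simp_all
  have "eventually (\<lambda>a. inj_on (\<lambda>E. FS \<beta> \<Gamma> 1 E a * FS \<beta> \<Gamma> 2 E a - coupling \<beta> a \<Gamma>) {z - r..z + r}) (at_right 0)"
    using FS_close[OF b h(1), of \<Gamma> 1] FS_close[OF b h(2), of \<Gamma> 2] eventually_admissible[OF b]
  proof eventually_elim
    case (elim a)
    show ?case
    proof (rule linorder_inj_onI)
      fix x y assume xy: "x < y" "x \<in> {z - r..z + r}" "y \<in> {z - r..z + r}"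
      have sgn: "\<bar>FS \<beta> \<Gamma> 1 E a - f0 \<beta> \<Gamma> 1 z\<bar> < \<bar>f0 \<beta> \<Gamma> 1 z\<bar>" "\<bar>FS \<beta> \<Gamma> 2 E a - f0 \<beta> \<Gamma> 2 z\<bar> < \<bar>f0 \<beta> \<Gamma> 2 z\<bar>"
        if E: "E \<in> {z - r..z + r}" for E
      proof -
        have "E \<le> - \<beta>" using E r by auto
        then have "\<bar>FS \<beta> \<Gamma> 1 E a - f0 \<beta> \<Gamma> 1 E\<bar> < h 1" "\<bar>FS \<beta> \<Gamma> 2 E a - f0 \<beta> \<Gamma> 2 E\<bar> < h 2"
          using elim by blast+
        moreover have "\<bar>E - z\<bar> \<le> r" using E by (auto simp: abs_le_iff)
        then have "\<bar>f0 \<beta> \<Gamma> 1 E - f0 \<beta> \<Gamma> 1 z\<bar> < h 1" "\<bar>f0 \<beta> \<Gamma> 2 E - f0 \<beta> \<Gamma> 2 z\<bar> < h 2"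
          using r r12 by auto
        moreover have "h 1 + h 1 = \<bar>f0 \<beta> \<Gamma> 1 z\<bar>" "h 2 + h 2 = \<bar>f0 \<beta> \<Gamma> 2 z\<bar>" by (auto simp: h_def)
        ultimately show "\<bar>FS \<beta> \<Gamma> 1 E a - f0 \<beta> \<Gamma> 1 z\<bar> < \<bar>f0 \<beta> \<Gamma> 1 z\<bar>" "\<bar>FS \<beta> \<Gamma> 2 E a - f0 \<beta> \<Gamma> 2 z\<bar> < \<bar>f0 \<beta> \<Gamma> 2 z\<bar>"
          by linarith+
      qed
      have "y \<le> - \<beta>" using xy r by auto
      then have lt: "FS \<beta> \<Gamma> 1 y a < FS \<beta> \<Gamma> 1 x a" "FS \<beta> \<Gamma> 2 y a < FS \<beta> \<Gamma> 2 x a"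
        using FS_strict_antimono[OF b, of a x y \<Gamma>] elim xy(1) by auto
      show "FS \<beta> \<Gamma> 1 x a * FS \<beta> \<Gamma> 2 x a - coupling \<beta> a \<Gamma> \<noteq> FS \<beta> \<Gamma> 1 y a * FS \<beta> \<Gamma> 2 y a - coupling \<beta> a \<Gamma>"
        using C0_zero_signs[OF g z(2)]
      proof
        assume "f0 \<beta> \<Gamma> 1 z > 0 \<and> f0 \<beta> \<Gamma> 2 z > 0"
        then have "FS \<beta> \<Gamma> 1 y a > 0" "FS \<beta> \<Gamma> 2 y a > 0" using sgn[OF xy(3)] by linarith+
        then show ?thesis using same_sign_mono_product(1)[OF lt] by simp
      next
        assume "f0 \<beta> \<Gamma> 1 z < 0 \<and> f0 \<beta> \<Gamma> 2 z < 0"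
        then have "FS \<beta> \<Gamma> 1 x a < 0" "FS \<beta> \<Gamma> 2 x a < 0" using sgn[OF xy(2)] by linarith+
        then show ?thesis using same_sign_mono_product(2)[OF lt] by simp
      qed
    qed auto
  qed
  then show ?thesis using r(1) by blast
qed

lemma coupled_roots:
  assumes b: "\<beta> > 0" and g: "gam0 \<beta> \<Gamma> \<noteq> 0"
  shows "\<exists>e. root_family (- \<beta>) (\<lambda>E a. FS \<beta> \<Gamma> 1 E a * FS \<beta> \<Gamma> 2 E a - coupling \<beta> a \<Gamma>) (C0 \<beta> \<Gamma>)
     (\<lambda>z. - C1 \<beta> \<Gamma> z / dC \<beta> \<Gamma> z) e"
proof -
  \<comment> \<open>Below M both factors f0 are at least 2 + 8 \<gamma>. After a perturbation
    smaller than 1 their product still exceeds 4 \<gamma> + 1/2, an eventual bound for the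
    coupling.\<close>
  define T where "T = \<bar>om0 \<beta> \<Gamma> 1\<bar> + \<bar>om0 \<beta> \<Gamma> 2\<bar> + 1 + 4 * gam0 \<beta> \<Gamma>"
  define M where "M = - \<beta> - T\<^sup>2"
  have T: "T \<ge> 0" using gam0_nonneg[of \<beta> \<Gamma>] by (simp add: T_def)
  have M: "M \<le> - \<beta>" by (simp add: M_def)
  have big: "f0 \<beta> \<Gamma> s E \<ge> 2 + 8 * gam0 \<beta> \<Gamma>" if "E \<le> M" for s E
  proof -
    have "f0 \<beta> \<Gamma> s E \<ge> 2 * (T - \<bar>om0 \<beta> \<Gamma> s\<bar>)" using f0_far[OF b T, of E \<Gamma> s] that by (simp add: M_def)
    moreover have "2 * (T - \<bar>om0 \<beta> \<Gamma> s\<bar>) \<ge> 2 + 8 * gam0 \<beta> \<Gamma>"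
      using exhaust_2[of s] by (auto simp: T_def)
    ultimately show ?thesis by linarith
  qed
  have prod_big: "x * y > 4 * gam0 \<beta> \<Gamma> + 1 / 2" if "x \<ge> 1 + 8 * gam0 \<beta> \<Gamma>" "y \<ge> 1 + 8 * gam0 \<beta> \<Gamma>" for x y
  proof -
    have "(1 + 8 * gam0 \<beta> \<Gamma>) * 1 \<le> x * y" using that gam0_nonneg[of \<beta> \<Gamma>] by (intro mult_mono) auto
    then show ?thesis using gam0_nonneg[of \<beta> \<Gamma>] by simp
  qed
  obtain C where C: "C \<ge> 0" "eventually (\<lambda>a. \<forall>E. M \<le> E \<longrightarrow> E < - \<beta> \<longrightarrow>
     \<bar>(FS \<beta> \<Gamma> 1 E a * FS \<beta> \<Gamma> 2 E a - coupling \<beta> a \<Gamma>) - C0 \<beta> \<Gamma> E - a\<^sup>2 * C1 \<beta> \<Gamma> E\<bar> \<le> C * a ^ 4) (at_right 0)"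
    using coupled_expansion[OF b] by blast
  obtain B where B: "B \<ge> 0" "\<And>E. M \<le> E \<Longrightarrow> E < - \<beta> \<Longrightarrow> \<bar>C1 \<beta> \<Gamma> E\<bar> \<le> B"
    using C1_bounded[OF b] by blast
  have coup: "eventually (\<lambda>a. coupling \<beta> a \<Gamma> < 4 * gam0 \<beta> \<Gamma> + 1 / 2) (at_right 0)"
  proof -
    obtain D where D: "D \<ge> 0" "eventually (\<lambda>\<alpha>. \<bar>coupling \<beta> \<alpha> \<Gamma> - 4 * gam0 \<beta> \<Gamma> - \<alpha>\<^sup>2 * (8 * eta \<beta> 1 2 * gam0 \<beta> \<Gamma>)\<bar> \<le> D * \<alpha> ^ 4) (at_right 0)"
      using coupling_expansion[OF b] by blast
    have "((\<lambda>a::real. D * a ^ 4 + a\<^sup>2 * (8 * eta \<beta> 1 2 * gam0 \<beta> \<Gamma>)) \<longlongrightarrow> D * 0 ^ 4 + 0\<^sup>2 * (8 * eta \<beta> 1 2 * gam0 \<beta> \<Gamma>)) (at_right 0)"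
      by (intro tendsto_intros)
    then have "eventually (\<lambda>a::real. D * a ^ 4 + a\<^sup>2 * (8 * eta \<beta> 1 2 * gam0 \<beta> \<Gamma>) < 1 / 2) (at_right 0)"
      by (intro order_tendstoD) auto
    then show ?thesis using D(2)
    proof eventually_elim
      case (elim a)
      then show ?case unfolding abs_le_iff by argo
    qed
  qed
  show ?thesis
    unfolding root_family_def
  proof (rule perturbed_roots[OF C(1) B(1) C(2) B(2)])
    show "continuous_on {M..- \<beta>} (C0 \<beta> \<Gamma>)"
      unfolding C0_def by (intro continuous_intros continuous_on_f0)
    show "eventually (\<lambda>a. \<forall>E<M. FS \<beta> \<Gamma> 1 E a * FS \<beta> \<Gamma> 2 E a - coupling \<beta> a \<Gamma> \<noteq> 0) (at_right 0)"
      using FS_close[OF b zero_less_one, of \<Gamma> 1] FS_close[OF b zero_less_one, of \<Gamma> 2] coup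
    proof eventually_elim
      case (elim a)
      show ?case
      proof (intro allI impI)
        fix E assume E: "E < M"
        then have E': "E \<le> - \<beta>" using M by simp
        have "\<bar>FS \<beta> \<Gamma> 1 E a - f0 \<beta> \<Gamma> 1 E\<bar> < 1" "\<bar>FS \<beta> \<Gamma> 2 E a - f0 \<beta> \<Gamma> 2 E\<bar> < 1"
          using elim E' by blast+
        then have "FS \<beta> \<Gamma> 1 E a \<ge> 1 + 8 * gam0 \<beta> \<Gamma>" "FS \<beta> \<Gamma> 2 E a \<ge> 1 + 8 * gam0 \<beta> \<Gamma>"
          using big[of E 1] big[of E 2] E by auto
        from prod_big[OF this] show "FS \<beta> \<Gamma> 1 E a * FS \<beta> \<Gamma> 2 E a - coupling \<beta> a \<Gamma> \<noteq> 0" using elim(3) by linarith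
      qed
    qed
    show "C0 \<beta> \<Gamma> E \<noteq> 0" if "E \<le> M" for E
    proof -
      have "f0 \<beta> \<Gamma> s E \<ge> 1 + 8 * gam0 \<beta> \<Gamma>" for s using big[OF that, of s] by linarith
      from prod_big[OF this[of 1] this[of 2]] show ?thesis unfolding C0_def by argo
    qed
    show "finite {E. E < - \<beta> \<and> C0 \<beta> \<Gamma> E = 0}" by (rule finite_C0_zeros[OF g])
    show "eventually (\<lambda>a. continuous_on {M..<- \<beta>} (\<lambda>E. FS \<beta> \<Gamma> 1 E a * FS \<beta> \<Gamma> 2 E a - coupling \<beta> a \<Gamma>)) (at_right 0)"
      using eventually_admissible[OF b]
    proof eventually_elim
      case (elim a)
      have "continuous_on {M..<- \<beta>} (\<lambda>E. FS \<beta> \<Gamma> s E a)" for s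
        by (rule continuous_on_subset[OF continuous_on_FS[OF b]]) (use elim in auto)
      then show ?case by (intro continuous_intros)
    qed
  qed (use dC_neq_0[OF b _ g] coupled_local[OF b] coupled_inj[OF b _ _ g] in blast)+
qed

section \<open>Identification of the coefficients and assembly\<close>

lemma eventually_at_right_0_obtain:
  assumes "eventually P (at_right (0::real))" "c > 0"
  shows "\<exists>\<alpha>0\<in>{0<..c}. \<forall>\<alpha>\<in>{0<..<\<alpha>0}. P \<alpha>"
proof -
  obtain d where d: "d > 0" "\<And>y. 0 < y \<Longrightarrow> y < d \<Longrightarrow> P y"
    using assms(1) by (auto simp: eventually_at_right_field)
  show ?thesis by (rule bexI[of _ "min d c"]) (use d assms(2) in auto)
qed

text \<open>All radicals of the explicit coefficient are expressions in A = sqrt (\<beta> - z) and B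
  = sqrt (-\<beta> - z): sqrt (z^2 - \<beta>^2) = A B, A B - z = (A + B)^2/2, -z - A B = (A - B)^2/2
  and \<beta> = (A - B) (A + B)/2. After cancellation only 2 A B N/S remains, the quotient of the
  implicit function rule.\<close>

lemma E2_coupled_eq:
  assumes b: "\<beta> > 0" and z: "z < - \<beta>" and g: "gam0 \<beta> \<Gamma> \<noteq> 0" "C0 \<beta> \<Gamma> z = 0"
  shows "- C1 \<beta> \<Gamma> z / dC \<beta> \<Gamma> z = E2_coupled \<beta> \<Gamma> z"
proof -
  define A B where "A = sqrt (\<beta> - z)" and "B = sqrt (- \<beta> - z)"
  have AB: "A\<^sup>2 = \<beta> - z" "B\<^sup>2 = - \<beta> - z" "A > 0" "B > 0" "A > B" using b z by (simp_all add: A_def B_def)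
  define w1 w2 where "w1 = om0 \<beta> \<Gamma> 1 + A" and "w2 = om0 \<beta> \<Gamma> 2 + B"
  define q1 q2 where "q1 = q0 \<beta> \<Gamma> z 1" and "q2 = q0 \<beta> \<Gamma> z 2"
  define N where "N = q2 * w1 + q1 * w2 - 2 * eta \<beta> 1 2 * gam0 \<beta> \<Gamma>"
  define S where "S = A * w1 + B * w2"
  have f0: "f0 \<beta> \<Gamma> 1 z = 2 * w1" "f0 \<beta> \<Gamma> 2 z = 2 * w2"
    by (simp_all add: f0_def w1_def w2_def A_def B_def spin_def)
  have dC: "dC \<beta> \<Gamma> z = - 2 * S / (A * B)"
    unfolding dC_def f0 S_def using AB(3,4) by (simp add: A_def[symmetric] B_def[symmetric] spin_def) (simp add: field_simps)
  have S: "S \<noteq> 0" using dC_neq_0[OF b z g] unfolding dC by auto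
  have C1: "C1 \<beta> \<Gamma> z = 4 * N"
    by (simp add: C1_def f0 f1_eq_q0[OF b z] N_def q1_def q2_def algebra_simps)
  have lhs: "- C1 \<beta> \<Gamma> z / dC \<beta> \<Gamma> z = 2 * (A * B) * N / S"
    unfolding C1 dC using S AB(3,4) by (simp add: field_simps)
  have s1: "sqrt (z\<^sup>2 - \<beta>\<^sup>2) = A * B"
  proof (rule real_sqrt_unique)
    show "(A * B)\<^sup>2 = z\<^sup>2 - \<beta>\<^sup>2" unfolding power_mult_distrib AB(1,2) by (simp add: algebra_simps power2_eq_square)
  qed (use AB in simp)
  have s2: "sqrt (- z - A * B) = (A - B) / sqrt 2"
  proof (rule real_sqrt_unique)
    have "(A - B)\<^sup>2 = 2 * (- z - A * B)" unfolding power2_diff AB(1,2) by simp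
    then show "((A - B) / sqrt 2)\<^sup>2 = - z - A * B" by (simp add: power_divide)
  qed (use AB in simp)
  have s3: "A * B - z = (A + B)\<^sup>2 / 2" unfolding power2_sum AB(1,2) by (simp add: field_simps)
  have s4: "\<beta> = (A - B) * (A + B) / 2"
  proof -
    have "(A - B) * (A + B) = A\<^sup>2 - B\<^sup>2" by (simp add: algebra_simps power2_eq_square)
    then show ?thesis unfolding AB(1,2) by simp
  qed
  have sum1: "(\<Sum>s\<in>UNIV. q0 \<beta> \<Gamma> z (flip s) * (om0 \<beta> \<Gamma> s + sqrt (spin s * \<beta> - z))) - 2 * eta \<beta> 1 2 * gam0 \<beta> \<Gamma> = N"
    by (simp add: sum_2 N_def flip_def spin_def q1_def q2_def w1_def w2_def A_def B_def)
  have sum2: "(\<Sum>s\<in>UNIV. sqrt (spin s * \<beta> - z) * (sqrt (spin s * \<beta> - z) + sqrt (- spin s * \<beta> - z))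
             * (om0 \<beta> \<Gamma> s + sqrt (spin s * \<beta> - z))) = (A + B) * S"
  proof -
    have "sqrt (spin 1 * \<beta> - z) = A" "sqrt (- spin 1 * \<beta> - z) = B"
      "sqrt (spin 2 * \<beta> - z) = B" "sqrt (- spin 2 * \<beta> - z) = A"
      by (simp_all add: spin_def A_def B_def)
    then show ?thesis
      unfolding sum_2 S_def w1_def w2_def by (simp only:) (simp add: algebra_simps)
  qed
  have "E2_coupled \<beta> \<Gamma> z = 2 * sqrt 2 / \<beta> * ((A + B)\<^sup>2 / 2) * (A * B) * ((A - B) / sqrt 2) * (N / ((A + B) * S))"
    unfolding E2_coupled_def sum1 sum2 s1 s2 s3 ..
  also have "\<dots> = 2 * (A * B) * N / S"
  proof -
    have nz: "A - B \<noteq> 0" "A + B \<noteq> 0" using AB by auto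
    have "2 * r / ((x * y) / 2) * (y\<^sup>2 / 2) * p * (x / r) * (N / (y * S)) = 2 * p * N / S"
      if "x \<noteq> 0" "y \<noteq> 0" "r \<noteq> 0" for x y r p :: real
      using that S by (simp add: divide_simps power2_eq_square)
    from this[OF nz, of "sqrt 2" "A * B"] show ?thesis
      unfolding s4[symmetric] by simp
  qed
  finally show ?thesis using lhs by simp
qed

lemma f0_zero_iff:
  assumes b: "\<beta> > 0"
  shows "z < - \<beta> \<and> f0 \<beta> \<Gamma> 1 z = 0 \<longleftrightarrow> z = \<beta> - (om0 \<beta> \<Gamma> 1)\<^sup>2 \<and> om0 \<beta> \<Gamma> 1 < - sqrt (2 * \<beta>)"
    and "z < - \<beta> \<and> f0 \<beta> \<Gamma> 2 z = 0 \<longleftrightarrow> z = - \<beta> - (om0 \<beta> \<Gamma> 2)\<^sup>2 \<and> om0 \<beta> \<Gamma> 2 < 0"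
proof -
  show "z < - \<beta> \<and> f0 \<beta> \<Gamma> 1 z = 0 \<longleftrightarrow> z = \<beta> - (om0 \<beta> \<Gamma> 1)\<^sup>2 \<and> om0 \<beta> \<Gamma> 1 < - sqrt (2 * \<beta>)"
  proof (intro iffI conjI; elim conjE)
    assume z: "z < - \<beta>" "f0 \<beta> \<Gamma> 1 z = 0"
    then have s: "sqrt (\<beta> - z) = - om0 \<beta> \<Gamma> 1" by (simp add: f0_def spin_def)
    then have "(sqrt (\<beta> - z))\<^sup>2 = (om0 \<beta> \<Gamma> 1)\<^sup>2" by simp
    then show "z = \<beta> - (om0 \<beta> \<Gamma> 1)\<^sup>2" using z b by simp
    have "sqrt (2 * \<beta>) < sqrt (\<beta> - z)" using z by simp
    then show "om0 \<beta> \<Gamma> 1 < - sqrt (2 * \<beta>)" using s by simp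
  next
    assume z: "z = \<beta> - (om0 \<beta> \<Gamma> 1)\<^sup>2" "om0 \<beta> \<Gamma> 1 < - sqrt (2 * \<beta>)"
    have neg: "om0 \<beta> \<Gamma> 1 < 0" using z(2) b by (smt (verit) real_sqrt_ge_zero)
    have "(sqrt (2 * \<beta>))\<^sup>2 < (- om0 \<beta> \<Gamma> 1)\<^sup>2" using z(2) b by (intro power_strict_mono) auto
    then show "z < - \<beta>" using z b by simp
    show "f0 \<beta> \<Gamma> 1 z = 0" using neg unfolding z(1) by (simp add: f0_def spin_def)
  qed
  show "z < - \<beta> \<and> f0 \<beta> \<Gamma> 2 z = 0 \<longleftrightarrow> z = - \<beta> - (om0 \<beta> \<Gamma> 2)\<^sup>2 \<and> om0 \<beta> \<Gamma> 2 < 0"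
  proof (intro iffI conjI; elim conjE)
    assume z: "z < - \<beta>" "f0 \<beta> \<Gamma> 2 z = 0"
    then have s: "sqrt (- \<beta> - z) = - om0 \<beta> \<Gamma> 2" by (simp add: f0_def spin_def)
    then have "(sqrt (- \<beta> - z))\<^sup>2 = (om0 \<beta> \<Gamma> 2)\<^sup>2" by simp
    then show "z = - \<beta> - (om0 \<beta> \<Gamma> 2)\<^sup>2" using z b by simp
    have "0 < sqrt (- \<beta> - z)" using z by simp
    then show "om0 \<beta> \<Gamma> 2 < 0" using s by simp
  next
    assume z: "z = - \<beta> - (om0 \<beta> \<Gamma> 2)\<^sup>2" "om0 \<beta> \<Gamma> 2 < 0"
    then have "(om0 \<beta> \<Gamma> 2)\<^sup>2 > 0" by simp
    then show "z < - \<beta>" using z by simp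
    show "f0 \<beta> \<Gamma> 2 z = 0" using z(2) unfolding z(1) by (simp add: f0_def spin_def)
  qed
qed

lemma ex_2: "(\<exists>s::2. P s) \<longleftrightarrow> P 1 \<or> P 2"
proof
  assume "\<exists>s::2. P s"
  then obtain s :: 2 where "P s" ..
  then show "P 1 \<or> P 2" using exhaust_2[of s] by metis
qed metis

text \<open>The case distinction in the coefficient only separates whether the two factors vanish at
  one common point. \<open>both\<close> and \<open>both'\<close> show that the excluded equalities
  describe precisely this coincidence, where both spins contribute.\<close>

lemma is_E2_decoupled_iff:
  assumes b: "\<beta> > 0" and g: "gam0 \<beta> \<Gamma> = 0" and z: "z < - \<beta>"
  shows "is_E2 \<beta> \<Gamma> z E2 \<longleftrightarrow> (\<exists>s. f0 \<beta> \<Gamma> s z = 0 \<and> E2 = - 2 * om0 \<beta> \<Gamma> s * q0 \<beta> \<Gamma> z s)"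
proof -
  define w1 w2 where "w1 = om0 \<beta> \<Gamma> 1" and "w2 = om0 \<beta> \<Gamma> 2"
  have i1: "f0 \<beta> \<Gamma> 1 z = 0 \<longleftrightarrow> z = \<beta> - w1\<^sup>2 \<and> w1 < - sqrt (2 * \<beta>)"
    using f0_zero_iff(1)[OF b, of z \<Gamma>] z by (simp add: w1_def)
  have i2: "f0 \<beta> \<Gamma> 2 z = 0 \<longleftrightarrow> z = - \<beta> - w2\<^sup>2 \<and> w2 < 0"
    using f0_zero_iff(2)[OF b, of z \<Gamma>] z by (simp add: w2_def)
  have eq: "is_E2 \<beta> \<Gamma> z E2 \<longleftrightarrow>
     (z = \<beta> - w1\<^sup>2 \<and> w1 < - sqrt (2 * \<beta>) \<and> w2 \<noteq> - sqrt (w1\<^sup>2 - 2 * \<beta>) \<and> E2 = - 2 * w1 * q0 \<beta> \<Gamma> z 1) \<or>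
     (z = - \<beta> - w2\<^sup>2 \<and> w2 < 0 \<and> w1 \<noteq> - sqrt (w2\<^sup>2 + 2 * \<beta>) \<and> E2 = - 2 * w2 * q0 \<beta> \<Gamma> z 2) \<or>
     (z = \<beta> - w1\<^sup>2 \<and> w1 < - sqrt (2 * \<beta>) \<and> w2 = - sqrt (w1\<^sup>2 - 2 * \<beta>) \<and> (\<exists>s. E2 = - 2 * om0 \<beta> \<Gamma> s * q0 \<beta> \<Gamma> z s))"
    using g by (simp add: is_E2_def Let_def w1_def w2_def)
  have ex: "(\<exists>s. f0 \<beta> \<Gamma> s z = 0 \<and> E2 = - 2 * om0 \<beta> \<Gamma> s * q0 \<beta> \<Gamma> z s) \<longleftrightarrow>
     (f0 \<beta> \<Gamma> 1 z = 0 \<and> E2 = - 2 * w1 * q0 \<beta> \<Gamma> z 1) \<or> (f0 \<beta> \<Gamma> 2 z = 0 \<and> E2 = - 2 * w2 * q0 \<beta> \<Gamma> z 2)"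
    unfolding w1_def w2_def ex_2 ..
  have both: "f0 \<beta> \<Gamma> 2 z = 0" if "z = \<beta> - w1\<^sup>2" "w1 < - sqrt (2 * \<beta>)" "w2 = - sqrt (w1\<^sup>2 - 2 * \<beta>)"
  proof -
    have "(sqrt (2 * \<beta>))\<^sup>2 < (- w1)\<^sup>2" using that(2) b by (intro power_strict_mono) auto
    then have "2 * \<beta> < w1\<^sup>2" using b by simp
    then show ?thesis unfolding i2 that(3) using that(1) by simp
  qed
  have both': "f0 \<beta> \<Gamma> 1 z = 0 \<and> w2 = - sqrt (w1\<^sup>2 - 2 * \<beta>)" if "z = - \<beta> - w2\<^sup>2" "w2 < 0" "w1 = - sqrt (w2\<^sup>2 + 2 * \<beta>)"
  proof
    have sq: "w1\<^sup>2 = w2\<^sup>2 + 2 * \<beta>" unfolding that(3) using b by simp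
    have "sqrt (2 * \<beta>) < sqrt (w2\<^sup>2 + 2 * \<beta>)" using that(2) by simp
    then show "f0 \<beta> \<Gamma> 1 z = 0" unfolding i1 using sq that(1,3) by simp
    show "w2 = - sqrt (w1\<^sup>2 - 2 * \<beta>)" unfolding sq using that(2) by simp
  qed
  have ex3: "(\<exists>s. E2 = - 2 * om0 \<beta> \<Gamma> s * q0 \<beta> \<Gamma> z s) \<longleftrightarrow> E2 = - 2 * w1 * q0 \<beta> \<Gamma> z 1 \<or> E2 = - 2 * w2 * q0 \<beta> \<Gamma> z 2"
    unfolding w1_def w2_def ex_2 ..
  show ?thesis
    unfolding eq ex ex3 using both both' i1 i2 by blast
qed

lemma decoupled_coefficient:
  assumes "\<beta> > 0" "z < - \<beta>" "f0 \<beta> \<Gamma> s z = 0"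
  shows "- f1 \<beta> \<Gamma> s z / (- 1 / sqrt (spin s * \<beta> - z)) = - 2 * om0 \<beta> \<Gamma> s * q0 \<beta> \<Gamma> z s"
proof -
  have "sqrt (spin s * \<beta> - z) = - om0 \<beta> \<Gamma> s" using assms(3) by (simp add: f0_def)
  then show ?thesis by (simp add: f1_eq_q0[OF assms(1,2)])
qed

lemma singular_spectrum_0_iff:
  assumes "\<beta> > 0" "hermitian_mat \<Gamma>" "E \<le> - \<beta>"
  shows "E \<in> singular_spectrum \<beta> 0 \<Gamma> \<longleftrightarrow> C0 \<beta> \<Gamma> E = 0"
proof -
  have "0\<^sup>2 < 2 * \<beta>" using assms(1) by simp
  from singular_spectrum_iff[OF assms(1) order_refl this assms(2,3)] show ?thesis
    unfolding FS_0[OF assms(1,3)] gam0_eq(1)[OF assms(1), symmetric] C0_def by simp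
qed

text \<open>The claim below the threshold in terms of the secular equation, so that both cases of
  \<gamma> deliver the same interface. The members are functions of \<alpha> and not pairs of
  coefficients, since two of them may start at one E0.\<close>

definition branches :: "real \<Rightarrow> complex^2^2 \<Rightarrow> (real \<Rightarrow> real) set \<Rightarrow> bool" where
  "branches \<beta> \<Gamma> \<E> \<longleftrightarrow> finite \<E> \<and>
     (\<forall>e\<in>\<E>. \<exists>(E0, E2)\<in>expansion_coeffs \<beta> \<Gamma>. (\<lambda>\<alpha>. e \<alpha> - (E0 + \<alpha>\<^sup>2 * E2)) \<in> O[at_right 0](\<lambda>\<alpha>. \<alpha> ^ 4)) \<and>
     (\<forall>(E0, E2)\<in>expansion_coeffs \<beta> \<Gamma>. \<exists>e\<in>\<E>. (\<lambda>\<alpha>. e \<alpha> - (E0 + \<alpha>\<^sup>2 * E2)) \<in> O[at_right 0](\<lambda>\<alpha>. \<alpha> ^ 4)) \<and>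
     (\<forall>e\<in>\<E>. eventually (\<lambda>\<alpha>. e \<alpha> < - \<beta> \<and> FS \<beta> \<Gamma> 1 (e \<alpha>) \<alpha> * FS \<beta> \<Gamma> 2 (e \<alpha>) \<alpha> = coupling \<beta> \<alpha> \<Gamma>) (at_right 0)) \<and>
     (\<forall>\<delta>>0. eventually (\<lambda>\<alpha>. \<forall>E< - \<beta> - \<delta>. FS \<beta> \<Gamma> 1 E \<alpha> * FS \<beta> \<Gamma> 2 E \<alpha> = coupling \<beta> \<alpha> \<Gamma> \<longrightarrow> E \<in> (\<lambda>e. e \<alpha>) ` \<E>) (at_right 0)) \<and>
     (C0 \<beta> \<Gamma> (- \<beta>) \<noteq> 0 \<longrightarrow> eventually (\<lambda>\<alpha>. \<forall>E< - \<beta>. FS \<beta> \<Gamma> 1 E \<alpha> * FS \<beta> \<Gamma> 2 E \<alpha> = coupling \<beta> \<alpha> \<Gamma> \<longrightarrow> E \<in> (\<lambda>e. e \<alpha>) ` \<E>) (at_right 0))"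

lemma branches_coupled:
  assumes b: "\<beta> > 0" and h: "hermitian_mat \<Gamma>" and g: "gam0 \<beta> \<Gamma> \<noteq> 0"
  shows "\<exists>\<E>. branches \<beta> \<Gamma> \<E>"
proof -
  define Z where "Z = {E. E < - \<beta> \<and> C0 \<beta> \<Gamma> E = 0}"
  obtain e where e: "root_family (- \<beta>) (\<lambda>E a. FS \<beta> \<Gamma> 1 E a * FS \<beta> \<Gamma> 2 E a - coupling \<beta> a \<Gamma>) (C0 \<beta> \<Gamma>) (\<lambda>z. - C1 \<beta> \<Gamma> z / dC \<beta> \<Gamma> z) e"
    using coupled_roots[OF b g] by blast
  have e1: "(\<lambda>a. e z a - (z + a\<^sup>2 * E2_coupled \<beta> \<Gamma> z)) \<in> O[at_right 0](\<lambda>a. a ^ 4)" if "z \<in> Z" for z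
  proof -
    have "(\<lambda>a. e z a - (z + a\<^sup>2 * (- C1 \<beta> \<Gamma> z / dC \<beta> \<Gamma> z))) \<in> O[at_right 0](\<lambda>a. a ^ 4)"
      using e that unfolding root_family_def Z_def by blast
    moreover have "- C1 \<beta> \<Gamma> z / dC \<beta> \<Gamma> z = E2_coupled \<beta> \<Gamma> z"
      using that by (intro E2_coupled_eq[OF b _ g]) (auto simp: Z_def)
    ultimately show ?thesis by (simp only:)
  qed
  have coeffs: "expansion_coeffs \<beta> \<Gamma> = (\<lambda>z. (z, E2_coupled \<beta> \<Gamma> z)) ` Z"
    using g singular_spectrum_0_iff[OF b h] by (auto simp: expansion_coeffs_def is_E2_def Z_def)
  have im: "(\<lambda>f. f a) ` (e ` Z) = (\<lambda>z. e z a) ` Z" for a by (simp add: image_image)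
  have "branches \<beta> \<Gamma> (e ` Z)"
    unfolding branches_def im
  proof (intro conjI)
    show "finite (e ` Z)" unfolding Z_def using finite_C0_zeros[OF g] by blast
    show "\<forall>f\<in>e ` Z. \<exists>(E0, E2)\<in>expansion_coeffs \<beta> \<Gamma>. (\<lambda>\<alpha>. f \<alpha> - (E0 + \<alpha>\<^sup>2 * E2)) \<in> O[at_right 0](\<lambda>\<alpha>. \<alpha> ^ 4)"
      unfolding coeffs using e1 by auto
    show "\<forall>(E0, E2)\<in>expansion_coeffs \<beta> \<Gamma>. \<exists>f\<in>e ` Z. (\<lambda>\<alpha>. f \<alpha> - (E0 + \<alpha>\<^sup>2 * E2)) \<in> O[at_right 0](\<lambda>\<alpha>. \<alpha> ^ 4)"
      unfolding coeffs using e1 by auto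
    show "\<forall>f\<in>e ` Z. eventually (\<lambda>\<alpha>. f \<alpha> < - \<beta> \<and> FS \<beta> \<Gamma> 1 (f \<alpha>) \<alpha> * FS \<beta> \<Gamma> 2 (f \<alpha>) \<alpha> = coupling \<beta> \<alpha> \<Gamma>) (at_right 0)"
      using e unfolding root_family_def Z_def by simp
  qed (use e in \<open>simp_all add: root_family_def Z_def\<close>)
  then show ?thesis by blast
qed

lemma gam0_0_imp_coupling_0:
  assumes "\<beta> > 0" "gam0 \<beta> \<Gamma> = 0"
  shows "coupling \<beta> \<alpha> \<Gamma> = 0"
proof -
  have "\<Gamma> $ 1 $ 2 = 0"
    using assms(2) N0_pos[OF assms(1), of 1] N0_pos[OF assms(1), of 2] by (simp add: gam0_def Gam0_def)
  then show ?thesis by (simp add: coupling_def)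
qed

lemma branches_decoupled:
  assumes b: "\<beta> > 0" and h: "hermitian_mat \<Gamma>" and g: "gam0 \<beta> \<Gamma> = 0"
  shows "\<exists>\<E>. branches \<beta> \<Gamma> \<E>"
proof -
  define Z where "Z s = {E. E < - \<beta> \<and> f0 \<beta> \<Gamma> s E = 0}" for s
  have "\<forall>s. \<exists>e. root_family (- \<beta>) (\<lambda>E a. FS \<beta> \<Gamma> s E a) (f0 \<beta> \<Gamma> s) (\<lambda>z. - f1 \<beta> \<Gamma> s z / (- 1 / sqrt (spin s * \<beta> - z))) e"
    using decoupled_roots[OF b] by blast
  from choice[OF this] obtain e where e: "\<And>s. root_family (- \<beta>) (\<lambda>E a. FS \<beta> \<Gamma> s E a) (f0 \<beta> \<Gamma> s) (\<lambda>z. - f1 \<beta> \<Gamma> s z / (- 1 / sqrt (spin s * \<beta> - z))) (e s)"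
    by blast
  have e1: "(\<lambda>a. e s z a - (z + a\<^sup>2 * (- 2 * om0 \<beta> \<Gamma> s * q0 \<beta> \<Gamma> z s))) \<in> O[at_right 0](\<lambda>a. a ^ 4)" if z: "z \<in> Z s" for z s
  proof -
    have "(\<lambda>a. e s z a - (z + a\<^sup>2 * (- f1 \<beta> \<Gamma> s z / (- 1 / sqrt (spin s * \<beta> - z))))) \<in> O[at_right 0](\<lambda>a. a ^ 4)"
      using e[of s] z unfolding root_family_def Z_def by blast
    moreover have "- f1 \<beta> \<Gamma> s z / (- 1 / sqrt (spin s * \<beta> - z)) = - 2 * om0 \<beta> \<Gamma> s * q0 \<beta> \<Gamma> z s"
      using z by (intro decoupled_coefficient[OF b]) (auto simp: Z_def)
    ultimately show ?thesis by (simp only:)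
  qed
  have C0: "C0 \<beta> \<Gamma> E = f0 \<beta> \<Gamma> 1 E * f0 \<beta> \<Gamma> 2 E" for E by (simp add: C0_def g)
  have C0': "C0 \<beta> \<Gamma> E = 0 \<longleftrightarrow> (\<exists>s. f0 \<beta> \<Gamma> s E = 0)" for E unfolding C0 ex_2 by simp
  have coeffs: "(E0, E2) \<in> expansion_coeffs \<beta> \<Gamma> \<longleftrightarrow> (\<exists>s. E0 \<in> Z s \<and> E2 = - 2 * om0 \<beta> \<Gamma> s * q0 \<beta> \<Gamma> E0 s)" for E0 E2
    unfolding expansion_coeffs_def Z_def
    using singular_spectrum_0_iff[OF b h, of E0] is_E2_decoupled_iff[OF b g, of E0 E2] C0'[of E0] by auto
  \<comment> \<open>If both factors vanish at the same E0, this union contains a root function of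
    each spin starting there, in accordance with the two values of the coefficient.\<close>
  define \<E> where "\<E> = (\<Union>s. e s ` Z s)"
  have im: "E \<in> (\<lambda>f. f a) ` \<E> \<longleftrightarrow> (\<exists>s. E \<in> (\<lambda>z. e s z a) ` Z s)" for a E
    by (auto simp: \<E>_def)
  have all2: "eventually (\<lambda>a. \<forall>s. P s a) (at_right 0)" if "\<And>s. eventually (P s) (at_right 0)" for P :: "2 \<Rightarrow> real \<Rightarrow> bool"
    using eventually_conj[OF that[of 1] that[of 2]] by (simp add: forall_2)
  have prod0: "FS \<beta> \<Gamma> 1 E a * FS \<beta> \<Gamma> 2 E a = coupling \<beta> a \<Gamma> \<longleftrightarrow> (\<exists>s. FS \<beta> \<Gamma> s E a = 0)" for E a
    unfolding gam0_0_imp_coupling_0[OF b g] ex_2 by simp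
  have "branches \<beta> \<Gamma> \<E>"
    unfolding branches_def prod0 im
  proof (intro conjI allI impI)
    show "finite \<E>" by (simp add: finite_f0_zeros \<E>_def Z_def)
    show "\<forall>f\<in>\<E>. \<exists>(E0, E2)\<in>expansion_coeffs \<beta> \<Gamma>. (\<lambda>\<alpha>. f \<alpha> - (E0 + \<alpha>\<^sup>2 * E2)) \<in> O[at_right 0](\<lambda>\<alpha>. \<alpha> ^ 4)"
    proof
      fix f assume "f \<in> \<E>"
      then obtain s z where z: "z \<in> Z s" "f = e s z" by (auto simp: \<E>_def)
      have "(z, - 2 * om0 \<beta> \<Gamma> s * q0 \<beta> \<Gamma> z s) \<in> expansion_coeffs \<beta> \<Gamma>" using coeffs z(1) by blast
      then show "\<exists>(E0, E2)\<in>expansion_coeffs \<beta> \<Gamma>. (\<lambda>\<alpha>. f \<alpha> - (E0 + \<alpha>\<^sup>2 * E2)) \<in> O[at_right 0](\<lambda>\<alpha>. \<alpha> ^ 4)"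
        using e1[OF z(1)] z(2) by blast
    qed
    show "\<forall>(E0, E2)\<in>expansion_coeffs \<beta> \<Gamma>. \<exists>f\<in>\<E>. (\<lambda>\<alpha>. f \<alpha> - (E0 + \<alpha>\<^sup>2 * E2)) \<in> O[at_right 0](\<lambda>\<alpha>. \<alpha> ^ 4)"
    proof (intro ballI, clarify)
      fix E0 E2 assume "(E0, E2) \<in> expansion_coeffs \<beta> \<Gamma>"
      then obtain s where s: "E0 \<in> Z s" "E2 = - 2 * om0 \<beta> \<Gamma> s * q0 \<beta> \<Gamma> E0 s" using coeffs by blast
      then show "\<exists>f\<in>\<E>. (\<lambda>\<alpha>. f \<alpha> - (E0 + \<alpha>\<^sup>2 * E2)) \<in> O[at_right 0](\<lambda>\<alpha>. \<alpha> ^ 4)"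
        using e1[OF s(1)] by (intro bexI[of _ "e s E0"]) (auto simp: \<E>_def)
    qed
    show "\<forall>f\<in>\<E>. eventually (\<lambda>\<alpha>. f \<alpha> < - \<beta> \<and> (\<exists>s. FS \<beta> \<Gamma> s (f \<alpha>) \<alpha> = 0)) (at_right 0)"
    proof
      fix f assume "f \<in> \<E>"
      then obtain s z where z: "z \<in> Z s" "f = e s z" by (auto simp: \<E>_def)
      then have "eventually (\<lambda>\<alpha>. f \<alpha> < - \<beta> \<and> FS \<beta> \<Gamma> s (f \<alpha>) \<alpha> = 0) (at_right 0)"
        using e[of s] unfolding root_family_def Z_def by blast
      then show "eventually (\<lambda>\<alpha>. f \<alpha> < - \<beta> \<and> (\<exists>s. FS \<beta> \<Gamma> s (f \<alpha>) \<alpha> = 0)) (at_right 0)"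
        by eventually_elim blast
    qed
    fix \<delta> :: real assume "\<delta> > 0"
    then have "eventually (\<lambda>\<alpha>. \<forall>s. \<forall>E< - \<beta> - \<delta>. FS \<beta> \<Gamma> s E \<alpha> = 0 \<longrightarrow> E \<in> (\<lambda>z. e s z \<alpha>) ` Z s) (at_right 0)"
      using e by (intro all2) (simp add: root_family_def Z_def)
    then show "eventually (\<lambda>\<alpha>. \<forall>E< - \<beta> - \<delta>. (\<exists>s. FS \<beta> \<Gamma> s E \<alpha> = 0) \<longrightarrow> (\<exists>s. E \<in> (\<lambda>z. e s z \<alpha>) ` Z s)) (at_right 0)"
      by eventually_elim blast
  next
    assume "C0 \<beta> \<Gamma> (- \<beta>) \<noteq> 0"
    then have "f0 \<beta> \<Gamma> s (- \<beta>) \<noteq> 0" for s using C0' by blast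
    then have "eventually (\<lambda>\<alpha>. \<forall>s. \<forall>E< - \<beta>. FS \<beta> \<Gamma> s E \<alpha> = 0 \<longrightarrow> E \<in> (\<lambda>z. e s z \<alpha>) ` Z s) (at_right 0)"
      using e by (intro all2) (simp add: root_family_def Z_def)
    then show "eventually (\<lambda>\<alpha>. \<forall>E< - \<beta>. (\<exists>s. FS \<beta> \<Gamma> s E \<alpha> = 0) \<longrightarrow> (\<exists>s. E \<in> (\<lambda>z. e s z \<alpha>) ` Z s)) (at_right 0)"
      by eventually_elim blast
  qed
  then show ?thesis by blast
qed

theorem theorem6p7:
  fixes \<beta> :: real and \<Gamma> R :: "complex^2^2"
  assumes "\<beta> > 0"
    and "hermitian_mat R"
    and "hermitian_mat \<Gamma>"
    and "\<Gamma> \<noteq> - R"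
  shows
    "(\<exists>\<E> :: (real \<Rightarrow> real) set. finite \<E> \<and>
        (\<forall>e\<in>\<E>. \<exists>(E0, E2)\<in>expansion_coeffs \<beta> \<Gamma>.
           (\<lambda>\<alpha>. e \<alpha> - (E0 + \<alpha>\<^sup>2 * E2)) \<in> O[at_right 0](\<lambda>\<alpha>. \<alpha> ^ 4)) \<and>
        (\<forall>(E0, E2)\<in>expansion_coeffs \<beta> \<Gamma>. \<exists>e\<in>\<E>.
           (\<lambda>\<alpha>. e \<alpha> - (E0 + \<alpha>\<^sup>2 * E2)) \<in> O[at_right 0](\<lambda>\<alpha>. \<alpha> ^ 4)) \<and>
        (- \<beta> \<notin> singular_spectrum \<beta> 0 \<Gamma> \<longrightarrow>
           (\<exists>\<alpha>0\<in>{0<..sqrt (2 * \<beta>)}. \<forall>\<alpha>\<in>{0<..<\<alpha>0}.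
              singular_spectrum \<beta> \<alpha> \<Gamma> \<inter> {..< - \<beta>} = (\<lambda>e. e \<alpha>) ` \<E>)) \<and>
        (\<exists>\<alpha>0\<in>{0<..sqrt (2 * \<beta>)}. \<forall>\<alpha>\<in>{0<..<\<alpha>0}.
           (\<lambda>e. e \<alpha>) ` \<E> \<subseteq> singular_spectrum \<beta> \<alpha> \<Gamma> \<inter> {..< - \<beta>}) \<and>
        (\<forall>\<delta>>0. \<exists>\<alpha>0\<in>{0<..sqrt (2 * \<beta>)}. \<forall>\<alpha>\<in>{0<..<\<alpha>0}.
           singular_spectrum \<beta> \<alpha> \<Gamma> \<inter> {..< - \<beta> - \<delta>} \<subseteq> (\<lambda>e. e \<alpha>) ` \<E>)) \<and>
     (\<exists>\<alpha>0\<in>{0<..sqrt (2 * \<beta>)}. \<forall>\<alpha>\<in>{0<..<\<alpha>0}.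
        \<forall>E\<in>singular_spectrum \<beta> \<alpha> \<Gamma>. E \<ge> - \<beta> \<longrightarrow> E = - \<beta> \<and> is_Gamma_circ \<beta> \<Gamma>)"
proof
  note b = assms(1) and h = assms(3)
  have c: "sqrt (2 * \<beta>) > 0" using b by simp
  obtain \<E> where E: "branches \<beta> \<Gamma> \<E>"
    using branches_coupled[OF b h] branches_decoupled[OF b h] by blast
  note E = E[unfolded branches_def]
  have fin: "finite \<E>" using E by blast
  have ss: "E \<in> singular_spectrum \<beta> \<alpha> \<Gamma> \<longleftrightarrow> FS \<beta> \<Gamma> 1 E \<alpha> * FS \<beta> \<Gamma> 2 E \<alpha> = coupling \<beta> \<alpha> \<Gamma>"
    if "0 < \<alpha>" "\<alpha>\<^sup>2 < 2 * \<beta>" "E < - \<beta>" for E \<alpha>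
    using singular_spectrum_iff[OF b _ that(2) h, of E] that by simp
  have sub: "eventually (\<lambda>\<alpha>. (\<lambda>e. e \<alpha>) ` \<E> \<subseteq> singular_spectrum \<beta> \<alpha> \<Gamma> \<inter> {..< - \<beta>}) (at_right 0)"
  proof -
    have "eventually (\<lambda>\<alpha>. \<forall>e\<in>\<E>. e \<alpha> < - \<beta> \<and> FS \<beta> \<Gamma> 1 (e \<alpha>) \<alpha> * FS \<beta> \<Gamma> 2 (e \<alpha>) \<alpha> = coupling \<beta> \<alpha> \<Gamma>) (at_right 0)"
      using E by (intro eventually_ball_finite[OF fin]) blast
    then show ?thesis using eventually_admissible[OF b]
      by eventually_elim (use ss in auto)
  qed
  have sup: "eventually (\<lambda>\<alpha>. singular_spectrum \<beta> \<alpha> \<Gamma> \<inter> {..< - \<beta> - \<delta>} \<subseteq> (\<lambda>e. e \<alpha>) ` \<E>) (at_right 0)" if "\<delta> > 0" for \<delta>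
  proof -
    have "eventually (\<lambda>\<alpha>. \<forall>E< - \<beta> - \<delta>. FS \<beta> \<Gamma> 1 E \<alpha> * FS \<beta> \<Gamma> 2 E \<alpha> = coupling \<beta> \<alpha> \<Gamma> \<longrightarrow> E \<in> (\<lambda>e. e \<alpha>) ` \<E>) (at_right 0)"
      using E that by blast
    then show ?thesis using eventually_admissible[OF b]
    proof eventually_elim
      case (elim \<alpha>)
      show ?case
      proof
        fix E assume "E \<in> singular_spectrum \<beta> \<alpha> \<Gamma> \<inter> {..< - \<beta> - \<delta>}"
        then have "E < - \<beta> - \<delta>" "FS \<beta> \<Gamma> 1 E \<alpha> * FS \<beta> \<Gamma> 2 E \<alpha> = coupling \<beta> \<alpha> \<Gamma>"
          using ss[of \<alpha> E] elim(2) that by auto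
        then show "E \<in> (\<lambda>e. e \<alpha>) ` \<E>" using elim(1) by blast
      qed
    qed
  qed
  have eq: "eventually (\<lambda>\<alpha>. singular_spectrum \<beta> \<alpha> \<Gamma> \<inter> {..< - \<beta>} = (\<lambda>e. e \<alpha>) ` \<E>) (at_right 0)"
    if "- \<beta> \<notin> singular_spectrum \<beta> 0 \<Gamma>"
  proof -
    have "C0 \<beta> \<Gamma> (- \<beta>) \<noteq> 0" using that singular_spectrum_0_iff[OF b h, of "- \<beta>"] by simp
    then have "eventually (\<lambda>\<alpha>. \<forall>E< - \<beta>. FS \<beta> \<Gamma> 1 E \<alpha> * FS \<beta> \<Gamma> 2 E \<alpha> = coupling \<beta> \<alpha> \<Gamma> \<longrightarrow> E \<in> (\<lambda>e. e \<alpha>) ` \<E>) (at_right 0)"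
      using E by blast
    then show ?thesis using eventually_admissible[OF b] sub
    proof eventually_elim
      case (elim \<alpha>)
      have "singular_spectrum \<beta> \<alpha> \<Gamma> \<inter> {..< - \<beta>} \<subseteq> (\<lambda>e. e \<alpha>) ` \<E>"
      proof
        fix E assume "E \<in> singular_spectrum \<beta> \<alpha> \<Gamma> \<inter> {..< - \<beta>}"
        then have "E < - \<beta>" "FS \<beta> \<Gamma> 1 E \<alpha> * FS \<beta> \<Gamma> 2 E \<alpha> = coupling \<beta> \<alpha> \<Gamma>"
          using ss[of \<alpha> E] elim(2) by auto
        then show "E \<in> (\<lambda>e. e \<alpha>) ` \<E>" using elim(1) by blast
      qed
      then show ?case using elim(3) by (rule subset_antisym)
    qed
  qed
  have conj1: "\<forall>e\<in>\<E>. \<exists>(E0, E2)\<in>expansion_coeffs \<beta> \<Gamma>. (\<lambda>\<alpha>. e \<alpha> - (E0 + \<alpha>\<^sup>2 * E2)) \<in> O[at_right 0](\<lambda>\<alpha>. \<alpha> ^ 4)"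
    and conj2: "\<forall>(E0, E2)\<in>expansion_coeffs \<beta> \<Gamma>. \<exists>e\<in>\<E>. (\<lambda>\<alpha>. e \<alpha> - (E0 + \<alpha>\<^sup>2 * E2)) \<in> O[at_right 0](\<lambda>\<alpha>. \<alpha> ^ 4)"
    using E by blast+
  show "\<exists>\<E> :: (real \<Rightarrow> real) set. finite \<E> \<and>
        (\<forall>e\<in>\<E>. \<exists>(E0, E2)\<in>expansion_coeffs \<beta> \<Gamma>.
           (\<lambda>\<alpha>. e \<alpha> - (E0 + \<alpha>\<^sup>2 * E2)) \<in> O[at_right 0](\<lambda>\<alpha>. \<alpha> ^ 4)) \<and>
        (\<forall>(E0, E2)\<in>expansion_coeffs \<beta> \<Gamma>. \<exists>e\<in>\<E>.
           (\<lambda>\<alpha>. e \<alpha> - (E0 + \<alpha>\<^sup>2 * E2)) \<in> O[at_right 0](\<lambda>\<alpha>. \<alpha> ^ 4)) \<and>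
        (- \<beta> \<notin> singular_spectrum \<beta> 0 \<Gamma> \<longrightarrow>
           (\<exists>\<alpha>0\<in>{0<..sqrt (2 * \<beta>)}. \<forall>\<alpha>\<in>{0<..<\<alpha>0}.
              singular_spectrum \<beta> \<alpha> \<Gamma> \<inter> {..< - \<beta>} = (\<lambda>e. e \<alpha>) ` \<E>)) \<and>
        (\<exists>\<alpha>0\<in>{0<..sqrt (2 * \<beta>)}. \<forall>\<alpha>\<in>{0<..<\<alpha>0}.
           (\<lambda>e. e \<alpha>) ` \<E> \<subseteq> singular_spectrum \<beta> \<alpha> \<Gamma> \<inter> {..< - \<beta>}) \<and>
        (\<forall>\<delta>>0. \<exists>\<alpha>0\<in>{0<..sqrt (2 * \<beta>)}. \<forall>\<alpha>\<in>{0<..<\<alpha>0}.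
           singular_spectrum \<beta> \<alpha> \<Gamma> \<inter> {..< - \<beta> - \<delta>} \<subseteq> (\<lambda>e. e \<alpha>) ` \<E>)"
    by (rule exI[of _ \<E>]; intro conjI fin conj1 conj2 impI allI eventually_at_right_0_obtain[OF _ c])
      (erule eq, rule sub, erule sup)
  \<comment> \<open>For these \<alpha> no E \<ge> -\<beta> at all belongs to the singular spectrum,
    so the implication of the second half holds with an empty premise.\<close>
  obtain \<alpha>0 where a0: "\<alpha>0 \<in> {0<..sqrt (2 * \<beta>)}" "\<And>\<alpha>. \<alpha> \<in> {0<..<\<alpha>0} \<Longrightarrow> - \<beta> \<notin> singular_spectrum \<beta> \<alpha> \<Gamma>"
    using threshold_eventually_notin_singular_spectrum[OF b h] by blast
  have "E < - \<beta>" if a: "\<alpha> \<in> {0<..<\<alpha>0}" and E: "E \<in> singular_spectrum \<beta> \<alpha> \<Gamma>" for \<alpha> E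
  proof -
    have "\<alpha>\<^sup>2 < (sqrt (2 * \<beta>))\<^sup>2" using a a0(1) by (intro power_strict_mono) auto
    then have "\<alpha>\<^sup>2 < 2 * \<beta>" using b by simp
    then have "\<not> E > - \<beta>" using notin_singular_spectrum_above_threshold[OF b _ _ h, of \<alpha> E] a E by auto
    moreover have "E \<noteq> - \<beta>" using a0(2)[OF a] E by auto
    ultimately show ?thesis by linarith
  qed
  then show "\<exists>\<alpha>0\<in>{0<..sqrt (2 * \<beta>)}. \<forall>\<alpha>\<in>{0<..<\<alpha>0}.
        \<forall>E\<in>singular_spectrum \<beta> \<alpha> \<Gamma>. E \<ge> - \<beta> \<longrightarrow> E = - \<beta> \<and> is_Gamma_circ \<beta> \<Gamma>"
    using a0(1) by (intro bexI[of _ \<alpha>0]) force+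
qed

end
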